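(* Let $d\ge1$, $1<\alpha\le2$, $\sigma>0$, $\nu\in[-1,1]$. Let $\xi=(\xi_k)_{k\in\mathbb{Z}^d}$ be i.i.d. real random variables in the normal domain of attraction of $\mathcal{S}_\alpha(\sigma,\nu)$, let $c=(c_k)_{k\in\mathbb{Z}^d}\in\ell^\alpha(\mathbb{Z}^d)$ be real, and let $\hat\xi_k=\sum_{l\in\mathbb{Z}^d}c_{k-l}\xi_l$, $k\in\mathbb{Z}^d$. For $h>0$ and a normalisation constant $\hat\gamma_h>0$, let $\hat\mu_h$ be the random signed measure on $\mathbb{R}^d$ with density $$\frac{d\hat\mu_h}{dx}(x)=\hat\gamma_h\sum_{k\in\mathbb{Z}^d}\hat\xi_k\,\mathbf{1}_{h(k+[0,1)^d)}(x),$$ and let $\mathcal{F}_{\hat\mu_h}$ be the set of $f\in L^1_{loc}(\mathbb{R}^d)$ such that $\int_{\mathbb{R}^d}f\,d\hat\mu_h$ converges almost surely. Let $W_\alpha$ be the independently scattered $\alpha$-stable random noise on $\mathbb{R}^d$ with Lebesgue control measure and constant skewness $\nu$. 1. Suppose $c\in\ell^1$, and let $\hat\gamma_h=\sigma^{-1}h^{(\alpha^{-1}-1)d}$ and $C=\sum_{k\in\mathbb{Z}^d}c_k$. Then for any $h>0$, $L^\alpha(\mathbb{R}^d)\subseteq\mathcal{F}_{\hat\mu_h}$, and as $h\to0$, $\hat\mu_h$ converges weakly to $C\,W_\alpha$ on $L^\alpha(\mathbb{R}^d)$. 2. Suppose that $c$ has regular variation at infinity of order $-\beta\in(-d,-\alpha^{-1}d)$,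 in the sense that $$\lim_{t\to\infty}\sup_{|x|=1}\left|t^\beta c_{[tx]}-p(x)\right|=0,$$ where $p:\mathbb{R}^d\setminus\{0\}\to\mathbb{R}$ is a locally integrable homogeneous function of order $-\beta$. Let $\hat\gamma_h=\sigma^{-1}h^{\alpha^{-1}d-\beta}$. Then for any $h>0$, $L^\alpha(\mathbb{R}^d)\cap L^1(\mathbb{R}^d)\subseteq\mathcal{F}_{\hat\mu_h}$, and as $h\to0$, $\hat\mu_h$ converges weakly on $L^\alpha\cap L^1$ to the fractional stable random noise $W_{\alpha,p}$ defined by $W_{\alpha,p}[f]=W_\alpha[f\ast\check p]$, $f\in L^1\cap L^\alpha$, where $\check p(x)=p(-x)$.
   Context: $\mathcal{S}_\alpha(\sigma,\nu)$ is the law with characteristic function $\bar\lambda(\theta)=\exp\left(-\sigma^\alpha|\theta|^\alpha\left(1-i\nu\varepsilon(\theta)\tan\frac{\pi\alpha}{2}\right)\right)$, where $\varepsilon$ is the sign function ($\varepsilon(0)=0$). A random variable $Y$ is in the normal domain of attraction of $\mathcal{S}_\alpha(\sigma,\nu)$ if $n^{-1/\alpha}\sum_{i=1}^nY_i$ converges in law to $\mathcal{S}_\alpha(\sigma,\nu)$ for i.i.d. copies $Y_i$ of $Y$ (no centering). $\ell^\alpha=\ell^\alpha(\mathbb{Z}^d)$ is the space of real sequences $u$ with $\sum_k|u_k|^\alpha<\infty$; for $c\in\ell^\alpha$ the series defining $\hat\xi_k$ converges a.s. $[y]\in\mathbb{Z}^d$ denotes the componentwise integer part (floor) of $y\in\mathbb{R}^d$.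 Homogeneous of order $-\beta$ means $p(tx)=t^{-\beta}p(x)$ for $t>0$, $x\ne0$. A random noise is a family $(W[f])_{f\in\mathcal{F}}$ of real random variables indexed by a linear space $\mathcal{F}$ of measurable functions with $W[a_1f_1+a_2f_2]=a_1W[f_1]+a_2W[f_2]$ a.s. $W_\alpha$ is the random noise indexed by $L^\alpha(\mathbb{R}^d)$ with $W_\alpha[f]\sim\mathcal{S}_\alpha(\sigma_f,\nu_f)$, where $\sigma_f=\left(\int|f|^\alpha dx\right)^{1/\alpha}$ and $\sigma_f^\alpha\nu_f=\int\nu\,\varepsilon(f)|f|^\alpha dx$. $\hat\mu_h[f]=\int f\,d\hat\mu_h$ is understood as the sum of the series $\hat\gamma_h\sum_{k\in\mathbb{Z}^d}\hat\xi_k\int_{h(k+[0,1)^d)}f(x)dx$, required only to converge almost surely (semi-convergence along a fixed enumeration of $\mathbb{Z}^d$; absolute convergence is not required). "$\hat\mu_h$ converges weakly to $W$ on $\mathcal{F}$ as $h\to0$" means that the finite-dimensional distributions of $(\hat\mu_h[f])_{f\in\mathcal{F}}$ converge weakly to those of $(W[f])_{f\in\mathcal{F}}$. *)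

theory Defs
  imports "HOL-Probability.Probability"
begin

text \<open>Here \<open>\<real>\<^sup>d\<close> is \<^typ>\<open>real ^ 'n\<close> and \<open>\<int>\<^sup>d\<close> is \<^typ>\<open>int ^ 'n\<close>, with \<open>d = CARD('n) \<ge> 1\<close>.\<close>

section \<open>Stable laws and their normal domain of attraction\<close>

definition stable_char :: "real \<Rightarrow> real \<Rightarrow> real \<Rightarrow> real \<Rightarrow> complex" where
  "stable_char \<alpha> \<sigma> \<nu> \<theta> =
     exp (- complex_of_real (\<sigma> powr \<alpha> * \<bar>\<theta>\<bar> powr \<alpha>) *
          (1 - \<i> * complex_of_real (\<nu> * sgn \<theta> * tan (pi * \<alpha> / 2))))"

definition stable_law :: "real \<Rightarrow> real \<Rightarrow> real \<Rightarrow> real measure \<Rightarrow> bool" where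
  "stable_law \<alpha> \<sigma> \<nu> L \<longleftrightarrow> real_distribution L \<and> (\<forall>\<theta>. char L \<theta> = stable_char \<alpha> \<sigma> \<nu> \<theta>)"

text \<open>A property of the law \<open>D\<close> of a random variable; the i.i.d. copies are the coordinates
  of the product space \<open>D\<^sup>n\<close>.\<close>

definition normal_domain_of_attraction ::
  "real \<Rightarrow> real \<Rightarrow> real \<Rightarrow> real measure \<Rightarrow> bool" where
  "normal_domain_of_attraction \<alpha> \<sigma> \<nu> D \<longleftrightarrow>
     (\<exists>L. stable_law \<alpha> \<sigma> \<nu> L \<and>
        weak_conv_m
          (\<lambda>n. distr (Pi\<^sub>M {..<n} (\<lambda>_. D)) borel
                 (\<lambda>y. real n powr (- 1 / \<alpha>) * (\<Sum>i<n. y i))) L)"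

section \<open>Function spaces\<close>

definition L_space :: "real \<Rightarrow> (real ^ 'n \<Rightarrow> real) set" where
  "L_space a = {f \<in> borel_measurable borel. integrable lborel (\<lambda>x. \<bar>f x\<bar> powr a)}"

definition locally_integrable_on :: "(real ^ 'n \<Rightarrow> real) \<Rightarrow> (real ^ 'n) set \<Rightarrow> bool" where
  "locally_integrable_on f S \<longleftrightarrow> (\<forall>K. compact K \<and> K \<subseteq> S \<longrightarrow> set_integrable lborel K f)"

text \<open>Where the defining integral does not converge, which is a null set in the case of
  interest, the convolution is \<open>0\<close>.\<close>

definition conv_fun ::
  "(real ^ 'n \<Rightarrow> real) \<Rightarrow> (real ^ 'n \<Rightarrow> real) \<Rightarrow> real ^ 'n \<Rightarrow> real" where
  "conv_fun f g x = (\<integral>y. f y * g (x - y) \<partial>lborel)"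

section \<open>Random noises\<close>

definition random_noise ::
  "'v measure \<Rightarrow> (real ^ 'n \<Rightarrow> real) set \<Rightarrow> ((real ^ 'n \<Rightarrow> real) \<Rightarrow> 'v \<Rightarrow> real) \<Rightarrow> bool" where
  "random_noise N F W \<longleftrightarrow>
     F \<subseteq> borel_measurable borel \<and> (\<lambda>_. 0) \<in> F \<and>
     (\<forall>f\<in>F. \<forall>g\<in>F. \<forall>a b. (\<lambda>x. a * f x + b * g x) \<in> F) \<and>
     (\<forall>f\<in>F. W f \<in> borel_measurable N) \<and>
     (\<forall>f\<in>F. \<forall>g\<in>F. \<forall>a b.
        AE \<omega> in N. W (\<lambda>x. a * f x + b * g x) \<omega> = a * W f \<omega> + b * W g \<omega>)"

definition noise_scale :: "real \<Rightarrow> (real ^ 'n \<Rightarrow> real) \<Rightarrow> real" where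
  "noise_scale \<alpha> f = (\<integral>x. \<bar>f x\<bar> powr \<alpha> \<partial>lborel) powr (1 / \<alpha>)"

text \<open>If the scale is \<open>0\<close> the skewness is irrelevant; division by zero makes it \<open>0\<close>.\<close>

definition noise_skew :: "real \<Rightarrow> real \<Rightarrow> (real ^ 'n \<Rightarrow> real) \<Rightarrow> real" where
  "noise_skew \<alpha> \<nu> f =
     (\<integral>x. \<nu> * sgn (f x) * \<bar>f x\<bar> powr \<alpha> \<partial>lborel) / noise_scale \<alpha> f powr \<alpha>"

definition stable_noise ::
  "real \<Rightarrow> real \<Rightarrow> 'v measure \<Rightarrow> ((real ^ 'n \<Rightarrow> real) \<Rightarrow> 'v \<Rightarrow> real) \<Rightarrow> bool" where
  "stable_noise \<alpha> \<nu> N W \<longleftrightarrow>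
     random_noise N (L_space \<alpha>) W \<and>
     (\<forall>f\<in>L_space \<alpha>. stable_law \<alpha> (noise_scale \<alpha> f) (noise_skew \<alpha> \<nu> f) (distr N borel (W f)))"

definition fractional_noise ::
  "((real ^ 'n \<Rightarrow> real) \<Rightarrow> 'v \<Rightarrow> real) \<Rightarrow> (real ^ 'n \<Rightarrow> real) \<Rightarrow> (real ^ 'n \<Rightarrow> real) \<Rightarrow> 'v \<Rightarrow> real" where
  "fractional_noise W p f = W (conv_fun f (\<lambda>x. p (- x)))"

text \<open>Weak convergence, as \<open>h\<close> tends to \<open>0\<close> from the right, of the finite-dimensional
  distributions on \<open>F\<close>.  A vector of \<open>\<real>\<^sup>n\<close> is represented by its extension by zero to a sequence;
  the bounded continuous functions on \<open>\<real>\<^sup>n\<close> are then exactly the restrictions of bounded functions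
  on \<^typ>\<open>nat \<Rightarrow> real\<close> that are continuous for the product topology.\<close>

definition fdd_converges ::
  "'w measure \<Rightarrow> (real \<Rightarrow> 'f \<Rightarrow> 'w \<Rightarrow> real) \<Rightarrow> 'v measure \<Rightarrow> ('f \<Rightarrow> 'v \<Rightarrow> real) \<Rightarrow> 'f set \<Rightarrow> bool" where
  "fdd_converges M X N Y F \<longleftrightarrow>
     (\<forall>n. \<forall>f :: nat \<Rightarrow> 'f. (\<forall>i<n. f i \<in> F) \<longrightarrow>
        (\<forall>\<phi> :: (nat \<Rightarrow> real) \<Rightarrow> real. continuous_on UNIV \<phi> \<and> bounded (range \<phi>) \<longrightarrow>
          ((\<lambda>h. \<integral>\<omega>. \<phi> (\<lambda>i. if i < n then X h (f i) \<omega> else 0) \<partial>M)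
             \<longlongrightarrow> (\<integral>\<omega>. \<phi> (\<lambda>i. if i < n then Y (f i) \<omega> else 0) \<partial>N)) (at_right 0)))"

section \<open>The lattice field and the rescaled random signed measure\<close>

text \<open>All series over \<open>\<int>\<^sup>d\<close> with random terms are summed along a fixed enumeration
  \<open>e\<close> of \<open>\<int>\<^sup>d\<close>, since they need not converge absolutely.\<close>

definition linear_field ::
  "(nat \<Rightarrow> int ^ 'n) \<Rightarrow> (int ^ 'n \<Rightarrow> real) \<Rightarrow> (int ^ 'n \<Rightarrow> 'w \<Rightarrow> real) \<Rightarrow> int ^ 'n \<Rightarrow> 'w \<Rightarrow> real" where
  "linear_field e c \<xi> k \<omega> = (\<Sum>j. c (k - e j) * \<xi> (e j) \<omega>)"

definition cell :: "real \<Rightarrow> int ^ 'n \<Rightarrow> (real ^ 'n) set" where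
  "cell h k = (\<lambda>x. h *\<^sub>R ((\<chi> i. real_of_int (k $ i)) + x)) ` {x. \<forall>i. 0 \<le> x $ i \<and> x $ i < 1}"

text \<open>The signed measure \<open>\<mu>\<^sub>h\<close> has density \<open>\<gamma> * X k \<omega>\<close> on \<open>cell h k\<close>; \<open>mu_terms\<close> gives the
  integrals of \<open>f\<close> over the successive cells.\<close>

definition mu_terms ::
  "(nat \<Rightarrow> int ^ 'n) \<Rightarrow> (int ^ 'n \<Rightarrow> 'w \<Rightarrow> real) \<Rightarrow> real \<Rightarrow>
   (real ^ 'n \<Rightarrow> real) \<Rightarrow> 'w \<Rightarrow> nat \<Rightarrow> real" where
  "mu_terms e X h f \<omega> j = X (e j) \<omega> * (LINT x:cell h (e j)|lborel. f x)"

definition mu_int ::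
  "(nat \<Rightarrow> int ^ 'n) \<Rightarrow> (int ^ 'n \<Rightarrow> 'w \<Rightarrow> real) \<Rightarrow> (real \<Rightarrow> real) \<Rightarrow> real \<Rightarrow>
   (real ^ 'n \<Rightarrow> real) \<Rightarrow> 'w \<Rightarrow> real" where
  "mu_int e X \<gamma> h f \<omega> = \<gamma> h * (\<Sum>j. mu_terms e X h f \<omega> j)"

text \<open>The positive constant \<open>\<gamma> h\<close> does not affect convergence.\<close>

definition mu_domain ::
  "'w measure \<Rightarrow> (nat \<Rightarrow> int ^ 'n) \<Rightarrow> (int ^ 'n \<Rightarrow> 'w \<Rightarrow> real) \<Rightarrow> real \<Rightarrow> (real ^ 'n \<Rightarrow> real) set" where
  "mu_domain M e X h =
     {f. f \<in> borel_measurable borel \<and> locally_integrable_on f UNIV \<and>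
         (AE \<omega> in M. summable (mu_terms e X h f \<omega>))}"

section \<open>Regular variation of the coefficients\<close>

definition homogeneous_of_order :: "real \<Rightarrow> (real ^ 'n \<Rightarrow> real) \<Rightarrow> bool" where
  "homogeneous_of_order r p \<longleftrightarrow> (\<forall>t>0. \<forall>x. x \<noteq> 0 \<longrightarrow> p (t *\<^sub>R x) = t powr r * p x)"

definition vec_floor :: "real ^ 'n \<Rightarrow> int ^ 'n" where
  "vec_floor y = (\<chi> i. \<lfloor>y $ i\<rfloor>)"

text \<open>The function \<open>p\<close> lives on \<open>\<real>\<^sup>d - {0}\<close>: its value at \<open>0\<close> is never constrained.  The supremum
  is taken in \<^typ>\<open>ereal\<close> so that it is meaningful when it is infinite.\<close>

definition regularly_varying ::
  "(int ^ 'n \<Rightarrow> real) \<Rightarrow> real \<Rightarrow> (real ^ 'n \<Rightarrow> real) \<Rightarrow> bool" where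
  "regularly_varying c \<beta> p \<longleftrightarrow>
     locally_integrable_on p (- {0}) \<and> homogeneous_of_order (- \<beta>) p \<and>
     ((\<lambda>t. SUP x\<in>sphere 0 1. ereal \<bar>t powr \<beta> * c (vec_floor (t *\<^sub>R x)) - p x\<bar>) \<longlongrightarrow> 0) at_top"

end

theory Submission
  imports Defs
begin

text \<open>
  The proof works with characteristic functions throughout.  Let \<open>\<phi>\<close> be the characteristic function
  of the \<open>\<xi>\<^sub>k\<close> and \<open>exp (- G)\<close> that of the stable law, so that \<open>G (r * t) = r powr \<alpha> * G t\<close> for
  \<open>r \<ge> 0\<close>.  Convergence of the normalised sums without centering forces
  \<open>\<phi> t = exp (- G t) + o (\<bar>t\<bar> powr \<alpha>)\<close> at \<open>0\<close> (\<open>normal_domain_of_attraction_char\<close>), and hence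
  \<open>\<bar>1 - \<phi> t\<bar> \<le> K * \<bar>t\<bar> powr \<alpha>\<close> for all \<open>t\<close> (\<open>char_minus_1_bound\<close>).

  This bound controls linear combinations \<open>S = (\<Sum>j. a j * \<xi> j)\<close>: it gives
  \<open>\<bar>1 - \<phi>\<^sub>S t\<bar> \<le> K * A * \<bar>t\<bar> powr \<alpha>\<close> with \<open>A = (\<Sum>j. \<bar>a j\<bar> powr \<alpha>)\<close>, and integrating
  \<open>(1 - Re (\<phi>\<^sub>S t)) / t\<^sup>2\<close> over the line turns it into \<open>E \<bar>S\<bar> \<le> const * A powr (1 / \<alpha>)\<close>
  (\<open>L1_partial_sum\<close>).  Ottaviani's inequality upgrades this to the same bound for the maximum of the
  partial sums (\<open>maximal_partial_sum\<close>).  So \<open>a \<mapsto> (\<Sum>j. a j * \<xi> j)\<close> is a bounded linear map from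
  \<open>\<ell>\<^sup>\<alpha>\<close> to \<open>L\<^sup>1\<close>, given by an almost surely convergent series.  It follows that the integral of \<open>f\<close>
  against the random signed measure at scale \<open>h\<close> is almost surely \<open>\<Sum>l. A\<^sub>l * \<xi>\<^sub>l\<close>, where
  \<open>A\<^sub>l\<close> is \<open>\<gamma> h\<close> times the integral of \<open>f y * c ([y / h] - l)\<close> over \<open>y\<close>.

  The characteristic function of this sum at \<open>t\<close> is \<open>\<Prod>l. \<phi> (t * A\<^sub>l)\<close>, which is close to
  \<open>exp (- (\<Sum>l. G (t * A\<^sub>l)))\<close> when the \<open>A\<^sub>l\<close> are uniformly small and bounded in \<open>\<ell>\<^sup>\<alpha>\<close>.  Let \<open>F\<^sub>h\<close> be
  the step function with value \<open>\<sigma> * h powr (- d / \<alpha>) * A\<^sub>l\<close> on the cell of \<open>l\<close>.  By homogeneity of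
  \<open>G\<close> the exponent is an integral over space of a function of \<open>F\<^sub>h\<close>, and if \<open>F\<^sub>h\<close> tends to \<open>F\<close> in
  \<open>L\<^sup>\<alpha>\<close> then the limit is the characteristic function of \<open>W F\<close> (\<open>lattice_limit\<close>,
  \<open>char_random_series_tendsto\<close>).  It remains to prove \<open>F\<^sub>h \<longlonglongrightarrow> F\<close> in \<open>L\<^sup>\<alpha>\<close>:

  \<^item> For summable \<open>c\<close> and \<open>F = C * f\<close>, Jensen's inequality bounds the distance by an average of
    \<open>\<parallel>f (\<sqdot> + h * u) - f\<parallel>\<close> over \<open>u\<close> against an integrable kernel, and translations are continuous in
    \<open>L\<^sup>\<alpha>\<close> (\<open>lattice_conv_tendsto_L1_case\<close>).

  \<^item> For regularly varying \<open>c\<close>, the kernel \<open>h powr (- \<beta>) * c ([y / h] - [x / h])\<close> converges to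
    \<open>p (y - x)\<close> for almost every \<open>y\<close> and is dominated by a multiple of \<open>\<bar>y - x\<bar> powr (- \<beta>)\<close>.  That
    kernel maps \<open>L\<^sup>1 \<inter> L\<^sup>\<alpha>\<close> to \<open>L\<^sup>\<alpha>\<close>, so dominated convergence in \<open>y\<close> and then in \<open>x\<close> applies
    (\<open>lattice_conv_tendsto_regularly_varying\<close>).

  Finite-dimensional distributions reduce to linear combinations, hence to single functions \<open>f\<close>, by
  the multivariate continuity theorem (\<open>multivariate_levy_continuity\<close>).
\<close>

section \<open>Characteristic functions in the normal domain of attraction\<close>

text \<open>The signed power.  Together with the absolute power it spans the homogeneous functions of degree
  \<open>a\<close>, which is how the skewness enters the stable exponent.\<close>

definition spow :: "real \<Rightarrow> real \<Rightarrow> real" where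
  "spow a x = sgn x * \<bar>x\<bar> powr a"

definition stable_exponent :: "real \<Rightarrow> real \<Rightarrow> real \<Rightarrow> real \<Rightarrow> complex" where
  "stable_exponent \<alpha> \<sigma> \<nu> \<theta> =
     complex_of_real (\<sigma> powr \<alpha>) *
       Complex (\<bar>\<theta>\<bar> powr \<alpha>) (- (\<nu> * tan (pi * \<alpha> / 2) * spow \<alpha> \<theta>))"

lemma abs_spow [simp]: "\<bar>spow a x\<bar> = \<bar>x\<bar> powr a"
  by (auto simp: spow_def abs_mult sgn_real_def)

lemma spow_mult: "spow a (x * y) = spow a x * spow a y"
  by (simp add: spow_def sgn_mult abs_mult powr_mult)

lemma spow_1 [simp]: "spow a 1 = 1" and spow_0 [simp]: "spow a 0 = 0"
  by (simp_all add: spow_def)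

lemma spow_pos: "x \<ge> 0 \<Longrightarrow> spow a x = x powr a"
  by (auto simp: spow_def sgn_real_def)

lemma measurable_spow [measurable]: "spow a \<in> borel_measurable borel"
  unfolding spow_def by measurable

lemma spow_alt: "a > 0 \<Longrightarrow> spow a x = max x 0 powr a - max (- x) 0 powr a"
  by (auto simp: spow_def sgn_real_def max_def)

lemma continuous_on_spow [continuous_intros]:
  fixes f :: "'a :: topological_space \<Rightarrow> real"
  assumes "a > 0" "continuous_on S f"
  shows "continuous_on S (\<lambda>x. spow a (f x))"
  unfolding spow_alt[OF \<open>a > 0\<close>] using assms
  by (intro continuous_intros continuous_on_powr') auto

lemma continuous_on_abs_powr [continuous_intros]:
  fixes f :: "'a :: topological_space \<Rightarrow> real"
  assumes "a > 0" "continuous_on S f"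
  shows "continuous_on S (\<lambda>x. \<bar>f x\<bar> powr a)"
  using assms by (intro continuous_on_powr' continuous_intros) auto

lemma stable_char_eq_exp: "stable_char \<alpha> \<sigma> \<nu> \<theta> = exp (- stable_exponent \<alpha> \<sigma> \<nu> \<theta>)"
  by (simp add: stable_char_def stable_exponent_def spow_def complex_eq_iff Re_exp Im_exp algebra_simps)

lemma Re_stable_exponent [simp]: "Re (stable_exponent \<alpha> \<sigma> \<nu> \<theta>) = \<sigma> powr \<alpha> * \<bar>\<theta>\<bar> powr \<alpha>"
  by (simp add: stable_exponent_def)

lemma stable_exponent_scale:
  assumes "r \<ge> 0"
  shows "stable_exponent \<alpha> \<sigma> \<nu> (r * \<theta>) = complex_of_real (r powr \<alpha>) * stable_exponent \<alpha> \<sigma> \<nu> \<theta>"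
  using assms by (simp add: stable_exponent_def complex_eq_iff spow_mult spow_pos abs_mult powr_mult)

lemma continuous_stable_exponent:
  "\<alpha> > 0 \<Longrightarrow> continuous_on S (stable_exponent \<alpha> \<sigma> \<nu>)"
  unfolding stable_exponent_def Complex_eq by (intro continuous_intros) auto

lemma norm_stable_exponent_le:
  "cmod (stable_exponent \<alpha> \<sigma> \<nu> \<theta>) \<le> \<sigma> powr \<alpha> * (1 + \<bar>\<nu> * tan (pi * \<alpha> / 2)\<bar>) * \<bar>\<theta>\<bar> powr \<alpha>"
proof -
  have "cmod (Complex (\<bar>\<theta>\<bar> powr \<alpha>) (- (\<nu> * tan (pi * \<alpha> / 2) * spow \<alpha> \<theta>)))
      \<le> \<bar>\<bar>\<theta>\<bar> powr \<alpha>\<bar> + \<bar>- (\<nu> * tan (pi * \<alpha> / 2) * spow \<alpha> \<theta>)\<bar>"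
    by (metis cmod_le complex.sel)
  also have "\<dots> = (1 + \<bar>\<nu> * tan (pi * \<alpha> / 2)\<bar>) * \<bar>\<theta>\<bar> powr \<alpha>"
    by (simp add: abs_mult algebra_simps)
  finally show ?thesis
    unfolding stable_exponent_def norm_mult by (simp add: mult.assoc mult_left_mono)
qed

text \<open>Linearises the exponential near \<open>0\<close>; the constant \<open>3\<close> is a bound for \<open>e\<close>.\<close>

lemma norm_exp_minus1_le:
  fixes w :: complex
  assumes "cmod w \<le> 1"
  shows "cmod (exp w - 1) \<le> 3 * cmod w"
proof -
  have "cmod (exp w - 1) \<le> exp (cmod w) * cmod w"
    using Taylor_exp_field[of w 0] by simp
  also have "\<dots> \<le> 3 * cmod w"
  proof (rule mult_right_mono)
    have "exp (cmod w) \<le> exp 1" using assms by simp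
    thus "exp (cmod w) \<le> 3" using exp_le by linarith
  qed simp
  finally show ?thesis .
qed

lemma norm_iexp_diff_le: "cmod (iexp a - iexp b) \<le> \<bar>a - b\<bar>"
proof -
  have "iexp a - iexp b = iexp b * (iexp (a - b) - 1)"
    by (simp add: algebra_simps flip: exp_add)
  hence "cmod (iexp a - iexp b) = cmod (iexp (a - b) - 1)"
    by (simp add: norm_mult)
  also have "\<dots> \<le> \<bar>a - b\<bar>"
    using iexp_approx1[of "a - b" 0] by simp
  finally show ?thesis .
qed

text \<open>Skorohod's theorem replaces weak convergence by almost sure convergence of copies \<open>Y n\<close> to \<open>Y'\<close>, and
  for \<open>\<bar>s\<bar> \<le> 1\<close> the difference of the characteristic functions is at most the expectation of
  \<open>min 2 \<bar>Y n - Y'\<bar>\<close>, which does not depend on \<open>s\<close>.\<close>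

lemma weak_conv_char_uniform:
  assumes mu: "\<And>n. real_distribution (\<mu> n)" and L: "real_distribution L" and conv: "weak_conv_m \<mu> L"
  obtains d where "d \<longlonglongrightarrow> 0" "\<And>n s. \<bar>s\<bar> \<le> 1 \<Longrightarrow> cmod (char (\<mu> n) s - char L s) \<le> d n"
proof -
  from Skorohod[OF assms] obtain Omega :: "real measure" and Y :: "nat \<Rightarrow> real \<Rightarrow> real" and Y' :: "real \<Rightarrow> real" where
    "prob_space Omega \<and> (\<forall>n. Y n \<in> borel_measurable Omega) \<and> (\<forall>n. distr Omega borel (Y n) = \<mu> n) \<and>
     Y' \<in> measurable Omega lborel \<and> distr Omega borel Y' = L \<and> (\<forall>x \<in> space Omega. (\<lambda>n. Y n x) \<longlonglongrightarrow> Y' x)"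
    by (elim exE)
  hence ps: "prob_space Omega" and [measurable]: "\<And>n. Y n \<in> borel_measurable Omega" "Y' \<in> borel_measurable Omega"
    and dY: "\<And>n. distr Omega borel (Y n) = \<mu> n" and dY': "distr Omega borel Y' = L"
    and lim: "\<And>x. x \<in> space Omega \<Longrightarrow> (\<lambda>n. Y n x) \<longlonglongrightarrow> Y' x"
    by simp_all
  interpret prob_space Omega by (rule ps)
  define d where "d n = (\<integral>x. min 2 \<bar>Y n x - Y' x\<bar> \<partial>Omega)" for n
  have "d \<longlonglongrightarrow> (\<integral>x. 0 \<partial>Omega)"
    unfolding d_def
  proof (rule integral_dominated_convergence[where w="\<lambda>_. 2"])
    show "AE x in Omega. (\<lambda>n. min 2 \<bar>Y n x - Y' x\<bar>) \<longlonglongrightarrow> 0"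
    proof (rule AE_I2)
      fix x assume "x \<in> space Omega"
      hence "(\<lambda>n. min 2 \<bar>Y n x - Y' x\<bar>) \<longlonglongrightarrow> min 2 \<bar>Y' x - Y' x\<bar>"
        by (intro tendsto_intros lim)
      thus "(\<lambda>n. min 2 \<bar>Y n x - Y' x\<bar>) \<longlonglongrightarrow> 0" by simp
    qed
  qed auto
  moreover have "cmod (char (\<mu> n) s - char L s) \<le> d n" if s: "\<bar>s\<bar> \<le> 1" for n s
  proof -
    have "char (\<mu> n) s - char L s = (CLINT x|Omega. iexp (s * Y n x) - iexp (s * Y' x))"
      unfolding dY[symmetric] dY'[symmetric] char_def
      by (simp add: integral_distr integrable_iexp)
    also have "cmod \<dots> \<le> (\<integral>x. cmod (iexp (s * Y n x) - iexp (s * Y' x)) \<partial>Omega)"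
      by (rule integral_norm_bound)
    also have "\<dots> \<le> d n"
      unfolding d_def
    proof (rule integral_mono)
      show "integrable Omega (\<lambda>x. cmod (iexp (s * Y n x) - iexp (s * Y' x)))"
        by (intro integrable_norm Bochner_Integration.integrable_diff integrable_iexp) auto
      show "integrable Omega (\<lambda>x. min 2 \<bar>Y n x - Y' x\<bar>)"
        by (rule integrable_const_bound[where B=2]) auto
      fix x
      have "cmod (iexp (s * Y n x) - iexp (s * Y' x)) \<le> \<bar>s\<bar> * \<bar>Y n x - Y' x\<bar>"
        using norm_iexp_diff_le[of "s * Y n x" "s * Y' x"] by (simp add: abs_mult flip: right_diff_distrib)
      also have "\<dots> \<le> 1 * \<bar>Y n x - Y' x\<bar>" by (intro mult_right_mono s) auto
      finally have "cmod (iexp (s * Y n x) - iexp (s * Y' x)) \<le> \<bar>Y n x - Y' x\<bar>" by simp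
      moreover have "cmod (iexp (s * Y n x) - iexp (s * Y' x)) \<le> 2"
        using norm_triangle_ineq4[of "iexp (s * Y n x)" "iexp (s * Y' x)"] by simp
      ultimately show "cmod (iexp (s * Y n x) - iexp (s * Y' x)) \<le> min 2 \<bar>Y n x - Y' x\<bar>" by simp
    qed
    finally show ?thesis .
  qed
  ultimately show ?thesis using that by simp
qed

text \<open>Identifies the branch of the logarithm: the difference of the two sides is continuous, takes values
  in the discrete set \<open>2 * pi * \<i> * \<int>\<close>, and vanishes at \<open>0\<close>.\<close>

lemma Ln_eq_of_exp_near_1:
  fixes D :: "real \<Rightarrow> complex"
  assumes cont: "continuous_on {-1..1} D" and D0: "D 0 = 0"
    and near: "\<And>s. s \<in> {-1..1} \<Longrightarrow> cmod (exp (D s) - 1) < 1/2" and s: "s \<in> {-1..1}"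
  shows "D s = Ln (exp (D s))"
proof -
  have nonpos: "exp (D s) \<notin> \<real>\<^sub>\<le>\<^sub>0" if "s \<in> {-1..1}" for s
  proof
    assume "exp (D s) \<in> \<real>\<^sub>\<le>\<^sub>0"
    hence "Re (exp (D s) - 1) \<le> -1" by (auto simp: complex_nonpos_Reals_iff)
    moreover have "\<bar>Re (exp (D s) - 1)\<bar> \<le> cmod (exp (D s) - 1)" by (rule abs_Re_le_cmod)
    ultimately show False using near[OF that] by linarith
  qed
  define g where "g s = D s - Ln (exp (D s))" for s
  have cg: "continuous_on {-1..1} g"
    unfolding g_def by (intro continuous_intros cont) (use nonpos in auto)
  have eg: "exp (g s) = 1" for s
    by (simp add: g_def exp_diff)
  have "g constant_on {-1..1}"
  proof (rule continuous_discrete_range_constant[OF _ cg])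
    fix x :: real assume "x \<in> {-1..1}"
    have "2 * pi \<le> cmod (g y - g x)" if "g y \<noteq> g x" for y
    proof (rule ccontr)
      assume "\<not> ?thesis"
      moreover have "\<bar>Im (g y) - Im (g x)\<bar> \<le> cmod (g y - g x)"
        using abs_Im_le_cmod[of "g y - g x"] by simp
      ultimately have "\<bar>Im (g y) - Im (g x)\<bar> < 2 * pi" by linarith
      moreover have "exp (g y) = exp (g x)" by (simp only: eg)
      ultimately have "g y = g x" by (rule exp_complex_eqI)
      with that show False by simp
    qed
    hence "\<forall>y. y \<in> {-1..1} \<and> g y \<noteq> g x \<longrightarrow> 2 * pi \<le> cmod (g y - g x)" by blast
    moreover have "2 * pi > 0" by simp
    ultimately show "\<exists>e>0. \<forall>y. y \<in> {-1..1} \<and> g y \<noteq> g x \<longrightarrow> e \<le> cmod (g y - g x)" by blast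
  qed auto
  then obtain k where k: "\<And>s. s \<in> {-1..1} \<Longrightarrow> g s = k" by (auto simp: constant_on_def)
  have "k = 0" using k[of 0] D0 by (simp add: g_def)
  thus ?thesis using k[OF s] by (simp add: g_def)
qed

lemma char_normalised_sum:
  assumes D: "real_distribution D"
  shows "real_distribution (distr (Pi\<^sub>M {..<n} (\<lambda>_. D)) borel (\<lambda>y. r * (\<Sum>i<n. y i)))" (is "real_distribution ?m")
    and "char (distr (Pi\<^sub>M {..<n} (\<lambda>_. D)) borel (\<lambda>y. r * (\<Sum>i<n. y i))) s = char D (s * r) ^ n"
proof -
  interpret D: real_distribution D by (rule D)
  interpret product_prob_space "\<lambda>_. D" "{..<n}" by unfold_locales
  interpret P: prob_space "Pi\<^sub>M {..<n} (\<lambda>_. D)" by (rule prob_space_PiM) (rule D.prob_space_axioms)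
  have [measurable]: "(\<lambda>y. r * (\<Sum>i<n. y i)) \<in> borel_measurable (Pi\<^sub>M {..<n} (\<lambda>_. D))"
    by (intro borel_measurable_times borel_measurable_sum) (auto intro!: measurable_component_singleton simp: D.M_is_borel)
  show "real_distribution ?m"
    by (intro real_distribution.intro P.prob_space_distr real_distribution_axioms.intro) auto
  have "char ?m s = (CLINT y|Pi\<^sub>M {..<n} (\<lambda>_. D). \<Prod>i<n. iexp (s * r * y i))"
    unfolding char_def
    by (subst integral_distr) (auto simp: exp_sum[symmetric] sum_distrib_left mult.assoc)
  also have "\<dots> = (\<Prod>i<n. CLINT y|D. iexp (s * r * y))"
    by (rule product_integral_prod) (auto intro!: D.integrable_iexp)
  finally show "char ?m s = char D (s * r) ^ n"
    by (simp add: char_def)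
qed


text \<open>By the uniform convergence above, \<open>n * Ln (\<phi> (s * n powr (- 1 / \<alpha>)))\<close> is close to \<open>- G s\<close> for all
  \<open>\<bar>s\<bar> \<le> 1\<close> once \<open>n\<close> is large.  A small \<open>t\<close> is of the form \<open>s * n powr (- 1 / \<alpha>)\<close> with \<open>n\<close> the integer
  part of \<open>\<bar>t\<bar> powr (- \<alpha>)\<close>.  Since \<open>G s = n * G t\<close>, dividing by \<open>n\<close> gives \<open>Ln (\<phi> t) = - G t + o (1 / n)\<close>,
  and \<open>1 / n\<close> is at most \<open>2 * \<bar>t\<bar> powr \<alpha>\<close>.\<close>

theorem normal_domain_of_attraction_char:
  assumes \<alpha>: "0 < \<alpha>" and D: "real_distribution D" and doa: "normal_domain_of_attraction \<alpha> \<sigma> \<nu> D"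
    and e: "e > 0"
  shows "\<exists>\<delta>>0. \<forall>t. \<bar>t\<bar> < \<delta> \<longrightarrow> cmod (char D t - stable_char \<alpha> \<sigma> \<nu> t) \<le> e * \<bar>t\<bar> powr \<alpha>"
proof -
  interpret D: real_distribution D by (rule D)
  define r where "r n = real n powr (- 1 / \<alpha>)" for n
  define \<mu> where "\<mu> n = distr (Pi\<^sub>M {..<n} (\<lambda>_. D)) borel (\<lambda>y. r n * (\<Sum>i<n. y i))" for n
  obtain L where L: "stable_law \<alpha> \<sigma> \<nu> L" and conv: "weak_conv_m \<mu> L"
    using doa unfolding normal_domain_of_attraction_def \<mu>_def r_def by auto
  have rL: "real_distribution L" and charL: "char L \<theta> = stable_char \<alpha> \<sigma> \<nu> \<theta>" for \<theta>
    using L by (auto simp: stable_law_def)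
  have charm: "char (\<mu> n) s = char D (s * r n) ^ n" and rm: "real_distribution (\<mu> n)" for n s
    unfolding \<mu>_def using char_normalised_sum[OF D, of n "r n"] by blast+
  obtain d where d0: "d \<longlonglongrightarrow> 0"
    and d: "\<And>n s. \<bar>s\<bar> \<le> 1 \<Longrightarrow> cmod (char D (s * r n) ^ n - stable_char \<alpha> \<sigma> \<nu> s) \<le> d n"
    using weak_conv_char_uniform[OF rm rL conv] by (auto simp: charm charL)
  define G where "G = stable_exponent \<alpha> \<sigma> \<nu>"
  define E where "E = exp (\<sigma> powr \<alpha>)"
  have nG: "cmod (exp (G s)) \<le> E" if "\<bar>s\<bar> \<le> 1" for s
  proof -
    have "\<bar>s\<bar> powr \<alpha> \<le> 1 powr \<alpha>" using that \<alpha> by (intro powr_mono2) auto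
    hence "\<sigma> powr \<alpha> * \<bar>s\<bar> powr \<alpha> \<le> \<sigma> powr \<alpha> * 1" by (intro mult_left_mono) auto
    thus ?thesis by (simp add: G_def E_def norm_exp_eq_Re)
  qed
  have r0: "r \<longlonglongrightarrow> 0"
    unfolding r_def using \<alpha> by (intro tendsto_neg_powr) (auto intro: filterlim_real_sequentially)
  \<comment> \<open>below \<open>1/2\<close> for the logarithm bound; the final estimate costs a factor \<open>12 = 2 * 3 * 2\<close>\<close>
  define \<eta> where "\<eta> = min (1/3) (e / 12)"
  have \<eta>: "0 < \<eta>" "\<eta> < 1/2" "12 * \<eta> \<le> e" using e by (auto simp: \<eta>_def)
  obtain \<delta>0 where \<delta>0: "\<delta>0 > 0" "\<And>t. \<bar>t\<bar> < \<delta>0 \<Longrightarrow> cmod (char D t - 1) < 1/2"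
  proof -
    have "\<exists>d>0. \<forall>x'. dist x' 0 < d \<longrightarrow> dist (char D x') (char D 0) < 1/2"
      using D.isCont_char[of 0] unfolding continuous_at_eps_delta by (metis half_gt_zero_iff zero_less_one)
    thus ?thesis using that by (auto simp: dist_norm D.char_zero)
  qed
  have "\<forall>\<^sub>F n in sequentially. d n * E < \<eta> \<and> \<bar>r n\<bar> < \<delta>0 \<and> n \<ge> 1"
  proof (intro eventually_conj)
    have "(\<lambda>n. d n * E) \<longlonglongrightarrow> 0 * E" by (intro tendsto_intros d0)
    thus "\<forall>\<^sub>F n in sequentially. d n * E < \<eta>" using \<eta>(1) by (intro order_tendstoD(2)) auto
    show "\<forall>\<^sub>F n in sequentially. \<bar>r n\<bar> < \<delta>0"
      using tendsto_rabs[OF r0] \<delta>0(1) by (intro order_tendstoD(2)) auto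
  qed (rule eventually_ge_at_top)
  then obtain N where N: "\<And>n. n \<ge> N \<Longrightarrow> d n * E < \<eta>" "\<And>n. n \<ge> N \<Longrightarrow> \<bar>r n\<bar> < \<delta>0"
    and N1: "\<And>n. n \<ge> N \<Longrightarrow> n \<ge> 1"
    by (auto simp: eventually_sequentially)
  have key: "cmod (of_nat n * Ln (char D (s * r n)) + G s) \<le> 2 * \<eta> \<and> char D (s * r n) \<noteq> 0"
    if n: "n \<ge> N" and s: "s \<in> {-1..1}" for n s
  proof -
    have near: "cmod (char D (s * r n) - 1) < 1/2" if "s \<in> {-1..1}" for s
    proof (rule \<delta>0(2))
      have "\<bar>s * r n\<bar> \<le> 1 * \<bar>r n\<bar>" unfolding abs_mult by (intro mult_right_mono) (use that in auto)
      thus "\<bar>s * r n\<bar> < \<delta>0" using N(2)[OF n] by simp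
    qed
    have nonpos: "char D (s * r n) \<notin> \<real>\<^sub>\<le>\<^sub>0" if "s \<in> {-1..1}" for s
    proof
      assume "char D (s * r n) \<in> \<real>\<^sub>\<le>\<^sub>0"
      hence "Re (char D (s * r n) - 1) \<le> -1" by (auto simp: complex_nonpos_Reals_iff)
      moreover have "\<bar>Re (char D (s * r n) - 1)\<bar> \<le> cmod (char D (s * r n) - 1)" by (rule abs_Re_le_cmod)
      ultimately show False using near[OF that] by linarith
    qed
    hence nz: "char D (s * r n) \<noteq> 0" if "s \<in> {-1..1}" for s using that by force
    define B where "B s = of_nat n * Ln (char D (s * r n)) + G s" for s
    have expB: "cmod (exp (B s) - 1) < \<eta>" if s: "s \<in> {-1..1}" for s
    proof -
      have s': "\<bar>s\<bar> \<le> 1" using s by auto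
      have "exp (B s) - 1 = (char D (s * r n) ^ n - stable_char \<alpha> \<sigma> \<nu> s) * exp (G s)"
        unfolding B_def exp_add exp_of_nat_mult using nz[OF s]
        by (simp add: stable_char_eq_exp G_def left_diff_distrib flip: exp_add)
      hence "cmod (exp (B s) - 1) \<le> d n * E"
        by (simp only: norm_mult)
          (intro mult_mono d nG order.trans[OF norm_ge_zero d[OF s']] s' norm_ge_zero)
      thus ?thesis using N(1)[OF n] by linarith
    qed
    have "continuous_on {-1..1} (\<lambda>s. char D (s * r n))"
      by (intro continuous_at_imp_continuous_on ballI continuous_at_compose[unfolded o_def, of _ "\<lambda>s. s * r n" "char D"]
            D.isCont_char continuous_intros)
    hence "continuous_on {-1..1} B"
      unfolding B_def G_def
      by (intro continuous_intros continuous_stable_exponent \<alpha>) (use nonpos in auto)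
    moreover have "B 0 = 0" by (simp add: B_def G_def stable_exponent_def D.char_zero complex_eq_iff)
    moreover have "cmod (exp (B s) - 1) < 1 / 2" if "s \<in> {-1..1}" for s
      using expB[OF that] \<eta>(2) by linarith
    ultimately have "B s = Ln (exp (B s))" using s by (rule Ln_eq_of_exp_near_1)
    hence "B s = Ln (1 + (exp (B s) - 1))" by simp
    also have "cmod \<dots> \<le> 2 * cmod (exp (B s) - 1)"
      using expB[OF s] \<eta> by (intro norm_Ln_le) auto
    also have "\<dots> \<le> 2 * \<eta>" using expB[OF s] by simp
    finally show ?thesis using nz[OF s] by (simp add: B_def)
  qed
  have N1': "N \<ge> 1" using N1 by simp
  show ?thesis
  proof (intro exI[of _ "real N powr (- 1 / \<alpha>)"] conjI allI impI)
    show "0 < real N powr (- 1 / \<alpha>)" using N1' by simp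
    fix t assume t: "\<bar>t\<bar> < real N powr (- 1 / \<alpha>)"
    show "cmod (char D t - stable_char \<alpha> \<sigma> \<nu> t) \<le> e * \<bar>t\<bar> powr \<alpha>"
    proof (cases "t = 0")
      case True
      thus ?thesis by (simp add: D.char_zero stable_char_def)
    next
      case False
      define q where "q = \<bar>t\<bar> powr \<alpha>"
      have q: "q > 0" using False by (simp add: q_def)
      have "q < (real N powr (- 1 / \<alpha>)) powr \<alpha>"
        unfolding q_def using t \<alpha> by (intro powr_less_mono2) auto
      also have "\<dots> = 1 / real N"
        by (subst powr_powr) (use \<alpha> N1' in \<open>simp add: powr_minus_divide\<close>)
      finally have qN: "real N < 1 / q" using q N1' by (simp add: field_simps)
      \<comment> \<open>chosen so that \<open>t = s * r n\<close> with \<open>\<bar>s\<bar> \<le> 1\<close>, while \<open>1 / n\<close> stays comparable to \<open>q\<close>\<close>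
      define n where "n = nat \<lfloor>1 / q\<rfloor>"
      have nn: "real n \<le> 1 / q" "1 / q < real n + 1" 
        using q by (auto simp: n_def intro: of_nat_floor) 
      have "n \<ge> N" using nn qN by linarith
      hence n: "n \<ge> N" "n \<ge> 1" using N1' by auto
      have n2: "1 / real n \<le> 2 * q"
      proof -
        have "1 / q \<le> 2 * real n" using nn n by linarith
        thus ?thesis using q n by (simp add: field_simps)
      qed 
      have tr: "\<bar>t\<bar> \<le> r n"
      proof -
        have "\<bar>t\<bar> = q powr (1 / \<alpha>)" using \<alpha> by (simp add: q_def powr_powr)
        also have "\<dots> \<le> (1 / real n) powr (1 / \<alpha>)"
          using nn n q \<alpha> by (intro powr_mono2) (auto simp: field_simps)
        also have "\<dots> = r n" using n by (simp add: r_def powr_minus_divide powr_divide)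
        finally show ?thesis .
      qed
      have rn: "r n > 0" using n by (simp add: r_def)
      define s where "s = t / r n"
      have s: "s \<in> {-1..1}" "s * r n = t" using tr rn by (auto simp: s_def divide_simps abs_le_iff)
      define w where "w = (of_nat n * Ln (char D t) + G s) / of_nat n"
      have nw: "cmod w \<le> 2 * \<eta> / real n" and nz: "char D t \<noteq> 0"
        using key[OF n(1) s(1)] by (auto simp: w_def s(2) norm_divide divide_right_mono)
      have "r n powr \<alpha> = 1 / real n"
        unfolding r_def by (subst powr_powr) (use \<alpha> n in \<open>simp add: powr_minus_divide\<close>)
      hence "G t = G s / of_nat n"
        using stable_exponent_scale[of "r n" \<alpha> \<sigma> \<nu> s] rn s(2) by (simp add: G_def mult.commute)
      hence Lnw: "Ln (char D t) = w - G t" using n by (simp add: w_def add_divide_distrib)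
      have "char D t = exp (w - G t)" using nz by (simp flip: Lnw)
      hence "char D t - stable_char \<alpha> \<sigma> \<nu> t = exp (- G t) * (exp w - 1)"
        by (simp add: stable_char_eq_exp G_def exp_diff exp_minus field_simps)
      moreover have "cmod (exp (- G t)) \<le> 1" by (simp add: G_def norm_exp_eq_Re)
      moreover have "cmod (exp w - 1) \<le> 3 * cmod w"
      proof -
        have "2 * \<eta> / real n \<le> 1" using n \<eta> by (simp add: field_simps)
        hence "cmod w \<le> 1" using nw by linarith
        thus ?thesis using norm_exp_minus1_le by blast
      qed
      ultimately have "cmod (char D t - stable_char \<alpha> \<sigma> \<nu> t) \<le> 1 * (3 * cmod w)"
        unfolding norm_mult by (metis (no_types) norm_mult mult_mono norm_ge_zero zero_le_one)
      also have "\<dots> \<le> 6 * \<eta> * (1 / real n)" using nw by simp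
      also have "\<dots> \<le> 6 * \<eta> * (2 * q)" using n2 \<eta> by (intro mult_left_mono) auto
      also have "\<dots> = (12 * \<eta>) * q" by simp
      also have "\<dots> \<le> e * q" using \<eta> q by (intro mult_right_mono) auto
      finally show ?thesis by (simp add: q_def)
    qed
  qed
qed

lemma char_minus_1_bound:
  assumes \<alpha>: "0 < \<alpha>" and D: "real_distribution D" and doa: "normal_domain_of_attraction \<alpha> \<sigma> \<nu> D"
  shows "\<exists>K\<ge>0. \<forall>t. cmod (1 - char D t) \<le> K * \<bar>t\<bar> powr \<alpha>"
proof -
  interpret D: real_distribution D by (rule D)
  obtain \<delta> where \<delta>: "\<delta> > 0"
    and near: "\<And>t. \<bar>t\<bar> < \<delta> \<Longrightarrow> cmod (char D t - stable_char \<alpha> \<sigma> \<nu> t) \<le> 1 * \<bar>t\<bar> powr \<alpha>"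
    using normal_domain_of_attraction_char[OF \<alpha> D doa, of 1] by auto
  define C where "C = \<sigma> powr \<alpha> * (1 + \<bar>\<nu> * tan (pi * \<alpha> / 2)\<bar>)"
  have C: "C \<ge> 0" by (simp add: C_def)
  have bd: "cmod (1 - char D t) \<le> (1 + 3 * C + 2 / \<delta> powr \<alpha>) * \<bar>t\<bar> powr \<alpha>" for t
  proof -
    define G where "G = stable_exponent \<alpha> \<sigma> \<nu> t"
    have G: "cmod G \<le> C * \<bar>t\<bar> powr \<alpha>" unfolding G_def C_def by (rule norm_stable_exponent_le)
    have "cmod (1 - exp (- G)) \<le> 3 * cmod G"
    proof (cases "cmod G \<le> 1")
      case True
      thus ?thesis using norm_exp_minus1_le[of "- G"] by (simp add: norm_minus_commute)
    next
      case False
      have "cmod (exp (- G)) \<le> 1" by (simp add: G_def norm_exp_eq_Re)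
      hence "cmod (1 - exp (- G)) \<le> 1 + 1"
        by (metis add_left_mono norm_one norm_triangle_ineq4 order.trans)
      thus ?thesis using False by simp
    qed
    hence st: "cmod (1 - stable_char \<alpha> \<sigma> \<nu> t) \<le> 3 * C * \<bar>t\<bar> powr \<alpha>"
      using G by (simp add: stable_char_eq_exp G_def)
    show ?thesis
    proof (cases "\<bar>t\<bar> < \<delta>")
      case True
      have "cmod (1 - char D t) \<le> cmod (1 - stable_char \<alpha> \<sigma> \<nu> t) + cmod (char D t - stable_char \<alpha> \<sigma> \<nu> t)"
        using norm_triangle_ineq4[of "1 - stable_char \<alpha> \<sigma> \<nu> t" "char D t - stable_char \<alpha> \<sigma> \<nu> t"] by simp
      also have "\<dots> \<le> (1 + 3 * C) * \<bar>t\<bar> powr \<alpha>" using st near[OF True] by (simp add: algebra_simps)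
      also have "\<dots> \<le> (1 + 3 * C + 2 / \<delta> powr \<alpha>) * \<bar>t\<bar> powr \<alpha>"
        using C by (intro mult_right_mono) auto
      finally show ?thesis .
    next
      case False
      have "cmod (1 - char D t) \<le> 1 + 1"
        by (metis add_left_mono norm_one norm_triangle_ineq4 order.trans D.cmod_char_le_1)
      also have "\<dots> \<le> 2 / \<delta> powr \<alpha> * \<bar>t\<bar> powr \<alpha>"
        using False \<delta> \<alpha> powr_mono2[of \<alpha> \<delta> "\<bar>t\<bar>"] by (simp add: field_simps)
      also have "\<dots> \<le> (1 + 3 * C + 2 / \<delta> powr \<alpha>) * \<bar>t\<bar> powr \<alpha>"
        using C by (intro mult_right_mono) auto
      finally show ?thesis .
    qed
  qed
  show ?thesis
    by (intro exI[of _ "1 + 3 * C + 2 / \<delta> powr \<alpha>"] conjI allI bd) (use C in auto)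
qed

section \<open>Moment and maximal inequalities for independent summands\<close>

text \<open>Integrable at the origin because \<open>\<alpha> - 2 > -1\<close>, and at infinity because of the truncation at \<open>2\<close>.\<close>

lemma nn_integral_min_powr_finite:
  assumes \<alpha>: "1 < \<alpha>"
  shows "(\<integral>\<^sup>+s. ennreal (min 2 (\<bar>s\<bar> powr \<alpha>) / s\<^sup>2) \<partial>lborel) < \<infinity>"
proof -
  define h :: "real \<Rightarrow> ennreal" where
    "h s = ennreal (s powr (\<alpha> - 2)) * indicator {0..1} s + ennreal (2 * s powr (-2)) * indicator {1..} s" for s
  have [measurable]: "h \<in> borel_measurable borel" unfolding h_def by measurable
  have "(\<integral>\<^sup>+s. h s \<partial>lborel) =
      (\<integral>\<^sup>+s. ennreal (s powr (\<alpha> - 2)) * indicator {0..1} s \<partial>lborel)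
      + (\<integral>\<^sup>+s. ennreal (2 * s powr (-2)) * indicator {1..} s \<partial>lborel)"
    unfolding h_def by (intro nn_integral_add) auto
  also have "(\<integral>\<^sup>+s. ennreal (s powr (\<alpha> - 2)) * indicator {0..1} s \<partial>lborel) = ennreal (1 powr (\<alpha> - 2 + 1) / (\<alpha> - 2 + 1))"
    by (rule nn_integral_has_integral_lebesgue'[OF _ has_integral_powr_from_0]) (use \<alpha> in auto)
  also have "(\<integral>\<^sup>+s. ennreal (2 * s powr (-2)) * indicator {1..} s \<partial>lborel) = ennreal (2 * (- (1 powr (-2 + 1)) / (-2 + 1)))"
    by (rule nn_integral_has_integral_lebesgue'[OF _ has_integral_mult_right[OF has_integral_powr_to_inf]]) auto
  finally have fin: "(\<integral>\<^sup>+s. h s \<partial>lborel) < \<infinity>" by (simp add: ennreal_plus[symmetric] del: ennreal_plus)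
  have "(\<integral>\<^sup>+s. ennreal (min 2 (\<bar>s\<bar> powr \<alpha>) / s\<^sup>2) \<partial>lborel) \<le> (\<integral>\<^sup>+s. h s + h (- s) \<partial>lborel)"
  proof (rule nn_integral_mono)
    fix s :: real
    have *: "ennreal (min 2 (s powr \<alpha>) / s\<^sup>2) \<le> h s" if s: "s > 0" for s
    proof (cases "s \<le> 1")
      case True
      have "min 2 (s powr \<alpha>) / s\<^sup>2 \<le> s powr \<alpha> / s\<^sup>2" by (intro divide_right_mono) auto
      also have "\<dots> = s powr (\<alpha> - 2)" using s by (simp add: powr_diff powr_numeral)
      finally have "ennreal (min 2 (s powr \<alpha>) / s\<^sup>2) \<le> ennreal (s powr (\<alpha> - 2)) * indicator {0..1} s"
        using True s by (auto intro!: ennreal_leI)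
      thus ?thesis unfolding h_def by (intro add_increasing2) auto
    next
      case False
      have "min 2 (s powr \<alpha>) / s\<^sup>2 \<le> 2 / s\<^sup>2" by (intro divide_right_mono) auto
      also have "\<dots> = 2 * s powr (-2)" using s by (simp add: powr_minus powr_numeral divide_inverse)
      finally have "ennreal (min 2 (s powr \<alpha>) / s\<^sup>2) \<le> ennreal (2 * s powr (-2)) * indicator {1..} s"
        using False s by (auto intro!: ennreal_leI)
      thus ?thesis unfolding h_def by (intro add_increasing) auto
    qed
    show "ennreal (min 2 (\<bar>s\<bar> powr \<alpha>) / s\<^sup>2) \<le> h s + h (- s)"
      using *[of s] *[of "- s"] by (cases "s > 0"; cases "s < 0") (auto intro: add_increasing add_increasing2)
  qed
  also have "\<dots> = (\<integral>\<^sup>+s. h s \<partial>lborel) + (\<integral>\<^sup>+s. h (- s) \<partial>lborel)"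
    by (intro nn_integral_add) auto
  also have "(\<integral>\<^sup>+s. h (- s) \<partial>lborel) = (\<integral>\<^sup>+s. h s \<partial>lborel)"
    by (subst (2) nn_integral_real_affine[where c="-1" and t=0]) auto
  finally show ?thesis
    by (rule le_less_trans) (use fin in \<open>simp add: less_top[symmetric]\<close>)
qed

lemma nn_integral_min_powr_scale:
  assumes \<alpha>: "1 < \<alpha>" and B: "B > 0"
  shows "(\<integral>\<^sup>+t. ennreal (min 2 (B * \<bar>t\<bar> powr \<alpha>) / t\<^sup>2) \<partial>lborel)
    = ennreal (B powr (1 / \<alpha>)) * (\<integral>\<^sup>+s. ennreal (min 2 (\<bar>s\<bar> powr \<alpha>) / s\<^sup>2) \<partial>lborel)"
proof -
  define \<tau> where "\<tau> = B powr (- 1 / \<alpha>)"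
  have "\<tau> powr \<alpha> = B powr (-1)" using \<alpha> by (simp add: \<tau>_def powr_powr)
  hence \<tau>: "\<tau> > 0" "B * \<tau> powr \<alpha> = 1" "1 / \<tau> = B powr (1 / \<alpha>)"
    using B \<alpha> by (auto simp: \<tau>_def powr_minus_divide)
  have "(\<integral>\<^sup>+t. ennreal (min 2 (B * \<bar>t\<bar> powr \<alpha>) / t\<^sup>2) \<partial>lborel)
      = ennreal \<tau> * (\<integral>\<^sup>+s. ennreal (min 2 (B * \<bar>\<tau> * s\<bar> powr \<alpha>) / (\<tau> * s)\<^sup>2) \<partial>lborel)"
    using \<tau> by (subst nn_integral_real_affine[where c=\<tau> and t=0]) auto
  also have "(\<lambda>s. ennreal (min 2 (B * \<bar>\<tau> * s\<bar> powr \<alpha>) / (\<tau> * s)\<^sup>2)) =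
      (\<lambda>s. ennreal (1 / \<tau>\<^sup>2) * ennreal (min 2 (\<bar>s\<bar> powr \<alpha>) / s\<^sup>2))"
  proof
    fix s :: real
    have "B * \<bar>\<tau> * s\<bar> powr \<alpha> = \<bar>s\<bar> powr \<alpha>" using \<tau> by (simp add: abs_mult powr_mult flip: mult.assoc)
    thus "ennreal (min 2 (B * \<bar>\<tau> * s\<bar> powr \<alpha>) / (\<tau> * s)\<^sup>2) = ennreal (1 / \<tau>\<^sup>2) * ennreal (min 2 (\<bar>s\<bar> powr \<alpha>) / s\<^sup>2)"
      by (simp add: power_mult_distrib flip: ennreal_mult)
  qed
  also have "(\<integral>\<^sup>+s. ennreal (1 / \<tau>\<^sup>2) * ennreal (min 2 (\<bar>s\<bar> powr \<alpha>) / s\<^sup>2) \<partial>lborel)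
      = ennreal (1 / \<tau>\<^sup>2) * (\<integral>\<^sup>+s. ennreal (min 2 (\<bar>s\<bar> powr \<alpha>) / s\<^sup>2) \<partial>lborel)"
    by (rule nn_integral_cmult) auto
  also have "ennreal \<tau> * (ennreal (1 / \<tau>\<^sup>2) * (\<integral>\<^sup>+s. ennreal (min 2 (\<bar>s\<bar> powr \<alpha>) / s\<^sup>2) \<partial>lborel))
    = ennreal (1 / \<tau>) * (\<integral>\<^sup>+s. ennreal (min 2 (\<bar>s\<bar> powr \<alpha>) / s\<^sup>2) \<partial>lborel)"
    using \<tau> by (simp add: power2_eq_square flip: mult.assoc ennreal_mult)
  finally show ?thesis by (simp only: \<tau>(3))
qed

text \<open>A lower bound version of the formula that recovers \<open>\<bar>x\<bar>\<close> from an integral of cosines.  On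
  \<open>1 / \<bar>x\<bar> \<le> t \<le> 2 / \<bar>x\<bar>\<close> the integrand is at least \<open>(1 - cos 1) * x\<^sup>2 / 4\<close>, and this interval has
  length \<open>1 / \<bar>x\<bar>\<close>.\<close>

lemma abs_le_nn_integral_cos:
  "ennreal ((1 - cos 1) / 4) * ennreal \<bar>x\<bar> \<le> (\<integral>\<^sup>+t. ennreal ((1 - cos (t * x)) / t\<^sup>2) \<partial>lborel)"
proof (cases "x = 0")
  case False
  define y where "y = \<bar>x\<bar>"
  have y: "y > 0" using False by (simp add: y_def)
  have cy: "cos (t * x) = cos (t * y)" for t by (auto simp: y_def abs_if)
  have "ennreal ((1 - cos 1) / 4) * ennreal \<bar>x\<bar>
      = (\<integral>\<^sup>+t. ennreal ((1 - cos 1) * y\<^sup>2 / 4) * indicator {1 / y .. 2 / y} t \<partial>lborel)"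
    using y by (subst nn_integral_cmult_indicator)
      (auto simp: divide_right_mono y_def[symmetric] power2_eq_square field_simps simp flip: ennreal_mult diff_divide_distrib)
  also have "\<dots> \<le> (\<integral>\<^sup>+t. ennreal ((1 - cos (t * x)) / t\<^sup>2) \<partial>lborel)"
  proof (rule nn_integral_mono)
    fix t :: real
    show "ennreal ((1 - cos 1) * y\<^sup>2 / 4) * indicator {1 / y .. 2 / y} t \<le> ennreal ((1 - cos (t * x)) / t\<^sup>2)"
    proof (cases "t \<in> {1 / y .. 2 / y}")
      case True
      hence t: "1 \<le> t * y" "t * y \<le> 2" "t > 0" using y by (auto simp: field_simps intro: less_le_trans[of _ "1 / y"])
      have "cos (t * y) \<le> cos 1" using t pi_gt3 by (intro cos_monotone_0_pi_le) auto
      moreover have "y\<^sup>2 / 4 \<le> 1 / t\<^sup>2"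
      proof -
        have "(t * y)\<^sup>2 \<le> 2\<^sup>2" using t by (intro power_mono) auto
        thus ?thesis using t by (simp add: field_simps power_mult_distrib)
      qed
      ultimately have "(1 - cos 1) * (y\<^sup>2 / 4) \<le> (1 - cos (t * y)) * (1 / t\<^sup>2)"
        by (intro mult_mono) auto
      thus ?thesis using True by (auto simp: cy intro!: ennreal_leI)
    qed auto
  qed
  finally show ?thesis .
qed auto

lemma cos_1_less_1: "cos (1::real) < 1"
  using cos_monotone_0_pi[of 0 "1::real"] pi_gt3 by simp

lemma tail_sums:
  fixes a :: "nat \<Rightarrow> real"
  assumes "summable a"
  shows "(\<lambda>j. if j < n then 0 else a j) sums (suminf a - (\<Sum>j<n. a j))"
    and "(\<lambda>n. suminf a - (\<Sum>j<n. a j)) \<longlonglongrightarrow> 0"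
proof -
  have "(\<lambda>j. a j - (if j \<in> {..<n} then a j else 0)) sums (suminf a - (\<Sum>j\<in>{..<n}. a j))"
    by (intro sums_diff summable_sums assms sums_If_finite_set) auto
  moreover have "(\<lambda>j. a j - (if j \<in> {..<n} then a j else 0)) = (\<lambda>j. if j < n then 0 else a j)" by auto
  ultimately show "(\<lambda>j. if j < n then 0 else a j) sums (suminf a - (\<Sum>j<n. a j))" by simp
  have "(\<lambda>n. suminf a - (\<Sum>j<n. a j)) \<longlonglongrightarrow> suminf a - suminf a"
    by (intro tendsto_diff tendsto_const summable_LIMSEQ assms)
  thus "(\<lambda>n. suminf a - (\<Sum>j<n. a j)) \<longlonglongrightarrow> 0" by simp
qed

text \<open>Ottaviani's inequality.  Let \<open>k\<close> be the first index at which the partial sum exceeds \<open>u + v\<close> in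
  modulus.  This event only involves the first \<open>k\<close> summands, so it is independent of the event that
  the remaining increment is at most \<open>u\<close>, which has probability at least \<open>1/2\<close>; when both occur, the
  total exceeds \<open>v\<close>.\<close>

lemma (in prob_space) ottaviani:
  fixes X :: "nat \<Rightarrow> 'a \<Rightarrow> real"
  assumes indep: "indep_vars (\<lambda>_. borel) X {..<n}"
    and half: "\<And>k. k \<le> n \<Longrightarrow> prob {\<omega>\<in>space M. u < \<bar>\<Sum>j\<in>{k..<n}. X j \<omega>\<bar>} \<le> 1 / 2"
  shows "prob {\<omega>\<in>space M. \<exists>k\<le>n. u + v < \<bar>\<Sum>j<k. X j \<omega>\<bar>} \<le> 2 * prob {\<omega>\<in>space M. v < \<bar>\<Sum>j<n. X j \<omega>\<bar>}"
proof -
  have [measurable]: "random_variable borel (X j)" if "j < n" for j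
    using indep that by (auto simp: indep_vars_def)
  define S where "S k \<omega> = (\<Sum>j<k. X j \<omega>)" for k \<omega>
  have [measurable]: "random_variable borel (S k)" if "k \<le> n" for k
    unfolding S_def using that by (intro borel_measurable_sum) auto
  define A where "A k = {\<omega>\<in>space M. u + v < \<bar>S k \<omega>\<bar> \<and> (\<forall>i<k. \<bar>S i \<omega>\<bar> \<le> u + v)}" for k
  define G where "G k = {\<omega>\<in>space M. \<bar>\<Sum>j\<in>{k..<n}. X j \<omega>\<bar> \<le> u}" for k
  have Am: "A k \<in> events" if "k \<le> n" for k
  proof -
    have "{\<omega>\<in>space M. u + v < \<bar>S k \<omega>\<bar> \<and> (\<forall>i\<in>{..<k}. \<bar>S i \<omega>\<bar> \<le> u + v)} \<in> events"
      using that
      by (intro sets.sets_Collect_conj sets.sets_Collect_finite_All borel_measurable_less borel_measurable_le borel_measurable_abs) auto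
    thus ?thesis by (simp add: A_def Ball_def)
  qed
  have Gm: "G k \<in> events" if "k \<le> n" for k
    unfolding G_def using that by measurable
  have indepAG: "prob (A k \<inter> G k) = prob (A k) * prob (G k)" if k: "k \<le> n" for k
  proof -
    define S' where "S' i x = (\<Sum>j<i. x j :: real)" for i and x :: "nat \<Rightarrow> real"
    define T where "T x = (\<Sum>j\<in>{k..<n}. x j :: real)" for x :: "nat \<Rightarrow> real"
    have iv: "indep_var (PiM {..<k} (\<lambda>_. borel)) (\<lambda>\<omega>. restrict (\<lambda>i. X i \<omega>) {..<k})
       (PiM {k..<n} (\<lambda>_. borel)) (\<lambda>\<omega>. restrict (\<lambda>i. X i \<omega>) {k..<n})"
      using k by (intro indep_var_restrict[OF indep]) auto
    have m1: "S' i \<in> borel_measurable (PiM {..<k} (\<lambda>_. borel))" if "i \<le> k" for i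
      unfolding S'_def using that by (intro borel_measurable_sum measurable_component_singleton) auto
    have m2 [measurable]: "T \<in> borel_measurable (PiM {k..<n} (\<lambda>_. borel))"
      unfolding T_def by (intro borel_measurable_sum measurable_component_singleton) auto
    define P where "P = {x \<in> space (PiM {..<k} (\<lambda>_. borel :: real measure)). u + v < \<bar>S' k x\<bar> \<and> (\<forall>i\<in>{..<k}. \<bar>S' i x\<bar> \<le> u + v)}"
    define Q where "Q = {x \<in> space (PiM {k..<n} (\<lambda>_. borel :: real measure)). \<bar>T x\<bar> \<le> u}"
    have "P \<in> sets (PiM {..<k} (\<lambda>_. borel))"
      unfolding P_def using m1
      by (intro sets.sets_Collect_conj sets.sets_Collect_finite_All borel_measurable_less borel_measurable_le borel_measurable_abs) auto
    moreover have "Q \<in> sets (PiM {k..<n} (\<lambda>_. borel))"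
      unfolding Q_def by measurable
    moreover have "A k = (\<lambda>\<omega>. restrict (\<lambda>i. X i \<omega>) {..<k}) -` P \<inter> space M"
      by (auto simp: A_def P_def S'_def S_def space_PiM)
    moreover have "G k = (\<lambda>\<omega>. restrict (\<lambda>i. X i \<omega>) {k..<n}) -` Q \<inter> space M"
      by (auto simp: G_def Q_def T_def space_PiM)
    ultimately show ?thesis
      using indep_varD[OF iv, of P Q] by (simp add: vimage_def Int_def conj_commute conj_left_commute) 
  qed
  have disj: "A k \<inter> A l = {}" if "k \<noteq> l" for k l
  proof -
    have "A k \<inter> A l = {}" if "k < l" for k l
    proof (intro equalityI subsetI)
      fix \<omega> assume "\<omega> \<in> A k \<inter> A l"
      hence "u + v < \<bar>S k \<omega>\<bar>" "\<bar>S k \<omega>\<bar> \<le> u + v" using that by (auto simp: A_def)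
      thus "\<omega> \<in> {}" by simp
    qed simp
    thus ?thesis using that by (metis Int_commute linorder_neqE_nat)
  qed
  have "prob {\<omega>\<in>space M. \<exists>k\<le>n. u + v < \<bar>S k \<omega>\<bar>} = prob (\<Union>k\<in>{..n}. A k)"
  proof (rule arg_cong[where f=prob])
    show "{\<omega>\<in>space M. \<exists>k\<le>n. u + v < \<bar>S k \<omega>\<bar>} = (\<Union>k\<in>{..n}. A k)"
    proof (intro equalityI subsetI)
      fix \<omega> assume "\<omega> \<in> {\<omega>\<in>space M. \<exists>k\<le>n. u + v < \<bar>S k \<omega>\<bar>}"
      hence w: "\<omega> \<in> space M" and "\<exists>k. k \<le> n \<and> u + v < \<bar>S k \<omega>\<bar>" by auto
      from exists_least_iff[THEN iffD1, OF this(2)] obtain k where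
        "k \<le> n" "u + v < \<bar>S k \<omega>\<bar>" "\<forall>i<k. \<not> (i \<le> n \<and> u + v < \<bar>S i \<omega>\<bar>)" by auto
      hence "\<omega> \<in> A k" using w by (auto simp: A_def)
      thus "\<omega> \<in> (\<Union>k\<in>{..n}. A k)" using \<open>k \<le> n\<close> by auto
    qed (auto simp: A_def)
  qed
  also have "\<dots> = (\<Sum>k\<in>{..n}. prob (A k))"
  proof (rule finite_measure_finite_Union)
    show "disjoint_family_on A {..n}"
      unfolding disjoint_family_on_def using disj by blast
  qed (use Am in auto)
  also have "\<dots> \<le> (\<Sum>k\<in>{..n}. 2 * prob (A k \<inter> G k))"
  proof (rule sum_mono)
    fix k assume "k \<in> {..n}"
    hence k: "k \<le> n" by simp
    have "G k = space M - {\<omega>\<in>space M. u < \<bar>\<Sum>j\<in>{k..<n}. X j \<omega>\<bar>}" by (auto simp: G_def)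
    moreover have "{\<omega>\<in>space M. u < \<bar>\<Sum>j\<in>{k..<n}. X j \<omega>\<bar>} \<in> events" by measurable
    ultimately have "prob (G k) \<ge> 1 / 2" using half[OF k] by (simp add: prob_compl)
    hence "prob (A k) * (1 / 2) \<le> prob (A k) * prob (G k)" by (intro mult_left_mono) auto
    thus "prob (A k) \<le> 2 * prob (A k \<inter> G k)" using indepAG[OF k] by simp
  qed
  also have "\<dots> = 2 * (\<Sum>k\<in>{..n}. prob (A k \<inter> G k))" by (simp add: sum_distrib_left)
  also have "(\<Sum>k\<in>{..n}. prob (A k \<inter> G k)) = prob (\<Union>k\<in>{..n}. A k \<inter> G k)"
  proof (rule finite_measure_finite_Union[symmetric])
    show "disjoint_family_on (\<lambda>k. A k \<inter> G k) {..n}"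
      unfolding disjoint_family_on_def using disj by blast
  qed (use Am Gm in auto)
  also have "\<dots> \<le> prob {\<omega>\<in>space M. v < \<bar>S n \<omega>\<bar>}"
  proof (rule finite_measure_mono)
    show "(\<Union>k\<in>{..n}. A k \<inter> G k) \<subseteq> {\<omega>\<in>space M. v < \<bar>S n \<omega>\<bar>}"
    proof safe
      fix k \<omega> assume k: "k \<le> n" and A: "\<omega> \<in> A k" and G: "\<omega> \<in> G k"
      have "S n \<omega> = S k \<omega> + (\<Sum>j\<in>{k..<n}. X j \<omega>)"
        unfolding S_def using k
        by (metis atLeast0LessThan sum.atLeastLessThan_concat zero_le)
      thus "v < \<bar>S n \<omega>\<bar>" using A G by (auto simp: A_def G_def)
    qed (auto simp: A_def)
  qed measurable
  finally show ?thesis unfolding S_def by simp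
qed


text \<open>The link to the stable law is the common bound \<open>K * \<bar>t\<bar> powr \<alpha>\<close> on the deviation of the
  characteristic functions from \<open>1\<close>; it is what makes every linear combination behave alike.\<close>

locale independent_stable_like = prob_space M for M :: "'a measure" +
  fixes \<zeta> :: "nat \<Rightarrow> 'a \<Rightarrow> real" and \<alpha> K :: real
  assumes indep: "indep_vars (\<lambda>_. borel) \<zeta> UNIV"
    and \<alpha>: "1 < \<alpha>" and K: "0 \<le> K"
    and char_near_1: "\<And>j t. cmod (1 - char (distr M borel (\<zeta> j)) t) \<le> K * \<bar>t\<bar> powr \<alpha>"
begin

lemma measurable_zeta [measurable]: "random_variable borel (\<zeta> j)"
  using indep by (auto simp: indep_vars_def)

lemma indep_scaled: "indep_vars (\<lambda>_. borel) (\<lambda>j \<omega>. a j * \<zeta> j \<omega>) J"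
proof (rule indep_vars_subset)
  show "indep_vars (\<lambda>_. borel) (\<lambda>j \<omega>. a j * \<zeta> j \<omega>) UNIV"
    by (rule indep_vars_compose2[OF indep, where Y="\<lambda>j x. a j * x"]) auto
qed simp

lemma char_scaled: "char (distr M borel (\<lambda>\<omega>. a * \<zeta> j \<omega>)) t = char (distr M borel (\<zeta> j)) (t * a)"
  unfolding char_def by (subst (1 2) integral_distr) (auto simp: mult.assoc)

lemma char_partial_sum:
  "char (distr M borel (\<lambda>\<omega>. \<Sum>j\<in>J. a j * \<zeta> j \<omega>)) t = (\<Prod>j\<in>J. char (distr M borel (\<zeta> j)) (t * a j))"
  by (subst char_distr_sum[OF indep_scaled]) (simp add: char_scaled)

lemma char_partial_sum_near_1:
  "cmod (1 - char (distr M borel (\<lambda>\<omega>. \<Sum>j\<in>J. a j * \<zeta> j \<omega>)) t) \<le> K * (\<Sum>j\<in>J. \<bar>a j\<bar> powr \<alpha>) * \<bar>t\<bar> powr \<alpha>"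
proof -
  have le1: "cmod (char (distr M borel (\<zeta> j)) s) \<le> 1" for j s
    by (rule real_distribution.cmod_char_le_1[OF real_distribution_distr]) simp
  have "cmod (1 - char (distr M borel (\<lambda>\<omega>. \<Sum>j\<in>J. a j * \<zeta> j \<omega>)) t)
      = cmod ((\<Prod>j\<in>J. 1) - (\<Prod>j\<in>J. char (distr M borel (\<zeta> j)) (t * a j)))"
    by (simp add: char_partial_sum)
  also have "\<dots> \<le> (\<Sum>j\<in>J. cmod (1 - char (distr M borel (\<zeta> j)) (t * a j)))"
    by (rule norm_prod_diff) (auto simp: le1)
  also have "\<dots> \<le> (\<Sum>j\<in>J. K * \<bar>t * a j\<bar> powr \<alpha>)"
    by (intro sum_mono char_near_1)
  also have "\<dots> = K * (\<Sum>j\<in>J. \<bar>a j\<bar> powr \<alpha>) * \<bar>t\<bar> powr \<alpha>"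
    by (simp add: abs_mult powr_mult sum_distrib_left sum_distrib_right mult_ac)
  finally show ?thesis .
qed

text \<open>Integrate the pointwise cosine bound and exchange the integrals: the expectation of
  \<open>1 - cos (t * X)\<close> is one minus the real part of the characteristic function.\<close>

lemma nn_integral_abs_le_char:
  assumes [measurable]: "random_variable borel X"
  shows "ennreal ((1 - cos 1) / 4) * (\<integral>\<^sup>+\<omega>. ennreal \<bar>X \<omega>\<bar> \<partial>M)
    \<le> (\<integral>\<^sup>+t. ennreal ((1 - Re (char (distr M borel X) t)) / t\<^sup>2) \<partial>lborel)"
proof -
  interpret L: pair_sigma_finite M "lborel :: real measure" by unfold_locales
  have "ennreal ((1 - cos 1) / 4) * (\<integral>\<^sup>+\<omega>. ennreal \<bar>X \<omega>\<bar> \<partial>M)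
      = (\<integral>\<^sup>+\<omega>. ennreal ((1 - cos 1) / 4) * ennreal \<bar>X \<omega>\<bar> \<partial>M)"
    by (rule nn_integral_cmult[symmetric]) measurable
  also have "\<dots> \<le> (\<integral>\<^sup>+\<omega>. (\<integral>\<^sup>+t. ennreal ((1 - cos (t * X \<omega>)) / t\<^sup>2) \<partial>lborel) \<partial>M)"
    by (intro nn_integral_mono abs_le_nn_integral_cos)
  also have "\<dots> = (\<integral>\<^sup>+t. (\<integral>\<^sup>+\<omega>. ennreal ((1 - cos (t * X \<omega>)) / t\<^sup>2) \<partial>M) \<partial>lborel)"
    by (rule L.Fubini'[symmetric]) measurable
  also have "\<dots> = (\<integral>\<^sup>+t. ennreal ((1 - Re (char (distr M borel X) t)) / t\<^sup>2) \<partial>lborel)"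
  proof (rule nn_integral_cong)
    fix t :: real
    have ic: "integrable M (\<lambda>\<omega>. cos (t * X \<omega>))"
      by (rule integrable_const_bound[where B=1]) auto
    have "char (distr M borel X) t = (CLINT \<omega>|M. iexp (t * X \<omega>))"
      by (simp add: char_def integral_distr)
    hence "Re (char (distr M borel X) t) = (\<integral>\<omega>. Re (iexp (t * X \<omega>)) \<partial>M)"
      by (simp add: integral_Re[OF integrable_iexp])
    hence re: "Re (char (distr M borel X) t) = (\<integral>\<omega>. cos (t * X \<omega>) \<partial>M)"
      by (simp add: Re_exp)
    have "(\<integral>\<^sup>+\<omega>. ennreal ((1 - cos (t * X \<omega>)) / t\<^sup>2) \<partial>M) = ennreal (\<integral>\<omega>. (1 - cos (t * X \<omega>)) / t\<^sup>2 \<partial>M)"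
      using ic by (intro nn_integral_eq_integral) auto
    also have "(\<integral>\<omega>. (1 - cos (t * X \<omega>)) / t\<^sup>2 \<partial>M) = (1 - Re (char (distr M borel X) t)) / t\<^sup>2"
      using ic by (simp add: re prob_space)
    finally show "(\<integral>\<^sup>+\<omega>. ennreal ((1 - cos (t * X \<omega>)) / t\<^sup>2) \<partial>M) = ennreal ((1 - Re (char (distr M borel X) t)) / t\<^sup>2)" .
  qed
  finally show ?thesis .
qed

definition L1_const :: real where
  "L1_const = 1 + (4 / (1 - cos 1)) * (K powr (1 / \<alpha>) *
     enn2real (\<integral>\<^sup>+s. ennreal (min 2 (\<bar>s\<bar> powr \<alpha>) / s\<^sup>2) \<partial>lborel))"

lemma L1_const_pos: "L1_const > 0"
  unfolding L1_const_def using cos_1_less_1 by (intro add_pos_nonneg mult_nonneg_nonneg) auto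

text \<open>Combines the cosine bound with \<open>\<bar>1 - \<phi>\<^sub>S t\<bar> \<le> K * A * \<bar>t\<bar> powr \<alpha>\<close>, where \<open>A\<close> is the sum of the
  \<open>\<bar>a j\<bar> powr \<alpha>\<close>.  The exponent \<open>1 / \<alpha>\<close> comes out of scaling \<open>t\<close> in the resulting integral.\<close>

lemma L1_partial_sum:
  "(\<integral>\<^sup>+\<omega>. ennreal \<bar>\<Sum>j\<in>J. a j * \<zeta> j \<omega>\<bar> \<partial>M) \<le> ennreal (L1_const * (\<Sum>j\<in>J. \<bar>a j\<bar> powr \<alpha>) powr (1 / \<alpha>))"
proof -
  define B where "B = K * (\<Sum>j\<in>J. \<bar>a j\<bar> powr \<alpha>)"
  define X where "X \<omega> = (\<Sum>j\<in>J. a j * \<zeta> j \<omega>)" for \<omega>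
  have [measurable]: "random_variable borel X" unfolding X_def by measurable
  define I where "I = (\<integral>\<^sup>+s. ennreal (min 2 (\<bar>s\<bar> powr \<alpha>) / s\<^sup>2) \<partial>lborel)"
  have I: "I = ennreal (enn2real I)"
    using nn_integral_min_powr_finite[OF \<alpha>] by (simp add: I_def)
  have B: "B \<ge> 0" unfolding B_def by (intro mult_nonneg_nonneg K sum_nonneg) auto
  have \<kappa>: "(1 - cos 1) / 4 > (0::real)" using cos_1_less_1 by simp
  have "ennreal ((1 - cos 1) / 4) * (\<integral>\<^sup>+\<omega>. ennreal \<bar>X \<omega>\<bar> \<partial>M)
    \<le> (\<integral>\<^sup>+t. ennreal ((1 - Re (char (distr M borel X) t)) / t\<^sup>2) \<partial>lborel)"
    by (rule nn_integral_abs_le_char) measurable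
  also have "\<dots> \<le> (\<integral>\<^sup>+t. ennreal (min 2 (B * \<bar>t\<bar> powr \<alpha>) / t\<^sup>2) \<partial>lborel)"
  proof (intro nn_integral_mono ennreal_leI divide_right_mono min.boundedI)
    fix t :: real
    have "cmod (char (distr M borel X) t) \<le> 1"
      by (rule real_distribution.cmod_char_le_1[OF real_distribution_distr]) simp
    hence "\<bar>Re (char (distr M borel X) t)\<bar> \<le> 1" using abs_Re_le_cmod order.trans by blast
    thus "1 - Re (char (distr M borel X) t) \<le> 2" by linarith
    have "1 - Re (char (distr M borel X) t) \<le> cmod (1 - char (distr M borel X) t)"
      using complex_Re_le_cmod[of "1 - char (distr M borel X) t"] by simp
    also have "\<dots> \<le> B * \<bar>t\<bar> powr \<alpha>"
      unfolding X_def B_def by (rule char_partial_sum_near_1)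
    finally show "1 - Re (char (distr M borel X) t) \<le> B * \<bar>t\<bar> powr \<alpha>" .
  qed auto
  also have "\<dots> \<le> ennreal (B powr (1 / \<alpha>)) * I"
  proof (cases "B = 0")
    case False
    thus ?thesis unfolding I_def using B by (subst nn_integral_min_powr_scale[OF \<alpha>]) auto
  qed simp
  also have "\<dots> = ennreal (B powr (1 / \<alpha>) * enn2real I)"
    by (subst I) (simp add: ennreal_mult)
  finally have "ennreal (4 / (1 - cos 1)) * (ennreal ((1 - cos 1) / 4) * (\<integral>\<^sup>+\<omega>. ennreal \<bar>X \<omega>\<bar> \<partial>M))
      \<le> ennreal (4 / (1 - cos 1)) * ennreal (B powr (1 / \<alpha>) * enn2real I)"
    by (rule mult_left_mono) simp
  also have "ennreal (4 / (1 - cos 1)) * ennreal (B powr (1 / \<alpha>) * enn2real I)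
      = ennreal (4 / (1 - cos 1) * (B powr (1 / \<alpha>) * enn2real I))"
    using cos_1_less_1 by (intro ennreal_mult[symmetric]) auto
  finally have "ennreal (4 / (1 - cos 1)) * ennreal ((1 - cos 1) / 4) * (\<integral>\<^sup>+\<omega>. ennreal \<bar>X \<omega>\<bar> \<partial>M)
      \<le> ennreal (4 / (1 - cos 1) * (B powr (1 / \<alpha>) * enn2real I))"
    by (simp only: mult.assoc)
  also have "ennreal (4 / (1 - cos 1)) * ennreal ((1 - cos 1) / 4) = 1"
    using cos_1_less_1 by (simp flip: ennreal_mult)
  finally have "(\<integral>\<^sup>+\<omega>. ennreal \<bar>X \<omega>\<bar> \<partial>M) \<le> ennreal (4 / (1 - cos 1) * (B powr (1 / \<alpha>) * enn2real I))"
    by simp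
  also have "4 / (1 - cos 1) * (B powr (1 / \<alpha>) * enn2real I)
      = (4 / (1 - cos 1) * (K powr (1 / \<alpha>) * enn2real I)) * (\<Sum>j\<in>J. \<bar>a j\<bar> powr \<alpha>) powr (1 / \<alpha>)"
    unfolding B_def using K by (simp add: powr_mult sum_nonneg mult_ac)
  also have "ennreal \<dots> \<le> ennreal (L1_const * (\<Sum>j\<in>J. \<bar>a j\<bar> powr \<alpha>) powr (1 / \<alpha>))"
    unfolding L1_const_def I_def by (intro ennreal_leI mult_right_mono) auto
  finally show ?thesis by (simp add: X_def)
qed


text \<open>With \<open>e\<close> the bound of the preceding lemma, Markov's inequality makes \<open>u = 2 * e\<close> admissible in
  Ottaviani's inequality.  Integrating that inequality over \<open>v \<ge> 0\<close> bounds the expected maximum by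
  \<open>2 * e\<close> plus twice the first absolute moment of the full sum.\<close>

lemma maximal_partial_sum:
  "(\<integral>\<^sup>+\<omega>. (SUP k\<in>{..n}. ennreal \<bar>\<Sum>j<k. a j * \<zeta> j \<omega>\<bar>) \<partial>M)
    \<le> ennreal (4 * L1_const * (\<Sum>j<n. \<bar>a j\<bar> powr \<alpha>) powr (1 / \<alpha>))"
proof -
  define X where "X j \<omega> = a j * \<zeta> j \<omega>" for j \<omega>
  define e where "e = L1_const * (\<Sum>j<n. \<bar>a j\<bar> powr \<alpha>) powr (1 / \<alpha>)"
  have [measurable]: "random_variable borel (X j)" for j unfolding X_def by measurable
  have L1: "(\<integral>\<^sup>+\<omega>. ennreal \<bar>\<Sum>j\<in>J. X j \<omega>\<bar> \<partial>M) \<le> ennreal e" if J: "J \<subseteq> {..<n}" for J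
  proof -
    have "(\<Sum>j\<in>J. \<bar>a j\<bar> powr \<alpha>) \<le> (\<Sum>j<n. \<bar>a j\<bar> powr \<alpha>)"
      using J by (intro sum_mono2) auto
    hence "L1_const * (\<Sum>j\<in>J. \<bar>a j\<bar> powr \<alpha>) powr (1 / \<alpha>) \<le> e"
      unfolding e_def using L1_const_pos \<alpha> by (intro mult_left_mono powr_mono2 sum_nonneg) auto
    thus ?thesis unfolding X_def using L1_partial_sum[where J=J and a=a] ennreal_leI order.trans by blast
  qed
  define mx where "mx \<omega> = (MAX k\<in>{..n}. \<bar>\<Sum>j<k. X j \<omega>\<bar>)" for \<omega>
  have [measurable]: "random_variable borel mx"
    unfolding mx_def by measurable
  have mx0: "mx \<omega> \<ge> 0" for \<omega>
    unfolding mx_def by (subst Max_ge_iff) auto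
  have mx_gt: "r < mx \<omega> \<longleftrightarrow> (\<exists>k\<le>n. r < \<bar>\<Sum>j<k. X j \<omega>\<bar>)" for r \<omega>
    unfolding mx_def by (subst Max_gr_iff) auto
  have SUP_eq: "(SUP k\<in>{..n}. ennreal \<bar>\<Sum>j<k. a j * \<zeta> j \<omega>\<bar>) = ennreal (mx \<omega>)" for \<omega>
  proof (rule antisym)
    show "(SUP k\<in>{..n}. ennreal \<bar>\<Sum>j<k. a j * \<zeta> j \<omega>\<bar>) \<le> ennreal (mx \<omega>)"
      unfolding mx_def X_def by (intro SUP_least ennreal_leI Max_ge) auto
    have "mx \<omega> \<in> (\<lambda>k. \<bar>\<Sum>j<k. X j \<omega>\<bar>) ` {..n}" unfolding mx_def by (intro Max_in) auto
    thus "ennreal (mx \<omega>) \<le> (SUP k\<in>{..n}. ennreal \<bar>\<Sum>j<k. a j * \<zeta> j \<omega>\<bar>)"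
      by (auto simp: X_def intro!: SUP_upper2)
  qed
  show ?thesis
  proof (cases "(\<Sum>j<n. \<bar>a j\<bar> powr \<alpha>) = 0")
    case True
    hence "\<forall>j\<in>{..<n}. \<bar>a j\<bar> powr \<alpha> = 0" by (subst (asm) sum_nonneg_eq_0_iff) auto
    hence "X j \<omega> = 0" if "j < n" for j \<omega> using that by (auto simp: X_def)
    hence "(\<Sum>j<k. X j \<omega>) = 0" if "k \<le> n" for k \<omega> using that by (intro sum.neutral) auto
    hence "mx \<omega> = 0" for \<omega> using mx_gt[of 0 \<omega>] mx0[of \<omega>] by auto
    thus ?thesis by (simp add: SUP_eq)
  next
    case False
    hence "(\<Sum>j<n. \<bar>a j\<bar> powr \<alpha>) > 0" by (simp add: order_less_le sum_nonneg)
    hence e: "e > 0" unfolding e_def using L1_const_pos by (intro mult_pos_pos) auto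
    have half: "prob {\<omega>\<in>space M. 2 * e < \<bar>\<Sum>j\<in>{k..<n}. X j \<omega>\<bar>} \<le> 1 / 2" if "k \<le> n" for k
    proof -
      define T where "T \<omega> = (\<Sum>j\<in>{k..<n}. X j \<omega>)" for \<omega>
      have [measurable]: "random_variable borel T" unfolding T_def by measurable
      have "ennreal (2 * e) * emeasure M {\<omega>\<in>space M. 2 * e < \<bar>T \<omega>\<bar>}
          = (\<integral>\<^sup>+\<omega>. ennreal (2 * e) * indicator {\<omega>\<in>space M. 2 * e < \<bar>T \<omega>\<bar>} \<omega> \<partial>M)"
        by (rule nn_integral_cmult_indicator[symmetric]) measurable
      also have "\<dots> \<le> (\<integral>\<^sup>+\<omega>. ennreal \<bar>T \<omega>\<bar> \<partial>M)"
        by (intro nn_integral_mono) (auto split: split_indicator intro!: ennreal_leI)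
      also have "\<dots> \<le> ennreal e" unfolding T_def by (rule L1) auto
      finally have "ennreal (2 * e * prob {\<omega>\<in>space M. 2 * e < \<bar>T \<omega>\<bar>}) \<le> ennreal e"
        using e by (simp add: emeasure_eq_measure ennreal_mult)
      hence "2 * e * prob {\<omega>\<in>space M. 2 * e < \<bar>T \<omega>\<bar>} \<le> e" using e by (subst (asm) ennreal_le_iff) auto
      thus ?thesis using e by (simp add: T_def field_simps)
    qed
    have tail: "emeasure M {\<omega>\<in>space M. 2 * e + v < mx \<omega>} \<le> 2 * emeasure M {\<omega>\<in>space M. v < \<bar>\<Sum>j<n. X j \<omega>\<bar>}" for v
    proof -
      have "prob {\<omega>\<in>space M. \<exists>k\<le>n. 2 * e + v < \<bar>\<Sum>j<k. X j \<omega>\<bar>} \<le> 2 * prob {\<omega>\<in>space M. v < \<bar>\<Sum>j<n. X j \<omega>\<bar>}"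
        by (rule ottaviani[OF _ half]) (auto simp: X_def intro: indep_scaled)
      hence "ennreal (prob {\<omega>\<in>space M. 2 * e + v < mx \<omega>}) \<le> ennreal (2 * prob {\<omega>\<in>space M. v < \<bar>\<Sum>j<n. X j \<omega>\<bar>})"
        unfolding mx_gt by (rule ennreal_leI)
      thus ?thesis by (simp add: emeasure_eq_measure ennreal_mult)
    qed
    interpret P: pair_sigma_finite M "lborel :: real measure" by unfold_locales
    have layer: "ennreal x = (\<integral>\<^sup>+v. indicator {0..<x} v \<partial>lborel)" if "x \<ge> 0" for x :: real
      using that by (subst nn_integral_indicator) auto
    have "(\<integral>\<^sup>+\<omega>. ennreal (mx \<omega>) \<partial>M)
       \<le> (\<integral>\<^sup>+\<omega>. ennreal (2 * e) + (\<integral>\<^sup>+v. (if 0 \<le> v \<and> 2 * e + v < mx \<omega> then 1 else 0) \<partial>lborel) \<partial>M)"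
    proof (rule nn_integral_mono)
      fix \<omega>
      have "ennreal (mx \<omega>) \<le> ennreal (2 * e + max 0 (mx \<omega> - 2 * e))" by (intro ennreal_leI) auto
      also have "\<dots> = ennreal (2 * e) + ennreal (max 0 (mx \<omega> - 2 * e))" using e by (intro ennreal_plus) auto
      also have "ennreal (max 0 (mx \<omega> - 2 * e)) = (\<integral>\<^sup>+v. indicator {0..<max 0 (mx \<omega> - 2 * e)} v \<partial>lborel)"
        by (rule layer) simp
      also have "\<dots> = (\<integral>\<^sup>+v. (if 0 \<le> v \<and> 2 * e + v < mx \<omega> then 1 else 0) \<partial>lborel)"
        by (intro nn_integral_cong) (auto split: split_indicator)
      finally show "ennreal (mx \<omega>) \<le> ennreal (2 * e) + (\<integral>\<^sup>+v. (if 0 \<le> v \<and> 2 * e + v < mx \<omega> then 1 else 0) \<partial>lborel)" .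
    qed
    also have "\<dots> = ennreal (2 * e) + (\<integral>\<^sup>+\<omega>. (\<integral>\<^sup>+v. (if 0 \<le> v \<and> 2 * e + v < mx \<omega> then 1 else 0) \<partial>lborel) \<partial>M)"
      by (subst nn_integral_add) (auto simp: emeasure_space_1)
    also have "(\<integral>\<^sup>+\<omega>. (\<integral>\<^sup>+v. (if 0 \<le> v \<and> 2 * e + v < mx \<omega> then 1 else 0) \<partial>lborel) \<partial>M)
       = (\<integral>\<^sup>+v. (\<integral>\<^sup>+\<omega>. (if 0 \<le> v \<and> 2 * e + v < mx \<omega> then 1 else 0) \<partial>M) \<partial>lborel)"
      by (rule P.Fubini'[symmetric]) measurable
    also have "\<dots> \<le> (\<integral>\<^sup>+v. 2 * (\<integral>\<^sup>+\<omega>. (if 0 \<le> v \<and> v < \<bar>\<Sum>j<n. X j \<omega>\<bar> then 1 else 0) \<partial>M) \<partial>lborel)"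
    proof (rule nn_integral_mono)
      fix v :: real
      show "(\<integral>\<^sup>+\<omega>. (if 0 \<le> v \<and> 2 * e + v < mx \<omega> then 1 else 0) \<partial>M)
          \<le> 2 * (\<integral>\<^sup>+\<omega>. (if 0 \<le> v \<and> v < \<bar>\<Sum>j<n. X j \<omega>\<bar> then 1 else 0) \<partial>M)"
      proof (cases "0 \<le> v")
        case True
        have "(\<integral>\<^sup>+\<omega>. (if 0 \<le> v \<and> 2 * e + v < mx \<omega> then 1 else 0) \<partial>M)
            = (\<integral>\<^sup>+\<omega>. indicator {\<omega>\<in>space M. 2 * e + v < mx \<omega>} \<omega> \<partial>M)"
          using True by (intro nn_integral_cong) (auto split: split_indicator)
        also have "\<dots> = emeasure M {\<omega>\<in>space M. 2 * e + v < mx \<omega>}" by (rule nn_integral_indicator) measurable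
        also have "\<dots> \<le> 2 * emeasure M {\<omega>\<in>space M. v < \<bar>\<Sum>j<n. X j \<omega>\<bar>}" by (rule tail)
        also have "emeasure M {\<omega>\<in>space M. v < \<bar>\<Sum>j<n. X j \<omega>\<bar>} = (\<integral>\<^sup>+\<omega>. indicator {\<omega>\<in>space M. v < \<bar>\<Sum>j<n. X j \<omega>\<bar>} \<omega> \<partial>M)"
          by (rule nn_integral_indicator[symmetric]) measurable
        also have "\<dots> = (\<integral>\<^sup>+\<omega>. (if 0 \<le> v \<and> v < \<bar>\<Sum>j<n. X j \<omega>\<bar> then 1 else 0) \<partial>M)"
          using True by (intro nn_integral_cong) (auto split: split_indicator)
        finally show ?thesis .
      qed auto
    qed
    also have "\<dots> = 2 * (\<integral>\<^sup>+v. (\<integral>\<^sup>+\<omega>. (if 0 \<le> v \<and> v < \<bar>\<Sum>j<n. X j \<omega>\<bar> then 1 else 0) \<partial>M) \<partial>lborel)"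
      by (rule nn_integral_cmult) measurable
    also have "(\<integral>\<^sup>+v. (\<integral>\<^sup>+\<omega>. (if 0 \<le> v \<and> v < \<bar>\<Sum>j<n. X j \<omega>\<bar> then 1 else 0) \<partial>M) \<partial>lborel)
      = (\<integral>\<^sup>+\<omega>. (\<integral>\<^sup>+v. (if 0 \<le> v \<and> v < \<bar>\<Sum>j<n. X j \<omega>\<bar> then 1 else 0) \<partial>lborel) \<partial>M)"
      by (rule P.Fubini') measurable
    also have "\<dots> = (\<integral>\<^sup>+\<omega>. ennreal \<bar>\<Sum>j<n. X j \<omega>\<bar> \<partial>M)"
    proof (rule nn_integral_cong)
      fix \<omega>
      have "ennreal \<bar>\<Sum>j<n. X j \<omega>\<bar> = (\<integral>\<^sup>+v. indicator {0..<\<bar>\<Sum>j<n. X j \<omega>\<bar>} v \<partial>lborel)" by (rule layer) simp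
      also have "\<dots> = (\<integral>\<^sup>+v. (if 0 \<le> v \<and> v < \<bar>\<Sum>j<n. X j \<omega>\<bar> then 1 else 0) \<partial>lborel)"
        by (intro nn_integral_cong) (auto split: split_indicator)
      finally show "(\<integral>\<^sup>+v. (if 0 \<le> v \<and> v < \<bar>\<Sum>j<n. X j \<omega>\<bar> then 1 else 0) \<partial>lborel) = ennreal \<bar>\<Sum>j<n. X j \<omega>\<bar>" ..
    qed
    also have "\<dots> \<le> ennreal e" by (rule L1) auto
    finally have "(\<integral>\<^sup>+\<omega>. ennreal (mx \<omega>) \<partial>M) \<le> ennreal (2 * e) + 2 * ennreal e"
      by (simp add: mult_left_mono add_left_mono)
    also have "\<dots> = ennreal (2 * e) + ennreal (2 * e)" using e by (simp add: ennreal_mult)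
    also have "\<dots> = ennreal (4 * e)" using e by (simp flip: ennreal_plus)
    finally show ?thesis by (simp add: SUP_eq e_def mult.assoc)
  qed
qed

lemma maximal_series:
  assumes a: "summable (\<lambda>j. \<bar>a j\<bar> powr \<alpha>)"
  shows "(\<integral>\<^sup>+\<omega>. (SUP k. ennreal \<bar>\<Sum>j<k. a j * \<zeta> j \<omega>\<bar>) \<partial>M)
    \<le> ennreal (4 * L1_const * (\<Sum>j. \<bar>a j\<bar> powr \<alpha>) powr (1 / \<alpha>))"
proof -
  define f where "f n \<omega> = (SUP k\<in>{..n}. ennreal \<bar>\<Sum>j<k. a j * \<zeta> j \<omega>\<bar>)" for n \<omega>
  have [measurable]: "f n \<in> borel_measurable M" for n unfolding f_def by measurable
  have inc: "incseq f"
    by (auto simp: f_def incseq_def le_fun_def intro!: SUP_subset_mono)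
  have "(SUP k. ennreal \<bar>\<Sum>j<k. a j * \<zeta> j \<omega>\<bar>) = (SUP n. f n \<omega>)" for \<omega>
    unfolding f_def
  proof (intro antisym SUP_least)
    fix k show "ennreal \<bar>\<Sum>j<k. a j * \<zeta> j \<omega>\<bar> \<le> (SUP n. SUP k\<in>{..n}. ennreal \<bar>\<Sum>j<k. a j * \<zeta> j \<omega>\<bar>)"
      by (rule SUP_upper2[of k], simp, rule SUP_upper2[of k]) auto
  qed (rule SUP_upper, simp)
  hence "(\<integral>\<^sup>+\<omega>. (SUP k. ennreal \<bar>\<Sum>j<k. a j * \<zeta> j \<omega>\<bar>) \<partial>M) = (SUP n. \<integral>\<^sup>+\<omega>. f n \<omega> \<partial>M)"
    using nn_integral_monotone_convergence_SUP[OF inc] by simp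
  also have "\<dots> \<le> ennreal (4 * L1_const * (\<Sum>j. \<bar>a j\<bar> powr \<alpha>) powr (1 / \<alpha>))"
  proof (rule SUP_least)
    fix n
    have "(\<Sum>j<n. \<bar>a j\<bar> powr \<alpha>) \<le> (\<Sum>j. \<bar>a j\<bar> powr \<alpha>)" by (rule sum_le_suminf[OF a]) auto
    hence "4 * L1_const * (\<Sum>j<n. \<bar>a j\<bar> powr \<alpha>) powr (1 / \<alpha>) \<le> 4 * L1_const * (\<Sum>j. \<bar>a j\<bar> powr \<alpha>) powr (1 / \<alpha>)"
      using L1_const_pos \<alpha> by (intro mult_left_mono powr_mono2 sum_nonneg) auto
    thus "(\<integral>\<^sup>+\<omega>. f n \<omega> \<partial>M) \<le> ennreal (4 * L1_const * (\<Sum>j. \<bar>a j\<bar> powr \<alpha>) powr (1 / \<alpha>))"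
      unfolding f_def using maximal_partial_sum[where n=n and a=a] ennreal_leI order.trans by blast
  qed
  finally show ?thesis .
qed

text \<open>The maximal inequality applied to the tails shows that the oscillation of the partial sums beyond
  \<open>m\<close> tends to \<open>0\<close> in \<open>L\<^sup>1\<close> as \<open>m\<close> grows.\<close>

theorem AE_summable:
  assumes a: "summable (\<lambda>j. \<bar>a j\<bar> powr \<alpha>)"
  shows "AE \<omega> in M. summable (\<lambda>j. a j * \<zeta> j \<omega>)"
proof -
  \<comment> \<open>\<open>D m\<close> bounds \<open>\<bar>S n - S m\<bar>\<close> for all \<open>n \<ge> m\<close>, where \<open>S\<close> is the sequence of partial sums\<close>
  define b where "b m j = (if j < m then 0 else a j)" for m j :: nat
  define D where "D m \<omega> = (SUP k. ennreal \<bar>\<Sum>j<k. b m j * \<zeta> j \<omega>\<bar>)" for m \<omega>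
  have [measurable]: "D m \<in> borel_measurable M" for m unfolding D_def by measurable
  have sb: "(\<lambda>j. \<bar>b m j\<bar> powr \<alpha>) sums ((\<Sum>j. \<bar>a j\<bar> powr \<alpha>) - (\<Sum>j<m. \<bar>a j\<bar> powr \<alpha>))" for m
  proof -
    have "(\<lambda>j. \<bar>b m j\<bar> powr \<alpha>) = (\<lambda>j. if j < m then 0 else \<bar>a j\<bar> powr \<alpha>)" by (auto simp: b_def)
    thus ?thesis using tail_sums(1)[OF a, of m] by simp
  qed
  define r where "r m = 4 * L1_const * ((\<Sum>j. \<bar>a j\<bar> powr \<alpha>) - (\<Sum>j<m. \<bar>a j\<bar> powr \<alpha>)) powr (1 / \<alpha>)" for m
  have "(\<lambda>m. ((\<Sum>j. \<bar>a j\<bar> powr \<alpha>) - (\<Sum>j<m. \<bar>a j\<bar> powr \<alpha>)) powr (1 / \<alpha>)) \<longlonglongrightarrow> 0 powr (1 / \<alpha>)"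
    by (intro tendsto_powr' tail_sums(2)[OF a] tendsto_const) (use \<alpha> in \<open>auto intro!: always_eventually sum_le_suminf[OF a]\<close>)
  hence "r \<longlonglongrightarrow> 4 * L1_const * 0"
    unfolding r_def by (intro tendsto_mult tendsto_const) simp
  hence r0: "(\<lambda>m. ennreal (r m)) \<longlonglongrightarrow> ennreal 0" by (intro tendsto_ennrealI) simp
  have "(\<integral>\<^sup>+\<omega>. (INF m. D m \<omega>) \<partial>M) \<le> ennreal (r m)" for m
  proof -
    have "(\<integral>\<^sup>+\<omega>. (INF m. D m \<omega>) \<partial>M) \<le> (\<integral>\<^sup>+\<omega>. D m \<omega> \<partial>M)"
      by (intro nn_integral_mono INF_lower) simp
    also have "\<dots> \<le> ennreal (r m)"
      using maximal_series[OF sums_summable[OF sb[of m]]] unfolding D_def r_def sums_unique[OF sb[of m], symmetric] .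
    finally show ?thesis .
  qed
  hence "(\<integral>\<^sup>+\<omega>. (INF m. D m \<omega>) \<partial>M) \<le> ennreal 0"
    by (intro LIMSEQ_le_const[OF r0]) auto
  hence "AE \<omega> in M. (INF m. D m \<omega>) = 0"
    by (subst nn_integral_0_iff_AE[symmetric]) auto
  thus ?thesis
  proof eventually_elim
    case (elim \<omega>)
    show ?case
    proof (rule real_Cauchy_convergent[THEN summable_iff_convergent[THEN iffD2]])
      show "Cauchy (\<lambda>n. \<Sum>j<n. a j * \<zeta> j \<omega>)"
        unfolding Cauchy_altdef2
      proof (intro allI impI)
        fix e :: real assume "0 < e"
        hence "(INF m. D m \<omega>) < ennreal e" using elim by simp
        then obtain m where m: "D m \<omega> < ennreal e" by (auto simp: INF_less_iff)
        have "\<bar>(\<Sum>j<n. a j * \<zeta> j \<omega>) - (\<Sum>j<m. a j * \<zeta> j \<omega>)\<bar> < e" if "n \<ge> m" for n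
        proof -
          have "(\<Sum>j<n. b m j * \<zeta> j \<omega>) = (\<Sum>j<n. a j * \<zeta> j \<omega>) - (\<Sum>j<m. a j * \<zeta> j \<omega>)"
          proof -
            have "(\<Sum>j<n. b m j * \<zeta> j \<omega>) = (\<Sum>j<m. b m j * \<zeta> j \<omega>) + (\<Sum>j\<in>{m..<n}. b m j * \<zeta> j \<omega>)"
              using that by (metis atLeast0LessThan sum.atLeastLessThan_concat zero_le)
            also have "\<dots> = (\<Sum>j\<in>{m..<n}. a j * \<zeta> j \<omega>)" by (simp add: b_def)
            also have "\<dots> = (\<Sum>j<n. a j * \<zeta> j \<omega>) - (\<Sum>j<m. a j * \<zeta> j \<omega>)"
              using sum.atLeastLessThan_concat[of 0 m n "\<lambda>j. a j * \<zeta> j \<omega>"] that by (simp add: atLeast0LessThan)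
            finally show ?thesis .
          qed
          moreover have "ennreal \<bar>\<Sum>j<n. b m j * \<zeta> j \<omega>\<bar> \<le> D m \<omega>" unfolding D_def by (rule SUP_upper) simp
          ultimately have "ennreal \<bar>(\<Sum>j<n. a j * \<zeta> j \<omega>) - (\<Sum>j<m. a j * \<zeta> j \<omega>)\<bar> < ennreal e"
            using m by (simp add: le_less_trans)
          thus ?thesis by (simp add: ennreal_less_iff)
        qed
        thus "\<exists>N. \<forall>n\<ge>N. dist (\<Sum>j<n. a j * \<zeta> j \<omega>) (\<Sum>j<N. a j * \<zeta> j \<omega>) < e"
          by (auto simp: dist_real_def)
      qed
    qed
  qed
qed

end

section \<open>The continuity theorem in several dimensions\<close>

text \<open>Real trigonometric polynomials in the first \<open>n\<close> coordinates; the phase \<open>s\<close> makes sines and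
  constants special cases.\<close>

inductive_set trig_polys :: "nat \<Rightarrow> ((nat \<Rightarrow> real) \<Rightarrow> real) set" for n where
  cos: "(\<lambda>x. c * cos ((\<Sum>i<n. t i * x i) + s)) \<in> trig_polys n"
| add: "f \<in> trig_polys n \<Longrightarrow> g \<in> trig_polys n \<Longrightarrow> (\<lambda>x. f x + g x) \<in> trig_polys n"

lemma trig_polys_mult:
  assumes "f \<in> trig_polys n" "g \<in> trig_polys n"
  shows "(\<lambda>x. f x * g x) \<in> trig_polys n"
  using assms
proof (induction arbitrary: g rule: trig_polys.induct)
  case (cos c t s)
  from cos show ?case
  proof (induction rule: trig_polys.induct)
    case (cos c' t' s')
    have prod: "c * cos A * (c' * cos B) = c * c' / 2 * cos (A - B) + c * c' / 2 * cos (A + B)" for A B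
    proof -
      have "c * cos A * (c' * cos B) = c * c' * (cos A * cos B)" by simp
      also have "\<dots> = c * c' * ((cos (A - B) + cos (A + B)) / 2)" by (simp only: cos_times_cos)
      finally show ?thesis by (simp add: add_divide_distrib distrib_left)
    qed
    have "(\<Sum>i<n. t i * x i) + s - ((\<Sum>i<n. t' i * x i) + s') = (\<Sum>i<n. (t i - t' i) * x i) + (s - s')"
      "(\<Sum>i<n. t i * x i) + s + ((\<Sum>i<n. t' i * x i) + s') = (\<Sum>i<n. (t i + t' i) * x i) + (s + s')" for x
      by (simp_all add: sum.distrib sum_subtractf algebra_simps)
    hence "c * cos ((\<Sum>i<n. t i * x i) + s) * (c' * cos ((\<Sum>i<n. t' i * x i) + s'))
      = c * c' / 2 * cos ((\<Sum>i<n. (t i - t' i) * x i) + (s - s')) + c * c' / 2 * cos ((\<Sum>i<n. (t i + t' i) * x i) + (s + s'))" for x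
      unfolding prod by (simp only:)
    thus ?case by (simp only:) (intro trig_polys.intros)
  next
    case (add f g)
    thus ?case by (simp add: distrib_left trig_polys.add)
  qed
next
  case (add f h)
  thus ?case by (simp add: distrib_right trig_polys.add)
qed

lemma (in prob_space) expectation_cos_shift:
  assumes [measurable]: "random_variable borel X"
  shows "expectation (\<lambda>\<omega>. cos (X \<omega> + s)) = Re (iexp s * (CLINT \<omega>|M. iexp (X \<omega>)))"
proof -
  have "iexp s * (CLINT \<omega>|M. iexp (X \<omega>)) = (CLINT \<omega>|M. iexp s * iexp (X \<omega>))" by simp
  also have "\<dots> = (CLINT \<omega>|M. iexp (X \<omega> + s))" by (simp add: exp_add algebra_simps)
  finally have "Re (iexp s * (CLINT \<omega>|M. iexp (X \<omega>))) = expectation (\<lambda>\<omega>. Re (iexp (X \<omega> + s)))"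
    by (simp only: integral_Re[OF integrable_iexp]) (simp add: integral_Re[OF integrable_iexp])
  thus ?thesis by (simp add: Re_exp)
qed

lemma (in prob_space) trig_polys_integrable:
  assumes f: "f \<in> trig_polys n" and [measurable]: "\<And>i. random_variable borel (X i)"
  shows "integrable M (\<lambda>\<omega>. f (\<lambda>i. X i \<omega>))"
  using f
proof induction
  case (cos c t s)
  show ?case by (rule integrable_const_bound[where B="\<bar>c\<bar>"]) (auto simp: abs_mult intro!: mult_left_le AE_I2)
qed auto

lemma trig_polys_tendsto:
  fixes X :: "nat \<Rightarrow> nat \<Rightarrow> 'a \<Rightarrow> real" and Y :: "nat \<Rightarrow> 'b \<Rightarrow> real"
  assumes M: "prob_space M" and N: "prob_space N"
    and [measurable]: "\<And>m i. X m i \<in> borel_measurable M" "\<And>i. Y i \<in> borel_measurable N"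
    and char: "\<And>t. (\<lambda>m. CLINT \<omega>|M. iexp (\<Sum>i<n. t i * X m i \<omega>)) \<longlonglongrightarrow> (CLINT \<omega>|N. iexp (\<Sum>i<n. t i * Y i \<omega>))"
    and f: "f \<in> trig_polys n"
  shows "(\<lambda>m. \<integral>\<omega>. f (\<lambda>i. X m i \<omega>) \<partial>M) \<longlonglongrightarrow> (\<integral>\<omega>. f (\<lambda>i. Y i \<omega>) \<partial>N)"
  using f
proof induction
  case (cos c t s)
  have "(\<lambda>m. c * Re (iexp s * (CLINT \<omega>|M. iexp (\<Sum>i<n. t i * X m i \<omega>))))
      \<longlonglongrightarrow> c * Re (iexp s * (CLINT \<omega>|N. iexp (\<Sum>i<n. t i * Y i \<omega>)))"
    by (intro tendsto_intros char)
  thus ?case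
    by (subst (asm) (1 2) prob_space.expectation_cos_shift[symmetric]) (auto simp: M N)
next
  case (add f g)
  thus ?case
    using tendsto_add[OF add.IH] prob_space.trig_polys_integrable[OF M] prob_space.trig_polys_integrable[OF N]
    by (subst (1 2) Bochner_Integration.integral_add) auto
qed

text \<open>Substituting \<open>u i = sin (x i / L)\<close> turns polynomials in \<open>u\<close> into trigonometric polynomials in
  \<open>x\<close>.  By Stone-Weierstrass on the cube, a polynomial in \<open>u\<close> approximates \<open>\<phi> (L * arcsin (u i))\<close>
  uniformly.  As \<open>u\<close> always lies in the cube, the trigonometric polynomial obeys nearly the
  same global bound as \<open>\<phi>\<close>, and for \<open>\<bar>x i\<bar> \<le> L * pi / 2\<close> the arcsine undoes the sine.\<close>

lemma trig_poly_approximation: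
  fixes \<phi> :: "(nat \<Rightarrow> real) \<Rightarrow> real"
  assumes \<phi>: "continuous_on UNIV \<phi>" and B: "\<And>x. \<bar>\<phi> x\<bar> \<le> B" and e: "e > 0" and L: "L > 0"
  obtains P where "P \<in> trig_polys n" "\<And>x. \<bar>P x\<bar> \<le> B + e"
    "\<And>x. (\<And>i. i < n \<Longrightarrow> \<bar>x i\<bar> \<le> L * (pi / 2)) \<Longrightarrow> \<bar>P x - \<phi> (\<lambda>i. if i < n then x i else 0)\<bar> \<le> e"
proof -
  define S :: "(nat \<Rightarrow> real) set" where "S = PiE UNIV (\<lambda>i. if i < n then {-1..1} else {0})"
  define v where "v x = (\<lambda>i. if i < n then sin (x i / L) else 0)" for x :: "nat \<Rightarrow> real"
  have vS: "v x \<in> S" for x by (auto simp: v_def S_def)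
  define R where "R = {f. continuous_on S f \<and> (\<lambda>x. f (v x)) \<in> trig_polys n}"
  interpret function_ring_on R S
  proof
    have "compactin (product_topology (\<lambda>_. euclidean) UNIV) S"
      unfolding S_def compactin_PiE by (auto simp: compactin_euclidean_iff)
    thus "compact S" by (simp add: euclidean_product_topology compactin_euclidean_iff)
  next
    fix c show "(\<lambda>_. c) \<in> R"
      using trig_polys.cos[of c "\<lambda>_. 0" n 0] by (auto simp: R_def)
  next
    fix x y assume xy: "x \<in> S" "y \<in> S" "x \<noteq> y"
    then obtain i where i: "x i \<noteq> y i" by blast
    have i': "i < n"
    proof (rule ccontr)
      assume "\<not> i < n"
      moreover have "x i \<in> (if i < n then {-1..1} else {0})" "y i \<in> (if i < n then {-1..1} else {0})"
        using xy(1,2) unfolding S_def by (auto simp: PiE_def Pi_def)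
      ultimately show False using i by simp
    qed
    have "(\<Sum>j<n. (if j = i then 1 / L else 0) * z j) = z i / L" for z :: "nat \<Rightarrow> real"
    proof -
      have "(\<Sum>j<n. (if j = i then 1 / L else 0) * z j) = (\<Sum>j<n. if j = i then z j / L else 0)"
        by (intro sum.cong) auto
      thus ?thesis using i' by simp
    qed
    hence "(\<lambda>z. 1 * cos (z i / L + - (pi / 2))) \<in> trig_polys n"
      using trig_polys.cos[of 1 "\<lambda>j. if j = i then 1 / L else 0" n "- (pi / 2)"] by simp
    moreover have "cos (a + - (pi / 2)) = sin a" for a :: real
      by (simp add: sin_cos_eq cos_minus[of "a - pi / 2", symmetric])
    ultimately have "(\<lambda>z. sin (z i / L)) \<in> trig_polys n" by simp
    moreover have "continuous_on S (\<lambda>z. z i)" by (rule continuous_on_subset[OF continuous_on_product_coordinates]) simp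
    ultimately have "(\<lambda>z. z i) \<in> R" using i' by (simp add: R_def v_def)
    thus "\<exists>f\<in>R. f x \<noteq> f y" by (rule bexI[rotated]) (rule i)
  next
    fix f assume "f \<in> R" thus "continuous_on S f" by (simp add: R_def)
  next
    fix f g assume "f \<in> R" "g \<in> R"
    thus "(\<lambda>x. f x + g x) \<in> R" "(\<lambda>x. f x * g x) \<in> R"
      by (simp_all add: R_def continuous_on_add continuous_on_mult trig_polys_mult trig_polys.add)
  qed
  define g where "g u = \<phi> (\<lambda>i. L * arcsin (u i))" for u
  have "continuous_on S (\<lambda>u i. L * arcsin (u i))"
  proof (intro continuous_on_coordinatewise_then_product continuous_intros ballI conjI)
    fix i show "continuous_on S (\<lambda>u. u i)" by (rule continuous_on_subset[OF continuous_on_product_coordinates]) simp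
    fix u assume "u \<in> S"
    hence "u i \<in> (if i < n then {-1..1} else {0})" unfolding S_def by (auto simp: PiE_def Pi_def)
    thus "-1 \<le> u i" "u i \<le> 1" by (auto split: if_splits)
  qed
  hence gc: "continuous_on S g"
    unfolding g_def by (rule continuous_on_compose2[OF \<phi>]) auto
  obtain Q where Q: "Q \<in> R" "\<And>u. u \<in> S \<Longrightarrow> \<bar>g u - Q u\<bar> < e"
    using Stone_Weierstrass_basic[OF gc e] by blast
  show ?thesis
  proof (rule that)
    show "(\<lambda>x. Q (v x)) \<in> trig_polys n" using Q(1) by (simp add: R_def)
    fix x
    show "\<bar>Q (v x)\<bar> \<le> B + e"
      using Q(2)[OF vS[of x]] B[of "\<lambda>i. L * arcsin (v x i)"] by (simp add: g_def abs_le_iff abs_less_iff)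
    assume x: "\<And>i. i < n \<Longrightarrow> \<bar>x i\<bar> \<le> L * (pi / 2)"
    have "L * arcsin (v x i) = (if i < n then x i else 0)" for i
    proof (cases "i < n")
      case True
      have "arcsin (sin (x i / L)) = x i / L"
        using x[OF True] L by (intro arcsin_sin) (auto simp: field_simps abs_le_iff)
      thus ?thesis using True L by (simp add: v_def)
    qed (simp add: v_def)
    hence "g (v x) = \<phi> (\<lambda>i. if i < n then x i else 0)" by (simp add: g_def)
    thus "\<bar>Q (v x) - \<phi> (\<lambda>i. if i < n then x i else 0)\<bar> \<le> e"
      using Q(2)[OF vS[of x]] by (simp add: abs_minus_commute)
  qed
qed

text \<open>A bounded continuous function that detects \<open>\<bar>y\<bar> \<ge> R + 1\<close>, used to express tightness through weak
  convergence.\<close>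

definition tail_fn :: "real \<Rightarrow> real \<Rightarrow> real" where
  "tail_fn R y = min 1 (max 0 (\<bar>y\<bar> - R))"

lemma tail_fn_bounds: "0 \<le> tail_fn R y" "tail_fn R y \<le> 1" "\<bar>tail_fn R y\<bar> \<le> 1"
  by (auto simp: tail_fn_def)

lemma tail_fn_measurable [measurable]: "tail_fn R \<in> borel_measurable borel"
  unfolding tail_fn_def by measurable

text \<open>Expectations of trigonometric polynomials converge because they are combinations of values of the
  characteristic functions.  Each coordinate converges in law by the one-dimensional theorem, so
  all coordinates are small compared with \<open>L\<close> up to a small probability, and there \<open>\<phi>\<close> is
  approximated by a trigonometric polynomial that is bounded everywhere.\<close>

lemma multivariate_levy_continuity:
  fixes X :: "nat \<Rightarrow> nat \<Rightarrow> 'a \<Rightarrow> real" and Y :: "nat \<Rightarrow> 'b \<Rightarrow> real" and \<phi> :: "(nat \<Rightarrow> real) \<Rightarrow> real"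
  assumes M: "prob_space M" and N: "prob_space N"
    and [measurable]: "\<And>m i. X m i \<in> borel_measurable M" "\<And>i. Y i \<in> borel_measurable N"
    and char: "\<And>t. (\<lambda>m. CLINT \<omega>|M. iexp (\<Sum>i<n. t i * X m i \<omega>)) \<longlonglongrightarrow> (CLINT \<omega>|N. iexp (\<Sum>i<n. t i * Y i \<omega>))"
    and \<phi>: "continuous_on UNIV \<phi>" and bdd: "bounded (range \<phi>)"
  shows "(\<lambda>m. \<integral>\<omega>. \<phi> (\<lambda>i. if i < n then X m i \<omega> else 0) \<partial>M) \<longlonglongrightarrow> (\<integral>\<omega>. \<phi> (\<lambda>i. if i < n then Y i \<omega> else 0) \<partial>N)"
proof -
  interpret M: prob_space M by (rule M)
  interpret N: prob_space N by (rule N)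
  obtain B where B: "\<And>x. \<bar>\<phi> x\<bar> \<le> B" using bdd unfolding bounded_iff by auto
  have B0: "B \<ge> 0" using B[of "\<lambda>_. 0"] by linarith
  have [measurable]: "\<phi> \<in> borel_measurable borel" using \<phi> by (rule borel_measurable_continuous_onI)
  have [measurable]: "(\<lambda>\<omega>. (\<lambda>i. if i < n then X m i \<omega> else 0)) \<in> borel_measurable M"
    "(\<lambda>\<omega>. (\<lambda>i. if i < n then Y i \<omega> else 0)) \<in> borel_measurable N" for m
    by (intro measurable_coordinatewise_then_product; simp)+
  \<comment> \<open>tightness\<close>
  have tail_conv: "(\<lambda>m. \<integral>\<omega>. tail_fn R (X m i \<omega>) \<partial>M) \<longlonglongrightarrow> (\<integral>\<omega>. tail_fn R (Y i \<omega>) \<partial>N)" if i: "i < n" for i R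
  proof -
    have "weak_conv_m (\<lambda>m. distr M borel (X m i)) (distr N borel (Y i))"
    proof (rule levy_continuity)
      fix \<theta> :: real
      have s: "(\<Sum>j<n. (if j = i then \<theta> else 0) * z j) = \<theta> * z i" for z :: "nat \<Rightarrow> real"
      proof -
        have "(\<Sum>j<n. (if j = i then \<theta> else 0) * z j) = (\<Sum>j<n. if j = i then \<theta> * z j else 0)"
          by (intro sum.cong) auto
        thus ?thesis using i by simp
      qed
      show "(\<lambda>m. char (distr M borel (X m i)) \<theta>) \<longlonglongrightarrow> char (distr N borel (Y i)) \<theta>"
        using char[of "\<lambda>j. if j = i then \<theta> else 0"] unfolding s char_def by (simp add: integral_distr)
    qed (auto intro: M.real_distribution_distr N.real_distribution_distr)
    hence "(\<lambda>m. integral\<^sup>L (distr M borel (X m i)) (tail_fn R)) \<longlonglongrightarrow> integral\<^sup>L (distr N borel (Y i)) (tail_fn R)"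
      by (rule weak_conv_imp_integral_bdd_continuous_conv[where B=1, rotated 2])
        (auto intro!: M.real_distribution_distr N.real_distribution_distr continuous_intros simp: tail_fn_bounds tail_fn_def[abs_def])
    thus ?thesis by (simp add: integral_distr)
  qed
  have tail_int: "integrable M (\<lambda>\<omega>. tail_fn R (X m i \<omega>))" "integrable N (\<lambda>\<omega>. tail_fn R (Y i \<omega>))" for m i R
    by (rule M.integrable_const_bound[where B=1] N.integrable_const_bound[where B=1]; simp add: tail_fn_bounds)+
  have tail0: "(\<lambda>R. \<integral>\<omega>. tail_fn (real R) (Y i \<omega>) \<partial>N) \<longlonglongrightarrow> 0" for i
  proof -
    have "(\<lambda>R. \<integral>\<omega>. tail_fn (real R) (Y i \<omega>) \<partial>N) \<longlonglongrightarrow> (\<integral>\<omega>. 0 \<partial>N)"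
    proof (rule integral_dominated_convergence[where w="\<lambda>_. 1"])
      show "AE \<omega> in N. (\<lambda>R. tail_fn (real R) (Y i \<omega>)) \<longlonglongrightarrow> 0"
      proof (rule AE_I2)
        fix \<omega>
        obtain R0 :: nat where "\<bar>Y i \<omega>\<bar> \<le> real R0" using real_arch_simple by blast
        hence "\<forall>\<^sub>F R in sequentially. tail_fn (real R) (Y i \<omega>) = 0"
          by (intro eventually_sequentiallyI[of R0]) (auto simp: tail_fn_def)
        thus "(\<lambda>R. tail_fn (real R) (Y i \<omega>)) \<longlonglongrightarrow> 0" by (rule tendsto_eventually)
      qed
    qed (auto simp: tail_fn_bounds)
    thus ?thesis by simp
  qed
  show ?thesis
  proof (rule LIMSEQ_I)
    fix r :: real assume r: "r > 0"
    define e where "e = r / 8"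
    have e: "e > 0" using r by (simp add: e_def)
    define C where "C = 2 * B + e"
    have C: "C > 0" using B0 e by (simp add: C_def)
    have "(\<lambda>R. C * (\<Sum>i<n. \<integral>\<omega>. tail_fn (real R) (Y i \<omega>) \<partial>N)) \<longlonglongrightarrow> C * (\<Sum>i<n. 0)"
      by (intro tendsto_mult tendsto_const tendsto_sum tail0)
    hence "\<forall>\<^sub>F R in sequentially. C * (\<Sum>i<n. \<integral>\<omega>. tail_fn (real R) (Y i \<omega>) \<partial>N) < e"
      using e by (intro order_tendstoD(2)) auto
    then obtain R :: nat where R: "C * (\<Sum>i<n. \<integral>\<omega>. tail_fn (real R) (Y i \<omega>) \<partial>N) < e"
      by (auto dest: eventually_happens)
    \<comment> \<open>the trigonometric approximation is accurate exactly up to where \<open>tail_fn R\<close> reaches \<open>1\<close>\<close>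
    define L where "L = (real R + 1) / (pi / 2)"
    have L: "L > 0" "L * (pi / 2) = real R + 1" by (auto simp: L_def add_pos_nonneg)
    obtain P where P: "P \<in> trig_polys n" "\<And>x. \<bar>P x\<bar> \<le> B + e"
      and Papp: "\<And>x. (\<And>i. i < n \<Longrightarrow> \<bar>x i\<bar> \<le> real R + 1) \<Longrightarrow> \<bar>P x - \<phi> (\<lambda>i. if i < n then x i else 0)\<bar> \<le> e"
      using trig_poly_approximation[OF \<phi> B e L(1), of n] unfolding L(2) by metis
    have dom: "\<bar>P x - \<phi> (\<lambda>i. if i < n then x i else 0)\<bar> \<le> e + C * (\<Sum>i<n. tail_fn (real R) (x i))" for x
    proof (cases "\<forall>i<n. \<bar>x i\<bar> \<le> real R + 1")
      case True
      hence "\<bar>P x - \<phi> (\<lambda>i. if i < n then x i else 0)\<bar> \<le> e" by (intro Papp) auto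
      moreover have "C * (\<Sum>i<n. tail_fn (real R) (x i)) \<ge> 0"
        using C by (intro mult_nonneg_nonneg sum_nonneg) (auto simp: tail_fn_bounds)
      ultimately show ?thesis by linarith
    next
      case False
      then obtain i where i: "i < n" "\<bar>x i\<bar> > real R + 1" by auto
      have "1 = tail_fn (real R) (x i)" using i by (simp add: tail_fn_def)
      also have "\<dots> \<le> (\<Sum>i<n. tail_fn (real R) (x i))"
        using i by (intro member_le_sum) (auto simp: tail_fn_bounds)
      finally have "C * 1 \<le> C * (\<Sum>i<n. tail_fn (real R) (x i))" using C by (intro mult_left_mono) auto
      moreover have "\<bar>P x - \<phi> (\<lambda>i. if i < n then x i else 0)\<bar> \<le> C"
        using P(2)[of x] B[of "\<lambda>i. if i < n then x i else 0"] unfolding C_def by linarith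
      ultimately show ?thesis using e by linarith
    qed
    define E_X where "E_X m = (\<integral>\<omega>. \<phi> (\<lambda>i. if i < n then X m i \<omega> else 0) \<partial>M)" for m
    define E_Y where "E_Y = (\<integral>\<omega>. \<phi> (\<lambda>i. if i < n then Y i \<omega> else 0) \<partial>N)"
    define PX where "PX m = (\<integral>\<omega>. P (\<lambda>i. X m i \<omega>) \<partial>M)" for m
    define PY where "PY = (\<integral>\<omega>. P (\<lambda>i. Y i \<omega>) \<partial>N)"
    define TX where "TX m = C * (\<Sum>i<n. \<integral>\<omega>. tail_fn (real R) (X m i \<omega>) \<partial>M)" for m
    define TY where "TY = C * (\<Sum>i<n. \<integral>\<omega>. tail_fn (real R) (Y i \<omega>) \<partial>N)"
    have bX: "\<bar>PX m - E_X m\<bar> \<le> e + TX m" for m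
    proof -
      have i1: "integrable M (\<lambda>\<omega>. P (\<lambda>i. X m i \<omega>))" by (rule M.trig_polys_integrable[OF P(1)]) simp
      have i2: "integrable M (\<lambda>\<omega>. \<phi> (\<lambda>i. if i < n then X m i \<omega> else 0))"
        by (rule M.integrable_const_bound[where B=B]) (use B in auto)
      have "\<bar>PX m - E_X m\<bar> = \<bar>\<integral>\<omega>. P (\<lambda>i. X m i \<omega>) - \<phi> (\<lambda>i. if i < n then X m i \<omega> else 0) \<partial>M\<bar>"
        unfolding PX_def E_X_def using i1 i2 by simp
      also have "\<dots> \<le> (\<integral>\<omega>. \<bar>P (\<lambda>i. X m i \<omega>) - \<phi> (\<lambda>i. if i < n then X m i \<omega> else 0)\<bar> \<partial>M)"
        by (rule integral_abs_bound)
      also have "\<dots> \<le> (\<integral>\<omega>. e + C * (\<Sum>i<n. tail_fn (real R) (X m i \<omega>)) \<partial>M)"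
        by (rule integral_mono) (use i1 i2 tail_int dom in auto)
      also have "\<dots> = e + TX m" using tail_int by (simp add: TX_def M.prob_space)
      finally show ?thesis .
    qed
    have bY: "\<bar>PY - E_Y\<bar> \<le> e + TY"
    proof -
      have i1: "integrable N (\<lambda>\<omega>. P (\<lambda>i. Y i \<omega>))" by (rule N.trig_polys_integrable[OF P(1)]) simp
      have i2: "integrable N (\<lambda>\<omega>. \<phi> (\<lambda>i. if i < n then Y i \<omega> else 0))"
        by (rule N.integrable_const_bound[where B=B]) (use B in auto)
      have "\<bar>PY - E_Y\<bar> = \<bar>\<integral>\<omega>. P (\<lambda>i. Y i \<omega>) - \<phi> (\<lambda>i. if i < n then Y i \<omega> else 0) \<partial>N\<bar>"
        unfolding PY_def E_Y_def using i1 i2 by simp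
      also have "\<dots> \<le> (\<integral>\<omega>. \<bar>P (\<lambda>i. Y i \<omega>) - \<phi> (\<lambda>i. if i < n then Y i \<omega> else 0)\<bar> \<partial>N)"
        by (rule integral_abs_bound)
      also have "\<dots> \<le> (\<integral>\<omega>. e + C * (\<Sum>i<n. tail_fn (real R) (Y i \<omega>)) \<partial>N)"
        by (rule integral_mono) (use i1 i2 tail_int dom in auto)
      also have "\<dots> = e + TY" using tail_int by (simp add: TY_def N.prob_space)
      finally show ?thesis .
    qed
    have "PX \<longlonglongrightarrow> PY" unfolding PX_def PY_def
      by (rule trig_polys_tendsto[OF M N _ _ char P(1)]) auto
    hence "\<forall>\<^sub>F m in sequentially. dist (PX m) PY < e" using e by (rule tendstoD)
    moreover have "TX \<longlonglongrightarrow> TY" unfolding TX_def TY_def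
      by (intro tendsto_mult tendsto_const tendsto_sum tail_conv) auto
    hence "\<forall>\<^sub>F m in sequentially. TX m < e" using R by (intro order_tendstoD(2)) (auto simp: TY_def)
    ultimately have "\<forall>\<^sub>F m in sequentially. norm (E_X m - E_Y) < r"
    proof eventually_elim
      case (elim m)
      thus ?case using bX[of m] bY R unfolding TY_def[symmetric] dist_real_def real_norm_def e_def by linarith
    qed
    thus "\<exists>no. \<forall>m\<ge>no. norm ((\<integral>\<omega>. \<phi> (\<lambda>i. if i < n then X m i \<omega> else 0) \<partial>M) - (\<integral>\<omega>. \<phi> (\<lambda>i. if i < n then Y i \<omega> else 0) \<partial>N)) < r"
      unfolding E_X_def E_Y_def eventually_sequentially .
  qed
qed

section \<open>Random series with coefficients in an \<open>\<ell>\<^sup>\<alpha>\<close> space\<close>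

lemma powr_abs_add_le:
  assumes "(\<alpha>::real) > 0"
  shows "\<bar>x + y\<bar> powr \<alpha> \<le> 2 powr \<alpha> * (\<bar>x\<bar> powr \<alpha> + \<bar>y\<bar> powr \<alpha>)"
proof -
  have "\<bar>x + y\<bar> powr \<alpha> \<le> (2 * max \<bar>x\<bar> \<bar>y\<bar>) powr \<alpha>"
    using assms by (intro powr_mono2) auto
  also have "\<dots> = 2 powr \<alpha> * max \<bar>x\<bar> \<bar>y\<bar> powr \<alpha>" by (simp add: powr_mult)
  also have "max \<bar>x\<bar> \<bar>y\<bar> powr \<alpha> \<le> \<bar>x\<bar> powr \<alpha> + \<bar>y\<bar> powr \<alpha>" by (simp add: max_def)
  finally show ?thesis by simp
qed

lemma summable_powr_lincomb:
  assumes \<alpha>: "(\<alpha>::real) > 0" and a: "summable (\<lambda>j. \<bar>a j\<bar> powr \<alpha>)" and b: "summable (\<lambda>j. \<bar>b j\<bar> powr \<alpha>)"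
  shows "summable (\<lambda>j. \<bar>s * a j + t * b j\<bar> powr \<alpha>)"
proof (rule summable_comparison_test'[where N=0])
  show "summable (\<lambda>j. 2 powr \<alpha> * (\<bar>s\<bar> powr \<alpha> * \<bar>a j\<bar> powr \<alpha> + \<bar>t\<bar> powr \<alpha> * \<bar>b j\<bar> powr \<alpha>))"
    by (intro summable_mult summable_add a b)
  fix j
  show "norm (\<bar>s * a j + t * b j\<bar> powr \<alpha>) \<le> 2 powr \<alpha> * (\<bar>s\<bar> powr \<alpha> * \<bar>a j\<bar> powr \<alpha> + \<bar>t\<bar> powr \<alpha> * \<bar>b j\<bar> powr \<alpha>)"
    using powr_abs_add_le[OF \<alpha>, of "s * a j" "t * b j"] by (simp add: abs_mult powr_mult)
qed

lemma AE_eq_L1_limit: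
  fixes T :: "nat \<Rightarrow> 'a \<Rightarrow> real"
  assumes [measurable]: "\<And>n. T n \<in> borel_measurable M" "S \<in> borel_measurable M" "Z \<in> borel_measurable M"
    and ae: "AE \<omega> in M. (\<lambda>n. T n \<omega>) \<longlonglongrightarrow> S \<omega>"
    and L1: "(\<lambda>n. \<integral>\<^sup>+\<omega>. ennreal \<bar>T n \<omega> - Z \<omega>\<bar> \<partial>M) \<longlonglongrightarrow> 0"
  shows "AE \<omega> in M. S \<omega> = Z \<omega>"
proof -
  have "(\<integral>\<^sup>+\<omega>. ennreal \<bar>S \<omega> - Z \<omega>\<bar> \<partial>M) = (\<integral>\<^sup>+\<omega>. liminf (\<lambda>n. ennreal \<bar>T n \<omega> - Z \<omega>\<bar>) \<partial>M)"
  proof (rule nn_integral_cong_AE, use ae in eventually_elim)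
    case (elim \<omega>)
    have "(\<lambda>n. ennreal \<bar>T n \<omega> - Z \<omega>\<bar>) \<longlonglongrightarrow> ennreal \<bar>S \<omega> - Z \<omega>\<bar>"
      by (intro tendsto_intros tendsto_ennrealI elim)
    thus ?case by (intro lim_imp_Liminf[symmetric]) simp_all
  qed
  also have "\<dots> \<le> liminf (\<lambda>n. \<integral>\<^sup>+\<omega>. ennreal \<bar>T n \<omega> - Z \<omega>\<bar> \<partial>M)"
    by (rule nn_integral_liminf) measurable
  also have "\<dots> = 0" using L1 by (simp add: lim_imp_Liminf)
  finally have "AE \<omega> in M. ennreal \<bar>S \<omega> - Z \<omega>\<bar> = 0"
    by (subst nn_integral_0_iff_AE[symmetric]) auto
  thus ?thesis by eventually_elim simp
qed

lemma le_suminf_ennreal: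
  fixes f :: "nat \<Rightarrow> ennreal"
  shows "f j \<le> (\<Sum>j. f j)"
  using sum_le_suminf[OF summableI, of "{j}" f] by simp

lemma suminf_ennreal_scaled_less_top:
  fixes f :: "nat \<Rightarrow> real"
  assumes "summable f" "\<And>j. f j \<ge> 0" "D \<ge> 0"
  shows "(\<Sum>j. ennreal (f j * D)) < top"
proof -
  have "(\<Sum>j. ennreal (f j * D)) \<noteq> top"
    using assms by (intro ennreal_suminf_neq_top summable_mult2) auto
  thus ?thesis by (simp only: less_top)
qed

context independent_stable_like
begin

definition random_series :: "(nat \<Rightarrow> real) \<Rightarrow> 'a \<Rightarrow> real" where
  "random_series a \<omega> = (\<Sum>j. a j * \<zeta> j \<omega>)"

lemma measurable_random_series [measurable]: "random_variable borel (random_series a)"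
  unfolding random_series_def by measurable

lemma AE_random_series_sums:
  assumes "summable (\<lambda>j. \<bar>a j\<bar> powr \<alpha>)"
  shows "AE \<omega> in M. (\<lambda>j. a j * \<zeta> j \<omega>) sums random_series a \<omega>"
  using AE_summable[OF assms] by eventually_elim (simp add: random_series_def summable_sums)

lemma L1_random_series:
  assumes a: "summable (\<lambda>j. \<bar>a j\<bar> powr \<alpha>)"
  shows "(\<integral>\<^sup>+\<omega>. ennreal \<bar>random_series a \<omega>\<bar> \<partial>M) \<le> ennreal (4 * L1_const * (\<Sum>j. \<bar>a j\<bar> powr \<alpha>) powr (1 / \<alpha>))"
proof -
  have "(\<integral>\<^sup>+\<omega>. ennreal \<bar>random_series a \<omega>\<bar> \<partial>M) \<le> (\<integral>\<^sup>+\<omega>. (SUP k. ennreal \<bar>\<Sum>j<k. a j * \<zeta> j \<omega>\<bar>) \<partial>M)"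
  proof (rule nn_integral_mono_AE, use AE_random_series_sums[OF a] in eventually_elim)
    case (elim \<omega>)
    hence "(\<lambda>k. ennreal \<bar>\<Sum>j<k. a j * \<zeta> j \<omega>\<bar>) \<longlonglongrightarrow> ennreal \<bar>random_series a \<omega>\<bar>"
      unfolding sums_def by (intro tendsto_ennrealI tendsto_rabs)
    thus ?case by (rule LIMSEQ_le_const2) (intro exI[of _ 0] allI impI SUP_upper UNIV_I)
  qed
  also have "\<dots> \<le> ennreal (4 * L1_const * (\<Sum>j. \<bar>a j\<bar> powr \<alpha>) powr (1 / \<alpha>))"
    by (rule maximal_series[OF a])
  finally show ?thesis .
qed

lemma random_series_lincomb:
  assumes a: "summable (\<lambda>j. \<bar>a j\<bar> powr \<alpha>)" and b: "summable (\<lambda>j. \<bar>b j\<bar> powr \<alpha>)"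
  shows "AE \<omega> in M. random_series (\<lambda>j. s * a j + t * b j) \<omega> = s * random_series a \<omega> + t * random_series b \<omega>"
  using AE_random_series_sums[OF a] AE_random_series_sums[OF b]
proof eventually_elim
  case (elim \<omega>)
  have "(\<lambda>j. s * (a j * \<zeta> j \<omega>) + t * (b j * \<zeta> j \<omega>)) sums (s * random_series a \<omega> + t * random_series b \<omega>)"
    by (intro sums_add sums_mult elim)
  hence "(\<lambda>j. (s * a j + t * b j) * \<zeta> j \<omega>) sums (s * random_series a \<omega> + t * random_series b \<omega>)"
    by (simp add: algebra_simps)
  thus ?case unfolding random_series_def by (rule sums_unique[symmetric])
qed

lemma random_series_sum:
  assumes C: "\<And>j. summable (\<lambda>l. \<bar>C j l\<bar> powr \<alpha>)"
  shows "summable (\<lambda>l. \<bar>\<Sum>j<n. b j * C j l\<bar> powr \<alpha>)"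
    and "AE \<omega> in M. random_series (\<lambda>l. \<Sum>j<n. b j * C j l) \<omega> = (\<Sum>j<(n::nat). b j * random_series (C j) \<omega>)"
proof (induction n)
  case 0
  case 1 show ?case using \<alpha> by simp
  case 2 show ?case by (simp add: random_series_def)
next
  case (Suc n)
  case 1
  show ?case using summable_powr_lincomb[OF _ Suc(1) C[of n], of 1 "b n"] \<alpha> by simp
  case 2
  show ?case using Suc(2) random_series_lincomb[OF Suc(1) C[of n], of 1 "b n"]
    by eventually_elim simp
qed

text \<open>Used to exchange the two summations in the integral of a test function: the partial sums over
  \<open>j\<close> are random series whose coefficients converge in \<open>\<ell>\<^sup>\<alpha>\<close>, so they converge in \<open>L\<^sup>1\<close>, and the almost sure
  limit has to agree with the \<open>L\<^sup>1\<close> limit.\<close>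

lemma random_series_superposition:
  assumes C: "\<And>j. summable (\<lambda>l. \<bar>C j l\<bar> powr \<alpha>)"
    and A: "\<And>n. summable (\<lambda>l. \<bar>A l - (\<Sum>j<n. b j * C j l)\<bar> powr \<alpha>)"
    and lim: "(\<lambda>n. \<Sum>l. \<bar>A l - (\<Sum>j<n. b j * C j l)\<bar> powr \<alpha>) \<longlonglongrightarrow> 0"
    and conv: "AE \<omega> in M. summable (\<lambda>j. b j * random_series (C j) \<omega>)"
  shows "AE \<omega> in M. (\<Sum>j. b j * random_series (C j) \<omega>) = random_series A \<omega>"
proof (rule AE_eq_L1_limit)
  show "AE \<omega> in M. (\<lambda>n. \<Sum>j<n. b j * random_series (C j) \<omega>) \<longlonglongrightarrow> (\<Sum>j. b j * random_series (C j) \<omega>)"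
    using conv by eventually_elim (rule summable_LIMSEQ)
  have sA: "summable (\<lambda>l. \<bar>A l\<bar> powr \<alpha>)" using A[of 0] by simp
  show "(\<lambda>n. \<integral>\<^sup>+\<omega>. ennreal \<bar>(\<Sum>j<n. b j * random_series (C j) \<omega>) - random_series A \<omega>\<bar> \<partial>M) \<longlonglongrightarrow> 0"
  proof (rule tendsto_sandwich[OF always_eventually always_eventually tendsto_const]; (intro allI)?)
    fix n
    have "(\<integral>\<^sup>+\<omega>. ennreal \<bar>(\<Sum>j<n. b j * random_series (C j) \<omega>) - random_series A \<omega>\<bar> \<partial>M)
      = (\<integral>\<^sup>+\<omega>. ennreal \<bar>random_series (\<lambda>l. 1 * A l + (-1) * (\<Sum>j<n. b j * C j l)) \<omega>\<bar> \<partial>M)"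
      using random_series_sum(2)[where C=C and b=b and n=n, OF C]
        random_series_lincomb[OF sA random_series_sum(1)[where C=C and b=b and n=n, OF C], of 1 "-1"]
      by (intro nn_integral_cong_AE, eventually_elim) (simp add: abs_minus_commute)
    also have "\<dots> \<le> ennreal (4 * L1_const * (\<Sum>l. \<bar>1 * A l + (-1) * (\<Sum>j<n. b j * C j l)\<bar> powr \<alpha>) powr (1 / \<alpha>))"
      by (rule L1_random_series) (use A[of n] in simp)
    finally show "(\<integral>\<^sup>+\<omega>. ennreal \<bar>(\<Sum>j<n. b j * random_series (C j) \<omega>) - random_series A \<omega>\<bar> \<partial>M)
        \<le> ennreal (4 * L1_const * (\<Sum>l. \<bar>A l - (\<Sum>j<n. b j * C j l)\<bar> powr \<alpha>) powr (1 / \<alpha>))" by simp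
  next
    have "(\<lambda>n. 4 * L1_const * (\<Sum>l. \<bar>A l - (\<Sum>j<n. b j * C j l)\<bar> powr \<alpha>) powr (1 / \<alpha>)) \<longlonglongrightarrow> 4 * L1_const * 0 powr (1 / \<alpha>)"
      by (intro tendsto_mult tendsto_const tendsto_powr' lim)
        (use \<alpha> A in \<open>auto intro!: always_eventually suminf_nonneg\<close>)
    hence "(\<lambda>n. ennreal (4 * L1_const * (\<Sum>l. \<bar>A l - (\<Sum>j<n. b j * C j l)\<bar> powr \<alpha>) powr (1 / \<alpha>))) \<longlonglongrightarrow> ennreal (4 * L1_const * 0 powr (1 / \<alpha>))"
      by (rule tendsto_ennrealI)
    thus "(\<lambda>n. ennreal (4 * L1_const * (\<Sum>l. \<bar>A l - (\<Sum>j<n. b j * C j l)\<bar> powr \<alpha>) powr (1 / \<alpha>))) \<longlonglongrightarrow> 0" by simp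
  qed auto
qed measurable

lemma AE_summable_superposition:
  assumes b: "summable (\<lambda>j. \<bar>b j\<bar>)"
    and C: "\<And>j. summable (\<lambda>l. \<bar>C j l\<bar> powr \<alpha>)" and B: "\<And>j. (\<Sum>l. \<bar>C j l\<bar> powr \<alpha>) \<le> B"
  shows "AE \<omega> in M. summable (\<lambda>j. b j * random_series (C j) \<omega>)"
proof -
  define D where "D = 4 * L1_const * B powr (1 / \<alpha>)"
  have D: "D \<ge> 0" using L1_const_pos by (simp add: D_def)
  have "(\<integral>\<^sup>+\<omega>. (\<Sum>j. ennreal \<bar>b j * random_series (C j) \<omega>\<bar>) \<partial>M) = (\<Sum>j. \<integral>\<^sup>+\<omega>. ennreal \<bar>b j * random_series (C j) \<omega>\<bar> \<partial>M)"
    by (rule nn_integral_suminf) measurable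
  also have "\<dots> \<le> (\<Sum>j. ennreal (\<bar>b j\<bar> * D))"
  proof (intro suminf_le allI summableI)
    fix j
    have "(\<Sum>l. \<bar>C j l\<bar> powr \<alpha>) powr (1 / \<alpha>) \<le> B powr (1 / \<alpha>)"
      using \<alpha> by (intro powr_mono2 B suminf_nonneg C) auto
    hence D': "4 * L1_const * (\<Sum>l. \<bar>C j l\<bar> powr \<alpha>) powr (1 / \<alpha>) \<le> D"
      unfolding D_def using L1_const_pos by (intro mult_left_mono) auto
    have "(\<integral>\<^sup>+\<omega>. ennreal \<bar>b j * random_series (C j) \<omega>\<bar> \<partial>M) = ennreal \<bar>b j\<bar> * (\<integral>\<^sup>+\<omega>. ennreal \<bar>random_series (C j) \<omega>\<bar> \<partial>M)"
      by (subst nn_integral_cmult[symmetric]) (auto simp: abs_mult ennreal_mult)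
    also have "\<dots> \<le> ennreal \<bar>b j\<bar> * ennreal D"
      using L1_random_series[OF C[of j]] D' by (intro mult_left_mono) (auto intro: order.trans ennreal_leI)
    finally show "(\<integral>\<^sup>+\<omega>. ennreal \<bar>b j * random_series (C j) \<omega>\<bar> \<partial>M) \<le> ennreal (\<bar>b j\<bar> * D)"
      using D by (simp add: ennreal_mult)
  qed
  also have "\<dots> < top"
    by (rule suminf_ennreal_scaled_less_top) (use b D in auto)
  finally have "AE \<omega> in M. (\<Sum>j. ennreal \<bar>b j * random_series (C j) \<omega>\<bar>) \<noteq> \<infinity>"
    by (intro nn_integral_PInf_AE) auto
  thus ?thesis
    by eventually_elim (auto intro!: summable_rabs_cancel[OF summable_suminf_not_top])
qed

lemma char_random_series:
  assumes a: "summable (\<lambda>j. \<bar>a j\<bar> powr \<alpha>)"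
  shows "(\<lambda>n. \<Prod>j<n. char (distr M borel (\<zeta> j)) (t * a j)) \<longlonglongrightarrow> char (distr M borel (random_series a)) t"
proof -
  have "(\<lambda>n. CLINT \<omega>|M. iexp (t * (\<Sum>j<n. a j * \<zeta> j \<omega>))) \<longlonglongrightarrow> (CLINT \<omega>|M. iexp (t * random_series a \<omega>))"
  proof (rule integral_dominated_convergence[where w="\<lambda>_. 1"])
    show "AE \<omega> in M. (\<lambda>n. iexp (t * (\<Sum>j<n. a j * \<zeta> j \<omega>))) \<longlonglongrightarrow> iexp (t * random_series a \<omega>)"
      using AE_random_series_sums[OF a] unfolding sums_def
      by eventually_elim (intro tendsto_intros)
  qed auto
  hence "(\<lambda>n. char (distr M borel (\<lambda>\<omega>. \<Sum>j<n. a j * \<zeta> j \<omega>)) t) \<longlonglongrightarrow> char (distr M borel (random_series a)) t"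
    by (simp add: char_def integral_distr)
  thus ?thesis by (simp add: char_partial_sum)
qed

text \<open>Both finite products have factors of modulus at most \<open>1\<close>, so their distance is at most the sum of the
  distances of the factors.\<close>

lemma char_random_series_approx:
  assumes a: "summable (\<lambda>j. \<bar>a j\<bar> powr \<alpha>)" and e: "e \<ge> 0"
    and near: "\<And>j t. \<bar>t\<bar> < \<delta> \<Longrightarrow> cmod (char (distr M borel (\<zeta> j)) t - stable_char \<alpha> \<sigma> \<nu> t) \<le> e * \<bar>t\<bar> powr \<alpha>"
    and small: "\<And>j. \<bar>t * a j\<bar> < \<delta>"
  shows "cmod (char (distr M borel (random_series a)) t - exp (- (\<Sum>j. stable_exponent \<alpha> \<sigma> \<nu> (t * a j))))
     \<le> e * \<bar>t\<bar> powr \<alpha> * (\<Sum>j. \<bar>a j\<bar> powr \<alpha>)"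
proof (rule LIMSEQ_le_const2)
  have "summable (\<lambda>j. stable_exponent \<alpha> \<sigma> \<nu> (t * a j))"
  proof (rule summable_comparison_test'[where N=0])
    show "summable (\<lambda>j. \<sigma> powr \<alpha> * (1 + \<bar>\<nu> * tan (pi * \<alpha> / 2)\<bar>) * (\<bar>t\<bar> powr \<alpha> * \<bar>a j\<bar> powr \<alpha>))"
      by (intro summable_mult a)
    show "cmod (stable_exponent \<alpha> \<sigma> \<nu> (t * a j)) \<le> \<sigma> powr \<alpha> * (1 + \<bar>\<nu> * tan (pi * \<alpha> / 2)\<bar>) * (\<bar>t\<bar> powr \<alpha> * \<bar>a j\<bar> powr \<alpha>)" for j
      using norm_stable_exponent_le[of \<alpha> \<sigma> \<nu> "t * a j"] by (simp add: abs_mult powr_mult)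
  qed
  hence lim: "(\<lambda>n. \<Sum>j<n. stable_exponent \<alpha> \<sigma> \<nu> (t * a j)) \<longlonglongrightarrow> (\<Sum>j. stable_exponent \<alpha> \<sigma> \<nu> (t * a j))"
    by (rule summable_LIMSEQ)
  show "(\<lambda>n. cmod ((\<Prod>j<n. char (distr M borel (\<zeta> j)) (t * a j)) - exp (- (\<Sum>j<n. stable_exponent \<alpha> \<sigma> \<nu> (t * a j)))))
     \<longlonglongrightarrow> cmod (char (distr M borel (random_series a)) t - exp (- (\<Sum>j. stable_exponent \<alpha> \<sigma> \<nu> (t * a j))))"
    by (intro tendsto_norm tendsto_diff char_random_series a tendsto_exp tendsto_minus lim)
  have "cmod ((\<Prod>j<n. char (distr M borel (\<zeta> j)) (t * a j)) - exp (- (\<Sum>j<n. stable_exponent \<alpha> \<sigma> \<nu> (t * a j))))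
     \<le> e * \<bar>t\<bar> powr \<alpha> * (\<Sum>j. \<bar>a j\<bar> powr \<alpha>)" for n
  proof -
    have "exp (- (\<Sum>j<n. stable_exponent \<alpha> \<sigma> \<nu> (t * a j))) = (\<Prod>j<n. stable_char \<alpha> \<sigma> \<nu> (t * a j))"
      by (simp add: stable_char_eq_exp exp_sum flip: sum_negf)
    hence "cmod ((\<Prod>j<n. char (distr M borel (\<zeta> j)) (t * a j)) - exp (- (\<Sum>j<n. stable_exponent \<alpha> \<sigma> \<nu> (t * a j))))
      = cmod ((\<Prod>j<n. char (distr M borel (\<zeta> j)) (t * a j)) - (\<Prod>j<n. stable_char \<alpha> \<sigma> \<nu> (t * a j)))" by simp
    also have "\<dots> \<le> (\<Sum>j<n. cmod (char (distr M borel (\<zeta> j)) (t * a j) - stable_char \<alpha> \<sigma> \<nu> (t * a j)))"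
      by (rule norm_prod_diff)
        (auto simp: stable_char_eq_exp norm_exp_eq_Re intro!: real_distribution.cmod_char_le_1[OF real_distribution_distr])
    also have "\<dots> \<le> (\<Sum>j<n. e * \<bar>t * a j\<bar> powr \<alpha>)"
      by (intro sum_mono near small)
    also have "\<dots> = e * \<bar>t\<bar> powr \<alpha> * (\<Sum>j<n. \<bar>a j\<bar> powr \<alpha>)"
      by (simp add: abs_mult powr_mult sum_distrib_left mult_ac)
    also have "\<dots> \<le> e * \<bar>t\<bar> powr \<alpha> * (\<Sum>j. \<bar>a j\<bar> powr \<alpha>)"
      using e by (intro mult_left_mono sum_le_suminf a) auto
    finally show ?thesis .
  qed
  thus "\<exists>N. \<forall>n\<ge>N. cmod ((\<Prod>j<n. char (distr M borel (\<zeta> j)) (t * a j)) - exp (- (\<Sum>j<n. stable_exponent \<alpha> \<sigma> \<nu> (t * a j))))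
     \<le> e * \<bar>t\<bar> powr \<alpha> * (\<Sum>j. \<bar>a j\<bar> powr \<alpha>)" by blast
qed

end

lemma suminf_ennreal_neq_top_member:
  fixes f :: "nat \<Rightarrow> ennreal"
  assumes "(\<Sum>i. f i) \<noteq> top"
  shows "f i \<noteq> top"
  using le_suminf_ennreal[of f i] assms by (auto simp: top_unique)

text \<open>Exchanging the order, the partial sums over \<open>j\<close> are \<open>\<Sum>i. c i * U\<^sub>i n\<close> with
  \<open>U\<^sub>i n = (\<Sum>j<n. b j * X i j)\<close>.  Each \<open>U\<^sub>i\<close> converges almost surely, and by the maximal inequality
  the suprema \<open>sup\<^sub>n \<bar>U\<^sub>i n\<bar>\<close> have expectations bounded uniformly in \<open>i\<close>, which dominates the series
  over \<open>i\<close>.  In the application the rows are shifted copies of one family, so they depend on each other.\<close>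

lemma AE_summable_double_series:
  fixes X :: "nat \<Rightarrow> nat \<Rightarrow> 'a \<Rightarrow> real"
  assumes X: "\<And>i. independent_stable_like M (X i) \<alpha> K"
    and b: "summable (\<lambda>j. \<bar>b j\<bar> powr \<alpha>)" and c: "summable (\<lambda>i. \<bar>c i\<bar>)"
  shows "AE \<omega> in M. \<forall>j. summable (\<lambda>i. \<bar>c i * X i j \<omega>\<bar>)"
    and "AE \<omega> in M. summable (\<lambda>j. b j * (\<Sum>i. c i * X i j \<omega>))"
proof -
  interpret X: independent_stable_like M "X i" \<alpha> K for i by (rule X)
  define L where "L = 4 * X.L1_const"
  have L: "L > 0" using X.L1_const_pos by (simp add: L_def)
  show ae1: "AE \<omega> in M. \<forall>j. summable (\<lambda>i. \<bar>c i * X i j \<omega>\<bar>)"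
    unfolding AE_all_countable
  proof
    fix j
    have "(\<integral>\<^sup>+\<omega>. (\<Sum>i. ennreal \<bar>c i * X i j \<omega>\<bar>) \<partial>M) = (\<Sum>i. \<integral>\<^sup>+\<omega>. ennreal \<bar>c i * X i j \<omega>\<bar> \<partial>M)"
      by (rule nn_integral_suminf) measurable
    also have "\<dots> \<le> (\<Sum>i. ennreal (\<bar>c i\<bar> * L))"
    proof (intro suminf_le allI summableI)
      fix i
      have "(\<integral>\<^sup>+\<omega>. ennreal \<bar>c i * X i j \<omega>\<bar> \<partial>M) = ennreal \<bar>c i\<bar> * (\<integral>\<^sup>+\<omega>. ennreal \<bar>X i j \<omega>\<bar> \<partial>M)"
        by (subst nn_integral_cmult[symmetric]) (auto simp: abs_mult ennreal_mult)
      also have "(\<integral>\<^sup>+\<omega>. ennreal \<bar>X i j \<omega>\<bar> \<partial>M) \<le> ennreal X.L1_const"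
        using X.L1_partial_sum[of "\<lambda>_. 1" i "{j}"] by simp
      also have "\<dots> \<le> ennreal L" using X.L1_const_pos by (intro ennreal_leI) (simp add: L_def)
      finally show "(\<integral>\<^sup>+\<omega>. ennreal \<bar>c i * X i j \<omega>\<bar> \<partial>M) \<le> ennreal (\<bar>c i\<bar> * L)"
        using L by (simp add: ennreal_mult mult_left_mono)
    qed
    also have "\<dots> < top"
      by (rule suminf_ennreal_scaled_less_top) (use c L in auto)
    finally have "AE \<omega> in M. (\<Sum>i. ennreal \<bar>c i * X i j \<omega>\<bar>) \<noteq> \<infinity>"
      by (intro nn_integral_PInf_AE) auto
    thus "AE \<omega> in M. summable (\<lambda>i. \<bar>c i * X i j \<omega>\<bar>)"
      by eventually_elim (auto intro!: summable_suminf_not_top)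
  qed
  define D where "D i \<omega> = (SUP k. ennreal \<bar>\<Sum>j<k. b j * X i j \<omega>\<bar>)" for i \<omega>
  have [measurable]: "D i \<in> borel_measurable M" for i unfolding D_def by measurable
  define B where "B = L * (\<Sum>j. \<bar>b j\<bar> powr \<alpha>) powr (1 / \<alpha>)"
  have B: "B \<ge> 0" using L by (simp add: B_def)
  have ae2: "AE \<omega> in M. (\<Sum>i. ennreal \<bar>c i\<bar> * D i \<omega>) \<noteq> \<infinity>"
  proof (rule nn_integral_PInf_AE)
    have "(\<integral>\<^sup>+\<omega>. (\<Sum>i. ennreal \<bar>c i\<bar> * D i \<omega>) \<partial>M) = (\<Sum>i. \<integral>\<^sup>+\<omega>. ennreal \<bar>c i\<bar> * D i \<omega> \<partial>M)"
      by (rule nn_integral_suminf) measurable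
    also have "\<dots> \<le> (\<Sum>i. ennreal (\<bar>c i\<bar> * B))"
    proof (intro suminf_le allI summableI)
      fix i
      have "(\<integral>\<^sup>+\<omega>. ennreal \<bar>c i\<bar> * D i \<omega> \<partial>M) = ennreal \<bar>c i\<bar> * (\<integral>\<^sup>+\<omega>. D i \<omega> \<partial>M)"
        by (rule nn_integral_cmult) measurable
      also have "\<dots> \<le> ennreal \<bar>c i\<bar> * ennreal B"
        using X.maximal_series[OF b, of i] unfolding D_def B_def L_def by (intro mult_left_mono) auto
      finally show "(\<integral>\<^sup>+\<omega>. ennreal \<bar>c i\<bar> * D i \<omega> \<partial>M) \<le> ennreal (\<bar>c i\<bar> * B)"
        using B by (simp add: ennreal_mult)
    qed
    also have "\<dots> < top"
      by (rule suminf_ennreal_scaled_less_top) (use c B in auto)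
    finally show "(\<integral>\<^sup>+\<omega>. (\<Sum>i. ennreal \<bar>c i\<bar> * D i \<omega>) \<partial>M) \<noteq> \<infinity>" by auto
  qed measurable
  have ae3: "AE \<omega> in M. \<forall>i. summable (\<lambda>j. b j * X i j \<omega>)"
    unfolding AE_all_countable by (intro allI X.AE_summable b)
  show "AE \<omega> in M. summable (\<lambda>j. b j * (\<Sum>i. c i * X i j \<omega>))"
    using ae1 ae2 ae3
  proof eventually_elim
    case (elim \<omega>)
    define W where "W i = enn2real (ennreal \<bar>c i\<bar> * D i \<omega>)" for i
    have fin: "ennreal \<bar>c i\<bar> * D i \<omega> \<noteq> top" for i
      using elim(2) suminf_ennreal_neq_top_member by simp
    have Weq: "ennreal (W i) = ennreal \<bar>c i\<bar> * D i \<omega>" for i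
      unfolding W_def using fin[of i] by (simp add: less_top)
    have W: "summable W"
    proof (rule summable_suminf_not_top)
      show "(\<Sum>i. ennreal (W i)) \<noteq> top" using elim(2) unfolding Weq by simp
    qed (simp add: W_def)
    have dom: "norm (c i * (\<Sum>j<n. b j * X i j \<omega>)) \<le> W i" for i n
    proof -
      have "ennreal (norm (c i * (\<Sum>j<n. b j * X i j \<omega>))) = ennreal \<bar>c i\<bar> * ennreal \<bar>\<Sum>j<n. b j * X i j \<omega>\<bar>"
        by (simp add: abs_mult ennreal_mult)
      also have "\<dots> \<le> ennreal \<bar>c i\<bar> * D i \<omega>"
        unfolding D_def by (intro mult_left_mono SUP_upper) auto
      finally show ?thesis unfolding Weq[symmetric] by (simp add: W_def)
    qed
    have dom': "\<forall>\<^sub>F (i, n) in sequentially \<times>\<^sub>F sequentially. norm (c i * (\<Sum>j<n. b j * X i j \<omega>)) \<le> W i"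
      using dom by (intro always_eventually) auto
    have lim: "(\<lambda>n. c i * (\<Sum>j<n. b j * X i j \<omega>)) \<longlonglongrightarrow> c i * (\<Sum>j. b j * X i j \<omega>)" for i
      using elim(3) by (intro tendsto_mult tendsto_const summable_LIMSEQ) auto
    have "(\<lambda>n. \<Sum>i. c i * (\<Sum>j<n. b j * X i j \<omega>)) \<longlonglongrightarrow> (\<Sum>i. c i * (\<Sum>j. b j * X i j \<omega>))"
      using tannerys_theorem[OF lim dom' W] by simp
    moreover have "(\<Sum>i. c i * (\<Sum>j<n. b j * X i j \<omega>)) = (\<Sum>j<n. b j * (\<Sum>i. c i * X i j \<omega>))" for n
    proof -
      have s: "summable (\<lambda>i. c i * X i j \<omega>)" for j
        by (rule summable_rabs_cancel) (rule elim(1)[rule_format])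
      have "(\<Sum>i. c i * (\<Sum>j<n. b j * X i j \<omega>)) = (\<Sum>i. \<Sum>j<n. b j * (c i * X i j \<omega>))"
        by (simp add: sum_distrib_left mult_ac)
      also have "\<dots> = (\<Sum>j<n. \<Sum>i. b j * (c i * X i j \<omega>))"
        by (rule suminf_sum) (intro summable_mult s)
      also have "\<dots> = (\<Sum>j<n. b j * (\<Sum>i. c i * X i j \<omega>))"
        by (simp add: suminf_mult s)
      finally show ?thesis .
    qed
    ultimately have "convergent (\<lambda>n. \<Sum>j<n. b j * (\<Sum>i. c i * X i j \<omega>))"
      by (auto simp: convergent_def)
    thus ?case by (simp add: summable_iff_convergent)
  qed
qed

section \<open>Lattice cells and step functions\<close>

lemma countable_UNIV_int_vec: "countable (UNIV :: (int ^ 'n) set)"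
proof -
  have "countable (range (vec_nth :: int ^ 'n \<Rightarrow> 'n \<Rightarrow> int))" by (rule countableI_type)
  moreover have "inj (vec_nth :: int ^ 'n \<Rightarrow> 'n \<Rightarrow> int)" by (simp add: inj_def vec_nth_inject)
  ultimately show ?thesis using countable_image_inj_on by blast
qed

definition lattice_point :: "real \<Rightarrow> real ^ 'n \<Rightarrow> int ^ 'n" where
  "lattice_point h x = vec_floor ((1 / h) *\<^sub>R x)"

lemma mem_cell_iff:
  assumes "h > 0"
  shows "x \<in> cell h k \<longleftrightarrow> (\<forall>i. h * k $ i \<le> x $ i \<and> x $ i < h * (k $ i + 1))"
proof
  assume "x \<in> cell h k"
  then obtain u where u: "\<forall>i. 0 \<le> u $ i \<and> u $ i < 1" "x = h *\<^sub>R ((\<chi> i. real_of_int (k $ i)) + u)"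
    by (auto simp: cell_def)
  thus "\<forall>i. h * k $ i \<le> x $ i \<and> x $ i < h * (k $ i + 1)" using assms by simp
next
  assume *: "\<forall>i. h * k $ i \<le> x $ i \<and> x $ i < h * (k $ i + 1)"
  define u where "u = (1 / h) *\<^sub>R x - (\<chi> i. real_of_int (k $ i))"
  have "x = h *\<^sub>R ((\<chi> i. real_of_int (k $ i)) + u)" using assms by (simp add: u_def)
  moreover have "\<forall>i. 0 \<le> u $ i \<and> u $ i < 1" using * assms by (auto simp: u_def field_simps)
  ultimately show "x \<in> cell h k" unfolding cell_def by blast
qed

lemma mem_cell_lattice_point:
  assumes "h > 0"
  shows "x \<in> cell h k \<longleftrightarrow> lattice_point h x = k"
proof -
  have "(h * k $ i \<le> x $ i \<and> x $ i < h * (k $ i + 1)) \<longleftrightarrow> \<lfloor>x $ i / h\<rfloor> = k $ i" for i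
    using assms by (auto simp: floor_eq_iff field_simps)
  thus ?thesis
    unfolding mem_cell_iff[OF assms] lattice_point_def vec_floor_def by (auto simp: vec_eq_iff)
qed

lemma sets_cell [measurable]:
  assumes "h > 0" shows "cell h k \<in> sets borel"
proof -
  have "cell h k = {x. \<forall>i. h * k $ i \<le> x $ i \<and> x $ i < h * (k $ i + 1)}"
    using mem_cell_iff[OF assms] by blast
  also have "\<dots> \<in> sets borel" by measurable
  finally show ?thesis .
qed

lemma measurable_lattice_point [measurable]:
  assumes "h > 0" shows "lattice_point h \<in> borel \<rightarrow>\<^sub>M count_space UNIV"
proof (subst measurable_count_space_eq_countable[OF countable_UNIV_int_vec], intro conjI ballI)
  fix k :: "int ^ 'n"
  have "lattice_point h -` {k} \<inter> space borel = cell h k"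
    using mem_cell_lattice_point[OF assms] by auto
  thus "lattice_point h -` {k} \<inter> space borel \<in> sets borel" using sets_cell[OF assms] by simp
qed auto

lemma emeasure_cell:
  assumes h: "h > 0"
  shows "emeasure lborel (cell h (k :: int ^ 'n)) = ennreal (h ^ CARD('n))"
proof -
  define a b :: "real ^ 'n" where "a = (\<chi> i. h * k $ i)" and "b = (\<chi> i. h * (k $ i + 1))"
  have ab: "a $ i \<le> b $ i" for i using h by (simp add: a_def b_def)
  have "cbox a b \<noteq> {}" using ab by (simp add: interval_ne_empty_cart)
  hence "measure lborel (cbox a b) = h ^ CARD('n)"
    by (simp add: content_cbox_cart a_def b_def algebra_simps)
  hence cb: "emeasure lborel (cbox a b) = ennreal (h ^ CARD('n))"
    by (subst emeasure_eq_ennreal_measure) (simp_all add: emeasure_lborel_cbox_eq)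
  have b: "emeasure lborel (box a b) = emeasure lborel (cbox a b)"
    by (simp add: emeasure_lborel_box_eq emeasure_lborel_cbox_eq)
  have "box a b \<subseteq> cell h k" "cell h k \<subseteq> cbox a b"
    by (auto simp: mem_cell_iff[OF h] mem_box_cart a_def b_def less_imp_le)
  hence "emeasure lborel (box a b) \<le> emeasure lborel (cell h k)" "emeasure lborel (cell h k) \<le> emeasure lborel (cbox a b)"
    using sets_cell[OF h, of k] by (auto intro!: emeasure_mono)
  thus ?thesis using cb b by simp
qed

lemma measure_cell: "h > 0 \<Longrightarrow> measure lborel (cell h (k :: int ^ 'n)) = h ^ CARD('n)"
  by (simp add: measure_def emeasure_cell)

lemma suminf_indicator_cell:
  fixes g :: "nat \<Rightarrow> 'b :: {comm_monoid_add, t2_space}"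
  assumes e: "bij (e :: nat \<Rightarrow> int ^ 'n)" and h: "h > 0"
  shows "(\<lambda>j. if x \<in> cell h (e j) then g j else 0) sums g (inv e (lattice_point h x))"
proof -
  have *: "(if x \<in> cell h (e j) then g j else 0) = (if j = inv e (lattice_point h x) then g j else 0)" for j
    using e mem_cell_lattice_point[OF h, of x "e j"] by (auto simp: bij_is_surj surj_f_inv_f bij_is_inj)
  show ?thesis unfolding * using sums_If_finite_set[of "{inv e (lattice_point h x)}" g] by simp
qed

lemma nn_integral_cells:
  fixes e :: "nat \<Rightarrow> int ^ 'n"
  assumes e: "bij e" and h: "h > 0" and [measurable]: "f \<in> borel_measurable borel"
  shows "(\<Sum>j. \<integral>\<^sup>+x. f x * indicator (cell h (e j)) x \<partial>lborel) = (\<integral>\<^sup>+x. f x \<partial>lborel)"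
proof -
  note [measurable] = sets_cell[OF h]
  have "(\<Sum>j. \<integral>\<^sup>+x. f x * indicator (cell h (e j)) x \<partial>lborel) = (\<integral>\<^sup>+x. (\<Sum>j. f x * indicator (cell h (e j)) x) \<partial>lborel)"
    by (rule nn_integral_suminf[symmetric]) measurable
  also have "(\<lambda>x. \<Sum>j. f x * indicator (cell h (e j)) x) = f"
  proof
    fix x
    have "(\<lambda>j. f x * indicator (cell h (e j)) x) = (\<lambda>j. if x \<in> cell h (e j) then f x else 0)" by auto
    thus "(\<Sum>j. f x * indicator (cell h (e j)) x) = f x"
      using sums_unique[OF suminf_indicator_cell[OF e h, of x "\<lambda>_. f x"]] by simp
  qed
  finally show ?thesis .
qed

lemma nn_integral_lattice:
  fixes e :: "nat \<Rightarrow> int ^ 'n"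
  assumes e: "bij e" and h: "h > 0"
  shows "(\<integral>\<^sup>+x. g (lattice_point h x) \<partial>lborel) = ennreal (h ^ CARD('n)) * (\<Sum>j. g (e j))"
proof -
  note [measurable] = sets_cell[OF h] measurable_lattice_point[OF h]
  have "(\<integral>\<^sup>+x. g (lattice_point h x) \<partial>lborel) = (\<Sum>j. \<integral>\<^sup>+x. g (lattice_point h x) * indicator (cell h (e j)) x \<partial>lborel)"
    by (rule nn_integral_cells[OF e h, symmetric]) measurable
  also have "\<dots> = (\<Sum>j. \<integral>\<^sup>+x. g (e j) * indicator (cell h (e j)) x \<partial>lborel)"
    by (intro suminf_cong nn_integral_cong) (auto simp: mem_cell_lattice_point[OF h] split: split_indicator)
  also have "\<dots> = (\<Sum>j. ennreal (h ^ CARD('n)) * g (e j))"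
    by (subst nn_integral_cmult_indicator) (auto simp: emeasure_cell[OF h] mult.commute)
  finally show ?thesis by (simp add: ennreal_suminf_cmult)
qed

lemma integral_cells_sums:
  fixes e :: "nat \<Rightarrow> int ^ 'n" and f :: "real ^ 'n \<Rightarrow> real"
  assumes e: "bij e" and h: "h > 0" and f: "integrable lborel f"
  shows "(\<lambda>j. LINT x:cell h (e j)|lborel. f x) sums (\<integral>x. f x \<partial>lborel)"
    and "summable (\<lambda>j. \<bar>LINT x:cell h (e j)|lborel. f x\<bar>)"
proof -
  note [measurable] = sets_cell[OF h]
  have [measurable]: "f \<in> borel_measurable borel" using f by simp
  define F where "F j x = indicator (cell h (e j)) x *\<^sub>R f x" for j x
  have Fi: "integrable lborel (F j)" for j
    unfolding F_def by (rule integrable_mult_indicator[OF _ f]) simp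
  have Feq: "F j x = (if x \<in> cell h (e j) then f x else 0)" "norm (F j x) = (if x \<in> cell h (e j) then \<bar>f x\<bar> else 0)" for j x
    by (auto simp: F_def)
  have s1: "summable (\<lambda>j. \<integral>x. norm (F j x) \<partial>lborel)"
  proof (rule summable_suminf_not_top)
    have "(\<Sum>j. ennreal (\<integral>x. norm (F j x) \<partial>lborel)) = (\<Sum>j. \<integral>\<^sup>+x. ennreal (norm (f x)) * indicator (cell h (e j)) x \<partial>lborel)"
    proof (intro suminf_cong)
      fix j
      have "ennreal (\<integral>x. norm (F j x) \<partial>lborel) = (\<integral>\<^sup>+x. ennreal (norm (F j x)) \<partial>lborel)"
        by (rule nn_integral_eq_integral[OF integrable_norm[OF Fi], symmetric]) simp
      also have "\<dots> = (\<integral>\<^sup>+x. ennreal (norm (f x)) * indicator (cell h (e j)) x \<partial>lborel)"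
        by (intro nn_integral_cong) (auto simp: F_def split: split_indicator)
      finally show "ennreal (\<integral>x. norm (F j x) \<partial>lborel) = (\<integral>\<^sup>+x. ennreal (norm (f x)) * indicator (cell h (e j)) x \<partial>lborel)" .
    qed
    also have "\<dots> = (\<integral>\<^sup>+x. ennreal (norm (f x)) \<partial>lborel)" by (rule nn_integral_cells[OF e h]) measurable
    also have "\<dots> < \<infinity>" using f by (simp add: integrable_iff_bounded)
    finally show "(\<Sum>j. ennreal (\<integral>x. norm (F j x) \<partial>lborel)) \<noteq> top" by auto
  qed simp
  have "(\<lambda>j. integral\<^sup>L lborel (F j)) sums (\<integral>x. (\<Sum>j. F j x) \<partial>lborel)"
  proof (rule sums_integral[OF Fi _ s1], rule AE_I2)
    show "summable (\<lambda>j. norm (F j x))" for x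
      unfolding Feq(2) by (rule sums_summable[OF suminf_indicator_cell[OF e h]])
  qed
  moreover have "(\<Sum>j. F j x) = f x" for x
    unfolding Feq using sums_unique[OF suminf_indicator_cell[OF e h, of x "\<lambda>_. f x"]] by simp
  ultimately show "(\<lambda>j. LINT x:cell h (e j)|lborel. f x) sums (\<integral>x. f x \<partial>lborel)"
    by (simp add: set_lebesgue_integral_def F_def[abs_def])
  show "summable (\<lambda>j. \<bar>LINT x:cell h (e j)|lborel. f x\<bar>)"
  proof (rule summable_comparison_test'[OF s1, where N=0])
    fix j show "norm \<bar>LINT x:cell h (e j)|lborel. f x\<bar> \<le> (\<integral>x. norm (F j x) \<partial>lborel)"
      using integral_norm_bound[of lborel "F j"] by (simp add: set_lebesgue_integral_def F_def)
  qed
qed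

lemma integral_lattice:
  fixes e :: "nat \<Rightarrow> int ^ 'n" and g :: "int ^ 'n \<Rightarrow> real"
  assumes e: "bij e" and h: "h > 0" and g: "summable (\<lambda>j. \<bar>g (e j)\<bar>)"
  shows "integrable lborel (\<lambda>x. g (lattice_point h x))"
    and "(\<integral>x. g (lattice_point h x) \<partial>lborel) = h ^ CARD('n) * (\<Sum>j. g (e j))"
proof -
  note [measurable] = measurable_lattice_point[OF h] sets_cell[OF h]
  show int: "integrable lborel (\<lambda>x. g (lattice_point h x))"
  proof (rule integrableI_bounded)
    have "(\<integral>\<^sup>+x. ennreal (norm (g (lattice_point h x))) \<partial>lborel) = ennreal (h ^ CARD('n)) * (\<Sum>j. ennreal (norm (g (e j))))"
      by (rule nn_integral_lattice[OF e h, of "\<lambda>k. ennreal (norm (g k))"])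
    also have "(\<Sum>j. ennreal (norm (g (e j)))) = ennreal (\<Sum>j. \<bar>g (e j)\<bar>)"
      using g by (simp add: suminf_ennreal2)
    finally show "(\<integral>\<^sup>+x. ennreal (norm (g (lattice_point h x))) \<partial>lborel) < \<infinity>"
      by (simp add: ennreal_mult_less_top)
  qed measurable
  have "(LINT x:cell h (e j)|lborel. g (lattice_point h x)) = h ^ CARD('n) * g (e j)" for j
  proof -
    have "(LINT x:cell h (e j)|lborel. g (lattice_point h x)) = (LINT x:cell h (e j)|lborel. g (e j))"
      by (rule set_lebesgue_integral_cong) (auto simp: mem_cell_lattice_point[OF h])
    moreover have "integrable lborel (indicator (cell h (e j)) :: _ \<Rightarrow> real)"
      by (rule integrable_real_indicator) (auto simp: emeasure_cell[OF h])
    ultimately show ?thesis by (simp add: measure_cell[OF h] set_lebesgue_integral_def)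
  qed
  hence "(\<lambda>j. h ^ CARD('n) * g (e j)) sums (\<integral>x. g (lattice_point h x) \<partial>lborel)"
    using integral_cells_sums(1)[OF e h int] by simp
  moreover have "(\<lambda>j. h ^ CARD('n) * g (e j)) sums (h ^ CARD('n) * (\<Sum>j. g (e j)))"
    by (intro sums_mult summable_sums) (rule summable_rabs_cancel[OF g])
  ultimately show "(\<integral>x. g (lattice_point h x) \<partial>lborel) = h ^ CARD('n) * (\<Sum>j. g (e j))"
    by (rule sums_unique2)
qed

text \<open>By multiplicativity only the ratio \<open>a / b\<close> matters.  Where it is near \<open>1\<close>, continuity of \<open>u\<close> at \<open>1\<close>
  gives the first term; elsewhere both \<open>\<bar>a\<bar>\<close> and \<open>\<bar>b\<bar>\<close> are at most a multiple of \<open>\<bar>a - b\<bar>\<close>.  The cases of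
  interest are the absolute and the signed power.\<close>

lemma multiplicative_diff_bound:
  fixes u :: "real \<Rightarrow> real"
  assumes mult: "\<And>x y. u (x * y) = u x * u y" and abs_u: "\<And>x. \<bar>u x\<bar> = \<bar>x\<bar> powr \<alpha>"
    and cont: "isCont u 1" and u1: "u 1 = 1" and \<alpha>: "\<alpha> > 0" and \<eta>: "\<eta> > 0"
  shows "\<exists>C\<ge>0. \<forall>a b. \<bar>u a - u b\<bar> \<le> \<eta> * \<bar>b\<bar> powr \<alpha> + C * \<bar>a - b\<bar> powr \<alpha>"
proof -
  from cont \<eta> obtain \<delta> where \<delta>: "\<delta> > 0" "\<And>x. \<bar>x - 1\<bar> < \<delta> \<Longrightarrow> \<bar>u x - 1\<bar> < \<eta>"
    unfolding continuous_at_eps_delta dist_real_def u1 by blast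
  define C where "C = (1 + 1 / \<delta>) powr \<alpha> + (1 / \<delta>) powr \<alpha>"
  show ?thesis
  proof (intro exI[of _ C] conjI allI)
    show "C \<ge> 0" by (simp add: C_def)
    fix a b :: real
    show "\<bar>u a - u b\<bar> \<le> \<eta> * \<bar>b\<bar> powr \<alpha> + C * \<bar>a - b\<bar> powr \<alpha>"
    proof (cases "\<bar>a - b\<bar> < \<delta> * \<bar>b\<bar>")
      case True
      hence b: "b \<noteq> 0" by auto
      have "\<bar>a / b - 1\<bar> = \<bar>a - b\<bar> / \<bar>b\<bar>" using b by (simp add: field_simps flip: abs_divide)
      hence "\<bar>u (a / b) - 1\<bar> < \<eta>" using True b by (intro \<delta>(2)) (simp add: field_simps)
      moreover have "u a - u b = u b * (u (a / b) - 1)"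
        using mult[of b "a / b"] b by (simp add: algebra_simps)
      ultimately have "\<bar>u a - u b\<bar> \<le> \<bar>b\<bar> powr \<alpha> * \<eta>"
        by (simp add: abs_mult abs_u mult_left_mono)
      thus ?thesis by (simp add: C_def mult.commute add_increasing2)
    next
      case False
      hence b: "\<bar>b\<bar> \<le> (1 / \<delta>) * \<bar>a - b\<bar>" using \<delta>(1) by (simp add: field_simps)
      hence a: "\<bar>a\<bar> \<le> (1 + 1 / \<delta>) * \<bar>a - b\<bar>" by (simp add: distrib_right)
      have "\<bar>u a - u b\<bar> \<le> \<bar>a\<bar> powr \<alpha> + \<bar>b\<bar> powr \<alpha>" using abs_triangle_ineq4[of "u a" "u b"] by (simp add: abs_u)
      also have "\<dots> \<le> ((1 + 1 / \<delta>) * \<bar>a - b\<bar>) powr \<alpha> + ((1 / \<delta>) * \<bar>a - b\<bar>) powr \<alpha>"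
        using \<alpha> by (intro add_mono powr_mono2 a b) auto
      also have "\<dots> = C * \<bar>a - b\<bar> powr \<alpha>"
      proof -
        have "(t * \<bar>a - b\<bar>) powr \<alpha> = t powr \<alpha> * \<bar>a - b\<bar> powr \<alpha>" if "t \<ge> 0" for t
          using that by (simp add: powr_mult)
        from this[of "1 + 1 / \<delta>"] this[of "1 / \<delta>"] show ?thesis
          using \<delta>(1) unfolding C_def distrib_right[of "_ powr _"] by simp
      qed
      finally show ?thesis using \<eta> by (simp add: add_increasing)
    qed
  qed
qed

lemma integral_multiplicative_tendsto:
  fixes u :: "real \<Rightarrow> real"
  assumes mult: "\<And>x y. u (x * y) = u x * u y" and abs_u: "\<And>x. \<bar>u x\<bar> = \<bar>x\<bar> powr \<alpha>"
    and cont: "isCont u 1" and u1: "u 1 = 1" and \<alpha>: "\<alpha> > 0" and [measurable]: "u \<in> borel_measurable borel"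
    and [measurable]: "\<And>m. F m \<in> borel_measurable M" "G \<in> borel_measurable M"
    and G: "integrable M (\<lambda>x. \<bar>G x\<bar> powr \<alpha>)"
    and D: "\<And>m. integrable M (\<lambda>x. \<bar>F m x - G x\<bar> powr \<alpha>)"
    and lim: "(\<lambda>m. \<integral>x. \<bar>F m x - G x\<bar> powr \<alpha> \<partial>M) \<longlonglongrightarrow> 0"
  shows "(\<lambda>m. \<integral>x. u (F m x) \<partial>M) \<longlonglongrightarrow> (\<integral>x. u (G x) \<partial>M)"
proof (rule LIMSEQ_I)
  fix r :: real assume r: "r > 0"
  define I where "I = (\<integral>x. \<bar>G x\<bar> powr \<alpha> \<partial>M)"
  have I: "I \<ge> 0" by (simp add: I_def)
  define \<eta> where "\<eta> = r / (2 * (I + 1))"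
  have \<eta>: "\<eta> > 0" "\<eta> * I < r / 2" using r I by (auto simp: \<eta>_def field_simps)
  obtain C where C: "C \<ge> 0" "\<And>a b. \<bar>u a - u b\<bar> \<le> \<eta> * \<bar>b\<bar> powr \<alpha> + C * \<bar>a - b\<bar> powr \<alpha>"
    using multiplicative_diff_bound[OF mult abs_u cont u1 \<alpha> \<eta>(1)] by blast
  have iG: "integrable M (\<lambda>x. u (G x))"
    by (rule Bochner_Integration.integrable_bound[OF G]) (auto simp: abs_u)
  have idiff: "integrable M (\<lambda>x. u (F m x) - u (G x))" for m
  proof (rule Bochner_Integration.integrable_bound)
    show "integrable M (\<lambda>x. \<eta> * \<bar>G x\<bar> powr \<alpha> + C * \<bar>F m x - G x\<bar> powr \<alpha>)"
      by (intro Bochner_Integration.integrable_add integrable_mult_right G D)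
    show "AE x in M. norm (u (F m x) - u (G x)) \<le> norm (\<eta> * \<bar>G x\<bar> powr \<alpha> + C * \<bar>F m x - G x\<bar> powr \<alpha>)"
      using C \<eta> by (intro AE_I2) (simp add: order.trans[OF C(2) abs_ge_self])
  qed measurable
  have bd: "\<bar>(\<integral>x. u (F m x) \<partial>M) - (\<integral>x. u (G x) \<partial>M)\<bar> \<le> \<eta> * I + C * (\<integral>x. \<bar>F m x - G x\<bar> powr \<alpha> \<partial>M)" for m
  proof -
    have iF: "integrable M (\<lambda>x. u (F m x))" using Bochner_Integration.integrable_add[OF idiff[of m] iG] by simp
    have "\<bar>(\<integral>x. u (F m x) \<partial>M) - (\<integral>x. u (G x) \<partial>M)\<bar> = \<bar>\<integral>x. u (F m x) - u (G x) \<partial>M\<bar>"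
      using iF iG by simp
    also have "\<dots> \<le> (\<integral>x. \<bar>u (F m x) - u (G x)\<bar> \<partial>M)" by (rule integral_abs_bound)
    also have "\<dots> \<le> (\<integral>x. \<eta> * \<bar>G x\<bar> powr \<alpha> + C * \<bar>F m x - G x\<bar> powr \<alpha> \<partial>M)"
      using C G D idiff by (intro integral_mono) auto
    also have "\<dots> = \<eta> * I + C * (\<integral>x. \<bar>F m x - G x\<bar> powr \<alpha> \<partial>M)"
      using G D by (simp add: I_def)
    finally show ?thesis .
  qed
  have "(\<lambda>m. C * (\<integral>x. \<bar>F m x - G x\<bar> powr \<alpha> \<partial>M)) \<longlonglongrightarrow> C * 0" by (intro tendsto_intros lim)
  hence "\<forall>\<^sub>F m in sequentially. C * (\<integral>x. \<bar>F m x - G x\<bar> powr \<alpha> \<partial>M) < r / 2" using r by (intro order_tendstoD(2)) auto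
  hence "\<forall>\<^sub>F m in sequentially. norm ((\<integral>x. u (F m x) \<partial>M) - (\<integral>x. u (G x) \<partial>M)) < r"
  proof eventually_elim
    case (elim m)
    show ?case using bd[of m] elim \<eta>(2) by simp
  qed
  thus "\<exists>no. \<forall>m\<ge>no. norm ((\<integral>x. u (F m x) \<partial>M) - (\<integral>x. u (G x) \<partial>M)) < r" unfolding eventually_sequentially .
qed

text \<open>A quantitative form of absolute continuity of the integral, obtained by truncating \<open>G\<close> at a high
  level \<open>B\<close>.\<close>

lemma integral_small_sets:
  fixes G :: "'a \<Rightarrow> real"
  assumes G: "integrable M G" and nn: "\<And>x. G x \<ge> 0" and e: "e > 0"
  shows "\<exists>B\<ge>0. \<forall>S\<in>sets M. emeasure M S < \<infinity> \<longrightarrow> (\<integral>x. indicator S x * G x \<partial>M) \<le> e + B * measure M S"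
proof -
  have [measurable]: "G \<in> borel_measurable M" using G by simp
  have "(\<lambda>n. \<integral>x. G x - min (G x) (real n) \<partial>M) \<longlonglongrightarrow> (\<integral>x. 0 \<partial>M)"
  proof (rule integral_dominated_convergence[OF _ _ G])
    show "AE x in M. (\<lambda>n. G x - min (G x) (real n)) \<longlonglongrightarrow> 0"
    proof (rule AE_I2)
      fix x
      obtain n0 :: nat where "G x \<le> real n0" using real_arch_simple by blast
      hence "\<forall>\<^sub>F n in sequentially. G x - min (G x) (real n) = 0"
        by (intro eventually_sequentiallyI[of n0]) auto
      thus "(\<lambda>n. G x - min (G x) (real n)) \<longlonglongrightarrow> 0" by (rule tendsto_eventually)
    qed
    show "AE x in M. norm (G x - min (G x) (real n)) \<le> G x" for n using nn by (intro AE_I2) (auto simp: min_def)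
  qed auto
  hence "\<forall>\<^sub>F n in sequentially. (\<integral>x. G x - min (G x) (real n) \<partial>M) < e" using e by (intro order_tendstoD(2)) auto
  then obtain n :: nat where n: "(\<integral>x. G x - min (G x) (real n) \<partial>M) < e" by (auto dest: eventually_happens)
  have im: "integrable M (\<lambda>x. min (G x) (real n))"
    by (rule Bochner_Integration.integrable_bound[OF G]) (use nn in auto)
  show ?thesis
  proof (intro exI[of _ "real n"] conjI ballI impI)
    fix S assume S: "S \<in> sets M" "emeasure M S < \<infinity>"
    have "(\<integral>x. indicator S x * G x \<partial>M) \<le> (\<integral>x. (G x - min (G x) (real n)) + real n * indicator S x \<partial>M)"
    proof (rule integral_mono)
      show "integrable M (\<lambda>x. indicator S x * G x)" using integrable_mult_indicator[OF S(1) G] by simp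
      show "integrable M (\<lambda>x. (G x - min (G x) (real n)) + real n * indicator S x)"
        using S G im by (intro Bochner_Integration.integrable_add Bochner_Integration.integrable_diff integrable_mult_right integrable_real_indicator) auto
      show "indicator S x * G x \<le> (G x - min (G x) (real n)) + real n * indicator S x" for x
        using nn[of x] by (auto split: split_indicator)
    qed
    also have "\<dots> = (\<integral>x. G x - min (G x) (real n) \<partial>M) + real n * measure M S"
      using S G im by (subst Bochner_Integration.integral_add) (auto intro!: integrable_real_indicator)
    also have "\<dots> \<le> e + real n * measure M S" using n by simp
    finally show "(\<integral>x. indicator S x * G x \<partial>M) \<le> e + real n * measure M S" .
  qed simp
qed


text \<open>The powers of \<open>h m\<close> cancel: \<open>\<sigma> powr \<alpha>\<close> times the sum of \<open>u (a m (e j))\<close> is the integral of \<open>u (Fm m x)\<close>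
  for both power functions \<open>u\<close>, because a cell has volume \<open>h m ^ d\<close>.  The coefficients are
  uniformly small because \<open>(\<sigma> * \<bar>a m k\<bar>) powr \<alpha>\<close> is the integral of \<open>\<bar>Fm m x\<bar> powr \<alpha>\<close> over one
  cell, and the volume of a cell tends to \<open>0\<close>.\<close>

lemma lattice_limit:
  fixes e :: "nat \<Rightarrow> int ^ 'n" and a :: "nat \<Rightarrow> int ^ 'n \<Rightarrow> real" and F :: "real ^ 'n \<Rightarrow> real"
  assumes e: "bij e" and h: "\<And>m. h m > 0" and h0: "h \<longlonglongrightarrow> 0" and \<alpha>: "\<alpha> > 0" and \<sigma>: "\<sigma> > 0"
    and F: "F \<in> L_space \<alpha>"
    and Fm: "\<And>m x. Fm m x = \<sigma> * h m powr (- real CARD('n) / \<alpha>) * a m (lattice_point (h m) x)"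
    and D: "\<And>m. integrable lborel (\<lambda>x. \<bar>Fm m x - F x\<bar> powr \<alpha>)"
    and lim: "(\<lambda>m. \<integral>x. \<bar>Fm m x - F x\<bar> powr \<alpha> \<partial>lborel) \<longlonglongrightarrow> 0"
  shows "summable (\<lambda>j. \<bar>a m (e j)\<bar> powr \<alpha>)"
    and "(\<lambda>m. \<sigma> powr \<alpha> * (\<Sum>j. \<bar>a m (e j)\<bar> powr \<alpha>)) \<longlonglongrightarrow> (\<integral>x. \<bar>F x\<bar> powr \<alpha> \<partial>lborel)"
    and "(\<lambda>m. \<sigma> powr \<alpha> * (\<Sum>j. spow \<alpha> (a m (e j)))) \<longlonglongrightarrow> (\<integral>x. spow \<alpha> (F x) \<partial>lborel)"
    and "\<delta> > 0 \<Longrightarrow> \<forall>\<^sub>F m in sequentially. \<forall>k. \<bar>a m k\<bar> < \<delta>"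
proof -
  note [measurable] = measurable_lattice_point[OF h] sets_cell[OF h]
  have [measurable]: "F \<in> borel_measurable borel" and Fi: "integrable lborel (\<lambda>x. \<bar>F x\<bar> powr \<alpha>)"
    using F by (auto simp: L_space_def)
  have [measurable]: "Fm m \<in> borel_measurable borel" for m
    unfolding Fm[abs_def] by measurable
  define r where "r m = \<sigma> * h m powr (- real CARD('n) / \<alpha>)" for m
  have Fmr: "Fm m x = r m * a m (lattice_point (h m) x)" for m x by (simp add: Fm r_def)
  have r: "r m > 0" "r m powr \<alpha> * h m ^ CARD('n) = \<sigma> powr \<alpha>" for m
  proof -
    show "r m > 0" using \<sigma> h[of m] by (simp add: r_def)
    have "r m powr \<alpha> = \<sigma> powr \<alpha> * (h m powr (- real CARD('n) / \<alpha>)) powr \<alpha>"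
      using \<sigma> by (simp add: r_def powr_mult)
    also have "(h m powr (- real CARD('n) / \<alpha>)) powr \<alpha> = h m powr (- real CARD('n))"
      by (subst powr_powr) (use \<alpha> in simp)
    also have "\<dots> = inverse (h m ^ CARD('n))" using h[of m] by (simp add: powr_minus powr_realpow)
    finally show "r m powr \<alpha> * h m ^ CARD('n) = \<sigma> powr \<alpha>" using h[of m] by simp
  qed
  have Fm_int: "integrable lborel (\<lambda>x. \<bar>Fm m x\<bar> powr \<alpha>)" for m
  proof (rule Bochner_Integration.integrable_bound)
    show "integrable lborel (\<lambda>x. 2 powr \<alpha> * (\<bar>Fm m x - F x\<bar> powr \<alpha> + \<bar>F x\<bar> powr \<alpha>))"
      by (intro integrable_mult_right Bochner_Integration.integrable_add D Fi)
    show "AE x in lborel. norm (\<bar>Fm m x\<bar> powr \<alpha>) \<le> norm (2 powr \<alpha> * (\<bar>Fm m x - F x\<bar> powr \<alpha> + \<bar>F x\<bar> powr \<alpha>))"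
      using powr_abs_add_le[OF \<alpha>, of "Fm m x - F x" "F x" for x] by (intro AE_I2) simp
  qed measurable
  show sum: "summable (\<lambda>j. \<bar>a m (e j)\<bar> powr \<alpha>)" for m
  proof (rule summable_suminf_not_top)
    have "(\<integral>\<^sup>+x. ennreal (\<bar>Fm m x\<bar> powr \<alpha>) \<partial>lborel) = (\<integral>\<^sup>+x. ennreal (r m powr \<alpha>) * ennreal (\<bar>a m (lattice_point (h m) x)\<bar> powr \<alpha>) \<partial>lborel)"
      using r(1)[of m] by (intro nn_integral_cong) (simp add: Fmr abs_mult powr_mult ennreal_mult)
    also have "\<dots> = ennreal (r m powr \<alpha>) * (\<integral>\<^sup>+x. ennreal (\<bar>a m (lattice_point (h m) x)\<bar> powr \<alpha>) \<partial>lborel)"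
      by (rule nn_integral_cmult) measurable
    also have "(\<integral>\<^sup>+x. ennreal (\<bar>a m (lattice_point (h m) x)\<bar> powr \<alpha>) \<partial>lborel) = ennreal (h m ^ CARD('n)) * (\<Sum>j. ennreal (\<bar>a m (e j)\<bar> powr \<alpha>))"
      by (rule nn_integral_lattice[OF e h, of "\<lambda>k. ennreal (\<bar>a m k\<bar> powr \<alpha>)"])
    finally have "ennreal (r m powr \<alpha>) * (ennreal (h m ^ CARD('n)) * (\<Sum>j. ennreal (\<bar>a m (e j)\<bar> powr \<alpha>))) \<noteq> top"
      using Fm_int[of m] by (auto simp: integrable_iff_bounded)
    thus "(\<Sum>j. ennreal (\<bar>a m (e j)\<bar> powr \<alpha>)) \<noteq> top"
      using r(1)[of m] h[of m] by (auto simp: ennreal_mult_eq_top_iff)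
  qed simp
  have key: "(\<integral>x. u (Fm m x) \<partial>lborel) = \<sigma> powr \<alpha> * (\<Sum>j. u (a m (e j)))"
    if mult: "\<And>x y. u (x * y) = u x * u y" and abs_u: "\<And>x. \<bar>u x\<bar> = \<bar>x\<bar> powr \<alpha>"
      and pos: "\<And>x. x \<ge> 0 \<Longrightarrow> u x = x powr \<alpha>" for u :: "real \<Rightarrow> real" and m
  proof -
    have "(\<integral>x. u (Fm m x) \<partial>lborel) = (\<integral>x. r m powr \<alpha> * u (a m (lattice_point (h m) x)) \<partial>lborel)"
      using r(1)[of m] by (simp add: Fmr mult pos)
    also have "\<dots> = r m powr \<alpha> * (\<integral>x. u (a m (lattice_point (h m) x)) \<partial>lborel)" by simp
    also have "(\<integral>x. u (a m (lattice_point (h m) x)) \<partial>lborel) = h m ^ CARD('n) * (\<Sum>j. u (a m (e j)))"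
      using integral_lattice(2)[OF e h, of "\<lambda>k. u (a m k)" m] sum[of m] by (simp add: abs_u)
    finally show ?thesis using r(2)[of m] by (simp flip: mult.assoc)
  qed
  have "(\<lambda>m. \<integral>x. \<bar>Fm m x\<bar> powr \<alpha> \<partial>lborel) \<longlonglongrightarrow> (\<integral>x. \<bar>F x\<bar> powr \<alpha> \<partial>lborel)"
    by (rule integral_multiplicative_tendsto[where \<alpha>=\<alpha>, OF _ _ _ _ \<alpha>  _ _ _ Fi D lim])
      (use \<alpha> in \<open>auto simp: abs_mult powr_mult intro!: continuous_intros\<close>)
  thus "(\<lambda>m. \<sigma> powr \<alpha> * (\<Sum>j. \<bar>a m (e j)\<bar> powr \<alpha>)) \<longlonglongrightarrow> (\<integral>x. \<bar>F x\<bar> powr \<alpha> \<partial>lborel)"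
    by (subst (asm) key) (auto simp: abs_mult powr_mult)
  have "continuous_on UNIV (spow \<alpha>)" using continuous_on_spow[OF \<alpha> continuous_on_id] by simp
  hence "isCont (spow \<alpha>) 1" by (simp add: continuous_on_eq_continuous_at)
  hence "(\<lambda>m. \<integral>x. spow \<alpha> (Fm m x) \<partial>lborel) \<longlonglongrightarrow> (\<integral>x. spow \<alpha> (F x) \<partial>lborel)"
    by (intro integral_multiplicative_tendsto[where \<alpha>=\<alpha>, OF _ _ _ _ \<alpha>  _ _ _ Fi D lim]) (auto simp: spow_mult)
  thus "(\<lambda>m. \<sigma> powr \<alpha> * (\<Sum>j. spow \<alpha> (a m (e j)))) \<longlonglongrightarrow> (\<integral>x. spow \<alpha> (F x) \<partial>lborel)"
    by (subst (asm) key) (auto simp: spow_mult spow_pos)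
  show "\<forall>\<^sub>F m in sequentially. \<forall>k. \<bar>a m k\<bar> < \<delta>" if \<delta>: "\<delta> > 0"
  proof -
    define \<epsilon> where "\<epsilon> = (\<sigma> * \<delta>) powr \<alpha> / (2 powr \<alpha> * 4)"
    have \<epsilon>: "\<epsilon> > 0" using \<sigma> \<delta> by (simp add: \<epsilon>_def)
    obtain B where B: "B \<ge> 0" "\<And>S. S \<in> sets lborel \<Longrightarrow> emeasure lborel S < \<infinity> \<Longrightarrow>
        (\<integral>x. indicator S x * \<bar>F x\<bar> powr \<alpha> \<partial>lborel) \<le> \<epsilon> + B * measure lborel S"
      using integral_small_sets[OF Fi _ \<epsilon>] by auto
    have "(\<lambda>m. B * h m ^ CARD('n)) \<longlonglongrightarrow> B * 0 ^ CARD('n)" by (intro tendsto_intros h0)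
    hence "(\<lambda>m. B * h m ^ CARD('n)) \<longlonglongrightarrow> 0" by (simp add: power_0_left)
    hence "\<forall>\<^sub>F m in sequentially. B * h m ^ CARD('n) < \<epsilon>" using \<epsilon> by (rule order_tendstoD(2))
    moreover have "\<forall>\<^sub>F m in sequentially. (\<integral>x. \<bar>Fm m x - F x\<bar> powr \<alpha> \<partial>lborel) < \<epsilon>"
      using lim \<epsilon> by (intro order_tendstoD(2)) auto
    ultimately show ?thesis
    proof eventually_elim
      case (elim m)
      show ?case
      proof
        fix k
        have ci: "integrable lborel (\<lambda>x. indicator (cell (h m) k) x * G x)" if "integrable lborel G" for G :: "real ^ 'n \<Rightarrow> real"
          using integrable_mult_indicator[OF _ that, of "cell (h m) k"] by simp
        have "(\<sigma> * \<bar>a m k\<bar>) powr \<alpha> = r m powr \<alpha> * h m ^ CARD('n) * \<bar>a m k\<bar> powr \<alpha>"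
          unfolding r(2) using \<sigma> by (simp add: powr_mult)
        also have "\<dots> = (\<integral>x. indicator (cell (h m) k) x * (r m powr \<alpha> * \<bar>a m k\<bar> powr \<alpha>) \<partial>lborel)"
        proof -
          have "integrable lborel (indicator (cell (h m) k) :: _ \<Rightarrow> real)"
            by (rule integrable_real_indicator) (auto simp: emeasure_cell[OF h])
          thus ?thesis by (simp add: measure_cell[OF h])
        qed
        also have "\<dots> = (\<integral>x. indicator (cell (h m) k) x * \<bar>Fm m x\<bar> powr \<alpha> \<partial>lborel)"
          using r(1)[of m] by (intro Bochner_Integration.integral_cong)
            (auto simp: mem_cell_lattice_point[OF h] Fmr abs_mult powr_mult split: split_indicator)
        also have "\<dots> \<le> (\<integral>x. 2 powr \<alpha> * (\<bar>Fm m x - F x\<bar> powr \<alpha> + indicator (cell (h m) k) x * \<bar>F x\<bar> powr \<alpha>) \<partial>lborel)"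
        proof (rule integral_mono)
          show "integrable lborel (\<lambda>x. indicator (cell (h m) k) x * \<bar>Fm m x\<bar> powr \<alpha>)" by (intro ci Fm_int)
          show "integrable lborel (\<lambda>x. 2 powr \<alpha> * (\<bar>Fm m x - F x\<bar> powr \<alpha> + indicator (cell (h m) k) x * \<bar>F x\<bar> powr \<alpha>))"
            by (intro integrable_mult_right Bochner_Integration.integrable_add D ci Fi)
          show "indicator (cell (h m) k) x * \<bar>Fm m x\<bar> powr \<alpha> \<le> 2 powr \<alpha> * (\<bar>Fm m x - F x\<bar> powr \<alpha> + indicator (cell (h m) k) x * \<bar>F x\<bar> powr \<alpha>)" for x
            using powr_abs_add_le[OF \<alpha>, of "Fm m x - F x" "F x"] by (auto split: split_indicator)
        qed
        also have "\<dots> = 2 powr \<alpha> * ((\<integral>x. \<bar>Fm m x - F x\<bar> powr \<alpha> \<partial>lborel) + (\<integral>x. indicator (cell (h m) k) x * \<bar>F x\<bar> powr \<alpha> \<partial>lborel))"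
          using D ci[OF Fi] by simp
        also have "\<dots> \<le> 2 powr \<alpha> * (\<epsilon> + (\<epsilon> + B * h m ^ CARD('n)))"
          using elim B(2)[of "cell (h m) k"] by (intro mult_left_mono add_mono) (auto simp: emeasure_cell[OF h] measure_cell[OF h])
        also have "\<dots> < 2 powr \<alpha> * (4 * \<epsilon>)" using elim \<epsilon> by (intro mult_strict_left_mono) auto
        also have "\<dots> = (\<sigma> * \<delta>) powr \<alpha>" by (simp add: \<epsilon>_def)
        finally have lt: "(\<sigma> * \<bar>a m k\<bar>) powr \<alpha> < (\<sigma> * \<delta>) powr \<alpha>" .
        show "\<bar>a m k\<bar> < \<delta>"
        proof (rule ccontr)
          assume "\<not> \<bar>a m k\<bar> < \<delta>"
          hence "(\<sigma> * \<delta>) powr \<alpha> \<le> (\<sigma> * \<bar>a m k\<bar>) powr \<alpha>" using \<sigma> \<delta> \<alpha> by (intro powr_mono2 mult_left_mono) auto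
          thus False using lt by linarith
        qed
      qed
    qed
  qed
qed

text \<open>Expresses the exponent of \<open>W F\<close> through two integrals.  When the scale vanishes both sides are
  \<open>0\<close>, whatever value the quotient in the skewness takes.\<close>

lemma stable_exponent_noise:
  assumes F: "F \<in> L_space \<alpha>" and \<alpha>: "\<alpha> > 0"
  shows "stable_exponent \<alpha> (noise_scale \<alpha> F) (noise_skew \<alpha> \<nu> F) \<theta> =
    Complex (\<bar>\<theta>\<bar> powr \<alpha> * (\<integral>x. \<bar>F x\<bar> powr \<alpha> \<partial>lborel))
      (- (\<nu> * tan (pi * \<alpha> / 2) * spow \<alpha> \<theta> * (\<integral>x. spow \<alpha> (F x) \<partial>lborel)))"
proof -
  have [measurable]: "F \<in> borel_measurable borel" and Fi: "integrable lborel (\<lambda>x. \<bar>F x\<bar> powr \<alpha>)"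
    using F by (auto simp: L_space_def)
  define I J where "I = (\<integral>x. \<bar>F x\<bar> powr \<alpha> \<partial>lborel)" and "J = (\<integral>x. spow \<alpha> (F x) \<partial>lborel)"
  have I: "I \<ge> 0" by (simp add: I_def)
  have s: "noise_scale \<alpha> F powr \<alpha> = I"
    unfolding noise_scale_def I_def[symmetric] using \<alpha> I by (simp add: powr_powr)
  have J: "(\<integral>x. \<nu> * sgn (F x) * \<bar>F x\<bar> powr \<alpha> \<partial>lborel) = \<nu> * J"
    by (simp add: J_def spow_def mult.assoc)
  have "\<bar>J\<bar> \<le> (\<integral>x. \<bar>spow \<alpha> (F x)\<bar> \<partial>lborel)" unfolding J_def by (rule integral_abs_bound)
  hence "I * noise_skew \<alpha> \<nu> F = \<nu> * J"
    unfolding noise_skew_def J s by (cases "I = 0") (auto simp: I_def)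
  thus ?thesis
    unfolding stable_exponent_def s I_def[symmetric] J_def[symmetric]
    by (simp add: complex_eq_iff algebra_simps)
qed

section \<open>Jensen and Young inequalities, continuity of translations\<close>

lemma ennreal_tendsto_0I:
  fixes f :: "'a \<Rightarrow> ennreal"
  assumes "\<And>r::real. 0 < r \<Longrightarrow> \<forall>\<^sub>F x in F. f x < ennreal r"
  shows "(f \<longlongrightarrow> 0) F"
proof (rule order_tendstoI)
  fix a :: ennreal assume "0 < a"
  then obtain r :: real where "0 < r" "ennreal r \<le> a"
    by (cases a) (auto intro: that[of 1])
  thus "\<forall>\<^sub>F x in F. f x < a" using assms[of r] by (auto elim!: eventually_mono intro: less_le_trans)
qed auto

lemma bernoulli_powr:
  fixes \<alpha> t :: real
  assumes \<alpha>: "\<alpha> > 1" and t: "t \<ge> 0"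
  shows "1 + \<alpha> * (t - 1) \<le> t powr \<alpha>"
proof -
  have "t * 1 \<le> t powr \<alpha> / \<alpha> + 1 powr (\<alpha> / (\<alpha> - 1)) / (\<alpha> / (\<alpha> - 1))"
    using \<alpha> t by (intro Youngs_inequality) (auto simp: field_simps)
  hence "t * \<alpha> \<le> (t powr \<alpha> / \<alpha> + (\<alpha> - 1) / \<alpha>) * \<alpha>" using \<alpha> by (intro mult_right_mono) auto
  also have "\<dots> = t powr \<alpha> + (\<alpha> - 1)" using \<alpha> by (simp add: distrib_right)
  finally show ?thesis by (simp add: algebra_simps)
qed

text \<open>Jensen's inequality for the measure with density \<open>\<bar>w\<bar>\<close>, normalised by its total mass.  It follows by
  integrating the tangent inequality of \<open>t powr \<alpha>\<close> at the weighted mean \<open>s\<close> of \<open>\<bar>g\<bar>\<close>.\<close>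

lemma weighted_jensen:
  fixes w g :: "'a \<Rightarrow> real"
  assumes \<alpha>: "\<alpha> > 1" and w: "integrable M w" and [measurable]: "g \<in> borel_measurable M"
    and wg: "integrable M (\<lambda>x. \<bar>w x\<bar> * \<bar>g x\<bar> powr \<alpha>)"
  shows "integrable M (\<lambda>x. w x * g x)"
    and "\<bar>\<integral>x. w x * g x \<partial>M\<bar> powr \<alpha> \<le> (\<integral>x. \<bar>w x\<bar> \<partial>M) powr (\<alpha> - 1) * (\<integral>x. \<bar>w x\<bar> * \<bar>g x\<bar> powr \<alpha> \<partial>M)"
proof -
  have [measurable]: "w \<in> borel_measurable M" using w by simp
  have wa: "integrable M (\<lambda>x. \<bar>w x\<bar>)" using w by simp
  have le: "\<bar>t\<bar> \<le> 1 + \<bar>t\<bar> powr \<alpha>" for t :: real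
  proof (cases "\<bar>t\<bar> \<le> 1")
    case False
    hence "\<bar>t\<bar> powr 1 \<le> \<bar>t\<bar> powr \<alpha>" using \<alpha> by (intro powr_mono) auto
    thus ?thesis using False by simp
  qed (simp add: add_increasing2)
  show int: "integrable M (\<lambda>x. w x * g x)"
  proof (rule Bochner_Integration.integrable_bound)
    show "integrable M (\<lambda>x. \<bar>w x\<bar> + \<bar>w x\<bar> * \<bar>g x\<bar> powr \<alpha>)" using wa wg by simp
    show "AE x in M. norm (w x * g x) \<le> norm (\<bar>w x\<bar> + \<bar>w x\<bar> * \<bar>g x\<bar> powr \<alpha>)"
      using mult_left_mono[OF le, of "\<bar>w x\<bar>" "g x" for x] by (intro AE_I2) (simp add: abs_mult distrib_left)
  qed measurable
  define W where "W = (\<integral>x. \<bar>w x\<bar> \<partial>M)"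
  define S where "S = (\<integral>x. \<bar>w x * g x\<bar> \<partial>M)"
  define I where "I = (\<integral>x. \<bar>w x\<bar> * \<bar>g x\<bar> powr \<alpha> \<partial>M)"
  have nn: "W \<ge> 0" "S \<ge> 0" "I \<ge> 0" by (auto simp: W_def S_def I_def)
  have abs_le: "\<bar>\<integral>x. w x * g x \<partial>M\<bar> \<le> S" unfolding S_def by (rule integral_abs_bound)
  have "S powr \<alpha> \<le> W powr (\<alpha> - 1) * I"
  proof (cases "S = 0")
    case False
    hence S: "S > 0" using nn by simp
    have W: "W > 0"
    proof (rule ccontr)
      assume "\<not> W > 0"
      hence "W = 0" using nn by simp
      hence "AE x in M. \<bar>w x\<bar> = 0" using integral_nonneg_eq_0_iff_AE[OF wa] by (simp add: W_def)
      hence "AE x in M. \<bar>w x * g x\<bar> = 0" by eventually_elim simp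
      hence "S = 0" unfolding S_def by (subst integral_eq_zero_AE) auto
      thus False using S by simp
    qed
    define s where "s = S / W"
    have s: "s > 0" using S W by (simp add: s_def)
    have sW: "s * W = S" using W by (simp add: s_def)
    have "s powr \<alpha> * (W + \<alpha> * (S / s - W)) = (\<integral>x. s powr \<alpha> * (\<bar>w x\<bar> + \<alpha> * (\<bar>w x * g x\<bar> / s - \<bar>w x\<bar>)) \<partial>M)"
      using wa int by (simp add: W_def S_def)
    also have "\<dots> \<le> I"
      unfolding I_def
    proof (rule integral_mono)
      fix x
      have "1 + \<alpha> * (\<bar>g x\<bar> / s - 1) \<le> (\<bar>g x\<bar> / s) powr \<alpha>" using s by (intro bernoulli_powr \<alpha>) auto
      hence "s powr \<alpha> * \<bar>w x\<bar> * (1 + \<alpha> * (\<bar>g x\<bar> / s - 1)) \<le> s powr \<alpha> * \<bar>w x\<bar> * (\<bar>g x\<bar> / s) powr \<alpha>"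
        by (intro mult_left_mono) auto
      also have "\<dots> = \<bar>w x\<bar> * \<bar>g x\<bar> powr \<alpha>" using s by (simp add: powr_divide)
      finally show "s powr \<alpha> * (\<bar>w x\<bar> + \<alpha> * (\<bar>w x * g x\<bar> / s - \<bar>w x\<bar>)) \<le> \<bar>w x\<bar> * \<bar>g x\<bar> powr \<alpha>"
        by (simp add: abs_mult algebra_simps)
    qed (use wa int wg in auto)
    also have "S / s = W" using s sW by (simp add: field_simps)
    finally have "s powr \<alpha> * W \<le> I" by simp
    hence "W powr (\<alpha> - 1) * (s powr \<alpha> * W) \<le> W powr (\<alpha> - 1) * I" by (intro mult_left_mono) auto
    moreover have "W powr (\<alpha> - 1) * (s powr \<alpha> * W) = S powr \<alpha>"
      using W s by (simp add: powr_mult powr_diff flip: sW)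
    ultimately show ?thesis by simp
  qed (use nn in simp)
  moreover have "\<bar>\<integral>x. w x * g x \<partial>M\<bar> powr \<alpha> \<le> S powr \<alpha>" using abs_le \<alpha> by (intro powr_mono2) auto
  ultimately show "\<bar>\<integral>x. w x * g x \<partial>M\<bar> powr \<alpha> \<le> (\<integral>x. \<bar>w x\<bar> \<partial>M) powr (\<alpha> - 1) * (\<integral>x. \<bar>w x\<bar> * \<bar>g x\<bar> powr \<alpha> \<partial>M)"
    unfolding W_def I_def by linarith
qed

text \<open>Common form of the Young-type estimates below: Jensen's inequality in \<open>y\<close> for each \<open>x\<close>, then integration over
  \<open>x\<close>.  It is applied to Lebesgue measure as well as to counting measure.\<close>

lemma kernel_bound:
  fixes w g :: "'a \<times> 'b \<Rightarrow> real"
  assumes \<alpha>: "\<alpha> > 1" and M1: "sigma_finite_measure M1" and M2: "sigma_finite_measure M2"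
    and [measurable]: "w \<in> borel_measurable (M1 \<Otimes>\<^sub>M M2)" "g \<in> borel_measurable (M1 \<Otimes>\<^sub>M M2)"
    and N: "\<And>x. x \<in> space M1 \<Longrightarrow> (\<integral>\<^sup>+y. ennreal \<bar>w (x, y)\<bar> \<partial>M2) \<le> ennreal N" and N0: "N \<ge> 0"
    and fin: "(\<integral>\<^sup>+x. (\<integral>\<^sup>+y. ennreal (\<bar>w (x, y)\<bar> * \<bar>g (x, y)\<bar> powr \<alpha>) \<partial>M2) \<partial>M1) < \<infinity>"
  shows "AE x in M1. integrable M2 (\<lambda>y. w (x, y) * g (x, y))"
    and "(\<integral>\<^sup>+x. ennreal (\<bar>\<integral>y. w (x, y) * g (x, y) \<partial>M2\<bar> powr \<alpha>) \<partial>M1)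
      \<le> ennreal (N powr (\<alpha> - 1)) * (\<integral>\<^sup>+x. (\<integral>\<^sup>+y. ennreal (\<bar>w (x, y)\<bar> * \<bar>g (x, y)\<bar> powr \<alpha>) \<partial>M2) \<partial>M1)"
proof -
  interpret M2: sigma_finite_measure M2 by (rule M2)
  have "AE x in M1. (\<integral>\<^sup>+y. ennreal (\<bar>w (x, y)\<bar> * \<bar>g (x, y)\<bar> powr \<alpha>) \<partial>M2) \<noteq> \<infinity>"
    using fin by (intro nn_integral_PInf_AE) auto
  hence *: "AE x in M1. integrable M2 (\<lambda>y. w (x, y) * g (x, y)) \<and>
     ennreal (\<bar>\<integral>y. w (x, y) * g (x, y) \<partial>M2\<bar> powr \<alpha>) \<le> ennreal (N powr (\<alpha> - 1)) * (\<integral>\<^sup>+y. ennreal (\<bar>w (x, y)\<bar> * \<bar>g (x, y)\<bar> powr \<alpha>) \<partial>M2)"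
    using AE_space
  proof eventually_elim
    case (elim x)
    note x [measurable] = elim(2)
    have [measurable]: "(\<lambda>y. w (x, y)) \<in> borel_measurable M2" "(\<lambda>y. g (x, y)) \<in> borel_measurable M2" by measurable
    have w: "integrable M2 (\<lambda>y. w (x, y))"
      by (rule integrableI_bounded) (use N[OF x] in \<open>auto intro: le_less_trans\<close>)
    have wg: "integrable M2 (\<lambda>y. \<bar>w (x, y)\<bar> * \<bar>g (x, y)\<bar> powr \<alpha>)"
      by (rule integrableI_bounded) (use elim(1) in \<open>auto simp: abs_mult less_top\<close>)
    have "ennreal (\<integral>y. \<bar>w (x, y)\<bar> \<partial>M2) \<le> ennreal N"
      using N[OF x] w by (subst nn_integral_eq_integral[symmetric]) auto
    hence W: "(\<integral>y. \<bar>w (x, y)\<bar> \<partial>M2) \<le> N" using N0 by simp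
    have "ennreal (\<bar>\<integral>y. w (x, y) * g (x, y) \<partial>M2\<bar> powr \<alpha>)
        \<le> ennreal ((\<integral>y. \<bar>w (x, y)\<bar> \<partial>M2) powr (\<alpha> - 1) * (\<integral>y. \<bar>w (x, y)\<bar> * \<bar>g (x, y)\<bar> powr \<alpha> \<partial>M2))"
      by (intro ennreal_leI weighted_jensen(2)[OF \<alpha> w _ wg]) measurable
    also have "\<dots> \<le> ennreal (N powr (\<alpha> - 1) * (\<integral>y. \<bar>w (x, y)\<bar> * \<bar>g (x, y)\<bar> powr \<alpha> \<partial>M2))"
      using W \<alpha> by (intro ennreal_leI mult_right_mono powr_mono2) auto
    also have "\<dots> = ennreal (N powr (\<alpha> - 1)) * (\<integral>\<^sup>+y. ennreal (\<bar>w (x, y)\<bar> * \<bar>g (x, y)\<bar> powr \<alpha>) \<partial>M2)"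
      using wg by (subst nn_integral_eq_integral) (auto simp: ennreal_mult)
    finally show ?case using weighted_jensen(1)[OF \<alpha> w _ wg] by simp
  qed
  thus "AE x in M1. integrable M2 (\<lambda>y. w (x, y) * g (x, y))" by eventually_elim simp
  have "(\<integral>\<^sup>+x. ennreal (\<bar>\<integral>y. w (x, y) * g (x, y) \<partial>M2\<bar> powr \<alpha>) \<partial>M1)
      \<le> (\<integral>\<^sup>+x. ennreal (N powr (\<alpha> - 1)) * (\<integral>\<^sup>+y. ennreal (\<bar>w (x, y)\<bar> * \<bar>g (x, y)\<bar> powr \<alpha>) \<partial>M2) \<partial>M1)"
    by (rule nn_integral_mono_AE) (use * in eventually_elim, simp)
  also have "\<dots> = ennreal (N powr (\<alpha> - 1)) * (\<integral>\<^sup>+x. (\<integral>\<^sup>+y. ennreal (\<bar>w (x, y)\<bar> * \<bar>g (x, y)\<bar> powr \<alpha>) \<partial>M2) \<partial>M1)"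
    by (rule nn_integral_cmult) measurable
  finally show "(\<integral>\<^sup>+x. ennreal (\<bar>\<integral>y. w (x, y) * g (x, y) \<partial>M2\<bar> powr \<alpha>) \<partial>M1)
      \<le> ennreal (N powr (\<alpha> - 1)) * (\<integral>\<^sup>+x. (\<integral>\<^sup>+y. ennreal (\<bar>w (x, y)\<bar> * \<bar>g (x, y)\<bar> powr \<alpha>) \<partial>M2) \<partial>M1)" .
qed

lemma nn_integral_lborel_shift:
  fixes z :: "'a::euclidean_space"
  assumes [measurable]: "g \<in> borel_measurable borel"
  shows "(\<integral>\<^sup>+x. g (x + z) \<partial>lborel) = (\<integral>\<^sup>+x. g x \<partial>lborel)"
proof -
  have "(\<integral>\<^sup>+x. g x \<partial>lborel) = (\<integral>\<^sup>+x. g x \<partial>distr lborel borel ((+) z))"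
    by (simp add: lborel_distr_plus)
  also have "\<dots> = (\<integral>\<^sup>+x. g (x + z) \<partial>lborel)"
    by (subst nn_integral_distr) (auto simp: add.commute)
  finally show ?thesis ..
qed

lemma nn_integral_lborel_affine:
  fixes t :: "'a::euclidean_space"
  assumes [measurable]: "g \<in> borel_measurable borel" and h: "h > 0"
  shows "(\<integral>\<^sup>+y. g y \<partial>lborel) = ennreal (h ^ DIM('a)) * (\<integral>\<^sup>+u. g (t + h *\<^sub>R u) \<partial>lborel)"
proof -
  have "(\<integral>\<^sup>+y. g y \<partial>lborel) = (\<integral>\<^sup>+y. g y \<partial>density (distr lborel borel (\<lambda>x. t + h *\<^sub>R x)) (\<lambda>_. \<bar>h\<bar>^DIM('a)))"
    using lborel_affine[of h t] h by simp
  also have "\<dots> = (\<integral>\<^sup>+u. ennreal (\<bar>h\<bar>^DIM('a)) * g (t + h *\<^sub>R u) \<partial>lborel)"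
    by (subst nn_integral_density) (auto simp: nn_integral_distr)
  also have "\<dots> = ennreal (h ^ DIM('a)) * (\<integral>\<^sup>+u. g (t + h *\<^sub>R u) \<partial>lborel)"
    using h by (subst nn_integral_cmult) auto
  finally show ?thesis .
qed

text \<open>For \<open>x \<in> U\<close> the translates eventually stay in \<open>U\<close>, so the part of \<open>U\<close> that is moved out vanishes by dominated
  convergence.  The part moved in has the same measure, since translations preserve the measure
  of \<open>U\<close>.\<close>

lemma translation_continuous_open:
  fixes U :: "'a::euclidean_space set" and z :: "nat \<Rightarrow> 'a"
  assumes U: "open U" and fin: "emeasure lborel U < \<infinity>" and z: "z \<longlonglongrightarrow> 0"
  shows "(\<lambda>m. \<integral>\<^sup>+x. ennreal \<bar>indicat_real U (x + z m) - indicat_real U x\<bar> \<partial>lborel) \<longlonglongrightarrow> 0"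
proof -
  have [measurable]: "U \<in> sets borel" using U by simp
  define P where "P m = (\<integral>\<^sup>+x. indicator U x * indicator (- U) (x + z m) \<partial>lborel :: ennreal)" for m
  define Q where "Q m = (\<integral>\<^sup>+x. indicator U (x + z m) * indicator (- U) x \<partial>lborel :: ennreal)" for m
  define R where "R m = (\<integral>\<^sup>+x. indicator U x * indicator U (x + z m) \<partial>lborel :: ennreal)" for m
  have "P \<longlonglongrightarrow> nn_integral (lborel :: 'a measure) (\<lambda>_. 0)"
    unfolding P_def
  proof (rule nn_integral_dominated_convergence[where w="indicator U"])
    show "AE x in lborel. (\<lambda>m. indicator U x * indicator (- U) (x + z m) :: ennreal) \<longlonglongrightarrow> 0"
    proof (rule AE_I2)
      fix x
      show "(\<lambda>m. indicator U x * indicator (- U) (x + z m) :: ennreal) \<longlonglongrightarrow> 0"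
      proof (cases "x \<in> U")
        case True
        have "(\<lambda>m. x + z m) \<longlonglongrightarrow> x + 0" by (intro tendsto_intros z)
        hence "\<forall>\<^sub>F m in sequentially. x + z m \<in> U" using U True by (intro topological_tendstoD) auto
        hence "\<forall>\<^sub>F m in sequentially. indicator U x * indicator (- U) (x + z m) = (0::ennreal)"
          by eventually_elim simp
        thus ?thesis by (rule tendsto_eventually)
      qed simp
    qed
  qed (use fin in \<open>auto split: split_indicator\<close>)
  hence P0: "P \<longlonglongrightarrow> 0" by simp
  have PR: "P m + R m = emeasure lborel U" for m
  proof -
    have "P m + R m = (\<integral>\<^sup>+x. indicator U x * indicator (- U) (x + z m) + indicator U x * indicator U (x + z m) \<partial>lborel)"
      unfolding P_def R_def by (rule nn_integral_add[symmetric]) measurable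
    also have "\<dots> = (\<integral>\<^sup>+x. indicator U x \<partial>lborel)" by (intro nn_integral_cong) (auto split: split_indicator)
    finally show ?thesis by simp
  qed
  have QR: "Q m + R m = emeasure lborel U" for m
  proof -
    have "Q m + R m = (\<integral>\<^sup>+x. indicator U (x + z m) * indicator (- U) x + indicator U x * indicator U (x + z m) \<partial>lborel)"
      unfolding Q_def R_def by (rule nn_integral_add[symmetric]) measurable
    also have "\<dots> = (\<integral>\<^sup>+x. indicator U (x + z m) \<partial>lborel)" by (intro nn_integral_cong) (auto split: split_indicator)
    also have "\<dots> = (\<integral>\<^sup>+x. indicator U x \<partial>lborel)" by (rule nn_integral_lborel_shift) measurable
    finally show ?thesis by simp
  qed
  have PQ: "P m = Q m" for m
  proof -
    have "R m \<noteq> top" using PR[of m] fin by (auto simp: top_unique)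
    moreover have "R m + P m = R m + Q m" using PR[of m] QR[of m] by (simp add: add.commute)
    ultimately show ?thesis by (simp add: ennreal_add_left_cancel)
  qed
  have "(\<integral>\<^sup>+x. ennreal \<bar>indicat_real U (x + z m) - indicat_real U x\<bar> \<partial>lborel) = P m + Q m" for m
    unfolding P_def Q_def
    by (subst nn_integral_add[symmetric]) (auto intro!: nn_integral_cong split: split_indicator)
  thus ?thesis using tendsto_add[OF P0 P0] PQ by simp
qed

text \<open>The functions with this property form a closed subspace of \<open>L\<^sup>1\<close>.  Indicators of measurable sets
  belong to it by outer regularity and the case of open sets.\<close>

lemma translation_continuous_L1:
  fixes f :: "'a::euclidean_space \<Rightarrow> real" and z :: "nat \<Rightarrow> 'a"
  assumes f: "integrable lborel f" and z: "z \<longlonglongrightarrow> 0"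
  shows "(\<lambda>m. \<integral>\<^sup>+x. ennreal \<bar>f (x + z m) - f x\<bar> \<partial>lborel) \<longlonglongrightarrow> 0"
proof -
  let ?osc = "\<lambda>g m. \<integral>\<^sup>+x. ennreal \<bar>g (x + z m) - g x\<bar> \<partial>lborel"
  let ?dist = "\<lambda>g f. \<integral>\<^sup>+x. ennreal \<bar>g x - f x\<bar> \<partial>lborel"
  have approx: "?osc f m
     \<le> ?osc g m + 2 * ?dist g f"
    if [measurable]: "f \<in> borel_measurable borel" "g \<in> borel_measurable borel" for f g :: "'a \<Rightarrow> real" and m
  proof -
    have "?osc f m
      \<le> (\<integral>\<^sup>+x. ennreal \<bar>g (x + z m) - g x\<bar> + (ennreal \<bar>g (x + z m) - f (x + z m)\<bar> + ennreal \<bar>g x - f x\<bar>) \<partial>lborel)"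
      by (intro nn_integral_mono) (auto simp flip: ennreal_plus intro!: ennreal_leI)
    also have "\<dots> = ?osc g m
        + ((\<integral>\<^sup>+x. ennreal \<bar>g (x + z m) - f (x + z m)\<bar> \<partial>lborel) + ?dist g f)"
      by (simp add: nn_integral_add)
    also have "(\<integral>\<^sup>+x. ennreal \<bar>g (x + z m) - f (x + z m)\<bar> \<partial>lborel) = ?dist g f"
      by (rule nn_integral_lborel_shift) measurable
    finally show ?thesis by (simp add: mult_2)
  qed
  have from_approx: "(\<lambda>m. ?osc f m) \<longlonglongrightarrow> 0"
    if mf: "f \<in> borel_measurable borel"
      and ex: "\<And>r::real. r > 0 \<Longrightarrow> \<exists>g. g \<in> borel_measurable borel \<and> ?dist g f \<le> ennreal r \<and>
        (\<lambda>m. ?osc g m) \<longlonglongrightarrow> 0" for f :: "'a \<Rightarrow> real"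
  proof (rule ennreal_tendsto_0I)
    fix r :: real assume r: "0 < r"
    then obtain g where mg: "g \<in> borel_measurable borel" and g: "?dist g f \<le> ennreal (r / 4)"
      and lim: "(\<lambda>m. ?osc g m) \<longlonglongrightarrow> 0"
      using ex[of "r / 4"] by auto
    have "\<forall>\<^sub>F m in sequentially. ?osc g m < ennreal (r / 2)"
      using lim r by (intro order_tendstoD(2)) auto
    thus "\<forall>\<^sub>F m in sequentially. ?osc f m < ennreal r"
    proof eventually_elim
      case (elim m)
      have "?osc f m \<le> ?osc g m + 2 * ennreal (r / 4)"
        using approx[OF mf mg, of m] g by (meson add_left_mono mult_left_mono order.trans zero_le)
      also have "2 * ennreal (r / 4) = ennreal (r / 2)"
      proof -
        have "2 * ennreal (r / 4) = ennreal 2 * ennreal (r / 4)" by simp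
        also have "\<dots> = ennreal (r / 2)" using r by (subst ennreal_mult[symmetric]) auto
        finally show ?thesis .
      qed
      also have "?osc g m + ennreal (r / 2) < ennreal (r / 2) + ennreal (r / 2)"
        using elim by (subst (1 2) add.commute) (simp add: ennreal_add_left_cancel_less)
      also have "\<dots> = ennreal r" using r by (simp flip: ennreal_plus)
      finally show ?case .
    qed
  qed
  show ?thesis
    using f
  proof (induction rule: integrable_induct)
    case (base A c)
    hence [measurable]: "A \<in> sets borel" by simp
    show ?case
    proof (rule from_approx)
      fix r :: real assume r: "r > 0"
      define s where "s = r / (\<bar>c\<bar> + 1)"
      have s: "s > 0" "\<bar>c\<bar> * s \<le> r" using r by (auto simp: s_def field_simps)
      obtain U where U: "open U" "A \<subseteq> U" "emeasure lborel (U - A) < ennreal s"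
        using outer_regular_lborel[of A s] s by auto
      have [measurable]: "U \<in> sets borel" using U by simp
      have "emeasure lborel U = emeasure lborel A + emeasure lborel (U - A)"
        using U(2) by (subst plus_emeasure) (auto simp: Un_absorb1)
      also have "\<dots> < \<infinity>" using base U(3) by (auto simp: ennreal_add_less_top less_top[symmetric])
      finally have Ufin: "emeasure lborel U < \<infinity>" .
      show "\<exists>g. g \<in> borel_measurable borel \<and> (\<integral>\<^sup>+x. ennreal \<bar>g x - indicator A x *\<^sub>R c\<bar> \<partial>lborel) \<le> ennreal r \<and>
        (\<lambda>m. ?osc g m) \<longlonglongrightarrow> 0"
      proof (intro exI[of _ "\<lambda>x. indicator U x *\<^sub>R c"] conjI)
        have "(\<integral>\<^sup>+x. ennreal \<bar>indicator U x *\<^sub>R c - indicator A x *\<^sub>R c\<bar> \<partial>lborel) = (\<integral>\<^sup>+x. ennreal \<bar>c\<bar> * indicator (U - A) x \<partial>lborel)"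
          using U(2) by (intro nn_integral_cong) (auto split: split_indicator)
        also have "\<dots> = ennreal \<bar>c\<bar> * emeasure lborel (U - A)" by (rule nn_integral_cmult_indicator) simp
        also have "\<dots> \<le> ennreal \<bar>c\<bar> * ennreal s" using U(3) by (intro mult_left_mono) auto
        also have "\<dots> \<le> ennreal r" using s by (simp add: ennreal_leI flip: ennreal_mult)
        finally show "(\<integral>\<^sup>+x. ennreal \<bar>indicator U x *\<^sub>R c - indicator A x *\<^sub>R c\<bar> \<partial>lborel) \<le> ennreal r" .
        have "(\<integral>\<^sup>+x. ennreal \<bar>indicator U (x + z m) *\<^sub>R c - indicator U x *\<^sub>R c\<bar> \<partial>lborel)
            = ennreal \<bar>c\<bar> * (\<integral>\<^sup>+x. ennreal \<bar>indicat_real U (x + z m) - indicat_real U x\<bar> \<partial>lborel)" for m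
        proof -
          have "\<bar>indicator U (x + z m) *\<^sub>R c - indicator U x *\<^sub>R c\<bar> = \<bar>c\<bar> * \<bar>indicat_real U (x + z m) - indicat_real U x\<bar>" for x
            by (auto split: split_indicator)
          thus ?thesis by (subst nn_integral_cmult[symmetric]) (auto simp: ennreal_mult)
        qed
        thus "(\<lambda>m. \<integral>\<^sup>+x. ennreal \<bar>indicator U (x + z m) *\<^sub>R c - indicator U x *\<^sub>R c\<bar> \<partial>lborel) \<longlonglongrightarrow> 0"
          using ennreal_tendsto_cmult[OF _ translation_continuous_open[OF U(1) Ufin z], of "ennreal \<bar>c\<bar>"] by simp
      qed measurable
    qed measurable
  next
    case (add f g)
    have [measurable]: "f \<in> borel_measurable borel" "g \<in> borel_measurable borel" using add by auto
    show ?case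
    proof (rule tendsto_sandwich[OF always_eventually always_eventually tendsto_const])
      show "\<forall>m. (\<integral>\<^sup>+x. ennreal \<bar>f (x + z m) + g (x + z m) - (f x + g x)\<bar> \<partial>lborel)
         \<le> ?osc f m + ?osc g m"
        by (subst nn_integral_add[symmetric]) (auto intro!: nn_integral_mono ennreal_leI simp flip: ennreal_plus)
      show "(\<lambda>m. ?osc f m + ?osc g m) \<longlonglongrightarrow> 0"
        using tendsto_add[OF add.IH] by simp
    qed auto
  next
    case (lim f s)
    have [measurable]: "f \<in> borel_measurable borel" "s i \<in> borel_measurable borel" for i using lim by auto
    have fi: "integrable lborel f" and s_lim: "(\<lambda>i. s i x) \<longlonglongrightarrow> f x" and s_le: "norm (s i x) \<le> 2 * norm (f x)"
      and IH: "(\<lambda>m. \<integral>\<^sup>+x. ennreal \<bar>s i (x + z m) - s i x\<bar> \<partial>lborel) \<longlonglongrightarrow> 0" for i x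
      using lim by auto
    have "(\<lambda>i. \<integral>\<^sup>+x. ennreal \<bar>s i x - f x\<bar> \<partial>lborel) \<longlonglongrightarrow> nn_integral (lborel :: 'a measure) (\<lambda>_. 0)"
    proof (rule nn_integral_dominated_convergence[where w="\<lambda>x. ennreal (3 * \<bar>f x\<bar>)"])
      show "AE x in lborel. ennreal \<bar>s i x - f x\<bar> \<le> ennreal (3 * \<bar>f x\<bar>)" for i
      proof (intro AE_I2 ennreal_leI)
        fix x show "\<bar>s i x - f x\<bar> \<le> 3 * \<bar>f x\<bar>" using s_le[of i x] by simp
      qed
      show "(\<integral>\<^sup>+x. ennreal (3 * \<bar>f x\<bar>) \<partial>lborel) < \<infinity>"
      proof -
        have "integrable lborel (\<lambda>x. 3 * \<bar>f x\<bar>)" using fi by simp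
        thus ?thesis by (subst nn_integral_eq_integral) auto
      qed
      show "AE x in lborel. (\<lambda>i. ennreal \<bar>s i x - f x\<bar>) \<longlonglongrightarrow> 0"
      proof (rule AE_I2)
        fix x
        have "(\<lambda>i. ennreal \<bar>s i x - f x\<bar>) \<longlonglongrightarrow> ennreal \<bar>f x - f x\<bar>"
          by (intro tendsto_ennrealI tendsto_intros s_lim)
        thus "(\<lambda>i. ennreal \<bar>s i x - f x\<bar>) \<longlonglongrightarrow> 0" by simp
      qed
    qed measurable
    hence D: "(\<lambda>i. \<integral>\<^sup>+x. ennreal \<bar>s i x - f x\<bar> \<partial>lborel) \<longlonglongrightarrow> 0" by simp
    show ?case
    proof (rule from_approx)
      fix r :: real assume "r > 0"
      hence "\<forall>\<^sub>F i in sequentially. (\<integral>\<^sup>+x. ennreal \<bar>s i x - f x\<bar> \<partial>lborel) < ennreal r"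
        using D by (intro order_tendstoD(2)) auto
      then obtain i where "(\<integral>\<^sup>+x. ennreal \<bar>s i x - f x\<bar> \<partial>lborel) < ennreal r" by (auto dest: eventually_happens)
      thus "\<exists>g. g \<in> borel_measurable borel \<and> ?dist g f \<le> ennreal r \<and>
        (\<lambda>m. ?osc g m) \<longlonglongrightarrow> 0"
        using IH[of i] by (intro exI[of _ "s i"]) auto
    qed measurable
  qed
qed

text \<open>Transfers \<open>L\<^sup>1\<close> estimates to \<open>L\<^sup>\<alpha>\<close>.  For equal signs this is superadditivity of \<open>t powr \<alpha>\<close>, for opposite
  signs it is the crude bound on the power of a sum.\<close>

lemma diff_powr_le_spow_diff:
  fixes a b \<alpha> :: real
  assumes \<alpha>: "\<alpha> > 1"
  shows "\<bar>a - b\<bar> powr \<alpha> \<le> 2 powr \<alpha> * \<bar>spow \<alpha> a - spow \<alpha> b\<bar>"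
proof -
  have super: "(p - q) powr \<alpha> \<le> p powr \<alpha> - q powr \<alpha>" if "0 \<le> q" "q \<le> p" for p q :: real
  proof (cases "p = 0")
    case False
    hence p: "p > 0" using that by simp
    have *: "t powr \<alpha> \<le> t" if "0 \<le> t" "t \<le> 1" for t :: real
    proof (cases "t = 0")
      case False
      thus ?thesis using powr_mono'[of 1 \<alpha> t] \<alpha> that by simp
    qed simp
    have "((p - q) / p) powr \<alpha> + (q / p) powr \<alpha> \<le> (p - q) / p + q / p"
      using that p by (intro add_mono *) auto
    also have "\<dots> = 1" using p by (simp add: field_simps)
    finally have "p powr \<alpha> * (((p - q) / p) powr \<alpha> + (q / p) powr \<alpha>) \<le> p powr \<alpha> * 1"
      by (intro mult_left_mono) auto
    thus ?thesis using p that by (simp add: powr_divide distrib_left)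
  qed (use that in simp)
  have one: "x \<le> 2 powr \<alpha> * y" if "x \<le> y" "0 \<le> y" for x y :: real
  proof -
    have "1 \<le> 2 powr \<alpha>" using \<alpha> by (simp add: ge_one_powr_ge_zero)
    hence "1 * y \<le> 2 powr \<alpha> * y" using that by (intro mult_right_mono) auto
    thus ?thesis using that by simp
  qed
  have same: "\<bar>a - b\<bar> powr \<alpha> \<le> 2 powr \<alpha> * \<bar>spow \<alpha> a - spow \<alpha> b\<bar>" if "0 \<le> b" "b \<le> a" for a b :: real
    using super[OF that] that by (intro one) (auto simp: spow_pos)
  have opp: "\<bar>a - b\<bar> powr \<alpha> \<le> 2 powr \<alpha> * \<bar>spow \<alpha> a - spow \<alpha> b\<bar>" if "b \<le> 0" "0 \<le> a" for a b :: real
  proof -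
    have "\<bar>a - b\<bar> powr \<alpha> \<le> 2 powr \<alpha> * (\<bar>a\<bar> powr \<alpha> + \<bar>- b\<bar> powr \<alpha>)"
      using powr_abs_add_le[of \<alpha> a "- b"] \<alpha> by simp
    also have "\<bar>a\<bar> powr \<alpha> + \<bar>- b\<bar> powr \<alpha> = \<bar>spow \<alpha> a - spow \<alpha> b\<bar>"
      using that by (auto simp: spow_def sgn_real_def)
    finally show ?thesis .
  qed
  have neg: "spow \<alpha> (- x) = - spow \<alpha> x" for x by (simp add: spow_def sgn_minus)
  consider "0 \<le> b" "b \<le> a" | "0 \<le> a" "a \<le> b" | "b \<le> 0" "0 \<le> a" | "a \<le> 0" "0 \<le> b" | "a \<le> b" "b \<le> 0" | "b \<le> a" "a \<le> 0"
    by linarith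
  thus ?thesis
  proof cases
    case 1 thus ?thesis by (rule same)
  next
    case 2 thus ?thesis using same[of a b] by (simp add: abs_minus_commute)
  next
    case 3 thus ?thesis by (rule opp)
  next
    case 4 thus ?thesis using opp[of a b] by (simp add: abs_minus_commute)
  next
    case 5 thus ?thesis using same[of "- b" "- a"] by (simp add: neg abs_minus_commute)
  next
    case 6 thus ?thesis using same[of "- a" "- b"] by (simp add: neg abs_minus_commute)
  qed
qed

lemma translation_continuous:
  fixes f :: "real ^ 'n \<Rightarrow> real"
  assumes \<alpha>: "\<alpha> > 1" and f: "f \<in> L_space \<alpha>" and z: "z \<longlonglongrightarrow> 0"
  shows "(\<lambda>m. \<integral>\<^sup>+x. ennreal (\<bar>f (x + z m) - f x\<bar> powr \<alpha>) \<partial>lborel) \<longlonglongrightarrow> 0"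
proof -
  have [measurable]: "f \<in> borel_measurable borel" and fi: "integrable lborel (\<lambda>x. \<bar>f x\<bar> powr \<alpha>)"
    using f by (auto simp: L_space_def)
  have "integrable lborel (\<lambda>x. spow \<alpha> (f x))"
    by (rule Bochner_Integration.integrable_bound[OF fi]) auto
  hence lim: "(\<lambda>m. \<integral>\<^sup>+x. ennreal \<bar>spow \<alpha> (f (x + z m)) - spow \<alpha> (f x)\<bar> \<partial>lborel) \<longlonglongrightarrow> 0"
    using z by (rule translation_continuous_L1)
  have lim0: "(\<lambda>m. ennreal (2 powr \<alpha>) * (\<integral>\<^sup>+x. ennreal \<bar>spow \<alpha> (f (x + z m)) - spow \<alpha> (f x)\<bar> \<partial>lborel)) \<longlonglongrightarrow> ennreal (2 powr \<alpha>) * 0"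
    by (rule ennreal_tendsto_cmult[OF _ lim]) simp
  have "(\<integral>\<^sup>+x. ennreal (\<bar>f (x + z m) - f x\<bar> powr \<alpha>) \<partial>lborel)
     \<le> ennreal (2 powr \<alpha>) * (\<integral>\<^sup>+x. ennreal \<bar>spow \<alpha> (f (x + z m)) - spow \<alpha> (f x)\<bar> \<partial>lborel)" for m
  proof -
    have "(\<integral>\<^sup>+x. ennreal (\<bar>f (x + z m) - f x\<bar> powr \<alpha>) \<partial>lborel)
      \<le> (\<integral>\<^sup>+x. ennreal (2 powr \<alpha>) * ennreal \<bar>spow \<alpha> (f (x + z m)) - spow \<alpha> (f x)\<bar> \<partial>lborel)"
    proof (rule nn_integral_mono)
      fix x
      have "ennreal (\<bar>f (x + z m) - f x\<bar> powr \<alpha>) \<le> ennreal (2 powr \<alpha> * \<bar>spow \<alpha> (f (x + z m)) - spow \<alpha> (f x)\<bar>)"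
        by (rule ennreal_leI, rule diff_powr_le_spow_diff[OF \<alpha>])
      thus "ennreal (\<bar>f (x + z m) - f x\<bar> powr \<alpha>) \<le> ennreal (2 powr \<alpha>) * ennreal \<bar>spow \<alpha> (f (x + z m)) - spow \<alpha> (f x)\<bar>"
        by (simp only: ennreal_mult powr_ge_zero abs_ge_zero)
    qed
    also have "\<dots> = ennreal (2 powr \<alpha>) * (\<integral>\<^sup>+x. ennreal \<bar>spow \<alpha> (f (x + z m)) - spow \<alpha> (f x)\<bar> \<partial>lborel)"
      by (rule nn_integral_cmult) measurable
    finally show ?thesis .
  qed
  note upper = this
  show ?thesis
  proof (rule tendsto_sandwich[OF always_eventually always_eventually tendsto_const])
    show "(\<lambda>m. ennreal (2 powr \<alpha>) * (\<integral>\<^sup>+x. ennreal \<bar>spow \<alpha> (f (x + z m)) - spow \<alpha> (f x)\<bar> \<partial>lborel)) \<longlonglongrightarrow> 0"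
      using lim0 by simp
  qed (use upper in simp_all)
qed

section \<open>Summable coefficients: convergence of the smoothed test functions\<close>

text \<open>Up to normalisation, the coefficient of \<open>\<xi> l\<close> in the integral of \<open>f\<close> against the random signed
  measure.\<close>

definition lattice_conv :: "(int ^ 'n \<Rightarrow> real) \<Rightarrow> (real ^ 'n \<Rightarrow> real) \<Rightarrow> real \<Rightarrow> int ^ 'n \<Rightarrow> real" where
  "lattice_conv c f h l = (\<integral>y. c (lattice_point h y - l) * f y \<partial>lborel)"

lemma sums_rearrange:
  fixes g :: "'k \<Rightarrow> real"
  assumes e: "bij e" "bij e'" and g: "summable (\<lambda>j. \<bar>g (e j)\<bar>)"
  shows "summable (\<lambda>j::nat. \<bar>g (e' j)\<bar>)" and "(\<Sum>j. g (e' j)) = (\<Sum>j::nat. g (e j))"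
proof -
  have re: "((\<lambda>j. f (e' j)) sums (\<Sum>j. f (e j)))" if "summable (\<lambda>j. \<bar>f (e j)\<bar>)" for f :: "'k \<Rightarrow> real"
  proof -
    have "((\<lambda>j. f (e j)) has_sum (\<Sum>j. f (e j))) UNIV"
    proof (rule norm_summable_imp_has_sum)
      show "summable (\<lambda>j. norm (f (e j)))" using that by simp
      show "(\<lambda>j. f (e j)) sums (\<Sum>j. f (e j))" by (rule summable_sums, rule summable_rabs_cancel[OF that])
    qed
    hence "(f has_sum (\<Sum>j. f (e j))) UNIV"
      using has_sum_reindex_bij_betw[OF e(1), of f] by simp
    hence "((\<lambda>j. f (e' j)) has_sum (\<Sum>j. f (e j))) UNIV"
      using has_sum_reindex_bij_betw[OF e(2), of f] by simp
    thus ?thesis by (rule has_sum_imp_sums)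
  qed
  show "summable (\<lambda>j. \<bar>g (e' j)\<bar>)" using re[of "\<lambda>k. \<bar>g k\<bar>"] g by (auto simp: sums_iff)
  show "(\<Sum>j. g (e' j)) = (\<Sum>j. g (e j))" using re[OF g] by (simp add: sums_iff)
qed

lemma bij_shift_enum:
  fixes e :: "nat \<Rightarrow> int ^ 'n"
  assumes "bij e"
  shows "bij (\<lambda>j. e j - l)" and "bij (\<lambda>j. l - e j)"
proof -
  have "bij (\<lambda>k. k - l)" by (rule o_bij[of "\<lambda>k. k + l"]) (auto simp: fun_eq_iff)
  from bij_comp[OF assms this] show "bij (\<lambda>j. e j - l)" by (simp add: o_def)
  have "bij (\<lambda>k. l - k)" by (rule o_bij[of "\<lambda>k. l - k"]) (auto simp: fun_eq_iff)
  from bij_comp[OF assms this] show "bij (\<lambda>j. l - e j)" by (simp add: o_def)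
qed

lemma measurable_lattice_pair:
  fixes G :: "int ^ 'n \<Rightarrow> int ^ 'n \<Rightarrow> 'b :: topological_space"
  assumes h: "h > 0"
  shows "(\<lambda>p. G (lattice_point h (fst p)) (lattice_point h (snd p))) \<in> borel_measurable (lborel \<Otimes>\<^sub>M lborel)"
proof -
  note [measurable] = measurable_lattice_point[OF h]
  have m1: "(\<lambda>p. G k (lattice_point h (snd p))) \<in> borel_measurable (lborel \<Otimes>\<^sub>M lborel)" for k
    by (rule measurable_compose[of "\<lambda>p. lattice_point h (snd p)" _ "count_space UNIV"]) measurable
  have m2: "(\<lambda>p::((real^'n) \<times> (real^'n)). lattice_point h (fst p)) \<in> (lborel \<Otimes>\<^sub>M lborel) \<rightarrow>\<^sub>M count_space UNIV"
    by measurable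
  show ?thesis
    by (rule measurable_compose_countable'[where f="\<lambda>k p. G k (lattice_point h (snd p))", OF m1 m2 countable_UNIV_int_vec])
qed

lemma lattice_diff_close:
  assumes h: "h > 0"
  shows "\<bar>((1 / h) *\<^sub>R (y - x)) $ i - of_int ((lattice_point h y - lattice_point h x) $ i)\<bar> < 1"
proof -
  have "((1 / h) *\<^sub>R (y - x)) $ i - of_int ((lattice_point h y - lattice_point h x) $ i)
    = (y $ i / h - of_int \<lfloor>y $ i / h\<rfloor>) - (x $ i / h - of_int \<lfloor>x $ i / h\<rfloor>)"
    by (simp add: lattice_point_def vec_floor_def diff_divide_distrib)
  moreover have "0 \<le> t - of_int \<lfloor>t\<rfloor>" "t - of_int \<lfloor>t\<rfloor> < 1" for t :: real by linarith+
  ultimately show ?thesis by (smt (verit))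
qed

lemma integral_tendsto_0_of_nn_integral:
  fixes g :: "nat \<Rightarrow> 'a \<Rightarrow> real"
  assumes [measurable]: "\<And>m. g m \<in> borel_measurable M" and nn: "\<And>m x. g m x \<ge> 0"
    and fin: "\<And>m. (\<integral>\<^sup>+x. ennreal (g m x) \<partial>M) < \<infinity>"
    and lim: "(\<lambda>m. \<integral>\<^sup>+x. ennreal (g m x) \<partial>M) \<longlonglongrightarrow> 0"
  shows "integrable M (g m)" and "(\<lambda>m. \<integral>x. g m x \<partial>M) \<longlonglongrightarrow> 0"
proof -
  show "integrable M (g m)" for m
    by (rule integrableI_bounded) (use fin[of m] nn in auto)
  have "(\<lambda>m. enn2real (\<integral>\<^sup>+x. ennreal (g m x) \<partial>M)) \<longlonglongrightarrow> 0"
    using lim by (intro tendsto_enn2real) simp_all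
  moreover have "(\<integral>x. g m x \<partial>M) = enn2real (\<integral>\<^sup>+x. ennreal (g m x) \<partial>M)" for m
    by (rule integral_eq_nn_integral) (use nn in auto)
  ultimately show "(\<lambda>m. \<integral>x. g m x \<partial>M) \<longlonglongrightarrow> 0" by simp
qed

text \<open>An integrable majorant, at unit scale, of the lattice kernel \<open>c ([y] - [x])\<close> as a function of
  \<open>y - x\<close>: the integer vector \<open>[y] - [x]\<close> differs from \<open>y - x\<close> by less than \<open>1\<close> in each coordinate.\<close>

definition cell_kernel :: "(nat \<Rightarrow> int ^ 'n) \<Rightarrow> (int ^ 'n \<Rightarrow> real) \<Rightarrow> real ^ 'n \<Rightarrow> ennreal" where
  "cell_kernel e c u = (\<Sum>j. ennreal \<bar>c (e j)\<bar> * indicator {u. \<forall>i. \<bar>u $ i - real_of_int (e j $ i)\<bar> < 1} u)"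

lemma cell_kernel_measurable [measurable]: "cell_kernel e c \<in> borel_measurable borel"
  unfolding cell_kernel_def by measurable

lemma nn_integral_cell_kernel:
  fixes e :: "nat \<Rightarrow> int ^ 'n"
  assumes c: "summable (\<lambda>j. \<bar>c (e j)\<bar>)"
  shows "(\<integral>\<^sup>+u. cell_kernel e c u \<partial>lborel) < \<infinity>"
proof -
  have em: "emeasure lborel {u :: real ^ 'n. \<forall>i. \<bar>u $ i - of_int (k $ i)\<bar> < 1} \<le> ennreal (2 ^ CARD('n))" for k :: "int ^ 'n"
  proof -
    define a b :: "real ^ 'n" where "a = (\<chi> i. of_int (k $ i) - 1)" and "b = (\<chi> i. of_int (k $ i) + 1)"
    have "{u :: real ^ 'n. \<forall>i. \<bar>u $ i - of_int (k $ i)\<bar> < 1} \<subseteq> cbox a b"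
      by (auto simp: mem_box_cart a_def b_def abs_less_iff) (smt (verit))+
    hence "emeasure lborel {u :: real ^ 'n. \<forall>i. \<bar>u $ i - of_int (k $ i)\<bar> < 1} \<le> emeasure lborel (cbox a b)"
      by (intro emeasure_mono) auto
    also have "\<dots> = ennreal (measure lborel (cbox a b))"
      by (subst emeasure_eq_ennreal_measure) (simp_all add: emeasure_lborel_cbox_eq)
    also have "measure lborel (cbox a b) = 2 ^ CARD('n)"
    proof -
      have "cbox a b \<noteq> {}" by (simp add: interval_ne_empty_cart a_def b_def)
      thus ?thesis by (simp add: content_cbox_cart a_def b_def)
    qed
    finally show ?thesis .
  qed
  have "(\<integral>\<^sup>+u. cell_kernel e c u \<partial>lborel) = (\<Sum>j. \<integral>\<^sup>+u. ennreal \<bar>c (e j)\<bar> * indicator {u. \<forall>i. \<bar>u $ i - real_of_int (e j $ i)\<bar> < 1} u \<partial>lborel)"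
    unfolding cell_kernel_def by (rule nn_integral_suminf) measurable
  also have "\<dots> \<le> (\<Sum>j. ennreal (\<bar>c (e j)\<bar> * 2 ^ CARD('n)))"
  proof (intro suminf_le allI summableI)
    fix j
    have "(\<integral>\<^sup>+u. ennreal \<bar>c (e j)\<bar> * indicator {u. \<forall>i. \<bar>u $ i - real_of_int (e j $ i)\<bar> < 1} u \<partial>lborel)
       = ennreal \<bar>c (e j)\<bar> * emeasure lborel {u :: real ^ 'n. \<forall>i. \<bar>u $ i - real_of_int (e j $ i)\<bar> < 1}"
      by (rule nn_integral_cmult_indicator) measurable
    also have "\<dots> \<le> ennreal \<bar>c (e j)\<bar> * ennreal (2 ^ CARD('n))" by (rule mult_left_mono[OF em]) simp
    also have "\<dots> = ennreal (\<bar>c (e j)\<bar> * 2 ^ CARD('n))" by (rule ennreal_mult[symmetric]) auto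
    finally show "(\<integral>\<^sup>+u. ennreal \<bar>c (e j)\<bar> * indicator {u. \<forall>i. \<bar>u $ i - real_of_int (e j $ i)\<bar> < 1} u \<partial>lborel)
       \<le> ennreal (\<bar>c (e j)\<bar> * 2 ^ CARD('n))" .
  qed
  also have "\<dots> < \<infinity>" unfolding infinity_ennreal_def by (rule suminf_ennreal_scaled_less_top[OF c]) simp_all
  finally show ?thesis .
qed

lemma cell_kernel_ge:
  fixes e :: "nat \<Rightarrow> int ^ 'n"
  assumes e: "bij e" and h: "h > 0"
  shows "ennreal \<bar>c (lattice_point h y - lattice_point h x)\<bar> \<le> cell_kernel e c ((1 / h) *\<^sub>R (y - x))"
proof -
  define j where "j = inv e (lattice_point h y - lattice_point h x)"
  have j: "e j = lattice_point h y - lattice_point h x" using e by (simp add: j_def bij_is_surj surj_f_inv_f)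
  define f where "f j = ennreal \<bar>c (e j)\<bar> * indicator {u. \<forall>i. \<bar>u $ i - real_of_int (e j $ i)\<bar> < 1} ((1 / h) *\<^sub>R (y - x))" for j
  have "f j = ennreal \<bar>c (lattice_point h y - lattice_point h x)\<bar>"
    using lattice_diff_close[OF h, of y x] by (auto simp: f_def j)
  moreover have "f j \<le> (\<Sum>j. f j)" by (rule le_suminf_ennreal)
  moreover have "(\<Sum>j. f j) = cell_kernel e c ((1 / h) *\<^sub>R (y - x))" by (simp add: f_def cell_kernel_def)
  ultimately show ?thesis by simp
qed

text \<open>For fixed \<open>x\<close> the kernel integrates to \<open>\<Sum>j. c (e j)\<close>, so the difference to be estimated is the integral of the
  kernel against \<open>f y - f x\<close>.  Jensen's inequality, the majorant and the substitution
  \<open>y = x + h * u\<close> bound its \<open>\<alpha>\<close>-th moment by an integral over \<open>u\<close> of the kernel times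
  \<open>\<integral> \<bar>f (x + h * u) - f x\<bar> powr \<alpha> dx\<close>, which tends to \<open>0\<close> boundedly.\<close>

lemma lattice_conv_tendsto_L1_case:
  fixes e :: "nat \<Rightarrow> int ^ 'n" and f :: "real ^ 'n \<Rightarrow> real"
  assumes e: "bij e" and \<alpha>: "\<alpha> > 1" and f: "f \<in> L_space \<alpha>" and c: "summable (\<lambda>j. \<bar>c (e j)\<bar>)"
    and h: "\<And>m. h m > 0" and h0: "h \<longlonglongrightarrow> 0"
    and Fm: "\<And>m x. Fm m x = (1 / h m ^ CARD('n)) * lattice_conv c f (h m) (lattice_point (h m) x)"
  shows "integrable lborel (\<lambda>x. \<bar>Fm m x - (\<Sum>j. c (e j)) * f x\<bar> powr \<alpha>)"
    and "(\<lambda>m. \<integral>x. \<bar>Fm m x - (\<Sum>j. c (e j)) * f x\<bar> powr \<alpha> \<partial>lborel) \<longlonglongrightarrow> 0"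
proof -
  let ?osc = "\<lambda>m u x. ennreal (\<bar>f (x + h m *\<^sub>R u) - f x\<bar> powr \<alpha>)"
  have [measurable]: "f \<in> borel_measurable borel" and fi: "integrable lborel (\<lambda>x. \<bar>f x\<bar> powr \<alpha>)"
    using f by (auto simp: L_space_def)
  note [measurable] = measurable_lattice_point[OF h]
  have [measurable]: "Fm m \<in> borel_measurable borel" for m unfolding Fm[abs_def] by measurable
  define C where "C = (\<Sum>j. c (e j))"
  define N where "N = (\<Sum>j. \<bar>c (e j)\<bar>)"
  have N: "N \<ge> 0" unfolding N_def by (intro suminf_nonneg c) auto
  have cs: "summable (\<lambda>j. \<bar>c (e j - l)\<bar>)" "(\<Sum>j. c (e j - l)) = C" "(\<Sum>j. \<bar>c (e j - l)\<bar>) = N" for l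
    using sums_rearrange[OF e bij_shift_enum(1)[OF e, of l], of c] sums_rearrange[OF e bij_shift_enum(1)[OF e, of l], of "\<lambda>k. \<bar>c k\<bar>"] c
    by (auto simp: C_def N_def)
  define w where "w m p = (1 / h m ^ CARD('n)) * c (lattice_point (h m) (snd p) - lattice_point (h m) (fst p))" for m and p :: "(real ^ 'n) \<times> (real ^ 'n)"
  define g where "g p = f (snd p) - f (fst p)" for p :: "(real ^ 'n) \<times> (real ^ 'n)"
  have [measurable]: "w m \<in> borel_measurable (lborel \<Otimes>\<^sub>M lborel)" for m
    unfolding w_def by (rule measurable_lattice_pair[OF h, of "\<lambda>k l. 1 / h m ^ CARD('n) * c (l - k)"])
  have [measurable]: "g \<in> borel_measurable (lborel \<Otimes>\<^sub>M lborel)" unfolding g_def by measurable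
  have hp: "h m ^ CARD('n) > 0" for m using h[of m] by simp
  have wi: "integrable lborel (\<lambda>y. w m (x, y))" "(\<integral>y. w m (x, y) \<partial>lborel) = C" for m x
  proof -
    have "(\<lambda>y. w m (x, y)) = (\<lambda>y. (1 / h m ^ CARD('n)) * c (lattice_point (h m) y - lattice_point (h m) x))" by (simp add: w_def)
    thus "integrable lborel (\<lambda>y. w m (x, y))" "(\<integral>y. w m (x, y) \<partial>lborel) = C"
      using integral_lattice[OF e h, of "\<lambda>k. c (k - lattice_point (h m) x)" m] cs[of "lattice_point (h m) x"] hp[of m] h[of m] by auto
  qed
  have wN: "(\<integral>\<^sup>+y. ennreal \<bar>w m (x, y)\<bar> \<partial>lborel) \<le> ennreal N" for m x
  proof -
    have "(\<integral>\<^sup>+y. ennreal \<bar>w m (x, y)\<bar> \<partial>lborel) = ennreal (\<integral>y. \<bar>w m (x, y)\<bar> \<partial>lborel)"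
      by (rule nn_integral_eq_integral) (use wi in auto)
    also have "(\<integral>y. \<bar>w m (x, y)\<bar> \<partial>lborel) = (\<integral>y. (1 / h m ^ CARD('n)) * \<bar>c (lattice_point (h m) y - lattice_point (h m) x)\<bar> \<partial>lborel)"
      using hp[of m] by (simp add: w_def abs_mult)
    also have "\<dots> = N"
      using integral_lattice(2)[OF e h, of "\<lambda>k. \<bar>c (k - lattice_point (h m) x)\<bar>" m] cs[of "lattice_point (h m) x"] hp[of m] h[of m] by simp
    finally show ?thesis by simp
  qed
  define I where "I m = (\<integral>\<^sup>+x. (\<integral>\<^sup>+y. ennreal (\<bar>w m (x, y)\<bar> * \<bar>g (x, y)\<bar> powr \<alpha>) \<partial>lborel) \<partial>lborel)" for m
  define K where "K = cell_kernel e c"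
  have [measurable]: "K \<in> borel_measurable borel" unfolding K_def by measurable
  define om where "om m u = (\<integral>\<^sup>+x. ?osc m u x \<partial>lborel)" for m u
  have [measurable]: "om m \<in> borel_measurable borel" for m unfolding om_def by measurable
  have I_le: "I m \<le> (\<integral>\<^sup>+u. K u * om m u \<partial>lborel)" for m
  proof -
    have "I m \<le> (\<integral>\<^sup>+x. (\<integral>\<^sup>+y. ennreal (1 / h m ^ CARD('n)) * (K ((1 / h m) *\<^sub>R (y - x)) * ennreal (\<bar>f y - f x\<bar> powr \<alpha>)) \<partial>lborel) \<partial>lborel)"
      unfolding I_def
    proof (intro nn_integral_mono)
      fix x y :: "real ^ 'n"
      have "ennreal (\<bar>w m (x, y)\<bar> * \<bar>g (x, y)\<bar> powr \<alpha>)
        = ennreal (1 / h m ^ CARD('n)) * (ennreal \<bar>c (lattice_point (h m) y - lattice_point (h m) x)\<bar> * ennreal (\<bar>f y - f x\<bar> powr \<alpha>))"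
        using hp[of m] by (simp add: w_def g_def abs_mult mult.assoc flip: ennreal_mult)
      also have "\<dots> \<le> ennreal (1 / h m ^ CARD('n)) * (K ((1 / h m) *\<^sub>R (y - x)) * ennreal (\<bar>f y - f x\<bar> powr \<alpha>))"
        unfolding K_def by (intro mult_left_mono mult_right_mono cell_kernel_ge e h) auto
      finally show "ennreal (\<bar>w m (x, y)\<bar> * \<bar>g (x, y)\<bar> powr \<alpha>) \<le> \<dots>" .
    qed
    also have "\<dots> = (\<integral>\<^sup>+x. (\<integral>\<^sup>+u. K u * ?osc m u x \<partial>lborel) \<partial>lborel)"
    proof (rule nn_integral_cong)
      fix x :: "real ^ 'n"
      have "(\<integral>\<^sup>+y. ennreal (1 / h m ^ CARD('n)) * (K ((1 / h m) *\<^sub>R (y - x)) * ennreal (\<bar>f y - f x\<bar> powr \<alpha>)) \<partial>lborel)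
        = ennreal (1 / h m ^ CARD('n)) * (\<integral>\<^sup>+y. K ((1 / h m) *\<^sub>R (y - x)) * ennreal (\<bar>f y - f x\<bar> powr \<alpha>) \<partial>lborel)"
        by (rule nn_integral_cmult) measurable
      also have "(\<integral>\<^sup>+y. K ((1 / h m) *\<^sub>R (y - x)) * ennreal (\<bar>f y - f x\<bar> powr \<alpha>) \<partial>lborel)
        = ennreal (h m ^ CARD('n)) * (\<integral>\<^sup>+u. K ((1 / h m) *\<^sub>R (x + h m *\<^sub>R u - x)) * ?osc m u x \<partial>lborel)"
        by (subst nn_integral_lborel_affine[OF _ h, of _ m x]) simp_all
      also have "(\<lambda>u. K ((1 / h m) *\<^sub>R (x + h m *\<^sub>R u - x)) * ?osc m u x) = (\<lambda>u. K u * ?osc m u x)"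
        using h[of m] by auto
      also have "ennreal (1 / h m ^ CARD('n)) * (ennreal (h m ^ CARD('n)) * (\<integral>\<^sup>+u. K u * ?osc m u x \<partial>lborel))
        = (\<integral>\<^sup>+u. K u * ?osc m u x \<partial>lborel)"
        using h[of m] hp[of m] by (simp flip: mult.assoc ennreal_mult)
      finally show "(\<integral>\<^sup>+y. ennreal (1 / h m ^ CARD('n)) * (K ((1 / h m) *\<^sub>R (y - x)) * ennreal (\<bar>f y - f x\<bar> powr \<alpha>)) \<partial>lborel)
        = (\<integral>\<^sup>+u. K u * ?osc m u x \<partial>lborel)" .
    qed
    also have "\<dots> = (\<integral>\<^sup>+u. (\<integral>\<^sup>+x. K u * ?osc m u x \<partial>lborel) \<partial>lborel)"
      by (rule lborel_pair.Fubini'[symmetric]) measurable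
    also have "\<dots> = (\<integral>\<^sup>+u. K u * om m u \<partial>lborel)"
      unfolding om_def by (intro nn_integral_cong nn_integral_cmult) measurable
    finally show ?thesis .
  qed
  define B where "B = ennreal (2 powr \<alpha>) * (2 * (\<integral>\<^sup>+x. ennreal (\<bar>f x\<bar> powr \<alpha>) \<partial>lborel))"
  have B: "B < \<infinity>"
    using fi by (auto simp: B_def integrable_iff_bounded ennreal_mult_less_top)
  have om_le: "om m u \<le> B" for m u
  proof -
    have "om m u \<le> (\<integral>\<^sup>+x. ennreal (2 powr \<alpha>) * (ennreal (\<bar>f (x + h m *\<^sub>R u)\<bar> powr \<alpha>) + ennreal (\<bar>f x\<bar> powr \<alpha>)) \<partial>lborel)"
      unfolding om_def
    proof (rule nn_integral_mono)
      fix x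
      have "\<bar>f (x + h m *\<^sub>R u) - f x\<bar> powr \<alpha> \<le> 2 powr \<alpha> * (\<bar>f (x + h m *\<^sub>R u)\<bar> powr \<alpha> + \<bar>f x\<bar> powr \<alpha>)"
        using powr_abs_add_le[of \<alpha> "f (x + h m *\<^sub>R u)" "- f x"] \<alpha> by simp
      from ennreal_leI[OF this]
      show "?osc m u x \<le> ennreal (2 powr \<alpha>) * (ennreal (\<bar>f (x + h m *\<^sub>R u)\<bar> powr \<alpha>) + ennreal (\<bar>f x\<bar> powr \<alpha>))"
        by (simp add: ennreal_mult)
    qed
    also have "\<dots> = ennreal (2 powr \<alpha>) * ((\<integral>\<^sup>+x. ennreal (\<bar>f (x + h m *\<^sub>R u)\<bar> powr \<alpha>) \<partial>lborel) + (\<integral>\<^sup>+x. ennreal (\<bar>f x\<bar> powr \<alpha>) \<partial>lborel))"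
      by (subst nn_integral_cmult) (auto simp: nn_integral_add)
    also have "(\<integral>\<^sup>+x. ennreal (\<bar>f (x + h m *\<^sub>R u)\<bar> powr \<alpha>) \<partial>lborel) = (\<integral>\<^sup>+x. ennreal (\<bar>f x\<bar> powr \<alpha>) \<partial>lborel)"
      by (rule nn_integral_lborel_shift) measurable
    finally show ?thesis by (simp add: B_def mult_2)
  qed
  have dom: "(\<integral>\<^sup>+u. K u * B \<partial>lborel) < \<infinity>"
    using nn_integral_cell_kernel[where e=e and c=c, OF c] B by (subst nn_integral_multc) (auto simp: K_def ennreal_mult_less_top)
  have "(\<lambda>m. \<integral>\<^sup>+u. K u * om m u \<partial>lborel) \<longlonglongrightarrow> (\<integral>\<^sup>+(u :: real ^ 'n). 0 \<partial>lborel)"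
  proof (rule nn_integral_dominated_convergence[OF _ _ _ _ dom])
    show "AE u in lborel. K u * om m u \<le> K u * B" for m by (intro AE_I2 mult_left_mono om_le) auto
    have "AE u in lborel. K u \<noteq> \<infinity>"
      using nn_integral_cell_kernel[where e=e and c=c, OF c] by (intro nn_integral_PInf_AE) (auto simp: K_def)
    thus "AE u in lborel. (\<lambda>m. K u * om m u) \<longlonglongrightarrow> 0"
    proof eventually_elim
      case (elim u)
      have "(\<lambda>m. h m *\<^sub>R u) \<longlonglongrightarrow> 0 *\<^sub>R u" by (intro tendsto_intros h0)
      hence "(\<lambda>m. om m u) \<longlonglongrightarrow> 0" unfolding om_def by (intro translation_continuous[OF \<alpha> f]) simp
      hence "(\<lambda>m. K u * om m u) \<longlonglongrightarrow> K u * 0" using elim by (intro ennreal_tendsto_cmult) (auto simp: less_top)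
      thus ?case by simp
    qed
  qed measurable
  hence I0: "(\<lambda>m. \<integral>\<^sup>+u. K u * om m u \<partial>lborel) \<longlonglongrightarrow> 0" by simp
  have Ifin: "I m < \<infinity>" for m
  proof -
    have "I m \<le> (\<integral>\<^sup>+u. K u * B \<partial>lborel)"
      using I_le[of m] by (rule order.trans) (intro nn_integral_mono mult_left_mono om_le, simp)
    thus ?thesis using dom by (rule le_less_trans)
  qed
  have bound: "(\<integral>\<^sup>+x. ennreal (\<bar>Fm m x - C * f x\<bar> powr \<alpha>) \<partial>lborel) \<le> ennreal (N powr (\<alpha> - 1)) * I m" for m
  proof -
    have sf: "sigma_finite_measure (lborel :: (real ^ 'n) measure)" by unfold_locales
    have kb: "AE x in lborel. integrable lborel (\<lambda>y. w m (x, y) * g (x, y))"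
      "(\<integral>\<^sup>+x. ennreal (\<bar>\<integral>y. w m (x, y) * g (x, y) \<partial>lborel\<bar> powr \<alpha>) \<partial>lborel) \<le> ennreal (N powr (\<alpha> - 1)) * I m"
      using kernel_bound[OF \<alpha> sf sf, of "w m" g N] wN N Ifin[of m] unfolding I_def by auto
    have ae: "AE x in lborel. (\<integral>y. w m (x, y) * g (x, y) \<partial>lborel) = Fm m x - C * f x"
      using kb(1)
    proof eventually_elim
      case (elim x)
      have i2: "integrable lborel (\<lambda>y. w m (x, y) * f x)" using wi(1) by simp
      have "integrable lborel (\<lambda>y. w m (x, y) * g (x, y) + w m (x, y) * f x)"
        using elim i2 by (rule Bochner_Integration.integrable_add)
      hence i3: "integrable lborel (\<lambda>y. w m (x, y) * f y)" by (simp add: g_def algebra_simps)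
      have "(\<integral>y. w m (x, y) * g (x, y) \<partial>lborel) = (\<integral>y. w m (x, y) * f y \<partial>lborel) - (\<integral>y. w m (x, y) * f x \<partial>lborel)"
        using i2 i3 by (simp add: g_def right_diff_distrib)
      also have "(\<integral>y. w m (x, y) * f x \<partial>lborel) = C * f x" using wi(2) by simp
      also have "(\<integral>y. w m (x, y) * f y \<partial>lborel) = Fm m x"
        by (simp add: Fm lattice_conv_def w_def mult.assoc)
      finally show ?case .
    qed
    have "(\<integral>\<^sup>+x. ennreal (\<bar>Fm m x - C * f x\<bar> powr \<alpha>) \<partial>lborel) = (\<integral>\<^sup>+x. ennreal (\<bar>\<integral>y. w m (x, y) * g (x, y) \<partial>lborel\<bar> powr \<alpha>) \<partial>lborel)"
      by (rule nn_integral_cong_AE) (use ae in eventually_elim, simp)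
    thus ?thesis using kb(2) by simp
  qed
  have lim: "(\<lambda>m. \<integral>\<^sup>+x. ennreal (\<bar>Fm m x - C * f x\<bar> powr \<alpha>) \<partial>lborel) \<longlonglongrightarrow> 0"
  proof (rule tendsto_sandwich[OF always_eventually always_eventually tendsto_const])
    show "\<forall>m. (\<integral>\<^sup>+x. ennreal (\<bar>Fm m x - C * f x\<bar> powr \<alpha>) \<partial>lborel) \<le> ennreal (N powr (\<alpha> - 1)) * (\<integral>\<^sup>+u. K u * om m u \<partial>lborel)"
      using bound I_le by (meson mult_left_mono order.trans zero_le)
    show "(\<lambda>m. ennreal (N powr (\<alpha> - 1)) * (\<integral>\<^sup>+u. K u * om m u \<partial>lborel)) \<longlonglongrightarrow> 0"
      using ennreal_tendsto_cmult[OF _ I0, of "ennreal (N powr (\<alpha> - 1))"] by simp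
  qed simp
  have fin: "(\<integral>\<^sup>+x. ennreal (\<bar>Fm m x - C * f x\<bar> powr \<alpha>) \<partial>lborel) < \<infinity>" for m
    using bound[of m] Ifin[of m] by (auto simp: ennreal_mult_less_top intro: le_less_trans)
  show "integrable lborel (\<lambda>x. \<bar>Fm m x - (\<Sum>j. c (e j)) * f x\<bar> powr \<alpha>)" for m
    using integral_tendsto_0_of_nn_integral(1)[OF _ _ fin lim] unfolding C_def by simp
  show "(\<lambda>m. \<integral>x. \<bar>Fm m x - (\<Sum>j. c (e j)) * f x\<bar> powr \<alpha> \<partial>lborel) \<longlonglongrightarrow> 0"
    using integral_tendsto_0_of_nn_integral(2)[OF _ _ fin lim] unfolding C_def by simp
qed

section \<open>Regularly varying coefficients: convergence to the Riesz-type potential\<close>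

definition int_vec :: "int ^ 'n \<Rightarrow> real ^ 'n" where
  "int_vec k = (\<chi> i. real_of_int (k $ i))"

lemma vec_floor_int_vec [simp]: "vec_floor (int_vec k) = k"
  by (simp add: vec_floor_def int_vec_def vec_eq_iff)

lemma regularly_varying_uniform:
  fixes p :: "real ^ 'n \<Rightarrow> real"
  assumes rv: "regularly_varying c \<beta> p" and e: "e > 0"
  obtains T where "\<And>t x. t \<ge> T \<Longrightarrow> x \<in> sphere 0 1 \<Longrightarrow> \<bar>t powr \<beta> * c (vec_floor (t *\<^sub>R x)) - p x\<bar> \<le> e"
proof -
  have "\<forall>\<^sub>F t in at_top. (SUP x\<in>sphere 0 1. ereal \<bar>t powr \<beta> * c (vec_floor (t *\<^sub>R x)) - p x\<bar>) < ereal e"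
    using rv e unfolding regularly_varying_def by (intro order_tendstoD(2)) auto
  then obtain T where T: "\<And>t. t \<ge> T \<Longrightarrow> (SUP x\<in>sphere 0 1. ereal \<bar>t powr \<beta> * c (vec_floor (t *\<^sub>R x)) - p x\<bar>) < ereal e"
    unfolding eventually_at_top_linorder by blast
  show ?thesis
  proof (rule that)
    fix t :: real and x :: "real ^ 'n" assume "T \<le> t" "x \<in> sphere 0 1"
    hence "ereal \<bar>t powr \<beta> * c (vec_floor (t *\<^sub>R x)) - p x\<bar>
        \<le> (SUP x\<in>sphere 0 1. ereal \<bar>t powr \<beta> * c (vec_floor (t *\<^sub>R x)) - p x\<bar>)"
      by (intro SUP_upper)
    also have "\<dots> < ereal e" by (rule T[OF \<open>T \<le> t\<close>])
    finally have "ereal \<bar>t powr \<beta> * c (vec_floor (t *\<^sub>R x)) - p x\<bar> < ereal e" .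
    thus "\<bar>t powr \<beta> * c (vec_floor (t *\<^sub>R x)) - p x\<bar> \<le> e" by simp
  qed
qed

lemma regularly_varying_polar:
  fixes p :: "real ^ 'n \<Rightarrow> real"
  assumes rv: "regularly_varying c \<beta> p" and z: "z \<noteq> 0"
  shows "p z = norm z powr (- \<beta>) * p (z /\<^sub>R norm z)"
proof -
  have "\<forall>t>0. \<forall>x. x \<noteq> 0 \<longrightarrow> p (t *\<^sub>R x) = t powr (- \<beta>) * p x"
    using rv by (simp add: regularly_varying_def homogeneous_of_order_def)
  from this[rule_format, of "norm z" "z /\<^sub>R norm z"] z show ?thesis by simp
qed

text \<open>At a fixed large scale, \<open>p\<close> on the unit sphere is within \<open>1\<close> of rescaled coefficients, which are
  bounded; so \<open>p\<close> is bounded there and homogeneity gives its decay.  The decay of \<open>c\<close> then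
  follows far from the origin from that of \<open>p\<close>, and near the origin from boundedness.\<close>

lemma regularly_varying_bounds:
  fixes c :: "int ^ 'n \<Rightarrow> real"
  assumes rv: "regularly_varying c \<beta> p" and \<beta>: "\<beta> > 0" and B: "\<And>k. \<bar>c k\<bar> \<le> B"
  shows "\<exists>Q\<ge>0. (\<forall>k. \<bar>c k\<bar> \<le> Q * (1 + norm (int_vec k)) powr (- \<beta>)) \<and> (\<forall>z. z \<noteq> 0 \<longrightarrow> \<bar>p z\<bar> \<le> Q * norm z powr (- \<beta>))"
proof -
  obtain T0 where T0: "\<And>t x. t \<ge> T0 \<Longrightarrow> x \<in> sphere 0 1 \<Longrightarrow> \<bar>t powr \<beta> * c (vec_floor (t *\<^sub>R x)) - p x\<bar> \<le> 1"
    by (rule regularly_varying_uniform[OF rv zero_less_one]) blast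
  define T where "T = max T0 1"
  have T: "T \<ge> 1" "T \<ge> T0" by (auto simp: T_def)
  have B0: "B \<ge> 0" using B[of 0] by linarith
  define P where "P = 1 + T powr \<beta> * B"
  have P0: "P \<ge> 1" using B0 by (simp add: P_def)
  have ps: "\<bar>p x\<bar> \<le> P" if "x \<in> sphere 0 1" for x
  proof -
    have "\<bar>T powr \<beta> * c (vec_floor (T *\<^sub>R x))\<bar> \<le> T powr \<beta> * B"
      using B by (simp add: abs_mult mult_left_mono)
    thus ?thesis using T0[OF T(2) that] unfolding P_def by linarith
  qed
  define Q where "Q = 2 powr \<beta> * (P + 1) + B * (1 + T) powr \<beta>"
  have Q: "P \<le> Q"
  proof -
    have "1 \<le> 2 powr \<beta>" using \<beta> by (simp add: ge_one_powr_ge_zero)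
    hence le: "1 * (P + 1) \<le> 2 powr \<beta> * (P + 1)" using P0 by (intro mult_right_mono) simp_all
    have "P \<le> 1 * (P + 1)" by simp
    hence "P \<le> 2 powr \<beta> * (P + 1)" using le by (rule order.trans)
    moreover have "0 \<le> B * (1 + T) powr \<beta>" using B0 by simp
    ultimately show ?thesis unfolding Q_def by (rule add_increasing2[rotated])
  qed
  have "\<bar>p z\<bar> \<le> Q * norm z powr (- \<beta>)" if z: "z \<noteq> 0" for z
  proof -
    have "\<bar>p z\<bar> = norm z powr (- \<beta>) * \<bar>p (z /\<^sub>R norm z)\<bar>"
      using regularly_varying_polar[OF rv z] by (simp add: abs_mult)
    also have "\<dots> \<le> norm z powr (- \<beta>) * Q" using ps[of "z /\<^sub>R norm z"] z Q by (intro mult_left_mono) auto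
    finally show ?thesis by (simp add: mult.commute)
  qed
  moreover have "\<bar>c k\<bar> \<le> Q * (1 + norm (int_vec k)) powr (- \<beta>)" for k
  proof (cases "norm (int_vec k) \<ge> T")
    case True
    define t where "t = norm (int_vec k)"
    have t: "t \<ge> 1" "t \<ge> T0" using True T by (auto simp: t_def)
    define x where "x = int_vec k /\<^sub>R t"
    have "int_vec k \<noteq> 0" using t by (auto simp: t_def)
    hence x: "x \<in> sphere 0 1" "t *\<^sub>R x = int_vec k" by (simp_all add: x_def t_def)
    have "\<bar>t powr \<beta> * c k\<bar> \<le> P + 1" using T0[OF t(2) x(1)] ps[OF x(1)] x(2) by simp
    hence "t powr \<beta> * \<bar>c k\<bar> \<le> P + 1" by (simp add: abs_mult)
    hence "\<bar>c k\<bar> \<le> t powr (- \<beta>) * (P + 1)" using t by (simp add: powr_minus field_simps)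
    also have "t powr (- \<beta>) \<le> 2 powr \<beta> * (1 + t) powr (- \<beta>)"
    proof -
      have "(1 + t) powr \<beta> \<le> (2 * t) powr \<beta>" using t \<beta> by (intro powr_mono2) auto
      hence "(1 + t) powr \<beta> \<le> 2 powr \<beta> * t powr \<beta>" using t by (simp add: powr_mult)
      thus ?thesis using t by (simp add: powr_minus field_simps)
    qed
    hence "t powr (- \<beta>) * (P + 1) \<le> 2 powr \<beta> * (1 + t) powr (- \<beta>) * (P + 1)" using P0 by (intro mult_right_mono) auto
    also have "\<dots> \<le> Q * (1 + t) powr (- \<beta>)"
      using B0 by (simp add: Q_def algebra_simps)
    finally show ?thesis by (simp add: t_def)
  next
    case False
    have "\<bar>c k\<bar> * 1 \<le> B * ((1 + T) powr \<beta> * (1 + norm (int_vec k)) powr (- \<beta>))"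
    proof (rule mult_mono[OF B])
      have "(1 + norm (int_vec k)) powr \<beta> \<le> (1 + T) powr \<beta>" using False \<beta> by (intro powr_mono2) auto
      moreover have "0 < 1 + norm (int_vec k)" by (simp add: add_pos_nonneg)
      ultimately show "1 \<le> (1 + T) powr \<beta> * (1 + norm (int_vec k)) powr (- \<beta>)"
        by (simp add: powr_minus field_simps)
    qed (use B0 in auto)
    also have "\<dots> \<le> Q * (1 + norm (int_vec k)) powr (- \<beta>)"
      using P0 by (simp add: Q_def algebra_simps)
    finally show ?thesis by simp
  qed
  ultimately show ?thesis using P0 Q by (intro exI[of _ Q]) auto
qed

text \<open>The uniform limit \<open>p\<close> need not be continuous on the coordinate hyperplanes, where the integer part jumps at
  every scale.  Elsewhere one can choose a large scale \<open>t\<close> for which no coordinate of \<open>t * x\<close> is an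
  integer.  Then nearby points share the integer part of \<open>t * x\<close>, hence the same coefficient of \<open>c\<close>, and
  both values of \<open>p\<close> are close to it.\<close>

lemma regularly_varying_limit_continuous:
  fixes c :: "int ^ 'n \<Rightarrow> real"
  assumes rv: "regularly_varying c \<beta> p" and x: "x \<in> sphere 0 1" and nz: "\<And>i. x $ i \<noteq> 0"
    and X: "X \<longlonglongrightarrow> x" and Xs: "\<forall>\<^sub>F m in sequentially. X m \<in> sphere 0 1"
  shows "(\<lambda>m. p (X m)) \<longlonglongrightarrow> p x"
proof (rule tendstoI)
  fix r :: real assume r: "r > 0"
  obtain T where T: "\<And>t x. t \<ge> T \<Longrightarrow> x \<in> sphere 0 1 \<Longrightarrow> \<bar>t powr \<beta> * c (vec_floor (t *\<^sub>R x)) - p x\<bar> \<le> r / 3"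
    using regularly_varying_uniform[OF rv, of "r / 3"] r by (metis divide_pos_pos zero_less_numeral)
  \<comment> \<open>only countably many scales put some coordinate of \<open>t * x\<close> on an integer\<close>
  have "\<exists>t\<ge>T. \<forall>i. t * x $ i \<notin> \<int>"
  proof (rule ccontr)
    assume "\<not> ?thesis"
    hence *: "\<exists>i. t * x $ i \<in> \<int>" if "t \<ge> T" for t using that by blast
    have "{T..} \<subseteq> (\<Union>i. (\<lambda>n. n / x $ i) ` \<int>)"
    proof
      fix t assume "t \<in> {T..}"
      then obtain i where "t * x $ i \<in> \<int>" using *[of t] by auto
      moreover have "t = (t * x $ i) / x $ i" using nz by simp
      ultimately show "t \<in> (\<Union>i. (\<lambda>n. n / x $ i) ` \<int>)" by blast
    qed
    moreover have "countable (\<Union>i. (\<lambda>n. n / x $ i) ` (\<int> :: real set))"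
      by (intro countable_UN countable_image countable_int) auto
    ultimately have "countable {T..}" by (rule countable_subset)
    moreover have "uncountable {T..T + 1}" by (simp add: uncountable_closed_interval)
    ultimately show False by (meson Icc_subset_Ici_iff countable_subset order_refl)
  qed
  then obtain t where t: "t \<ge> T" "\<And>i. t * x $ i \<notin> \<int>" by blast
  have "\<forall>\<^sub>F m in sequentially. \<lfloor>t * X m $ i\<rfloor> = \<lfloor>t * x $ i\<rfloor>" for i
  proof -
    have "(\<lambda>m. t * X m $ i) \<longlonglongrightarrow> t * x $ i" by (intro tendsto_intros tendsto_vec_nth X)
    thus ?thesis using t(2)[of i] by (rule eventually_floor_eq)
  qed
  hence "\<forall>\<^sub>F m in sequentially. \<forall>i. \<lfloor>t * X m $ i\<rfloor> = \<lfloor>t * x $ i\<rfloor>"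
    by (intro eventually_all_finite) auto
  with Xs show "\<forall>\<^sub>F m in sequentially. dist (p (X m)) (p x) < r"
  proof eventually_elim
    case (elim m)
    have "vec_floor (t *\<^sub>R X m) = vec_floor (t *\<^sub>R x)" using elim by (simp add: vec_floor_def)
    with T[OF t(1) elim(1)] have "\<bar>t powr \<beta> * c (vec_floor (t *\<^sub>R x)) - p (X m)\<bar> \<le> r / 3" by simp
    with T[OF t(1) x] r show ?case unfolding dist_real_def by linarith
  qed
qed

text \<open>Local integrability away from the origin gives measurability on an exhausting sequence of
  compact annuli; the single point \<open>0\<close> is added by hand.\<close>

lemma regularly_varying_limit_measurable:
  fixes p :: "real ^ 'n \<Rightarrow> real"
  assumes rv: "regularly_varying c \<beta> p"
  shows "p \<in> borel_measurable borel"
proof -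
  define K where "K n = cball (0 :: real ^ 'n) (real n) - ball 0 (1 / (real n + 1))" for n
  define P where "P n x = indicator (K n) x *\<^sub>R p x" for n x
  have [measurable]: "P n \<in> borel_measurable borel" for n
  proof -
    have "compact (K n)" unfolding K_def by (intro compact_diff) auto
    moreover have "K n \<subseteq> - {0}" by (auto simp: K_def)
    ultimately have "set_integrable lborel (K n) p"
      using rv unfolding regularly_varying_def locally_integrable_on_def by blast
    thus ?thesis unfolding set_integrable_def P_def by auto
  qed
  have lim: "(\<lambda>n. P n x) \<longlonglongrightarrow> (if x = 0 then 0 else p x)" for x
  proof (cases "x = 0")
    case True
    thus ?thesis by (simp add: P_def K_def)
  next
    case False
    obtain n1 :: nat where n1: "norm x \<le> real n1" using real_arch_simple by blast
    obtain n2 :: nat where n2: "1 / norm x \<le> real n2" using real_arch_simple by blast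
    have "\<forall>\<^sub>F n in sequentially. P n x = p x"
    proof (rule eventually_sequentiallyI)
      fix n assume n: "max n1 n2 \<le> n"
      hence nn: "real n1 \<le> real n" "real n2 \<le> real n" by auto
      have "1 / norm x \<le> real n + 1" using n2 nn by linarith
      hence "1 / (real n + 1) \<le> norm x" using False by (simp add: field_simps)
      hence "x \<in> K n" using n1 nn by (simp add: K_def)
      thus "P n x = p x" by (simp add: P_def)
    qed
    thus ?thesis using False by (simp add: tendsto_eventually)
  qed
  have "(\<lambda>x. if x = 0 then 0 else p x) \<in> borel_measurable borel"
    by (rule borel_measurable_LIMSEQ_real[OF lim]) measurable
  hence "(\<lambda>x. if x = 0 then p 0 else (if x = 0 then 0 else p x)) \<in> borel_measurable borel"
    by measurable
  moreover have "(\<lambda>x. if x = 0 then p 0 else (if x = 0 then 0 else p x)) = p" by auto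
  ultimately show ?thesis by simp
qed

lemma norm_le_lattice_diff:
  fixes x y :: "real ^ 'n"
  assumes h: "h > 0"
  shows "norm (y - x) \<le> real CARD('n) * (h * (1 + norm (int_vec (lattice_point h y - lattice_point h x))))"
proof -
  define k where "k = lattice_point h y - lattice_point h x"
  define v where "v = (1 / h) *\<^sub>R (y - x) - int_vec k"
  have "norm v \<le> (\<Sum>i\<in>UNIV. \<bar>v $ i\<bar>)" by (rule norm_le_l1_cart)
  also have "\<dots> \<le> (\<Sum>i\<in>(UNIV :: 'n set). 1)"
    using lattice_diff_close[OF h, of y x] by (intro sum_mono) (simp add: v_def int_vec_def k_def less_imp_le)
  finally have v: "norm v \<le> real CARD('n)" by simp
  have d: "real CARD('n) \<ge> 1" by (simp add: Suc_le_eq)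
  have "y - x = h *\<^sub>R (v + int_vec k)" using h by (simp add: v_def)
  hence "norm (y - x) = h * norm (v + int_vec k)" using h by simp
  also have "\<dots> \<le> h * (norm v + norm (int_vec k))" using h by (intro mult_left_mono norm_triangle_ineq) auto
  also have "\<dots> \<le> h * (real CARD('n) * 1 + real CARD('n) * norm (int_vec k))"
    using h v d by (intro mult_left_mono add_mono) (auto simp: mult_le_cancel_right1)
  finally show ?thesis by (simp add: k_def algebra_simps)
qed

lemma rescaled_kernel_bound:
  fixes x y :: "real ^ 'n"
  assumes h: "h > 0" and \<beta>: "\<beta> > 0" and Q: "Q \<ge> 0"
    and c: "\<And>k. \<bar>c k\<bar> \<le> Q * (1 + norm (int_vec k)) powr (- \<beta>)" and xy: "x \<noteq> y"
  shows "\<bar>h powr (- \<beta>) * c (lattice_point h y - lattice_point h x)\<bar> \<le> Q * real CARD('n) powr \<beta> * norm (y - x) powr (- \<beta>)"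
proof -
  define s where "s = 1 + norm (int_vec (lattice_point h y - lattice_point h x))"
  have s: "s > 0" by (simp add: s_def add_pos_nonneg)
  have n: "norm (y - x) > 0" using xy by simp
  have "\<bar>h powr (- \<beta>) * c (lattice_point h y - lattice_point h x)\<bar> \<le> h powr (- \<beta>) * (Q * s powr (- \<beta>))"
    using c by (simp add: abs_mult s_def mult_left_mono)
  also have "\<dots> = Q * (h * s) powr (- \<beta>)" using h s by (simp add: powr_mult)
  also have "(h * s) powr (- \<beta>) \<le> real CARD('n) powr \<beta> * norm (y - x) powr (- \<beta>)"
  proof -
    have "norm (y - x) powr \<beta> \<le> (real CARD('n) * (h * s)) powr \<beta>"
      unfolding s_def using \<beta> h by (intro powr_mono2 norm_le_lattice_diff) auto
    also have "\<dots> = real CARD('n) powr \<beta> * (h * s) powr \<beta>" using h s by (simp add: powr_mult)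
    finally show ?thesis using h s n by (simp add: powr_minus field_simps)
  qed
  hence "Q * (h * s) powr (- \<beta>) \<le> Q * (real CARD('n) powr \<beta> * norm (y - x) powr (- \<beta>))" by (intro mult_left_mono Q)
  finally show ?thesis by (simp add: mult.assoc)
qed

text \<open>Write the integer vector \<open>k = [y / h] - [x / h]\<close> in polar form.  Its length tends to infinity and its direction to
  that of \<open>y - x\<close>, while \<open>h * \<bar>k\<bar>\<close> tends to \<open>\<bar>y - x\<bar>\<close>.  As \<open>k\<close> is its own integer part, regular variation
  applies at the point \<open>k\<close> itself.\<close>

lemma rescaled_kernel_tendsto:
  fixes x y :: "real ^ 'n"
  assumes rv: "regularly_varying c \<beta> p" and h: "\<And>m. h m > 0" and h0: "h \<longlonglongrightarrow> 0"
    and nz: "\<And>i. y $ i \<noteq> x $ i"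
  shows "(\<lambda>m. h m powr (- \<beta>) * c (lattice_point (h m) y - lattice_point (h m) x)) \<longlonglongrightarrow> p (y - x)"
proof -
  define z where "z = y - x"
  have z0: "z \<noteq> 0" using nz[of undefined] by (auto simp: z_def)
  define k where "k m = lattice_point (h m) y - lattice_point (h m) x" for m
  define v where "v m = h m *\<^sub>R int_vec (k m)" for m
  have v: "v \<longlonglongrightarrow> z"
  proof (rule vec_tendstoI)
    fix i
    have "(\<lambda>m. v m $ i - z $ i) \<longlonglongrightarrow> 0"
    proof (rule Lim_null_comparison[OF always_eventually h0], rule allI)
      fix m
      have "\<bar>z $ i / h m - real_of_int (k m $ i)\<bar> < 1"
        using lattice_diff_close[OF h, of m y x i] by (simp add: k_def z_def)
      hence "h m * \<bar>z $ i / h m - real_of_int (k m $ i)\<bar> \<le> h m * 1" using h[of m] by (intro mult_left_mono) auto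
      also have "h m * \<bar>z $ i / h m - real_of_int (k m $ i)\<bar> = \<bar>h m * (z $ i / h m - real_of_int (k m $ i))\<bar>"
        using h[of m] by (simp add: abs_mult)
      also have "h m * (z $ i / h m - real_of_int (k m $ i)) = z $ i - v m $ i"
        using h[of m] by (simp add: v_def int_vec_def right_diff_distrib)
      finally show "norm (v m $ i - z $ i) \<le> h m" by (simp add: abs_minus_commute)
    qed
    thus "(\<lambda>m. v m $ i) \<longlonglongrightarrow> z $ i" by (rule LIM_zero_cancel)
  qed
  define n where "n m = norm (v m)" for m
  have n: "n \<longlonglongrightarrow> norm z" unfolding n_def by (intro tendsto_norm v)
  have npos: "\<forall>\<^sub>F m in sequentially. n m > 0" using order_tendstoD(1)[OF n, of 0] z0 by simp
  define u where "u m = v m /\<^sub>R n m" for m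
  define t where "t m = n m / h m" for m
  have us: "\<forall>\<^sub>F m in sequentially. u m \<in> sphere 0 1"
    using npos by eventually_elim (simp add: u_def n_def)
  have ul: "u \<longlonglongrightarrow> z /\<^sub>R norm z" unfolding u_def using z0 by (intro tendsto_intros v n) auto
  have tu: "\<forall>\<^sub>F m in sequentially. h m powr (- \<beta>) * c (k m) = n m powr (- \<beta>) * (t m powr \<beta> * c (vec_floor (t m *\<^sub>R u m)))"
    using npos
  proof eventually_elim
    case (elim m)
    have "t m *\<^sub>R u m = int_vec (k m)" using elim h[of m] by (simp add: t_def u_def v_def)
    hence "vec_floor (t m *\<^sub>R u m) = k m" by simp
    moreover have "n m powr (- \<beta>) * t m powr \<beta> = h m powr (- \<beta>)"
      using elim h[of m] by (simp add: t_def powr_divide powr_minus field_simps)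
    ultimately show ?case by (simp flip: mult.assoc)
  qed
  have t_top: "filterlim t at_top sequentially"
    unfolding t_def divide_inverse using z0 h
    by (intro filterlim_tendsto_pos_mult_at_top[OF n] filterlim_inverse_at_top[OF h0]) auto
  have "(\<lambda>m. t m powr \<beta> * c (vec_floor (t m *\<^sub>R u m)) - p (u m)) \<longlonglongrightarrow> 0"
  proof (rule tendstoI)
    fix r :: real assume r: "r > 0"
    obtain T where T: "\<And>t x. t \<ge> T \<Longrightarrow> x \<in> sphere 0 1 \<Longrightarrow> \<bar>t powr \<beta> * c (vec_floor (t *\<^sub>R x)) - p x\<bar> \<le> r / 2"
      using regularly_varying_uniform[OF rv, of "r / 2"] r by (metis half_gt_zero)
    have "\<forall>\<^sub>F m in sequentially. T \<le> t m" using t_top by (simp add: filterlim_at_top)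
    with us show "\<forall>\<^sub>F m in sequentially. dist (t m powr \<beta> * c (vec_floor (t m *\<^sub>R u m)) - p (u m)) 0 < r"
    proof eventually_elim
      case (elim m)
      thus ?case using T[of "t m" "u m"] r by simp
    qed
  qed
  moreover have "(\<lambda>m. p (u m)) \<longlonglongrightarrow> p (z /\<^sub>R norm z)"
    by (rule regularly_varying_limit_continuous[OF rv _ _ ul us]) (use z0 nz in \<open>auto simp: z_def\<close>)
  ultimately have "(\<lambda>m. (t m powr \<beta> * c (vec_floor (t m *\<^sub>R u m)) - p (u m)) + p (u m)) \<longlonglongrightarrow> 0 + p (z /\<^sub>R norm z)"
    by (rule tendsto_add)
  hence "(\<lambda>m. n m powr (- \<beta>) * (t m powr \<beta> * c (vec_floor (t m *\<^sub>R u m)))) \<longlonglongrightarrow> norm z powr (- \<beta>) * p (z /\<^sub>R norm z)"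
    using z0 by (intro tendsto_mult tendsto_powr n tendsto_const) auto
  moreover have "norm z powr (- \<beta>) * p (z /\<^sub>R norm z) = p z"
    by (rule regularly_varying_polar[OF rv z0, symmetric])
  ultimately have "(\<lambda>m. n m powr (- \<beta>) * (t m powr \<beta> * c (vec_floor (t m *\<^sub>R u m)))) \<longlonglongrightarrow> p z" by simp
  hence "(\<lambda>m. h m powr (- \<beta>) * c (k m)) \<longlonglongrightarrow> p z"
    by (rule Lim_transform_eventually) (use tu in eventually_elim, simp)
  thus ?thesis by (simp add: k_def z_def)
qed


lemma ex_dyadic_ge_1:
  fixes r :: real
  assumes "r \<ge> 1"
  shows "\<exists>j::nat. 2 ^ j \<le> r \<and> r < 2 ^ Suc j"
proof -
  obtain n :: nat where n: "r < 2 ^ n" using real_arch_pow[of 2 r] by auto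
  define m where "m = (LEAST n. r < 2 ^ n)"
  have m: "r < 2 ^ m" unfolding m_def using n by (rule LeastI)
  have "m \<noteq> 0" using m assms by (intro notI) simp
  then obtain j where j: "m = Suc j" using not0_implies_Suc by blast
  have "\<not> r < 2 ^ j" using not_less_Least[of j "\<lambda>n. r < 2 ^ n"] j by (simp add: m_def)
  thus ?thesis using m j by (intro exI[of _ j]) auto
qed

text \<open>Dominate the power by a sum of constants on dyadic balls; the integral becomes a geometric
  series of ratio \<open>2 powr (d - s)\<close>.\<close>

lemma nn_integral_norm_powr_far:
  assumes s: "s > real DIM('a::euclidean_space)"
  shows "(\<integral>\<^sup>+z. ennreal (if 1 < norm z then norm z powr (- s) else 0) \<partial>(lborel :: 'a measure)) < \<infinity>"
proof -
  define V where "V = unit_ball_vol (real DIM('a))"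
  have V: "V \<ge> 0" by (simp add: V_def)
  define q where "q = 2 powr (real DIM('a) - s)"
  define F :: "nat \<Rightarrow> 'a \<Rightarrow> ennreal" where "F j z = ennreal ((2 ^ j) powr (- s)) * indicator (cball 0 (2 ^ Suc j)) z" for j z
  have [measurable]: "F j \<in> borel_measurable borel" for j
    unfolding F_def by (intro borel_measurable_times_ennreal borel_measurable_const borel_measurable_indicator) simp
  have q: "0 < q" "q < 1" using s by (auto simp: q_def powr_less_one)
  have "(\<integral>\<^sup>+z. ennreal (if 1 < norm z then norm z powr (- s) else 0) \<partial>(lborel :: 'a measure))
    \<le> (\<integral>\<^sup>+z. (\<Sum>j. F j z) \<partial>(lborel :: 'a measure))"
  proof (rule nn_integral_mono)
    fix z :: 'a
    show "ennreal (if 1 < norm z then norm z powr (- s) else 0) \<le> (\<Sum>j. F j z)"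
    proof (cases "1 < norm z")
      case True
      then obtain j :: nat where j: "2 ^ j \<le> norm z" "norm z < 2 ^ Suc j" using ex_dyadic_ge_1[of "norm z"] by auto
      have "norm z powr (- s) \<le> (2 ^ j) powr (- s)" using j s by (intro powr_mono2') auto
      hence "ennreal (norm z powr (- s)) \<le> F j z"
        using j by (simp add: F_def ennreal_leI)
      also have "\<dots> \<le> (\<Sum>j. F j z)"
        by (rule le_suminf_ennreal)
      finally show ?thesis using True by simp
    next
      case False
      hence "(if 1 < norm z then norm z powr (- s) else 0) = 0" by auto
      thus ?thesis by (simp only: ennreal_0 zero_le)
    qed
  qed
  also have "\<dots> = (\<Sum>j. \<integral>\<^sup>+z. F j z \<partial>(lborel :: 'a measure))"
    by (rule nn_integral_suminf) measurable
  also have "\<dots> = (\<Sum>j. ennreal (q ^ j * (V * 2 ^ DIM('a))))"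
  proof (rule suminf_cong)
    fix j
    have "(\<integral>\<^sup>+z. F j z \<partial>(lborel :: 'a measure))
      = ennreal ((2 ^ j) powr (- s)) * emeasure lborel (cball (0 :: 'a) (2 ^ Suc j))"
      unfolding F_def by (rule nn_integral_cmult_indicator) simp
    also have "emeasure lborel (cball (0 :: 'a) (2 ^ Suc j)) = ennreal (V * (2 ^ Suc j) ^ DIM('a))"
      unfolding V_def by (rule emeasure_cball) simp
    also have "ennreal ((2 ^ j) powr (- s)) * \<dots> = ennreal ((2 ^ j) powr (- s) * (V * (2 ^ Suc j) ^ DIM('a)))"
      using V by (intro ennreal_mult[symmetric]) auto
    also have "(2 ^ j) powr (- s) * (V * (2 ^ Suc j) ^ DIM('a)) = q ^ j * (V * 2 ^ DIM('a))"
    proof -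
      have "(2 ^ Suc j :: real) ^ DIM('a) = 2 ^ DIM('a) * (2 ^ j) powr real DIM('a)"
        by (simp add: power_mult_distrib powr_realpow)
      moreover have "(2 ^ j :: real) powr (- s) * (2 ^ j) powr real DIM('a) = q ^ j"
      proof -
        have "(2 ^ j :: real) powr (- s) * (2 ^ j) powr real DIM('a) = (2 ^ j) powr (real DIM('a) - s)"
          by (simp flip: powr_add)
        also have "\<dots> = (2 powr real j) powr (real DIM('a) - s)" by (simp add: powr_realpow)
        also have "\<dots> = q powr real j" by (simp add: q_def powr_powr mult.commute)
        also have "\<dots> = q ^ j" using q by (simp add: powr_realpow)
        finally show ?thesis .
      qed
      ultimately show ?thesis by (simp add: mult_ac)
    qed
    finally show "(\<integral>\<^sup>+z. F j z \<partial>(lborel :: 'a measure)) = ennreal (q ^ j * (V * 2 ^ DIM('a)))" .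
  qed
  also have "\<dots> < top"
    by (rule suminf_ennreal_scaled_less_top) (use q V in \<open>simp_all add: summable_geometric\<close>)
  finally show ?thesis by simp
qed

text \<open>As in the preceding lemma, with balls shrinking to the origin and ratio \<open>2 powr (s - d)\<close>.\<close>

lemma nn_integral_norm_powr_near:
  assumes s: "0 < s" "s < real DIM('a::euclidean_space)"
  shows "(\<integral>\<^sup>+z. ennreal (if norm z \<le> 1 then norm z powr (- s) else 0) \<partial>(lborel :: 'a measure)) < \<infinity>"
proof -
  define V where "V = unit_ball_vol (real DIM('a))"
  have V: "V \<ge> 0" by (simp add: V_def)
  define q where "q = 2 powr (s - real DIM('a))"
  define F :: "nat \<Rightarrow> 'a \<Rightarrow> ennreal" where "F j z = ennreal ((2 ^ Suc j) powr s) * indicator (cball 0 (inverse (2 ^ j))) z" for j z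
  have [measurable]: "F j \<in> borel_measurable borel" for j
    unfolding F_def by (intro borel_measurable_times_ennreal borel_measurable_const borel_measurable_indicator) simp
  have q: "0 < q" "q < 1" using s by (auto simp: q_def powr_less_one)
  have "(\<integral>\<^sup>+z. ennreal (if norm z \<le> 1 then norm z powr (- s) else 0) \<partial>(lborel :: 'a measure))
    \<le> (\<integral>\<^sup>+z. (\<Sum>j. F j z) \<partial>(lborel :: 'a measure))"
  proof (rule nn_integral_mono)
    fix z :: 'a
    show "ennreal (if norm z \<le> 1 then norm z powr (- s) else 0) \<le> (\<Sum>j. F j z)"
    proof (cases "norm z \<le> 1 \<and> z \<noteq> 0")
      case True
      hence z: "norm z > 0" "1 \<le> inverse (norm z)" by (auto simp: one_le_inverse_iff)
      then obtain j :: nat where j: "2 ^ j \<le> inverse (norm z)" "inverse (norm z) < 2 ^ Suc j"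
        using ex_dyadic_ge_1[of "inverse (norm z)"] by auto
      have "norm z powr (- s) = inverse (norm z) powr s" using z by (simp add: powr_minus inverse_powr)
      also have "\<dots> \<le> (2 ^ Suc j) powr s" using j s z by (intro powr_mono2) auto
      finally have "ennreal (norm z powr (- s)) \<le> ennreal ((2 ^ Suc j) powr s)" by (rule ennreal_leI)
      moreover have "norm z \<le> inverse (2 ^ j)" using j(1) z(1) le_imp_inverse_le[OF j(1)] by simp
      ultimately have "ennreal (norm z powr (- s)) \<le> F j z"
        by (simp add: F_def)
      also have "\<dots> \<le> (\<Sum>j. F j z)"
        by (rule le_suminf_ennreal)
      finally show ?thesis using True by simp
    next
      case False
      hence "(if norm z \<le> 1 then norm z powr (- s) else 0) = 0" by auto
      thus ?thesis by (simp only: ennreal_0 zero_le)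
    qed
  qed
  also have "\<dots> = (\<Sum>j. \<integral>\<^sup>+z. F j z \<partial>(lborel :: 'a measure))"
    by (rule nn_integral_suminf) measurable
  also have "\<dots> = (\<Sum>j. ennreal (q ^ j * (V * 2 powr s)))"
  proof (rule suminf_cong)
    fix j
    have "(\<integral>\<^sup>+z. F j z \<partial>(lborel :: 'a measure))
      = ennreal ((2 ^ Suc j) powr s) * emeasure lborel (cball (0 :: 'a) (inverse (2 ^ j)))"
      unfolding F_def by (rule nn_integral_cmult_indicator) simp
    also have "emeasure lborel (cball (0 :: 'a) (inverse (2 ^ j))) = ennreal (V * inverse (2 ^ j) ^ DIM('a))"
      unfolding V_def by (rule emeasure_cball) simp
    also have "ennreal ((2 ^ Suc j) powr s) * \<dots> = ennreal ((2 ^ Suc j) powr s * (V * inverse (2 ^ j) ^ DIM('a)))"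
      using V by (intro ennreal_mult[symmetric]) auto
    also have "(2 ^ Suc j) powr s * (V * inverse (2 ^ j) ^ DIM('a)) = q ^ j * (V * 2 powr s)"
    proof -
      have "(2 ^ Suc j :: real) powr s = 2 powr s * (2 ^ j) powr s" by (simp add: powr_mult)
      moreover have "inverse (2 ^ j :: real) ^ DIM('a) = (2 ^ j) powr (- real DIM('a))"
        by (simp add: powr_minus powr_realpow power_inverse)
      moreover have "(2 ^ j :: real) powr s * (2 ^ j) powr (- real DIM('a)) = q ^ j"
      proof -
        have "(2 ^ j :: real) powr s * (2 ^ j) powr (- real DIM('a)) = (2 ^ j) powr (s - real DIM('a))"
          by (simp flip: powr_add)
        also have "\<dots> = (2 powr real j) powr (s - real DIM('a))" by (simp add: powr_realpow)
        also have "\<dots> = q powr real j" by (simp add: q_def powr_powr mult.commute)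
        also have "\<dots> = q ^ j" using q by (simp add: powr_realpow)
        finally show ?thesis .
      qed
      ultimately show ?thesis by (simp add: mult_ac)
    qed
    finally show "(\<integral>\<^sup>+z. F j z \<partial>(lborel :: 'a measure)) = ennreal (q ^ j * (V * 2 powr s))" .
  qed
  also have "\<dots> < top"
    by (rule suminf_ennreal_scaled_less_top) (use q V in \<open>simp_all add: summable_geometric\<close>)
  finally show ?thesis by simp
qed


text \<open>Split the kernel at distance \<open>1\<close>.  The singular part is integrable since \<open>\<beta> < d\<close> and acts on
  \<open>\<bar>f\<bar> powr \<alpha>\<close>; the tail has an integrable \<open>\<alpha>\<close>-th power since \<open>\<alpha> * \<beta> > d\<close> and is averaged against the
  integrable weight \<open>\<bar>f\<bar>\<close>.\<close>

lemma riesz_potential_Lp: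
  fixes f :: "real ^ 'n \<Rightarrow> real"
  assumes \<alpha>: "\<alpha> > 1" and \<beta>: "real CARD('n) / \<alpha> < \<beta>" "\<beta> < real CARD('n)"
    and f: "f \<in> L_space \<alpha>" and f1: "f \<in> L_space 1"
  shows "AE x in lborel. integrable lborel (\<lambda>y. norm (y - x) powr (- \<beta>) * \<bar>f y\<bar>)"
    and "integrable lborel (\<lambda>x. \<bar>\<integral>y. norm (y - x) powr (- \<beta>) * \<bar>f y\<bar> \<partial>lborel\<bar> powr \<alpha>)"
proof -
  let ?J = "\<lambda>w g. \<integral>\<^sup>+x. (\<integral>\<^sup>+y. ennreal (\<bar>w (x, y)\<bar> * \<bar>g (x, y)\<bar> powr \<alpha>) \<partial>lborel) \<partial>(lborel :: (real ^ 'n) measure)"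
  let ?U = "\<lambda>q x. \<integral>y. q (y - x) * \<bar>f y\<bar> \<partial>lborel"
  have [measurable]: "f \<in> borel_measurable borel" and fi: "integrable lborel (\<lambda>x. \<bar>f x\<bar> powr \<alpha>)"
    and f1i: "integrable lborel (\<lambda>x. \<bar>f x\<bar>)"
    using f f1 by (auto simp: L_space_def)
  have \<beta>0: "\<beta> > 0" using \<beta>(1) \<alpha> by (smt (verit) divide_nonneg_pos of_nat_0_le_iff)
  define q1 where "q1 z = (if norm z \<le> 1 then norm z powr (- \<beta>) else 0)" for z :: "real ^ 'n"
  define q2 where "q2 z = (if 1 < norm z then norm z powr (- \<beta>) else 0)" for z :: "real ^ 'n"
  have [measurable]: "q1 \<in> borel_measurable borel" "q2 \<in> borel_measurable borel"
    unfolding q1_def q2_def by measurable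
  have q: "q1 z \<ge> 0" "q2 z \<ge> 0" "q1 z + q2 z = norm z powr (- \<beta>)" for z by (auto simp: q1_def q2_def)
  have sf: "sigma_finite_measure (lborel :: (real ^ 'n) measure)" by unfold_locales
  have shift: "(\<integral>\<^sup>+x. g (y - x) \<partial>lborel) = (\<integral>\<^sup>+z. g z \<partial>lborel)" if [measurable]: "g \<in> borel_measurable borel"
    for g :: "real ^ 'n \<Rightarrow> ennreal" and y
  proof -
    have eq: "lborel = distr lborel borel (\<lambda>x. y - x)"
      using lborel_affine[of "-1" y] by (simp add: density_1)
    have "(\<integral>\<^sup>+z. g z \<partial>lborel) = (\<integral>\<^sup>+z. g z \<partial>distr lborel borel (\<lambda>x. y - x))" by (subst eq) simp
    also have "\<dots> = (\<integral>\<^sup>+x. g (y - x) \<partial>lborel)" by (rule nn_integral_distr) measurable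
    finally show ?thesis ..
  qed
  \<comment> \<open>the singular part of the kernel is integrable\<close>
  have Q1: "(\<integral>\<^sup>+z. ennreal (q1 z) \<partial>lborel) < \<infinity>"
    unfolding q1_def by (rule nn_integral_norm_powr_near) (use \<beta> \<beta>0 in auto)
  define N1 where "N1 = enn2real (\<integral>\<^sup>+z. ennreal (q1 z) \<partial>lborel)"
  have N1: "(\<integral>\<^sup>+z. ennreal (q1 z) \<partial>lborel) = ennreal N1" "N1 \<ge> 0" using Q1 by (auto simp: N1_def)
  have A: "AE x in lborel. integrable lborel (\<lambda>y. q1 (y - x) * \<bar>f y\<bar>)"
    "(\<integral>\<^sup>+x. ennreal (\<bar>?U q1 x\<bar> powr \<alpha>) \<partial>lborel) < \<infinity>"
  proof -
    define w where "w p = q1 (snd p - fst p)" for p :: "(real ^ 'n) \<times> (real ^ 'n)"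
    define g where "g p = \<bar>f (snd p)\<bar>" for p :: "(real ^ 'n) \<times> (real ^ 'n)"
    have [measurable]: "w \<in> borel_measurable (lborel \<Otimes>\<^sub>M lborel)" "g \<in> borel_measurable (lborel \<Otimes>\<^sub>M lborel)"
      unfolding w_def g_def by measurable
    have wN: "(\<integral>\<^sup>+y. ennreal \<bar>w (x, y)\<bar> \<partial>lborel) \<le> ennreal N1" for x
      using nn_integral_lborel_shift[of "\<lambda>z. ennreal (q1 z)" "- x"] N1 q(1) by (simp add: w_def)
    have "?J w g
      = (\<integral>\<^sup>+y. (\<integral>\<^sup>+x. ennreal (\<bar>w (x, y)\<bar> * \<bar>g (x, y)\<bar> powr \<alpha>) \<partial>lborel) \<partial>lborel)"
      by (rule lborel_pair.Fubini'[symmetric]) measurable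
    also have "\<dots> = (\<integral>\<^sup>+y. ennreal N1 * ennreal (\<bar>f y\<bar> powr \<alpha>) \<partial>lborel)"
    proof (rule nn_integral_cong)
      fix y
      have "(\<integral>\<^sup>+x. ennreal (\<bar>w (x, y)\<bar> * \<bar>g (x, y)\<bar> powr \<alpha>) \<partial>lborel) = (\<integral>\<^sup>+x. ennreal (q1 (y - x)) * ennreal (\<bar>f y\<bar> powr \<alpha>) \<partial>lborel)"
        using q by (intro nn_integral_cong) (simp add: w_def g_def ennreal_mult)
      also have "\<dots> = (\<integral>\<^sup>+x. ennreal (q1 (y - x)) \<partial>lborel) * ennreal (\<bar>f y\<bar> powr \<alpha>)" by (rule nn_integral_multc) measurable
      also have "(\<integral>\<^sup>+x. ennreal (q1 (y - x)) \<partial>lborel) = ennreal N1" using shift[of "\<lambda>z. ennreal (q1 z)" y] N1 by simp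
      finally show "(\<integral>\<^sup>+x. ennreal (\<bar>w (x, y)\<bar> * \<bar>g (x, y)\<bar> powr \<alpha>) \<partial>lborel) = ennreal N1 * ennreal (\<bar>f y\<bar> powr \<alpha>)" .
    qed
    also have "\<dots> = ennreal N1 * (\<integral>\<^sup>+y. ennreal (\<bar>f y\<bar> powr \<alpha>) \<partial>lborel)" by (rule nn_integral_cmult) measurable
    also have "\<dots> < \<infinity>" using fi by (simp add: integrable_iff_bounded ennreal_mult_less_top)
    finally have I: "?J w g < \<infinity>" .
    note kb = kernel_bound[OF \<alpha> sf sf, of w g N1, OF _ _ wN N1(2) I]
    show "AE x in lborel. integrable lborel (\<lambda>y. q1 (y - x) * \<bar>f y\<bar>)" using kb(1) by (simp add: w_def g_def)
    have "(\<integral>\<^sup>+x. ennreal (\<bar>\<integral>y. w (x, y) * g (x, y) \<partial>lborel\<bar> powr \<alpha>) \<partial>lborel) < \<infinity>"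
      by (rule le_less_trans[OF kb(2)]) (use I in \<open>auto simp: ennreal_mult_less_top\<close>)
    thus "(\<integral>\<^sup>+x. ennreal (\<bar>?U q1 x\<bar> powr \<alpha>) \<partial>lborel) < \<infinity>" by (simp add: w_def g_def)
  qed
  \<comment> \<open>the tail of the kernel has a finite \<open>\<alpha>\<close>-th moment\<close>
  have Q2: "(\<integral>\<^sup>+z. ennreal (q2 z powr \<alpha>) \<partial>lborel) < \<infinity>"
  proof -
    have "q2 z powr \<alpha> = (if 1 < norm z then norm z powr (- (\<beta> * \<alpha>)) else 0)" for z
      by (auto simp: q2_def powr_powr)
    moreover have "\<beta> * \<alpha> > real CARD('n)" using \<beta>(1) \<alpha> by (simp add: field_simps)
    ultimately show ?thesis using nn_integral_norm_powr_far[where 'a="real ^ 'n", of "\<beta> * \<alpha>"] by simp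
  qed
  define N2 where "N2 = (\<integral>y. \<bar>f y\<bar> \<partial>lborel)"
  have N2: "N2 \<ge> 0" "(\<integral>\<^sup>+y. ennreal \<bar>f y\<bar> \<partial>lborel) = ennreal N2"
    using f1i by (auto simp: N2_def nn_integral_eq_integral)
  have B: "AE x in lborel. integrable lborel (\<lambda>y. q2 (y - x) * \<bar>f y\<bar>)"
    "(\<integral>\<^sup>+x. ennreal (\<bar>?U q2 x\<bar> powr \<alpha>) \<partial>lborel) < \<infinity>"
  proof -
    define w where "w p = \<bar>f (snd p)\<bar>" for p :: "(real ^ 'n) \<times> (real ^ 'n)"
    define g where "g p = q2 (snd p - fst p)" for p :: "(real ^ 'n) \<times> (real ^ 'n)"
    have [measurable]: "w \<in> borel_measurable (lborel \<Otimes>\<^sub>M lborel)" "g \<in> borel_measurable (lborel \<Otimes>\<^sub>M lborel)"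
      unfolding w_def g_def by measurable
    have wN: "(\<integral>\<^sup>+y. ennreal \<bar>w (x, y)\<bar> \<partial>lborel) \<le> ennreal N2" for x by (simp add: w_def N2)
    have "?J w g
      = (\<integral>\<^sup>+y. (\<integral>\<^sup>+x. ennreal (\<bar>w (x, y)\<bar> * \<bar>g (x, y)\<bar> powr \<alpha>) \<partial>lborel) \<partial>lborel)"
      by (rule lborel_pair.Fubini'[symmetric]) measurable
    also have "\<dots> = (\<integral>\<^sup>+y. ennreal \<bar>f y\<bar> * (\<integral>\<^sup>+z. ennreal (q2 z powr \<alpha>) \<partial>lborel) \<partial>lborel)"
    proof (rule nn_integral_cong)
      fix y
      have "(\<integral>\<^sup>+x. ennreal (\<bar>w (x, y)\<bar> * \<bar>g (x, y)\<bar> powr \<alpha>) \<partial>lborel) = (\<integral>\<^sup>+x. ennreal \<bar>f y\<bar> * ennreal (q2 (y - x) powr \<alpha>) \<partial>lborel)"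
        using q by (intro nn_integral_cong) (simp add: w_def g_def ennreal_mult)
      also have "\<dots> = ennreal \<bar>f y\<bar> * (\<integral>\<^sup>+x. ennreal (q2 (y - x) powr \<alpha>) \<partial>lborel)" by (rule nn_integral_cmult) measurable
      also have "(\<integral>\<^sup>+x. ennreal (q2 (y - x) powr \<alpha>) \<partial>lborel) = (\<integral>\<^sup>+z. ennreal (q2 z powr \<alpha>) \<partial>lborel)"
        by (rule shift) measurable
      finally show "(\<integral>\<^sup>+x. ennreal (\<bar>w (x, y)\<bar> * \<bar>g (x, y)\<bar> powr \<alpha>) \<partial>lborel) = ennreal \<bar>f y\<bar> * (\<integral>\<^sup>+z. ennreal (q2 z powr \<alpha>) \<partial>lborel)" .
    qed
    also have "\<dots> = ennreal N2 * (\<integral>\<^sup>+z. ennreal (q2 z powr \<alpha>) \<partial>lborel)" by (subst nn_integral_multc) (auto simp: N2)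
    also have "\<dots> < \<infinity>" using Q2 by (simp add: ennreal_mult_less_top)
    finally have I: "?J w g < \<infinity>" .
    note kb = kernel_bound[OF \<alpha> sf sf, of w g N2, OF _ _ wN N2(1) I]
    show "AE x in lborel. integrable lborel (\<lambda>y. q2 (y - x) * \<bar>f y\<bar>)" using kb(1) by (simp add: w_def g_def mult.commute)
    have "(\<integral>\<^sup>+x. ennreal (\<bar>\<integral>y. w (x, y) * g (x, y) \<partial>lborel\<bar> powr \<alpha>) \<partial>lborel) < \<infinity>"
      by (rule le_less_trans[OF kb(2)]) (use I in \<open>auto simp: ennreal_mult_less_top\<close>)
    thus "(\<integral>\<^sup>+x. ennreal (\<bar>?U q2 x\<bar> powr \<alpha>) \<partial>lborel) < \<infinity>" by (simp add: w_def g_def mult.commute)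
  qed
  have split: "norm (y - x) powr (- \<beta>) * \<bar>f y\<bar> = q1 (y - x) * \<bar>f y\<bar> + q2 (y - x) * \<bar>f y\<bar>" for x y
    by (simp add: q(3) flip: distrib_right)
  show "AE x in lborel. integrable lborel (\<lambda>y. norm (y - x) powr (- \<beta>) * \<bar>f y\<bar>)"
    using A(1) B(1) unfolding split by eventually_elim (rule Bochner_Integration.integrable_add)
  show "integrable lborel (\<lambda>x. \<bar>\<integral>y. norm (y - x) powr (- \<beta>) * \<bar>f y\<bar> \<partial>lborel\<bar> powr \<alpha>)"
  proof (rule Bochner_Integration.integrable_bound)
    have "integrable lborel (\<lambda>x. \<bar>?U q1 x\<bar> powr \<alpha>)"
      by (rule integrableI_bounded) (use A(2) in auto)
    moreover have "integrable lborel (\<lambda>x. \<bar>?U q2 x\<bar> powr \<alpha>)"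
      by (rule integrableI_bounded) (use B(2) in auto)
    ultimately show "integrable lborel (\<lambda>x. 2 powr \<alpha> * (\<bar>?U q1 x\<bar> powr \<alpha> + \<bar>?U q2 x\<bar> powr \<alpha>))"
      by (intro integrable_mult_right Bochner_Integration.integrable_add)
    show "AE x in lborel. norm (\<bar>\<integral>y. norm (y - x) powr (- \<beta>) * \<bar>f y\<bar> \<partial>lborel\<bar> powr \<alpha>)
      \<le> norm (2 powr \<alpha> * (\<bar>?U q1 x\<bar> powr \<alpha> + \<bar>?U q2 x\<bar> powr \<alpha>))"
      using A(1) B(1)
    proof eventually_elim
      case (elim x)
      have "(\<integral>y. norm (y - x) powr (- \<beta>) * \<bar>f y\<bar> \<partial>lborel) = ?U q1 x + ?U q2 x"
        unfolding split using elim by (rule Bochner_Integration.integral_add)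
      thus ?case using powr_abs_add_le[of \<alpha> "\<integral>y. q1 (y - x) * \<bar>f y\<bar> \<partial>lborel" "\<integral>y. q2 (y - x) * \<bar>f y\<bar> \<partial>lborel"] \<alpha> by simp
    qed
  qed measurable
qed

lemma AE_all_coordinates_neq:
  fixes x :: "real ^ 'n"
  shows "AE y in lborel. \<forall>i. y $ i \<noteq> x $ i"
proof (subst AE_finite_all[of UNIV, simplified])
  show "\<forall>i. AE y in lborel. y $ i \<noteq> x $ i"
  proof
    fix i
    have "AE y in lborel. y \<bullet> axis i (1::real) \<noteq> x $ i" by (rule AE_lborel_inner_neq) (auto simp: Basis_vec_def)
    thus "AE y in lborel. y $ i \<noteq> x $ i" by (simp add: inner_axis)
  qed
qed simp

text \<open>Dominated convergence twice: in \<open>y\<close> for every \<open>x\<close> at which the Riesz potential of \<open>\<bar>f\<bar>\<close> is finite,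
  and then in \<open>x\<close>, where the \<open>\<alpha>\<close>-th power of that potential is the majorant.\<close>

lemma lattice_conv_tendsto_regularly_varying:
  fixes f :: "real ^ 'n \<Rightarrow> real"
  assumes \<alpha>: "\<alpha> > 1" and \<beta>: "real CARD('n) / \<alpha> < \<beta>" "\<beta> < real CARD('n)"
    and f: "f \<in> L_space \<alpha>" and f1: "f \<in> L_space 1"
    and rv: "regularly_varying c \<beta> p" and B: "\<And>k. \<bar>c k\<bar> \<le> B"
  shows "AE x in lborel. integrable lborel (\<lambda>y. f y * p (- (x - y)))"
    and "conv_fun f (\<lambda>x. p (- x)) \<in> L_space \<alpha>"
    and "\<lbrakk>\<And>m. h m > 0; h \<longlonglongrightarrow> 0; \<And>m x. Fm m x = h m powr (- \<beta>) * lattice_conv c f (h m) (lattice_point (h m) x)\<rbrakk>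
      \<Longrightarrow> integrable lborel (\<lambda>x. \<bar>Fm m x - conv_fun f (\<lambda>x. p (- x)) x\<bar> powr \<alpha>)"
    and "\<lbrakk>\<And>m. h m > 0; h \<longlonglongrightarrow> 0; \<And>m x. Fm m x = h m powr (- \<beta>) * lattice_conv c f (h m) (lattice_point (h m) x)\<rbrakk>
      \<Longrightarrow> (\<lambda>m. \<integral>x. \<bar>Fm m x - conv_fun f (\<lambda>x. p (- x)) x\<bar> powr \<alpha> \<partial>lborel) \<longlonglongrightarrow> 0"
proof -
  have [measurable]: "f \<in> borel_measurable borel" using f by (simp add: L_space_def)
  have [measurable]: "p \<in> borel_measurable borel" by (rule regularly_varying_limit_measurable[OF rv])
  have \<beta>0: "\<beta> > 0" using \<beta>(1) \<alpha> by (smt (verit) divide_nonneg_pos of_nat_0_le_iff)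
  define F where "F = conv_fun f (\<lambda>x. p (- x))"
  have [measurable]: "F \<in> borel_measurable borel" unfolding F_def conv_fun_def by measurable
  obtain Q where Q: "Q \<ge> 0" "\<And>k. \<bar>c k\<bar> \<le> Q * (1 + norm (int_vec k)) powr (- \<beta>)" "\<And>z. z \<noteq> 0 \<Longrightarrow> \<bar>p z\<bar> \<le> Q * norm z powr (- \<beta>)"
    using regularly_varying_bounds[OF rv \<beta>0 B] by blast
  define D where "D = Q * real CARD('n) powr \<beta>"
  have "1 \<le> real CARD('n) powr \<beta>" using \<beta>0 by (intro ge_one_powr_ge_zero) (auto simp: Suc_le_eq)
  hence QD: "Q \<le> D" "D \<ge> 0" using Q(1) by (auto simp: D_def mult_le_cancel_left1)
  define G where "G x = (\<integral>y. norm (y - x) powr (- \<beta>) * \<bar>f y\<bar> \<partial>lborel)" for x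
  have [measurable]: "G \<in> borel_measurable borel" unfolding G_def by measurable
  have Gi: "integrable lborel (\<lambda>x. \<bar>G x\<bar> powr \<alpha>)" unfolding G_def by (rule riesz_potential_Lp[OF \<alpha> \<beta> f f1])
  have fin: "AE x in lborel. integrable lborel (\<lambda>y. norm (y - x) powr (- \<beta>) * \<bar>f y\<bar>)" by (rule riesz_potential_Lp[OF \<alpha> \<beta> f f1])
  have pb: "AE y in lborel. norm (f y * p (- (x - y))) \<le> D * (norm (y - x) powr (- \<beta>) * \<bar>f y\<bar>)" for x
    using AE_all_coordinates_neq[of x]
  proof eventually_elim
    case (elim y)
    hence "y - x \<noteq> 0" by auto
    from Q(3)[OF this] have "\<bar>p (y - x)\<bar> \<le> D * norm (y - x) powr (- \<beta>)"
      using QD by (meson mult_right_mono order.trans powr_ge_zero)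
    hence "\<bar>f y\<bar> * \<bar>p (y - x)\<bar> \<le> \<bar>f y\<bar> * (D * norm (y - x) powr (- \<beta>))" by (intro mult_left_mono) auto
    thus ?case by (simp add: abs_mult mult_ac)
  qed
  have int: "integrable lborel (\<lambda>y. f y * p (- (x - y)))" if "integrable lborel (\<lambda>y. norm (y - x) powr (- \<beta>) * \<bar>f y\<bar>)" for x
  proof (rule Bochner_Integration.integrable_bound)
    show "integrable lborel (\<lambda>y. D * (norm (y - x) powr (- \<beta>) * \<bar>f y\<bar>))" using that by simp
    show "AE y in lborel. norm (f y * p (- (x - y))) \<le> norm (D * (norm (y - x) powr (- \<beta>) * \<bar>f y\<bar>))"
      using pb[of x] by eventually_elim simp
  qed measurable
  show "AE x in lborel. integrable lborel (\<lambda>y. f y * p (- (x - y)))"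
    using fin by eventually_elim (rule int)
  have F_le: "\<bar>F x\<bar> \<le> D * G x" if x: "integrable lborel (\<lambda>y. norm (y - x) powr (- \<beta>) * \<bar>f y\<bar>)" for x
  proof -
    have "\<bar>F x\<bar> \<le> (\<integral>y. norm (f y * p (- (x - y))) \<partial>lborel)"
      unfolding F_def conv_fun_def using integral_norm_bound[of lborel "\<lambda>y. f y * p (- (x - y))"] by simp
    also have "\<dots> \<le> (\<integral>y. D * (norm (y - x) powr (- \<beta>) * \<bar>f y\<bar>) \<partial>lborel)"
      by (rule integral_mono_AE[OF integrable_norm[OF int[OF x]] _ pb]) (use x in simp)
    finally show ?thesis by (simp add: G_def)
  qed
  have "integrable lborel (\<lambda>x. \<bar>F x\<bar> powr \<alpha>)"
  proof (rule Bochner_Integration.integrable_bound)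
    show "integrable lborel (\<lambda>x. D powr \<alpha> * \<bar>G x\<bar> powr \<alpha>)" using Gi by simp
    show "AE x in lborel. norm (\<bar>F x\<bar> powr \<alpha>) \<le> norm (D powr \<alpha> * \<bar>G x\<bar> powr \<alpha>)"
      using fin
    proof eventually_elim
      case (elim x)
      have "D * G x \<le> D * \<bar>G x\<bar>" using QD by (intro mult_left_mono) auto
      hence "\<bar>F x\<bar> \<le> D * \<bar>G x\<bar>" using F_le[OF elim] by linarith
      hence "\<bar>F x\<bar> powr \<alpha> \<le> (D * \<bar>G x\<bar>) powr \<alpha>" using \<alpha> by (intro powr_mono2) auto
      thus ?case using QD by (simp add: powr_mult)
    qed
  qed measurable
  thus "conv_fun f (\<lambda>x. p (- x)) \<in> L_space \<alpha>" unfolding F_def[symmetric] by (simp add: L_space_def)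
  assume h: "\<And>m. h m > 0" and h0: "h \<longlonglongrightarrow> 0"
    and Fm: "\<And>m x. Fm m x = h m powr (- \<beta>) * lattice_conv c f (h m) (lattice_point (h m) x)"
  note [measurable] = measurable_lattice_point[OF h]
  have [measurable]: "Fm m \<in> borel_measurable borel" for m unfolding Fm[abs_def] by measurable
  define k where "k m x y = h m powr (- \<beta>) * c (lattice_point (h m) y - lattice_point (h m) x)" for m x y
  have [measurable]: "k m x \<in> borel_measurable borel" for m x unfolding k_def by measurable
  have Fmk: "Fm m x = (\<integral>y. k m x y * f y \<partial>lborel)" for m x
    by (simp add: Fm lattice_conv_def k_def mult.assoc)
  have kb: "AE y in lborel. norm (k m x y * f y) \<le> D * (norm (y - x) powr (- \<beta>) * \<bar>f y\<bar>)" for m x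
    using AE_all_coordinates_neq[of x]
  proof eventually_elim
    case (elim y)
    hence "x \<noteq> y" by auto
    from rescaled_kernel_bound[OF h \<beta>0 Q(1) Q(2) this, of m]
    have "\<bar>k m x y\<bar> * \<bar>f y\<bar> \<le> (D * norm (y - x) powr (- \<beta>)) * \<bar>f y\<bar>"
      unfolding k_def D_def by (intro mult_right_mono) auto
    thus ?case by (simp add: abs_mult mult_ac)
  qed
  have Fm_le: "\<bar>Fm m x\<bar> \<le> D * G x" if x: "integrable lborel (\<lambda>y. norm (y - x) powr (- \<beta>) * \<bar>f y\<bar>)" for x m
  proof -
    have i: "integrable lborel (\<lambda>y. k m x y * f y)"
    proof (rule Bochner_Integration.integrable_bound)
      show "integrable lborel (\<lambda>y. D * (norm (y - x) powr (- \<beta>) * \<bar>f y\<bar>))" using x by simp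
      show "AE y in lborel. norm (k m x y * f y) \<le> norm (D * (norm (y - x) powr (- \<beta>) * \<bar>f y\<bar>))"
        using kb[of m x] by eventually_elim simp
    qed measurable
    have "\<bar>Fm m x\<bar> \<le> (\<integral>y. norm (k m x y * f y) \<partial>lborel)"
      unfolding Fmk using integral_norm_bound[of lborel "\<lambda>y. k m x y * f y"] by simp
    also have "\<dots> \<le> (\<integral>y. D * (norm (y - x) powr (- \<beta>) * \<bar>f y\<bar>) \<partial>lborel)"
      by (rule integral_mono_AE[OF integrable_norm[OF i] _ kb]) (use x in simp)
    finally show ?thesis by (simp add: G_def)
  qed
  have Fm_lim: "(\<lambda>m. Fm m x) \<longlonglongrightarrow> F x" if x: "integrable lborel (\<lambda>y. norm (y - x) powr (- \<beta>) * \<bar>f y\<bar>)" for x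
    unfolding Fmk F_def conv_fun_def
  proof (rule integral_dominated_convergence[where w="\<lambda>y. D * (norm (y - x) powr (- \<beta>) * \<bar>f y\<bar>)", OF _ _ _ _ kb])
    show "AE y in lborel. (\<lambda>m. k m x y * f y) \<longlonglongrightarrow> f y * p (- (x - y))"
      using AE_all_coordinates_neq[of x]
    proof eventually_elim
      case (elim y)
      have "(\<lambda>m. k m x y * f y) \<longlonglongrightarrow> p (y - x) * f y"
        unfolding k_def using elim by (intro tendsto_mult tendsto_const rescaled_kernel_tendsto[OF rv h h0]) auto
      thus ?case by (simp add: mult.commute)
    qed
  qed (use x in auto)
  have dom: "AE x in lborel. norm (\<bar>Fm m x - F x\<bar> powr \<alpha>) \<le> (2 * D) powr \<alpha> * \<bar>G x\<bar> powr \<alpha>" for m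
    using fin
  proof eventually_elim
    case (elim x)
    have "D * G x \<le> D * \<bar>G x\<bar>" using QD by (intro mult_left_mono) auto
    hence "\<bar>Fm m x - F x\<bar> \<le> 2 * D * \<bar>G x\<bar>" using F_le[OF elim] Fm_le[OF elim, of m] by linarith
    hence "\<bar>Fm m x - F x\<bar> powr \<alpha> \<le> (2 * D * \<bar>G x\<bar>) powr \<alpha>" using \<alpha> by (intro powr_mono2) auto
    thus ?case using QD by (simp add: powr_mult)
  qed
  have domi: "integrable lborel (\<lambda>x. (2 * D) powr \<alpha> * \<bar>G x\<bar> powr \<alpha>)" using Gi by simp
  show "integrable lborel (\<lambda>x. \<bar>Fm m x - conv_fun f (\<lambda>x. p (- x)) x\<bar> powr \<alpha>)"
    unfolding F_def[symmetric]
  proof (rule Bochner_Integration.integrable_bound[OF domi])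
    show "AE x in lborel. norm (\<bar>Fm m x - F x\<bar> powr \<alpha>) \<le> norm ((2 * D) powr \<alpha> * \<bar>G x\<bar> powr \<alpha>)"
      using dom[of m] by eventually_elim simp
  qed measurable
  have "(\<lambda>m. \<integral>x. \<bar>Fm m x - F x\<bar> powr \<alpha> \<partial>lborel) \<longlonglongrightarrow> integral\<^sup>L (lborel :: (real ^ 'n) measure) (\<lambda>_. 0)"
  proof (rule integral_dominated_convergence[OF _ _ domi _ dom])
    show "AE x in lborel. (\<lambda>m. \<bar>Fm m x - F x\<bar> powr \<alpha>) \<longlonglongrightarrow> 0"
      using fin
    proof eventually_elim
      case (elim x)
      have "(\<lambda>m. \<bar>Fm m x - F x\<bar> powr \<alpha>) \<longlonglongrightarrow> \<bar>F x - F x\<bar> powr \<alpha>"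
        by (rule tendsto_powr'[OF tendsto_rabs[OF tendsto_diff[OF Fm_lim[OF elim] tendsto_const]] tendsto_const]) (use \<alpha> in auto)
      thus ?case using \<alpha> by simp
    qed
  qed measurable
  thus "(\<lambda>m. \<integral>x. \<bar>Fm m x - conv_fun f (\<lambda>x. p (- x)) x\<bar> powr \<alpha> \<partial>lborel) \<longlonglongrightarrow> 0" by (simp add: F_def)
qed

section \<open>The lattice field and its limit\<close>

text \<open>The estimate for counting measure, in the form needed for tails of the series over the cells.\<close>

lemma series_kernel_bound:
  fixes w g :: "nat \<Rightarrow> nat \<Rightarrow> real"
  assumes \<alpha>: "\<alpha> > 1"
    and w: "\<And>l. summable (\<lambda>j. \<bar>w l j\<bar>)" "\<And>l. (\<Sum>j. \<bar>w l j\<bar>) \<le> N" and N0: "N \<ge> 0"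
    and I: "(\<Sum>j. \<Sum>l. ennreal (\<bar>w l j\<bar> * \<bar>g l j\<bar> powr \<alpha>)) \<le> ennreal I" and I0: "I \<ge> 0"
  shows "summable (\<lambda>j. \<bar>w l j * g l j\<bar>)"
    and "summable (\<lambda>l. \<bar>\<Sum>j. w l j * g l j\<bar> powr \<alpha>)"
    and "(\<Sum>l. \<bar>\<Sum>j. w l j * g l j\<bar> powr \<alpha>) \<le> N powr (\<alpha> - 1) * I"
proof -
  let ?C = "count_space (UNIV :: nat set)"
  have sf: "sigma_finite_measure ?C" by (rule sigma_finite_measure_count_space)
  interpret pair_sigma_finite ?C ?C by (intro pair_sigma_finite.intro sf)
  have meas: "f \<in> borel_measurable (?C \<Otimes>\<^sub>M ?C)" for f :: "nat \<times> nat \<Rightarrow> 'b :: topological_space"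
    by (simp add: pair_measure_countable)
  define w' g' where "w' = (\<lambda>p. w (fst p) (snd p))" and "g' = (\<lambda>p. g (fst p) (snd p))"
  have wN: "(\<integral>\<^sup>+y. ennreal \<bar>w' (x, y)\<bar> \<partial>?C) \<le> ennreal N" for x
    unfolding nn_integral_count_space_nat w'_def using w[of x] by (simp add: suminf_ennreal2 ennreal_leI)
  have "(\<integral>\<^sup>+x. (\<integral>\<^sup>+y. ennreal (\<bar>w' (x, y)\<bar> * \<bar>g' (x, y)\<bar> powr \<alpha>) \<partial>?C) \<partial>?C)
      = (\<integral>\<^sup>+y. (\<integral>\<^sup>+x. ennreal (\<bar>w' (x, y)\<bar> * \<bar>g' (x, y)\<bar> powr \<alpha>) \<partial>?C) \<partial>?C)"
    by (rule Fubini'[symmetric]) (rule meas)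
  also have "\<dots> \<le> ennreal I" using I by (simp add: nn_integral_count_space_nat w'_def g'_def)
  finally have J: "(\<integral>\<^sup>+x. (\<integral>\<^sup>+y. ennreal (\<bar>w' (x, y)\<bar> * \<bar>g' (x, y)\<bar> powr \<alpha>) \<partial>?C) \<partial>?C) \<le> ennreal I" .
  have Jf: "(\<integral>\<^sup>+x. (\<integral>\<^sup>+y. ennreal (\<bar>w' (x, y)\<bar> * \<bar>g' (x, y)\<bar> powr \<alpha>) \<partial>?C) \<partial>?C) < \<infinity>"
    by (rule le_less_trans[OF J]) simp
  note kb = kernel_bound[OF \<alpha> sf sf meas meas wN N0 Jf]
  have int: "integrable ?C (\<lambda>j. w l j * g l j)" for l
    using kb(1) by (simp add: AE_count_space w'_def g'_def)
  show "summable (\<lambda>j. \<bar>w l j * g l j\<bar>)" for l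
    using int[of l] by (simp add: integrable_count_space_nat_iff)
  have eq: "(\<integral>j. w' (l, j) * g' (l, j) \<partial>?C) = (\<Sum>j. w l j * g l j)" for l
    using integral_count_space_nat[OF int[of l]] by (simp add: w'_def g'_def)
  have "(\<Sum>l. ennreal (\<bar>\<Sum>j. w l j * g l j\<bar> powr \<alpha>)) = (\<integral>\<^sup>+l. ennreal (\<bar>\<integral>j. w' (l, j) * g' (l, j) \<partial>?C\<bar> powr \<alpha>) \<partial>?C)"
    unfolding eq by (rule nn_integral_count_space_nat[symmetric])
  also have "\<dots> \<le> ennreal (N powr (\<alpha> - 1)) * (\<integral>\<^sup>+x. (\<integral>\<^sup>+y. ennreal (\<bar>w' (x, y)\<bar> * \<bar>g' (x, y)\<bar> powr \<alpha>) \<partial>?C) \<partial>?C)"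
    by (rule kb(2))
  also have "\<dots> \<le> ennreal (N powr (\<alpha> - 1)) * ennreal I" by (rule mult_left_mono[OF J]) simp
  also have "\<dots> = ennreal (N powr (\<alpha> - 1) * I)" using I0 by (simp add: ennreal_mult)
  finally have le: "(\<Sum>l. ennreal (\<bar>\<Sum>j. w l j * g l j\<bar> powr \<alpha>)) \<le> ennreal (N powr (\<alpha> - 1) * I)" .
  show sum: "summable (\<lambda>l. \<bar>\<Sum>j. w l j * g l j\<bar> powr \<alpha>)"
    by (rule summable_suminf_not_top) (use le in \<open>auto simp: top_unique\<close>)
  show "(\<Sum>l. \<bar>\<Sum>j. w l j * g l j\<bar> powr \<alpha>) \<le> N powr (\<alpha> - 1) * I"
    using le sum I0 by (simp add: suminf_ennreal2)
qed

lemma L_space_lincomb: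
  assumes \<alpha>: "\<alpha> > 0" and f: "f \<in> L_space \<alpha>" and g: "g \<in> L_space \<alpha>"
  shows "(\<lambda>x. a * f x + b * g x) \<in> L_space \<alpha>"
proof -
  have [measurable]: "f \<in> borel_measurable borel" "g \<in> borel_measurable borel"
    and i: "integrable lborel (\<lambda>x. \<bar>f x\<bar> powr \<alpha>)" "integrable lborel (\<lambda>x. \<bar>g x\<bar> powr \<alpha>)"
    using f g by (auto simp: L_space_def)
  have "integrable lborel (\<lambda>x. \<bar>a * f x + b * g x\<bar> powr \<alpha>)"
  proof (rule Bochner_Integration.integrable_bound)
    show "integrable lborel (\<lambda>x. 2 powr \<alpha> * (\<bar>a\<bar> powr \<alpha> * \<bar>f x\<bar> powr \<alpha> + \<bar>b\<bar> powr \<alpha> * \<bar>g x\<bar> powr \<alpha>))"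
      by (intro integrable_mult_right Bochner_Integration.integrable_add i)
    show "AE x in lborel. norm (\<bar>a * f x + b * g x\<bar> powr \<alpha>)
        \<le> norm (2 powr \<alpha> * (\<bar>a\<bar> powr \<alpha> * \<bar>f x\<bar> powr \<alpha> + \<bar>b\<bar> powr \<alpha> * \<bar>g x\<bar> powr \<alpha>))"
      using powr_abs_add_le[OF \<alpha>, of "a * f x" "b * g x" for x] by (intro AE_I2) (simp add: abs_mult powr_mult)
  qed measurable
  thus ?thesis by (simp add: L_space_def)
qed

lemma L_space_0: "(\<lambda>_. 0) \<in> L_space \<alpha>"
  by (simp add: L_space_def)

lemma L_space_sum:
  assumes \<alpha>: "\<alpha> > 0" and f: "\<And>i. i < n \<Longrightarrow> f i \<in> L_space \<alpha>"
  shows "(\<lambda>x. \<Sum>i<(n::nat). t i * f i x) \<in> L_space \<alpha>"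
  using f
proof (induction n)
  case (Suc n)
  hence "(\<lambda>x. 1 * (\<Sum>i<n. t i * f i x) + t n * f n x) \<in> L_space \<alpha>"
    by (intro L_space_lincomb[OF \<alpha>]) auto
  thus ?case by simp
qed (simp add: L_space_0)

lemma locally_integrable_L_space:
  fixes f :: "real ^ 'n \<Rightarrow> real"
  assumes \<alpha>: "\<alpha> \<ge> 1" and f: "f \<in> L_space \<alpha>"
  shows "locally_integrable_on f UNIV"
  unfolding locally_integrable_on_def
proof (intro allI impI)
  fix K :: "(real ^ 'n) set" assume "compact K \<and> K \<subseteq> UNIV"
  hence K: "K \<in> sets borel" "emeasure lborel K < \<infinity>"
    using emeasure_bounded_finite[OF compact_imp_bounded, of K] by (auto simp: borel_compact)
  have [measurable]: "f \<in> borel_measurable borel" "K \<in> sets borel" and i: "integrable lborel (\<lambda>x. \<bar>f x\<bar> powr \<alpha>)"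
    using f K by (auto simp: L_space_def)
  show "set_integrable lborel K f"
    unfolding set_integrable_def
  proof (rule Bochner_Integration.integrable_bound)
    show "integrable lborel (\<lambda>x. indicator K x + \<bar>f x\<bar> powr \<alpha>)"
      using K i by (intro Bochner_Integration.integrable_add integrable_real_indicator) auto
    show "AE x in lborel. norm (indicator K x *\<^sub>R f x) \<le> norm (indicator K x + \<bar>f x\<bar> powr \<alpha>)"
    proof (rule AE_I2)
      fix x
      have "\<bar>f x\<bar> \<le> 1 + \<bar>f x\<bar> powr \<alpha>"
      proof (cases "\<bar>f x\<bar> \<le> 1")
        case False
        hence "\<bar>f x\<bar> powr 1 \<le> \<bar>f x\<bar> powr \<alpha>" using \<alpha> by (intro powr_mono) auto
        thus ?thesis using False by simp
      qed (simp add: add_increasing2)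
      thus "norm (indicator K x *\<^sub>R f x) \<le> norm (indicator K x + \<bar>f x\<bar> powr \<alpha>)"
        by (auto split: split_indicator)
    qed
  qed measurable
qed

lemma set_integrable_cell:
  fixes f :: "real ^ 'n \<Rightarrow> real"
  assumes h: "h > 0" and f: "locally_integrable_on f UNIV"
  shows "set_integrable lborel (cell h k) f"
proof -
  define a b :: "real ^ 'n" where "a = (\<chi> i. h * k $ i)" and "b = (\<chi> i. h * (k $ i + 1))"
  have "set_integrable lborel (cbox a b) f" using f by (simp add: locally_integrable_on_def)
  moreover have "cell h k \<in> sets lborel" using sets_cell[OF h, of k] by simp
  moreover have "cell h k \<subseteq> cbox a b" by (auto simp: mem_cell_iff[OF h] mem_box_cart a_def b_def less_imp_le)
  ultimately show ?thesis by (rule set_integrable_subset)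
qed

lemma stable_noise_sum:
  assumes W: "stable_noise \<alpha> \<nu> N W" and \<alpha>: "\<alpha> > 0" and F: "\<And>i. i < n \<Longrightarrow> F i \<in> L_space \<alpha>"
  shows "AE \<omega> in N. W (\<lambda>x. \<Sum>i<(n::nat). t i * F i x) \<omega> = (\<Sum>i<n. t i * W (F i) \<omega>)"
  using F
proof (induction n)
  have lin: "AE \<omega> in N. W (\<lambda>x. a * f x + b * g x) \<omega> = a * W f \<omega> + b * W g \<omega>"
    if "f \<in> L_space \<alpha>" "g \<in> L_space \<alpha>" for f g a b
    using W that unfolding stable_noise_def random_noise_def by blast
  {
    case 0
    show ?case using lin[OF L_space_0 L_space_0, of 0 0] by simp
  next
    case (Suc n)
    have "AE \<omega> in N. W (\<lambda>x. 1 * (\<Sum>i<n. t i * F i x) + t n * F n x) \<omega> = 1 * W (\<lambda>x. \<Sum>i<n. t i * F i x) \<omega> + t n * W (F n) \<omega>"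
      using Suc by (intro lin L_space_sum[OF \<alpha>]) auto
    moreover have "AE \<omega> in N. W (\<lambda>x. \<Sum>i<n. t i * F i x) \<omega> = (\<Sum>i<n. t i * W (F i) \<omega>)" using Suc by auto
    ultimately show ?case by eventually_elim simp
  }
qed

text \<open>Every enumeration \<open>\<pi>\<close> of the lattice is required to give an admissible sequence, not only \<open>e\<close>: the
  case of summable coefficients uses all shifted enumerations \<open>e j - e i\<close>.\<close>

locale stable_lattice_field = prob_space M for M :: "'w measure" +
  fixes \<xi> :: "int ^ 'n \<Rightarrow> 'w \<Rightarrow> real" and e :: "nat \<Rightarrow> int ^ 'n" and c :: "int ^ 'n \<Rightarrow> real" and \<alpha> \<sigma> \<nu> K :: real
  assumes e: "bij e" and \<sigma>: "\<sigma> > 0"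
    and isl: "\<And>\<pi>. bij \<pi> \<Longrightarrow> independent_stable_like M (\<lambda>j. \<xi> (\<pi> j)) \<alpha> K"
    and near: "\<And>\<epsilon>. \<epsilon> > 0 \<Longrightarrow> \<exists>\<delta>>0. \<forall>k t. \<bar>t\<bar> < \<delta> \<longrightarrow> cmod (char (distr M borel (\<xi> k)) t - stable_char \<alpha> \<sigma> \<nu> t) \<le> \<epsilon> * \<bar>t\<bar> powr \<alpha>"
    and c: "summable (\<lambda>j. \<bar>c (e j)\<bar> powr \<alpha>)"
begin

sublocale Z: independent_stable_like M "\<lambda>j. \<xi> (e j)" \<alpha> K by (rule isl[OF e])

lemma \<alpha>: "\<alpha> > 1" by (rule Z.\<alpha>)

lemma linear_field_eq: "linear_field e c \<xi> k = Z.random_series (\<lambda>j. c (k - e j))"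
  by (rule ext) (simp add: linear_field_def Z.random_series_def)

lemma c_shift:
  "summable (\<lambda>j. \<bar>c (k - e j)\<bar> powr \<alpha>)" "(\<Sum>j. \<bar>c (k - e j)\<bar> powr \<alpha>) = (\<Sum>j. \<bar>c (e j)\<bar> powr \<alpha>)"
  using sums_rearrange[OF e bij_shift_enum(2)[OF e, of k], of "\<lambda>k. \<bar>c k\<bar> powr \<alpha>"] c by auto

lemma c_bounded: "\<exists>B. \<forall>k. \<bar>c k\<bar> \<le> B"
proof -
  have "\<bar>c k\<bar> \<le> (\<Sum>j. \<bar>c (e j)\<bar> powr \<alpha>) powr (1 / \<alpha>)" for k
  proof -
    define j where "j = inv e k"
    have j: "e j = k" using e by (simp add: j_def bij_is_surj surj_f_inv_f)
    have "\<bar>c k\<bar> powr \<alpha> \<le> (\<Sum>j. \<bar>c (e j)\<bar> powr \<alpha>)" using sum_le_suminf[OF c, of "{j}"] j by simp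
    hence "(\<bar>c k\<bar> powr \<alpha>) powr (1 / \<alpha>) \<le> (\<Sum>j. \<bar>c (e j)\<bar> powr \<alpha>) powr (1 / \<alpha>)"
      using \<alpha> by (intro powr_mono2) auto
    thus ?thesis using \<alpha> by (simp add: powr_powr)
  qed
  thus ?thesis by blast
qed

lemma measurable_mu_int [measurable]: "mu_int e (linear_field e c \<xi>) \<gamma> h f \<in> borel_measurable M"
  unfolding mu_int_def mu_terms_def linear_field_eq by measurable

lemma lattice_conv_sums:
  assumes h: "h > 0" and int: "integrable lborel (\<lambda>y. c (lattice_point h y - l) * f y)"
  shows "(\<lambda>j. (LINT x:cell h (e j)|lborel. f x) * c (e j - l)) sums lattice_conv c f h l"
proof -
  have "(LINT x:cell h (e j)|lborel. c (lattice_point h x - l) * f x) = (LINT x:cell h (e j)|lborel. f x) * c (e j - l)" for j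
  proof -
    have "(LINT x:cell h (e j)|lborel. c (lattice_point h x - l) * f x) = (LINT x:cell h (e j)|lborel. c (e j - l) * f x)"
      unfolding set_lebesgue_integral_def
      by (intro Bochner_Integration.integral_cong) (auto simp: mem_cell_lattice_point[OF h] split: split_indicator)
    thus ?thesis by (simp add: mult.commute)
  qed
  thus ?thesis using integral_cells_sums(1)[OF e h int] by (simp add: lattice_conv_def)
qed

text \<open>Common part of both cases: once the tails of the coefficients vanish in \<open>\<ell>\<^sup>\<alpha>\<close> and the series over
  the cells converges almost surely, its sum is a random series in the \<open>\<xi>\<close> themselves.\<close>

lemma mu_terms_sums:
  assumes h: "h > 0" and int: "\<And>l. integrable lborel (\<lambda>y. c (lattice_point h y - l) * f y)"
    and tail: "\<And>n. summable (\<lambda>l. \<bar>\<Sum>j. (if j < n then 0 else (LINT x:cell h (e j)|lborel. f x)) * c (e j - e l)\<bar> powr \<alpha>)"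
    and lim: "(\<lambda>n. \<Sum>l. \<bar>\<Sum>j. (if j < n then 0 else (LINT x:cell h (e j)|lborel. f x)) * c (e j - e l)\<bar> powr \<alpha>) \<longlonglongrightarrow> 0"
    and conv: "AE \<omega> in M. summable (\<lambda>j. (LINT x:cell h (e j)|lborel. f x) * linear_field e c \<xi> (e j) \<omega>)"
  shows "summable (\<lambda>j. \<bar>lattice_conv c f h (e j)\<bar> powr \<alpha>)"
    and "AE \<omega> in M. mu_terms e (linear_field e c \<xi>) h f \<omega> sums Z.random_series (\<lambda>j. lattice_conv c f h (e j)) \<omega>"
proof -
  define b where "b j = (LINT x:cell h (e j)|lborel. f x)" for j
  have eq: "(\<Sum>j. (if j < n then 0 else b j) * c (e j - e l)) = lattice_conv c f h (e l) - (\<Sum>j<n. b j * c (e j - e l))" for n l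
  proof -
    have s: "(\<lambda>j. b j * c (e j - e l)) sums lattice_conv c f h (e l)"
      unfolding b_def by (rule lattice_conv_sums[OF h int])
    have "(\<lambda>j. if j < n then 0 else b j * c (e j - e l)) sums (lattice_conv c f h (e l) - (\<Sum>j<n. b j * c (e j - e l)))"
      using tail_sums(1)[OF sums_summable[OF s], of n] sums_unique[OF s] by simp
    moreover have "(\<lambda>j. if j < n then 0 else b j * c (e j - e l)) = (\<lambda>j. (if j < n then 0 else b j) * c (e j - e l))" by auto
    ultimately show ?thesis by (simp add: sums_iff)
  qed
  note tail' = tail[folded b_def, unfolded eq] and lim' = lim[folded b_def, unfolded eq]
  show "summable (\<lambda>j. \<bar>lattice_conv c f h (e j)\<bar> powr \<alpha>)" using tail'[of 0] by simp
  have conv': "AE \<omega> in M. summable (\<lambda>j. b j * Z.random_series (\<lambda>l. c (e j - e l)) \<omega>)"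
    using conv by (simp add: linear_field_eq b_def)
  have "AE \<omega> in M. (\<Sum>j. b j * Z.random_series (\<lambda>l. c (e j - e l)) \<omega>) = Z.random_series (\<lambda>j. lattice_conv c f h (e j)) \<omega>"
    by (rule Z.random_series_superposition[OF c_shift(1) tail' lim' conv'])
  with conv' show "AE \<omega> in M. mu_terms e (linear_field e c \<xi>) h f \<omega> sums Z.random_series (\<lambda>j. lattice_conv c f h (e j)) \<omega>"
  proof eventually_elim
    case (elim \<omega>)
    have "(\<lambda>j. b j * Z.random_series (\<lambda>l. c (e j - e l)) \<omega>) sums Z.random_series (\<lambda>j. lattice_conv c f h (e j)) \<omega>"
      using summable_sums[OF elim(1)] unfolding elim(2) .
    thus ?case by (simp add: mu_terms_def[abs_def] linear_field_eq b_def mult.commute)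
  qed
qed

lemma c_diff_eq:
  assumes "summable (\<lambda>j. \<bar>g (e j)\<bar>)"
  shows "summable (\<lambda>l. \<bar>g (e j - e l) :: real\<bar>)" "(\<Sum>l. g (e j - e l)) = (\<Sum>l. g (e l))"
    "summable (\<lambda>l. \<bar>g (e l - e j)\<bar>)" "(\<Sum>l. g (e l - e j)) = (\<Sum>l. g (e l))"
  using sums_rearrange[OF e bij_shift_enum(2)[OF e, of "e j"], of g]
    sums_rearrange[OF e bij_shift_enum(1)[OF e, of "e j"], of g] assms by auto

text \<open>The cell integrals of \<open>f\<close> are in \<open>\<ell>\<^sup>\<alpha>\<close>, and convolution with the summable \<open>c\<close> preserves this space.  The
  series over the cells need not converge absolutely.  Its almost sure convergence comes from rewriting the field as
  \<open>\<Sum>i. c (e i) * \<xi> (e j - e i)\<close> and applying the result on double series.\<close>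

lemma mu_terms_sums_L1_coefficients:
  assumes h: "h > 0" and c1: "summable (\<lambda>j. \<bar>c (e j)\<bar>)" and f: "f \<in> L_space \<alpha>"
  shows "summable (\<lambda>j. \<bar>lattice_conv c f h (e j)\<bar> powr \<alpha>)" (is ?A)
    and "AE \<omega> in M. mu_terms e (linear_field e c \<xi>) h f \<omega> sums Z.random_series (\<lambda>j. lattice_conv c f h (e j)) \<omega>" (is ?B)
proof -
  note [measurable] = measurable_lattice_point[OF h] sets_cell[OF h]
  have [measurable]: "f \<in> borel_measurable borel" and fi: "integrable lborel (\<lambda>x. \<bar>f x\<bar> powr \<alpha>)"
    using f by (auto simp: L_space_def)
  obtain B where B: "\<And>k. \<bar>c k\<bar> \<le> B" using c_bounded by blast
  define b where "b j = (LINT x:cell h (e j)|lborel. f x)" for j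
  define N where "N = (\<Sum>j. \<bar>c (e j)\<bar>)"
  have N: "N \<ge> 0" unfolding N_def by (intro suminf_nonneg c1) auto
  have cN: "summable (\<lambda>l. \<bar>c (e j - e l)\<bar>)" "(\<Sum>l. \<bar>c (e j - e l)\<bar>) = N"
    "summable (\<lambda>l. \<bar>c (e l - e j)\<bar>)" "(\<Sum>l. \<bar>c (e l - e j)\<bar>) = N" for j
    using c_diff_eq[of "\<lambda>k. \<bar>c k\<bar>" j] c1 by (auto simp: N_def)
  have int: "integrable lborel (\<lambda>y. c (lattice_point h y - l) * f y)" for l
  proof (rule weighted_jensen(1)[OF \<alpha>])
    have "summable (\<lambda>j. \<bar>c (e j - l)\<bar>)"
      using sums_rearrange(1)[OF e bij_shift_enum(1)[OF e, of l], of c] c1 by simp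
    thus "integrable lborel (\<lambda>y. c (lattice_point h y - l))"
      using integral_lattice(1)[OF e h, of "\<lambda>k. c (k - l)"] by simp
    show "integrable lborel (\<lambda>y. \<bar>c (lattice_point h y - l)\<bar> * \<bar>f y\<bar> powr \<alpha>)"
    proof (rule Bochner_Integration.integrable_bound)
      show "integrable lborel (\<lambda>y. B * \<bar>f y\<bar> powr \<alpha>)" using fi by simp
      show "AE y in lborel. norm (\<bar>c (lattice_point h y - l)\<bar> * \<bar>f y\<bar> powr \<alpha>) \<le> norm (B * \<bar>f y\<bar> powr \<alpha>)"
        by (intro AE_I2) (auto simp: abs_mult intro!: mult_right_mono order.trans[OF B])
    qed measurable
  qed measurable
  have b: "summable (\<lambda>j. \<bar>b j\<bar> powr \<alpha>)"
  proof (rule summable_comparison_test'[where N=0])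
    show "summable (\<lambda>j. (h ^ CARD('n)) powr (\<alpha> - 1) * (LINT x:cell h (e j)|lborel. \<bar>f x\<bar> powr \<alpha>))"
      by (intro summable_mult sums_summable[OF integral_cells_sums(1)[OF e h fi]])
    fix j
    have ind: "integrable lborel (indicator (cell h (e j)) :: _ \<Rightarrow> real)"
      by (rule integrable_real_indicator) (auto simp: emeasure_cell[OF h])
    have "integrable lborel (\<lambda>x. \<bar>indicator (cell h (e j)) x\<bar> * \<bar>f x\<bar> powr \<alpha>)"
      using integrable_mult_indicator[OF _ fi, of "cell h (e j)"] by simp
    from weighted_jensen(2)[OF \<alpha> ind _ this]
    show "norm (\<bar>b j\<bar> powr \<alpha>) \<le> (h ^ CARD('n)) powr (\<alpha> - 1) * (LINT x:cell h (e j)|lborel. \<bar>f x\<bar> powr \<alpha>)"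
      by (simp add: b_def set_lebesgue_integral_def measure_cell[OF h])
  qed
  define r where "r n = (\<Sum>j. \<bar>b j\<bar> powr \<alpha>) - (\<Sum>j<n. \<bar>b j\<bar> powr \<alpha>)" for n
  have bn: "(\<lambda>j. \<bar>if j < n then 0 else b j\<bar> powr \<alpha>) sums r n" for n
  proof -
    have "(\<lambda>j. \<bar>if j < n then 0 else b j\<bar> powr \<alpha>) = (\<lambda>j. if j < n then 0 else \<bar>b j\<bar> powr \<alpha>)" by auto
    thus ?thesis using tail_sums(1)[OF b, of n] by (simp add: r_def)
  qed
  have r: "r n \<ge> 0" for n by (rule sums_le[OF _ sums_zero bn]) simp
  have I: "(\<Sum>j. \<Sum>l. ennreal (\<bar>c (e j - e l)\<bar> * \<bar>if j < n then 0 else b j\<bar> powr \<alpha>)) \<le> ennreal (N * r n)" for n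
  proof -
    have "(\<Sum>l. ennreal (\<bar>c (e j - e l)\<bar> * \<bar>if j < n then 0 else b j\<bar> powr \<alpha>)) = ennreal (N * \<bar>if j < n then 0 else b j\<bar> powr \<alpha>)" for j
    proof (rule suminf_ennreal_eq)
      show "(\<lambda>l. \<bar>c (e j - e l)\<bar> * \<bar>if j < n then 0 else b j\<bar> powr \<alpha>) sums (N * \<bar>if j < n then 0 else b j\<bar> powr \<alpha>)"
        by (rule sums_mult2) (rule summable_sums[OF cN(1), of j, unfolded cN(2)])
    qed (intro mult_nonneg_nonneg; simp)
    moreover have "(\<lambda>j. N * \<bar>if j < n then 0 else b j\<bar> powr \<alpha>) sums (N * r n)" by (intro sums_mult bn)
    ultimately show ?thesis
      using suminf_ennreal_eq[of "\<lambda>j. N * \<bar>if j < n then 0 else b j\<bar> powr \<alpha>" "N * r n"] N by (simp only: mult_nonneg_nonneg powr_ge_zero)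
  qed
  note skb = series_kernel_bound[OF \<alpha>, of "\<lambda>l j. c (e j - e l)" N "\<lambda>l j. if j < n then 0 else b j" "N * r n" for n,
      OF cN(3) eq_refl[OF cN(4)] N I mult_nonneg_nonneg[OF N r]]
  have tail: "summable (\<lambda>l. \<bar>\<Sum>j. (if j < n then 0 else b j) * c (e j - e l)\<bar> powr \<alpha>)" for n
    using skb(2)[of n] by (simp add: mult.commute)
  have "(\<lambda>n. \<Sum>l. \<bar>\<Sum>j. (if j < n then 0 else b j) * c (e j - e l)\<bar> powr \<alpha>) \<longlonglongrightarrow> 0"
  proof (rule tendsto_sandwich[OF always_eventually always_eventually tendsto_const])
    show "\<forall>n. (\<Sum>l. \<bar>\<Sum>j. (if j < n then 0 else b j) * c (e j - e l)\<bar> powr \<alpha>) \<le> N powr (\<alpha> - 1) * (N * r n)"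
      using skb(3) by (simp add: mult.commute)
    have "(\<lambda>n. N powr (\<alpha> - 1) * (N * r n)) \<longlonglongrightarrow> N powr (\<alpha> - 1) * (N * 0)"
      unfolding r_def by (intro tendsto_mult tendsto_const tail_sums(2)[OF b])
    thus "(\<lambda>n. N powr (\<alpha> - 1) * (N * r n)) \<longlonglongrightarrow> 0" by simp
  qed (use tail in \<open>auto intro: suminf_nonneg\<close>)
  moreover have "AE \<omega> in M. summable (\<lambda>j. b j * linear_field e c \<xi> (e j) \<omega>)"
  proof -
    have X: "independent_stable_like M (\<lambda>j. \<xi> (e j - e i)) \<alpha> K" for i
      by (rule isl[OF bij_shift_enum(1)[OF e]])
    note ds = AE_summable_double_series[of M "\<lambda>i j. \<xi> (e j - e i)" \<alpha> K b "\<lambda>i. c (e i)", OF X b c1]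
    show ?thesis
      using ds
    proof eventually_elim
      case (elim \<omega>)
      have "(\<Sum>i. c (e i) * \<xi> (e j - e i) \<omega>) = linear_field e c \<xi> (e j) \<omega>" for j
        using sums_rearrange(2)[OF bij_shift_enum(2)[OF e, of "e j"] e, of "\<lambda>k. c (e j - k) * \<xi> k \<omega>"] elim(1)
        by (simp add: linear_field_def)
      thus ?case using elim(2) by simp
    qed
  qed
  ultimately show ?A ?B using mu_terms_sums[OF h int, folded b_def, OF tail] by blast+
qed

text \<open>Now the cell integrals are absolutely summable and the values of the field are bounded in \<open>L\<^sup>1\<close>, so
  the series converges absolutely almost surely.\<close>

lemma mu_terms_sums_L1_function:
  assumes h: "h > 0" and f1: "f \<in> L_space 1"
  shows "summable (\<lambda>j. \<bar>lattice_conv c f h (e j)\<bar> powr \<alpha>)" (is ?A)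
    and "AE \<omega> in M. mu_terms e (linear_field e c \<xi>) h f \<omega> sums Z.random_series (\<lambda>j. lattice_conv c f h (e j)) \<omega>" (is ?B)
proof -
  note [measurable] = measurable_lattice_point[OF h] sets_cell[OF h]
  have [measurable]: "f \<in> borel_measurable borel" and fa: "integrable lborel (\<lambda>x. \<bar>f x\<bar>)"
    using f1 by (auto simp: L_space_def)
  have fi: "integrable lborel f" by (rule Bochner_Integration.integrable_bound[OF fa]) auto
  obtain B where B: "\<And>k. \<bar>c k\<bar> \<le> B" using c_bounded by blast
  define b where "b j = (LINT x:cell h (e j)|lborel. f x)" for j
  define S where "S = (\<Sum>j. \<bar>c (e j)\<bar> powr \<alpha>)"
  have S: "S \<ge> 0" unfolding S_def by (intro suminf_nonneg c) auto
  have int: "integrable lborel (\<lambda>y. c (lattice_point h y - l) * f y)" for l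
  proof (rule Bochner_Integration.integrable_bound)
    show "integrable lborel (\<lambda>y. B * \<bar>f y\<bar>)" using fi by simp
    show "AE y in lborel. norm (c (lattice_point h y - l) * f y) \<le> norm (B * \<bar>f y\<bar>)"
      by (intro AE_I2) (auto simp: abs_mult intro!: mult_right_mono order.trans[OF B])
  qed measurable
  have b: "summable (\<lambda>j. \<bar>b j\<bar>)" unfolding b_def by (rule integral_cells_sums(2)[OF e h fi])
  define r where "r n = (\<Sum>j. \<bar>b j\<bar>) - (\<Sum>j<n. \<bar>b j\<bar>)" for n
  have bn: "(\<lambda>j. \<bar>if j < n then 0 else b j\<bar>) sums r n" for n
  proof -
    have "(\<lambda>j. \<bar>if j < n then 0 else b j\<bar>) = (\<lambda>j. if j < n then 0 else \<bar>b j\<bar>)" by auto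
    thus ?thesis using tail_sums(1)[OF b, of n] by (simp add: r_def)
  qed
  have r: "r n \<ge> 0" for n by (rule sums_le[OF _ sums_zero bn]) simp
  have I: "(\<Sum>j. \<Sum>l. ennreal (\<bar>if j < n then 0 else b j\<bar> * \<bar>c (e j - e l)\<bar> powr \<alpha>)) \<le> ennreal (r n * S)" for n
  proof -
    have "(\<Sum>l. ennreal (\<bar>if j < n then 0 else b j\<bar> * \<bar>c (e j - e l)\<bar> powr \<alpha>)) = ennreal (\<bar>if j < n then 0 else b j\<bar> * S)" for j
    proof (rule suminf_ennreal_eq)
      show "(\<lambda>l. \<bar>if j < n then 0 else b j\<bar> * \<bar>c (e j - e l)\<bar> powr \<alpha>) sums (\<bar>if j < n then 0 else b j\<bar> * S)"
        unfolding S_def by (rule sums_mult) (rule summable_sums[OF c_shift(1), of "e j", unfolded c_shift(2)])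
    qed (intro mult_nonneg_nonneg; simp)
    moreover have "(\<lambda>j. \<bar>if j < n then 0 else b j\<bar> * S) sums (r n * S)" by (intro sums_mult2 bn)
    ultimately show ?thesis
      using suminf_ennreal_eq[of "\<lambda>j. \<bar>if j < n then 0 else b j\<bar> * S" "r n * S"] S by (simp only: mult_nonneg_nonneg abs_ge_zero)
  qed
  note skb = series_kernel_bound[OF \<alpha>, of "\<lambda>l j. if j < n then 0 else b j" "r n" "\<lambda>l j. c (e j - e l)" "r n * S" for n,
      OF sums_summable[OF bn] eq_refl[OF sums_unique[OF bn, symmetric]] r I mult_nonneg_nonneg[OF r S]]
  have tail: "summable (\<lambda>l. \<bar>\<Sum>j. (if j < n then 0 else b j) * c (e j - e l)\<bar> powr \<alpha>)" for n
    by (rule skb(2))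
  have "(\<lambda>n. \<Sum>l. \<bar>\<Sum>j. (if j < n then 0 else b j) * c (e j - e l)\<bar> powr \<alpha>) \<longlonglongrightarrow> 0"
  proof (rule tendsto_sandwich[OF always_eventually always_eventually tendsto_const])
    show "\<forall>n. (\<Sum>l. \<bar>\<Sum>j. (if j < n then 0 else b j) * c (e j - e l)\<bar> powr \<alpha>) \<le> r n powr (\<alpha> - 1) * (r n * S)"
      using skb(3) by blast
    have r0: "r \<longlonglongrightarrow> 0" unfolding r_def by (rule tail_sums(2)[OF b])
    have "(\<lambda>n. r n powr (\<alpha> - 1) * (r n * S)) \<longlonglongrightarrow> 0 powr (\<alpha> - 1) * (0 * S)"
      by (intro tendsto_mult tendsto_const r0 tendsto_powr') (use \<alpha> r in auto)
    thus "(\<lambda>n. r n powr (\<alpha> - 1) * (r n * S)) \<longlonglongrightarrow> 0" by simp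
  qed (use tail in \<open>auto intro: suminf_nonneg\<close>)
  moreover have "AE \<omega> in M. summable (\<lambda>j. b j * linear_field e c \<xi> (e j) \<omega>)"
    unfolding linear_field_eq
    by (rule Z.AE_summable_superposition[OF b c_shift(1), where B=S]) (simp add: c_shift(2) S_def)
  ultimately show ?A ?B using mu_terms_sums[OF h int, folded b_def, OF tail] by blast+
qed


lemma suminf_stable_exponent:
  assumes a: "summable (\<lambda>j. \<bar>a j\<bar> powr \<alpha>)"
  shows "(\<Sum>j. stable_exponent \<alpha> \<sigma> \<nu> (t * a j)) =
    Complex (\<bar>t\<bar> powr \<alpha> * (\<sigma> powr \<alpha> * (\<Sum>j. \<bar>a j\<bar> powr \<alpha>)))
      (- (\<nu> * tan (pi * \<alpha> / 2) * spow \<alpha> t * (\<sigma> powr \<alpha> * (\<Sum>j::nat. spow \<alpha> (a j)))))"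
proof (rule sums_unique[symmetric], unfold sums_complex_iff complex.sel, intro conjI)
  have s: "(\<lambda>j. spow \<alpha> (a j)) sums (\<Sum>j. spow \<alpha> (a j))"
    by (rule summable_sums, rule summable_rabs_cancel) (simp add: a)
  have "(\<lambda>j. \<bar>t\<bar> powr \<alpha> * (\<sigma> powr \<alpha> * \<bar>a j\<bar> powr \<alpha>)) sums (\<bar>t\<bar> powr \<alpha> * (\<sigma> powr \<alpha> * (\<Sum>j. \<bar>a j\<bar> powr \<alpha>)))"
    by (intro sums_mult summable_sums a)
  thus "(\<lambda>j. Re (stable_exponent \<alpha> \<sigma> \<nu> (t * a j))) sums (\<bar>t\<bar> powr \<alpha> * (\<sigma> powr \<alpha> * (\<Sum>j. \<bar>a j\<bar> powr \<alpha>)))"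
    by (simp add: abs_mult powr_mult mult_ac)
  have "(\<lambda>j. - (\<nu> * tan (pi * \<alpha> / 2) * spow \<alpha> t * (\<sigma> powr \<alpha> * spow \<alpha> (a j))))
     sums (- (\<nu> * tan (pi * \<alpha> / 2) * spow \<alpha> t * (\<sigma> powr \<alpha> * (\<Sum>j. spow \<alpha> (a j)))))"
    by (intro sums_minus sums_mult s)
  thus "(\<lambda>j. Im (stable_exponent \<alpha> \<sigma> \<nu> (t * a j))) sums (- (\<nu> * tan (pi * \<alpha> / 2) * spow \<alpha> t * (\<sigma> powr \<alpha> * (\<Sum>j. spow \<alpha> (a j)))))"
    by (simp add: stable_exponent_def spow_mult mult_ac)
qed

text \<open>The exponents converge by the lattice limit.  The error of replacing \<open>\<phi>\<close> by \<open>exp (- G)\<close>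
  in each factor is at most \<open>\<epsilon> * \<bar>t\<bar> powr \<alpha>\<close> times a bounded quantity as soon as all coefficients are small.\<close>

lemma char_random_series_tendsto:
  fixes a :: "nat \<Rightarrow> int ^ 'n \<Rightarrow> real" and F :: "real ^ 'n \<Rightarrow> real"
  assumes h: "\<And>m. h m > 0" and h0: "h \<longlonglongrightarrow> 0" and F: "F \<in> L_space \<alpha>"
    and Fm: "\<And>m x. Fm m x = \<sigma> * h m powr (- real CARD('n) / \<alpha>) * a m (lattice_point (h m) x)"
    and D: "\<And>m. integrable lborel (\<lambda>x. \<bar>Fm m x - F x\<bar> powr \<alpha>)"
    and lim: "(\<lambda>m. \<integral>x. \<bar>Fm m x - F x\<bar> powr \<alpha> \<partial>lborel) \<longlonglongrightarrow> 0"
  shows "(\<lambda>m. char (distr M borel (Z.random_series (\<lambda>j. a m (e j)))) t)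
      \<longlonglongrightarrow> stable_char \<alpha> (noise_scale \<alpha> F) (noise_skew \<alpha> \<nu> F) t"
proof -
  have \<alpha>0: "\<alpha> > 0" using \<alpha> by simp
  note ll = lattice_limit[OF e h h0 \<alpha>0 \<sigma> F Fm D lim]
  define E where "E m = (\<Sum>j. stable_exponent \<alpha> \<sigma> \<nu> (t * a m (e j)))" for m
  define T where "T m = char (distr M borel (Z.random_series (\<lambda>j. a m (e j)))) t" for m
  have "E \<longlonglongrightarrow> stable_exponent \<alpha> (noise_scale \<alpha> F) (noise_skew \<alpha> \<nu> F) t"
    unfolding E_def suminf_stable_exponent[OF ll(1)] stable_exponent_noise[OF F \<alpha>0]
    by (intro tendsto_Complex tendsto_minus tendsto_mult tendsto_const ll(2) ll(3))
  hence lim1: "(\<lambda>m. exp (- E m)) \<longlonglongrightarrow> stable_char \<alpha> (noise_scale \<alpha> F) (noise_skew \<alpha> \<nu> F) t"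
    unfolding stable_char_eq_exp by (intro tendsto_exp tendsto_minus)
  have "(\<lambda>m. T m - exp (- E m)) \<longlonglongrightarrow> 0"
  proof (rule tendstoI)
    fix r :: real assume r: "r > 0"
    define L where "L = (\<integral>x. \<bar>F x\<bar> powr \<alpha> \<partial>lborel)"
    have L: "L \<ge> 0" by (simp add: L_def)
    define C where "C = \<bar>t\<bar> powr \<alpha> * ((L + 1) / \<sigma> powr \<alpha>)"
    have C: "C \<ge> 0" using L by (simp add: C_def)
    define \<epsilon> where "\<epsilon> = r / (2 * (C + 1))"
    have "0 < C * r + r * 2" using r C by (intro add_nonneg_pos) auto
    hence \<epsilon>: "\<epsilon> > 0" "\<epsilon> * C < r" using r C by (auto simp: \<epsilon>_def field_simps)
    obtain \<delta> where \<delta>: "\<delta> > 0" "\<And>k t. \<bar>t\<bar> < \<delta> \<Longrightarrow> cmod (char (distr M borel (\<xi> k)) t - stable_char \<alpha> \<sigma> \<nu> t) \<le> \<epsilon> * \<bar>t\<bar> powr \<alpha>"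
      using near[OF \<epsilon>(1)] by blast
    have d: "\<delta> / (\<bar>t\<bar> + 1) > 0" using \<delta>(1) by (simp add: add_nonneg_pos)
    have "\<forall>\<^sub>F m in sequentially. \<forall>k. \<bar>a m k\<bar> < \<delta> / (\<bar>t\<bar> + 1)" by (rule ll(4)[OF d])
    moreover have "\<forall>\<^sub>F m in sequentially. \<sigma> powr \<alpha> * (\<Sum>j. \<bar>a m (e j)\<bar> powr \<alpha>) < L + 1"
      using ll(2) by (intro order_tendstoD(2)) (auto simp: L_def)
    ultimately show "\<forall>\<^sub>F m in sequentially. dist (T m - exp (- E m)) 0 < r"
    proof eventually_elim
      case (elim m)
      have small: "\<bar>t * a m (e j)\<bar> < \<delta>" for j
      proof -
        have "\<bar>t\<bar> * \<bar>a m (e j)\<bar> \<le> (\<bar>t\<bar> + 1) * \<bar>a m (e j)\<bar>" by (intro mult_right_mono) auto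
        also have "\<dots> < (\<bar>t\<bar> + 1) * (\<delta> / (\<bar>t\<bar> + 1))" using elim(1) by (intro mult_strict_left_mono) auto
        also have "\<dots> = \<delta>" by (simp add: add_nonneg_eq_0_iff)
        finally show ?thesis by (simp add: abs_mult)
      qed
      have "cmod (T m - exp (- E m)) \<le> \<epsilon> * \<bar>t\<bar> powr \<alpha> * (\<Sum>j. \<bar>a m (e j)\<bar> powr \<alpha>)"
        unfolding T_def E_def
        by (rule Z.char_random_series_approx[OF ll(1) less_imp_le[OF \<epsilon>(1)] \<delta>(2) small])
      also have "\<dots> \<le> \<epsilon> * \<bar>t\<bar> powr \<alpha> * ((L + 1) / \<sigma> powr \<alpha>)"
        using elim(2) \<sigma> \<epsilon>(1) by (intro mult_left_mono) (auto simp: field_simps)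
      also have "\<dots> = \<epsilon> * C" by (simp add: C_def)
      also have "\<dots> < r" by (rule \<epsilon>(2))
      finally show ?case by simp
    qed
  qed
  from tendsto_add[OF this lim1] show ?thesis by (simp add: T_def)
qed

text \<open>Reduces both parts to convergence in \<open>L\<^sup>\<alpha>\<close> of the step functions to \<open>T f\<close>.  Along a sequence of scales, a linear
  combination of the values at \<open>f i\<close> is almost surely the value at one function of \<open>\<F>\<close>, on either
  side, so the multivariate continuity theorem needs only one-dimensional characteristic functions.\<close>

lemma fdd_convergence:
  fixes T :: "(real ^ 'n \<Rightarrow> real) \<Rightarrow> real ^ 'n \<Rightarrow> real" and N :: "'v measure"
  assumes N: "prob_space N" and W: "stable_noise \<alpha> \<nu> N W"
    and lin: "\<And>n t f. (\<And>i. i < n \<Longrightarrow> f i \<in> \<F>) \<Longrightarrow> (\<lambda>x. \<Sum>i<(n::nat). t i * f i x) \<in> \<F>"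
    and loc: "\<And>f. f \<in> \<F> \<Longrightarrow> locally_integrable_on f UNIV"
    and series: "\<And>f h. f \<in> \<F> \<Longrightarrow> h > 0 \<Longrightarrow> summable (\<lambda>j. \<bar>lattice_conv c f h (e j)\<bar> powr \<alpha>)"
      "\<And>f h. f \<in> \<F> \<Longrightarrow> h > 0 \<Longrightarrow> AE \<omega> in M. mu_terms e (linear_field e c \<xi>) h f \<omega> sums Z.random_series (\<lambda>j. lattice_conv c f h (e j)) \<omega>"
    and TL: "\<And>f. f \<in> \<F> \<Longrightarrow> T f \<in> L_space \<alpha>"
    and Tlin: "\<And>n t f. (\<And>i. i < n \<Longrightarrow> f i \<in> \<F>) \<Longrightarrow>
      AE x in lborel. T (\<lambda>x. \<Sum>i<(n::nat). t i * f i x) x = (\<Sum>i<n. t i * T (f i) x)"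
    and Y: "\<And>f. f \<in> \<F> \<Longrightarrow> Y f \<in> borel_measurable N" "\<And>f. f \<in> \<F> \<Longrightarrow> AE \<omega> in N. Y f \<omega> = W (T f) \<omega>"
    and lim: "\<And>f h Fm. f \<in> \<F> \<Longrightarrow> (\<And>m. h m > 0) \<Longrightarrow> h \<longlonglongrightarrow> 0 \<Longrightarrow>
      (\<And>m x. Fm m x = \<sigma> * h m powr (- real CARD('n) / \<alpha>) * (\<gamma> (h m) * lattice_conv c f (h m) (lattice_point (h m) x))) \<Longrightarrow>
      (\<forall>m. integrable lborel (\<lambda>x. \<bar>Fm m x - T f x\<bar> powr \<alpha>)) \<and> (\<lambda>m. \<integral>x. \<bar>Fm m x - T f x\<bar> powr \<alpha> \<partial>lborel) \<longlonglongrightarrow> 0"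
  shows "fdd_converges M (mu_int e (linear_field e c \<xi>) \<gamma>) N Y \<F>"
  unfolding fdd_converges_def tendsto_at_iff_sequentially o_def
proof (intro allI impI, elim conjE)
  let ?X = "linear_field e c \<xi>"
  fix n and f :: "nat \<Rightarrow> real ^ 'n \<Rightarrow> real" and \<phi> :: "(nat \<Rightarrow> real) \<Rightarrow> real" and h :: "nat \<Rightarrow> real"
  assume f: "\<forall>i<n. f i \<in> \<F>" and \<phi>: "continuous_on UNIV \<phi>" "bounded (range \<phi>)"
    and hp: "\<forall>i. h i \<in> {0<..} - {0}" and h0: "h \<longlonglongrightarrow> 0"
  have h: "h m > 0" for m using hp by auto
  have \<alpha>0: "\<alpha> > 0" using \<alpha> by simp
  interpret N: prob_space N by (rule N)
  define mu where "mu m = mu_int e (?X) \<gamma> (h m)" for m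
  have [measurable]: "mu m g \<in> borel_measurable M" for m g unfolding mu_def by measurable
  define X where "X m i = (if i < n then mu m (f i) else (\<lambda>_. 0))" for m i
  define Y' where "Y' i = (if i < n then Y (f i) else (\<lambda>_. 0))" for i
  have [measurable]: "X m i \<in> borel_measurable M" for m i unfolding X_def by auto
  have [measurable]: "Y' i \<in> borel_measurable N" for i unfolding Y'_def using Y(1) f by auto
  have "(\<lambda>m. \<integral>\<omega>. \<phi> (\<lambda>i. if i < n then X m i \<omega> else 0) \<partial>M) \<longlonglongrightarrow> (\<integral>\<omega>. \<phi> (\<lambda>i. if i < n then Y' i \<omega> else 0) \<partial>N)"
  proof (rule multivariate_levy_continuity[OF prob_space_axioms N _ _ _ \<phi>])
    fix t :: "nat \<Rightarrow> real"
    define g where "g x = (\<Sum>i<n. t i * f i x)" for x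
    have g: "g \<in> \<F>" using lin[of n f t] f by (simp add: g_def[abs_def])
    define a where "a m k = \<gamma> (h m) * lattice_conv c g (h m) k" for m k
    define Fm where "Fm m x = \<sigma> * h m powr (- real CARD('n) / \<alpha>) * a m (lattice_point (h m) x)" for m x
    have l: "\<And>m. integrable lborel (\<lambda>x. \<bar>Fm m x - T g x\<bar> powr \<alpha>)" "(\<lambda>m. \<integral>x. \<bar>Fm m x - T g x\<bar> powr \<alpha> \<partial>lborel) \<longlonglongrightarrow> 0"
      using lim[OF g h h0, of Fm] unfolding Fm_def a_def by blast+
    have muX: "AE \<omega> in M. (\<Sum>i<n. t i * X m i \<omega>) = Z.random_series (\<lambda>j. a m (e j)) \<omega>" for m
    proof -
      have b: "(LINT x:cell (h m) k|lborel. g x) = (\<Sum>i<n. t i * (LINT x:cell (h m) k|lborel. f i x))" for k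
      proof -
        have "set_integrable lborel (cell (h m) k) (f i)" if "i < n" for i
          by (intro set_integrable_cell[OF h] loc) (use f that in auto)
        hence "integrable lborel (\<lambda>x. indicator (cell (h m) k) x *\<^sub>R f i x)" if "i < n" for i
          using that by (simp add: set_integrable_def)
        hence "(\<integral>x. (\<Sum>i<n. t i * (indicator (cell (h m) k) x *\<^sub>R f i x)) \<partial>lborel) = (\<Sum>i<n. t i * (\<integral>x. indicator (cell (h m) k) x *\<^sub>R f i x \<partial>lborel))"
          by (subst Bochner_Integration.integral_sum) auto
        thus ?thesis by (simp add: set_lebesgue_integral_def g_def sum_distrib_left mult_ac)
      qed
      have "AE \<omega> in M. \<forall>i\<in>{..<n}. mu_terms e (?X) (h m) (f i) \<omega> sums Z.random_series (\<lambda>j. lattice_conv c (f i) (h m) (e j)) \<omega>"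
        by (subst AE_finite_all) (use series(2)[OF _ h] f in auto)
      moreover have "AE \<omega> in M. Z.random_series (\<lambda>j. \<gamma> (h m) * lattice_conv c g (h m) (e j) + 0 * lattice_conv c g (h m) (e j)) \<omega>
          = \<gamma> (h m) * Z.random_series (\<lambda>j. lattice_conv c g (h m) (e j)) \<omega> + 0 * Z.random_series (\<lambda>j. lattice_conv c g (h m) (e j)) \<omega>"
        by (intro Z.random_series_lincomb series(1)[OF g h])
      moreover note series(2)[OF g h, of m]
      ultimately show ?thesis
      proof eventually_elim
        case (elim \<omega>)
        have s: "summable (mu_terms e (?X) (h m) (f i) \<omega>)" if "i < n" for i
          using elim(1) that sums_summable by blast
        have "mu_terms e (?X) (h m) g \<omega> = (\<lambda>j. \<Sum>i<n. t i * mu_terms e (?X) (h m) (f i) \<omega> j)"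
          by (simp add: mu_terms_def b sum_distrib_left fun_eq_iff mult_ac)
        hence "(\<Sum>j. mu_terms e (?X) (h m) g \<omega> j) = (\<Sum>j. \<Sum>i<n. t i * mu_terms e (?X) (h m) (f i) \<omega> j)"
          by simp
        also have "\<dots> = (\<Sum>i<n. \<Sum>j. t i * mu_terms e (?X) (h m) (f i) \<omega> j)"
          by (rule suminf_sum) (intro summable_mult s, simp)
        also have "\<dots> = (\<Sum>i<n. t i * (\<Sum>j. mu_terms e (?X) (h m) (f i) \<omega> j))"
          by (intro sum.cong refl suminf_mult s) simp
        finally have "\<gamma> (h m) * Z.random_series (\<lambda>j. lattice_conv c g (h m) (e j)) \<omega>
            = \<gamma> (h m) * (\<Sum>i<n. t i * (\<Sum>j. mu_terms e (?X) (h m) (f i) \<omega> j))"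
          using sums_unique[OF elim(3)] by simp
        also have "\<dots> = (\<Sum>i<n. t i * X m i \<omega>)"
          by (simp add: X_def mu_def mu_int_def sum_distrib_left mult_ac)
        finally show ?case using elim(2) by (simp add: a_def)
      qed
    qed
    have charX: "(CLINT \<omega>|M. iexp (\<Sum>i<n. t i * X m i \<omega>)) = char (distr M borel (Z.random_series (\<lambda>j. a m (e j)))) 1" for m
    proof -
      have "(CLINT \<omega>|M. iexp (\<Sum>i<n. t i * X m i \<omega>)) = (CLINT \<omega>|M. iexp (Z.random_series (\<lambda>j. a m (e j)) \<omega>))"
        by (rule integral_cong_AE) (measurable, use muX[of m] in eventually_elim, simp)
      thus ?thesis by (simp add: char_def integral_distr)
    qed
    have Fi: "T (f i) \<in> L_space \<alpha>" if "i < n" for i using f that by (intro TL) auto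
    define G where "G x = (\<Sum>i<n. t i * T (f i) x)" for x
    have G: "G \<in> L_space \<alpha>" unfolding G_def[abs_def] by (rule L_space_sum[OF \<alpha>0 Fi])
    have [measurable]: "W G \<in> borel_measurable N" using W G unfolding stable_noise_def random_noise_def by blast
    have TG: "AE x in lborel. T g x = G x"
      using Tlin[of n f t] f by (simp add: g_def[abs_def] G_def)
    have [measurable]: "T g \<in> borel_measurable borel" "G \<in> borel_measurable borel"
      using TL[OF g] G by (auto simp: L_space_def)
    have scale: "noise_scale \<alpha> (T g) = noise_scale \<alpha> G"
      unfolding noise_scale_def by (rule arg_cong[where f="\<lambda>x. x powr (1 / \<alpha>)"], rule integral_cong_AE)
        (measurable, use TG in eventually_elim, simp)
    have skew: "noise_skew \<alpha> \<nu> (T g) = noise_skew \<alpha> \<nu> G"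
      unfolding noise_skew_def scale by (rule arg_cong[where f="\<lambda>x. x / noise_scale \<alpha> G powr \<alpha>"], rule integral_cong_AE)
        (measurable, use TG in eventually_elim, simp)
    have "AE \<omega> in N. \<forall>i\<in>{..<n}. Y (f i) \<omega> = W (T (f i)) \<omega>"
      by (subst AE_finite_all) (use Y(2) f in auto)
    moreover have "AE \<omega> in N. W G \<omega> = (\<Sum>i<n. t i * W (T (f i)) \<omega>)"
      unfolding G_def[abs_def] by (rule stable_noise_sum[OF W \<alpha>0 Fi])
    ultimately have YG: "AE \<omega> in N. (\<Sum>i<n. t i * Y' i \<omega>) = W G \<omega>"
      by eventually_elim (simp add: Y'_def)
    have "(CLINT \<omega>|N. iexp (\<Sum>i<n. t i * Y' i \<omega>)) = (CLINT \<omega>|N. iexp (W G \<omega>))"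
      by (rule integral_cong_AE) (measurable, use YG in eventually_elim, simp)
    also have "\<dots> = char (distr N borel (W G)) 1" by (simp add: char_def integral_distr)
    also have "\<dots> = stable_char \<alpha> (noise_scale \<alpha> G) (noise_skew \<alpha> \<nu> G) 1"
      using W G unfolding stable_noise_def stable_law_def by blast
    finally have charY: "(CLINT \<omega>|N. iexp (\<Sum>i<n. t i * Y' i \<omega>)) = stable_char \<alpha> (noise_scale \<alpha> (T g)) (noise_skew \<alpha> \<nu> (T g)) 1"
      by (simp add: scale skew)
    show "(\<lambda>m. CLINT \<omega>|M. iexp (\<Sum>i<n. t i * X m i \<omega>)) \<longlonglongrightarrow> (CLINT \<omega>|N. iexp (\<Sum>i<n. t i * Y' i \<omega>))"
      unfolding charX charY by (rule char_random_series_tendsto[OF h h0 TL[OF g] Fm_def l])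
  qed measurable
  moreover have "(\<lambda>i. if i < n then X m i \<omega> else 0) = (\<lambda>i. if i < n then mu_int e (?X) \<gamma> (h m) (f i) \<omega> else 0)" for m \<omega>
    by (auto simp: X_def mu_def)
  moreover have "(\<lambda>i. if i < n then Y' i \<omega> else 0) = (\<lambda>i. if i < n then Y (f i) \<omega> else 0)" for \<omega>
    by (auto simp: Y'_def)
  ultimately show "(\<lambda>m. \<integral>\<omega>. \<phi> (\<lambda>i. if i < n then mu_int e (?X) \<gamma> (h m) (f i) \<omega> else 0) \<partial>M)
      \<longlonglongrightarrow> (\<integral>\<omega>. \<phi> (\<lambda>i. if i < n then Y (f i) \<omega> else 0) \<partial>N)"
    by simp
qed

end

section \<open>Convergence of the rescaled random signed measures\<close>

lemma conv_fun_sum_AE: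
  fixes f :: "nat \<Rightarrow> real ^ 'n \<Rightarrow> real"
  assumes "\<And>i. i < n \<Longrightarrow> AE x in lborel. integrable lborel (\<lambda>y. f i y * g (x - y))"
  shows "AE x in lborel. conv_fun (\<lambda>y. \<Sum>i<n. t i * f i y) g x = (\<Sum>i<n. t i * conv_fun (f i) g x)"
proof -
  have "AE x in lborel. \<forall>i\<in>{..<n}. integrable lborel (\<lambda>y. f i y * g (x - y))"
    by (subst AE_finite_all) (use assms in auto)
  thus ?thesis
  proof eventually_elim
    case (elim x)
    have "(\<integral>y. (\<Sum>i<n. t i * (f i y * g (x - y))) \<partial>lborel) = (\<Sum>i<n. t i * (\<integral>y. f i y * g (x - y) \<partial>lborel))"
      using elim by (subst Bochner_Integration.integral_sum) auto
    thus ?case by (simp add: conv_fun_def sum_distrib_right mult.assoc)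
  qed
qed

lemma (in prob_space) indep_vars_inj_reindex:
  assumes ind: "indep_vars (\<lambda>_. S) X UNIV" and \<pi>: "inj \<pi>"
  shows "indep_vars (\<lambda>_. S) (\<lambda>j. X (\<pi> j)) UNIV"
proof -
  have isets: "indep_sets (\<lambda>i. {X i -` A \<inter> space M |A. A \<in> sets S}) UNIV" and rv: "random_variable S (X i)" for i
    using ind by (auto simp: indep_vars_def2)
  have "indep_sets (\<lambda>j. {X (\<pi> j) -` A \<inter> space M |A. A \<in> sets S}) UNIV"
  proof (rule indep_setsI)
    show "{X (\<pi> j) -` A \<inter> space M |A. A \<in> sets S} \<subseteq> events" for j
      using rv by (auto intro: measurable_sets)
    fix A J assume J: "J \<noteq> {}" "finite J" and A: "\<forall>j\<in>J. A j \<in> {X (\<pi> j) -` A \<inter> space M |A. A \<in> sets S}"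
    define A' where "A' i = A (inv \<pi> i)" for i
    have A': "A' (\<pi> j) = A j" for j using \<pi> by (simp add: A'_def)
    have "prob (\<Inter>i\<in>\<pi> ` J. A' i) = (\<Prod>i\<in>\<pi> ` J. prob (A' i))"
      by (rule indep_setsD[OF isets]) (use J A A' in auto)
    thus "prob (\<Inter>j\<in>J. A j) = (\<Prod>j\<in>J. prob (A j))"
      using \<pi> by (simp add: A' prod.reindex inj_on_subset)
  qed
  thus ?thesis using rv by (simp add: indep_vars_def2)
qed

theorem theorem4p1:
  fixes \<alpha> \<sigma> \<nu> :: real
    and M :: "'w measure" and N :: "'v measure"
    and e :: "nat \<Rightarrow> int ^ 'n"
    and \<xi> :: "int ^ 'n \<Rightarrow> 'w \<Rightarrow> real"
    and c :: "int ^ 'n \<Rightarrow> real"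
    and W :: "(real ^ 'n \<Rightarrow> real) \<Rightarrow> 'v \<Rightarrow> real"
  assumes "1 < \<alpha>" "\<alpha> \<le> 2" "\<sigma> > 0" "\<nu> \<in> {-1..1}"
    and "bij e"
    and "prob_space M"
    and "prob_space.indep_vars M (\<lambda>_. borel) \<xi> UNIV"
    and "\<forall>k l. distr M borel (\<xi> k) = distr M borel (\<xi> l)"
    and "\<forall>k. normal_domain_of_attraction \<alpha> \<sigma> \<nu> (distr M borel (\<xi> k))"
    and "(\<lambda>k. \<bar>c k\<bar> powr \<alpha>) summable_on UNIV"
    and "prob_space N"
    and "stable_noise \<alpha> \<nu> N W"
  shows
    "((\<lambda>k. \<bar>c k\<bar>) summable_on UNIV \<longrightarrow>
        (\<forall>h>0. L_space \<alpha> \<subseteq> mu_domain M e (linear_field e c \<xi>) h) \<and>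
        fdd_converges
          M (mu_int e (linear_field e c \<xi>)
               (\<lambda>h. inverse \<sigma> * h powr ((1 / \<alpha> - 1) * real CARD('n))))
          N (\<lambda>f \<omega>. (\<Sum>\<^sub>\<infinity>k. c k) * W f \<omega>)
          (L_space \<alpha>))
     \<and>
     (\<forall>\<beta> p. - \<beta> \<in> {- real CARD('n) <..< - real CARD('n) / \<alpha>} \<and> regularly_varying c \<beta> p \<longrightarrow>
        (\<forall>h>0. L_space \<alpha> \<inter> L_space 1 \<subseteq> mu_domain M e (linear_field e c \<xi>) h) \<and>
        fdd_converges
          M (mu_int e (linear_field e c \<xi>)
               (\<lambda>h. inverse \<sigma> * h powr (real CARD('n) / \<alpha> - \<beta>)))
          N (fractional_noise W p)
          (L_space \<alpha> \<inter> L_space 1))"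
proof -
  note \<alpha> = assms(1) and \<sigma> = assms(3) and e = assms(5) and same = assms(8) and doa = assms(9) and N = assms(11) and W = assms(12)
  have \<alpha>0: "\<alpha> > 0" using \<alpha> by simp
  interpret prob_space M by (rule assms(6))
  have indep: "indep_vars (\<lambda>_. borel) \<xi> UNIV" by (rule assms(7))
  have meas: "random_variable borel (\<xi> k)" for k using indep by (auto simp: indep_vars_def)
  define D where "D = distr M borel (\<xi> 0)"
  have D: "distr M borel (\<xi> k) = D" for k using same unfolding D_def by blast
  have rD: "real_distribution D" unfolding D_def by (rule real_distribution_distr[OF meas])
  have doaD: "normal_domain_of_attraction \<alpha> \<sigma> \<nu> D" using doa unfolding D_def by blast
  obtain K where K: "K \<ge> 0" "\<And>t. cmod (1 - char D t) \<le> K * \<bar>t\<bar> powr \<alpha>"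
    using char_minus_1_bound[OF \<alpha>0 rD doaD] by blast
  have sum_iff: "summable (\<lambda>j. \<bar>g (e j)\<bar>) \<longleftrightarrow> (\<lambda>k. \<bar>g k\<bar> :: real) summable_on UNIV" for g
  proof -
    have "(\<lambda>k. \<bar>g k\<bar>) summable_on UNIV \<longleftrightarrow> (\<lambda>j. \<bar>g (e j)\<bar>) summable_on UNIV"
      using summable_on_reindex_bij_betw[OF e, of "\<lambda>k. \<bar>g k\<bar>"] by simp
    also have "\<dots> \<longleftrightarrow> summable (\<lambda>j. \<bar>g (e j)\<bar>)" by (rule summable_on_UNIV_nonneg_real_iff) simp
    finally show ?thesis ..
  qed
  have lattice_field: "stable_lattice_field M \<xi> e c \<alpha> \<sigma> \<nu> K"
  proof (intro stable_lattice_field.intro stable_lattice_field_axioms.intro prob_space_axioms e \<sigma>)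
    fix \<pi> :: "nat \<Rightarrow> int ^ 'n" assume \<pi>: "bij \<pi>"
    show "independent_stable_like M (\<lambda>j. \<xi> (\<pi> j)) \<alpha> K"
    proof (intro independent_stable_like.intro independent_stable_like_axioms.intro prob_space_axioms \<alpha> K(1))
      show "indep_vars (\<lambda>_. borel) (\<lambda>j. \<xi> (\<pi> j)) UNIV"
        by (rule indep_vars_inj_reindex[OF indep bij_is_inj[OF \<pi>]])
      show "cmod (1 - char (distr M borel (\<xi> (\<pi> j))) t) \<le> K * \<bar>t\<bar> powr \<alpha>" for j t unfolding D by (rule K(2))
    qed
  next
    fix \<epsilon> :: real assume \<epsilon>: "\<epsilon> > 0"
    show "\<exists>\<delta>>0. \<forall>k t. \<bar>t\<bar> < \<delta> \<longrightarrow> cmod (char (distr M borel (\<xi> k)) t - stable_char \<alpha> \<sigma> \<nu> t) \<le> \<epsilon> * \<bar>t\<bar> powr \<alpha>"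
      unfolding D using normal_domain_of_attraction_char[OF \<alpha>0 rD doaD \<epsilon>] by blast
  next
    show "summable (\<lambda>j. \<bar>c (e j)\<bar> powr \<alpha>)"
      using sum_iff[of "\<lambda>k. \<bar>c k\<bar> powr \<alpha>"] assms(10) by simp
  qed
  interpret L: stable_lattice_field M \<xi> e c \<alpha> \<sigma> \<nu> K by (rule lattice_field)
  have domain: "f \<in> mu_domain M e (linear_field e c \<xi>) h"
    if "f \<in> L_space a" "a \<ge> 1" "AE \<omega> in M. mu_terms e (linear_field e c \<xi>) h f \<omega> sums S \<omega>" for f :: "real ^ 'n \<Rightarrow> real" and a h S
  proof -
    have "AE \<omega> in M. summable (mu_terms e (linear_field e c \<xi>) h f \<omega>)"
      using that(3) by eventually_elim (rule sums_summable)
    moreover have "locally_integrable_on f UNIV" by (rule locally_integrable_L_space[OF that(2,1)])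
    moreover have "f \<in> borel_measurable borel" using that(1) by (simp add: L_space_def)
    ultimately show ?thesis by (simp add: mu_domain_def)
  qed
  have Wm: "W f \<in> borel_measurable N" if "f \<in> L_space \<alpha>" for f
    using W that unfolding stable_noise_def random_noise_def by blast
  have part1: "(\<forall>h>0. L_space \<alpha> \<subseteq> mu_domain M e (linear_field e c \<xi>) h) \<and>
        fdd_converges
          M (mu_int e (linear_field e c \<xi>)
               (\<lambda>h. inverse \<sigma> * h powr ((1 / \<alpha> - 1) * real CARD('n))))
          N (\<lambda>f \<omega>. (\<Sum>\<^sub>\<infinity>k. c k) * W f \<omega>)
          (L_space \<alpha>)"
    if c1': "(\<lambda>k. \<bar>c k\<bar>) summable_on UNIV"
  proof (intro conjI allI impI subsetI)
    have c1: "summable (\<lambda>j. \<bar>c (e j)\<bar>)" using sum_iff[of c] c1' by simp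
    define C where "C = (\<Sum>j. c (e j))"
    have "((\<lambda>j. c (e j)) has_sum C) UNIV"
    proof (rule norm_summable_imp_has_sum)
      show "summable (\<lambda>j. norm (c (e j)))" using c1 by simp
      show "(\<lambda>j. c (e j)) sums C" unfolding C_def by (rule summable_sums, rule summable_rabs_cancel[OF c1])
    qed
    hence "(c has_sum C) UNIV" using has_sum_reindex_bij_betw[OF e, of c] by simp
    hence C: "(\<Sum>\<^sub>\<infinity>k. c k) = C" by (rule infsumI)
    show "f \<in> mu_domain M e (linear_field e c \<xi>) h" if "h > 0" "f \<in> L_space \<alpha>" for h f
      by (rule domain[OF that(2) _ L.mu_terms_sums_L1_coefficients(2)[OF that(1) c1 that(2)]]) (use \<alpha> in simp)
    show "fdd_converges M (mu_int e (linear_field e c \<xi>) (\<lambda>h. inverse \<sigma> * h powr ((1 / \<alpha> - 1) * real CARD('n))))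
          N (\<lambda>f \<omega>. (\<Sum>\<^sub>\<infinity>k. c k) * W f \<omega>) (L_space \<alpha>)"
      unfolding C
    proof (rule L.fdd_convergence[where T="\<lambda>f x. C * f x", OF N W])
      show "(\<lambda>x. C * f x) \<in> L_space \<alpha>" if "f \<in> L_space \<alpha>" for f :: "real ^ 'n \<Rightarrow> real"
        using L_space_lincomb[OF \<alpha>0 that that, of C 0] by simp
      show "AE x in lborel. C * (\<Sum>i<n. t i * f i x) = (\<Sum>i<n. t i * (C * f i x))" for n t and f :: "nat \<Rightarrow> real ^ 'n \<Rightarrow> real"
        by (simp add: sum_distrib_left mult_ac)
      show "AE \<omega> in N. C * W f \<omega> = W (\<lambda>x. C * f x) \<omega>" if "f \<in> L_space \<alpha>" for f
      proof -
        have "AE \<omega> in N. W (\<lambda>x. C * f x + 0 * f x) \<omega> = C * W f \<omega> + 0 * W f \<omega>"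
          using W that unfolding stable_noise_def random_noise_def by blast
        thus ?thesis by eventually_elim simp
      qed
      show "locally_integrable_on f UNIV" if "f \<in> L_space \<alpha>" for f :: "real ^ 'n \<Rightarrow> real"
        using \<alpha> that by (intro locally_integrable_L_space[of \<alpha>]) auto
      show "(\<lambda>\<omega>. C * W f \<omega>) \<in> borel_measurable N" if "f \<in> L_space \<alpha>" for f using Wm[OF that] by simp
    next
      fix f :: "real ^ 'n \<Rightarrow> real" and h :: "nat \<Rightarrow> real" and Fm
      assume f: "f \<in> L_space \<alpha>" and h: "\<And>m. h m > 0" and h0: "h \<longlonglongrightarrow> 0"
        and Fm: "\<And>m x. Fm m x = \<sigma> * h m powr (- real CARD('n) / \<alpha>) *
           (inverse \<sigma> * h m powr ((1 / \<alpha> - 1) * real CARD('n)) * lattice_conv c f (h m) (lattice_point (h m) x))"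
      have "Fm m x = 1 / h m ^ CARD('n) * lattice_conv c f (h m) (lattice_point (h m) x)" for m x
      proof -
        have "h m powr (- real CARD('n) / \<alpha>) * h m powr ((1 / \<alpha> - 1) * real CARD('n)) = h m powr (- real CARD('n))"
          by (simp add: left_diff_distrib flip: powr_add)
        also have "\<dots> = 1 / h m ^ CARD('n)" using h[of m] by (simp add: powr_minus_divide powr_realpow)
        finally have "h m powr (- real CARD('n) / \<alpha>) * h m powr ((1 / \<alpha> - 1) * real CARD('n)) = 1 / h m ^ CARD('n)" .
        moreover have "Fm m x = h m powr (- real CARD('n) / \<alpha>) * h m powr ((1 / \<alpha> - 1) * real CARD('n)) * lattice_conv c f (h m) (lattice_point (h m) x)"
          using \<sigma> by (simp add: Fm)
        ultimately show ?thesis by simp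
      qed
      note lim = lattice_conv_tendsto_L1_case[where Fm=Fm, OF e \<alpha> f c1 h h0 this]
      show "(\<forall>m. integrable lborel (\<lambda>x. \<bar>Fm m x - C * f x\<bar> powr \<alpha>)) \<and> (\<lambda>m. \<integral>x. \<bar>Fm m x - C * f x\<bar> powr \<alpha> \<partial>lborel) \<longlonglongrightarrow> 0"
        unfolding C_def using lim by blast
    qed (use \<alpha> c1 in \<open>auto intro: L_space_sum L.mu_terms_sums_L1_coefficients\<close>)
  qed
  have part2: "(\<forall>h>0. L_space \<alpha> \<inter> L_space 1 \<subseteq> mu_domain M e (linear_field e c \<xi>) h) \<and>
        fdd_converges
          M (mu_int e (linear_field e c \<xi>)
               (\<lambda>h. inverse \<sigma> * h powr (real CARD('n) / \<alpha> - \<beta>)))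
          N (fractional_noise W p)
          (L_space \<alpha> \<inter> L_space 1)"
    if \<beta>: "- \<beta> \<in> {- real CARD('n) <..< - real CARD('n) / \<alpha>}" and rv: "regularly_varying c \<beta> p" for \<beta> p
  proof (intro conjI allI impI subsetI)
    have \<beta>1: "real CARD('n) / \<alpha> < \<beta>" and \<beta>2: "\<beta> < real CARD('n)" using \<beta> by auto
    obtain B where B: "\<And>k. \<bar>c k\<bar> \<le> B" using L.c_bounded by blast
    note rvl = lattice_conv_tendsto_regularly_varying[OF \<alpha> \<beta>1 \<beta>2 _ _ rv B]
    show "f \<in> mu_domain M e (linear_field e c \<xi>) h" if "h > 0" "f \<in> L_space \<alpha> \<inter> L_space 1" for h f
      by (rule domain[OF _ order.refl L.mu_terms_sums_L1_function(2)[OF that(1)]]) (use that in auto)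
    show "fdd_converges M (mu_int e (linear_field e c \<xi>) (\<lambda>h. inverse \<sigma> * h powr (real CARD('n) / \<alpha> - \<beta>)))
          N (fractional_noise W p) (L_space \<alpha> \<inter> L_space 1)"
    proof (rule L.fdd_convergence[where T="\<lambda>f. conv_fun f (\<lambda>x. p (- x))", OF N W])
      show TL: "conv_fun f (\<lambda>x. p (- x)) \<in> L_space \<alpha>" if "f \<in> L_space \<alpha> \<inter> L_space 1" for f
        using that by (intro rvl(2)) auto
      show "AE x in lborel. conv_fun (\<lambda>x. \<Sum>i<n. t i * f i x) (\<lambda>x. p (- x)) x = (\<Sum>i<n. t i * conv_fun (f i) (\<lambda>x. p (- x)) x)"
        if "\<And>i. i < n \<Longrightarrow> f i \<in> L_space \<alpha> \<inter> L_space 1" for n t and f :: "nat \<Rightarrow> real ^ 'n \<Rightarrow> real"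
        by (rule conv_fun_sum_AE[where g="\<lambda>x. p (- x)"], rule rvl(1)) (use that in auto)
      show "fractional_noise W p f \<in> borel_measurable N" if "f \<in> L_space \<alpha> \<inter> L_space 1" for f
        unfolding fractional_noise_def by (rule Wm[OF TL[OF that]])
      show "AE \<omega> in N. fractional_noise W p f \<omega> = W (conv_fun f (\<lambda>x. p (- x))) \<omega>" for f
        by (simp add: fractional_noise_def)
      show "(\<lambda>x. \<Sum>i<n. t i * f i x) \<in> L_space \<alpha> \<inter> L_space 1" if "\<And>i. i < n \<Longrightarrow> f i \<in> L_space \<alpha> \<inter> L_space 1" for n t and f :: "nat \<Rightarrow> real ^ 'n \<Rightarrow> real"
        using that by (intro IntI L_space_sum \<alpha>0) auto
    next
      fix f :: "real ^ 'n \<Rightarrow> real" and h :: "nat \<Rightarrow> real" and Fm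
      assume f: "f \<in> L_space \<alpha> \<inter> L_space 1" and h: "\<And>m. h m > 0" and h0: "h \<longlonglongrightarrow> 0"
        and Fm: "\<And>m x. Fm m x = \<sigma> * h m powr (- real CARD('n) / \<alpha>) *
           (inverse \<sigma> * h m powr (real CARD('n) / \<alpha> - \<beta>) * lattice_conv c f (h m) (lattice_point (h m) x))"
      have "Fm m x = h m powr (- \<beta>) * lattice_conv c f (h m) (lattice_point (h m) x)" for m x
      proof -
        have "h m powr (- real CARD('n) / \<alpha>) * h m powr (real CARD('n) / \<alpha> - \<beta>) = h m powr (- \<beta>)"
          by (simp flip: powr_add)
        moreover have "Fm m x = h m powr (- real CARD('n) / \<alpha>) * h m powr (real CARD('n) / \<alpha> - \<beta>) * lattice_conv c f (h m) (lattice_point (h m) x)"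
          using \<sigma> by (simp add: Fm)
        ultimately show ?thesis by simp
      qed
      note lim = rvl(3,4)[where Fm=Fm, OF _ _ h h0 this]
      show "(\<forall>m. integrable lborel (\<lambda>x. \<bar>Fm m x - conv_fun f (\<lambda>x. p (- x)) x\<bar> powr \<alpha>)) \<and>
          (\<lambda>m. \<integral>x. \<bar>Fm m x - conv_fun f (\<lambda>x. p (- x)) x\<bar> powr \<alpha> \<partial>lborel) \<longlonglongrightarrow> 0"
        using lim f by blast
    qed (use \<alpha> in \<open>auto intro: locally_integrable_L_space[of 1] L.mu_terms_sums_L1_function\<close>)
  qed
  show ?thesis using part1 part2 by blast
qed

end
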